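(* Let $G\subset\mathbb{R}^n$ be a bounded closed region whose interior contains $0$, let $l$ be a positive integer, and let $\omega\in\mathbb{R}^n\setminus\{0\}$ satisfy the Diophantine condition: there are $\gamma>0$ and $\tau>n-1$ with $|\langle k,\omega\rangle|>\gamma/|k|^\tau$ for all $k\in\mathbb{Z}^n\setminus\{0\}$. Consider the real analytic Hamiltonian system $$H(y,x,\varepsilon)=h(y)+\varepsilon P(y,x,\varepsilon),\qquad h(y)=\langle\omega,y\rangle+\frac{1}{2l+2}|y|^{2l+2},\qquad (y,x)\in G\times\mathbb{T}^n.$$ Then this Hamiltonian system admits an invariant torus with frequency $\omega$ for any small enough perturbation; that is, for every such $P$ there is $\varepsilon'>0$ such that for all $0<\varepsilon<\varepsilon'$ the system admits an invariant torus with frequency $\omega$.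
   Context: $\mathbb{T}^n$ is the standard $n$-torus (angle variable $x$), $y$ is the action variable, $|y|$ is the Euclidean norm, and $G\times\mathbb{T}^n$ carries the standard symplectic structure, so the equations of motion are $\dot y=-\partial_xH$, $\dot x=\partial_yH$. For $k\in\mathbb{Z}^n$, $|k|=|k_1|+\cdots+|k_n|$. Real analyticity of $P$ on $G\times\mathbb{T}^n$ means analytic extension to a complex neighbourhood $\{(y,x):\mathrm{dist}(y,G)<s,\ |\mathrm{Im}\,x|<r\}$ for some $0<s,r<1$; the supremum norm of $P$ there is bounded uniformly in $\varepsilon$. An invariant torus with frequency $\omega$ is an invariant $n$-torus of the flow on which the motion is conjugate to the linear flow $\dot\theta=\omega$ on $\mathbb{T}^n$. *)

theory Defs
  imports "HOL-Analysis.Analysis"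
begin

text \<open>Closed region: the closure of a nonempty connected open set.\<close>

definition closed_region :: "'a::topological_space set \<Rightarrow> bool" where
  "closed_region G \<longleftrightarrow> (\<exists>U. open U \<and> connected U \<and> U \<noteq> {} \<and> G = closure U)"

definition diophantine :: "real^'n \<Rightarrow> bool" where
  "diophantine \<omega> \<longleftrightarrow>
    (\<exists>\<gamma> \<tau>. 0 < \<gamma> \<and> real CARD('n) - 1 < \<tau> \<and>
      (\<forall>k::int^'n. k \<noteq> 0 \<longrightarrow>
        \<gamma> / (real_of_int (\<Sum>i\<in>UNIV. \<bar>k $ i\<bar>)) powr \<tau> < \<bar>(\<chi> i. real_of_int (k $ i)) \<bullet> \<omega>\<bar>))"

text \<open>The torus is \<open>\<real>\<^sup>n / (2\<pi>\<int>)\<^sup>n\<close>. As a topological space it is realised as a product of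
  unit circles; \<open>angle\<close> is the quotient map. Functions of an angle variable are represented by
  their \<open>2\<pi>\<close>-periodic lifts to \<open>\<real>\<^sup>n\<close>, resp. to a strip in \<open>\<complex>\<^sup>n\<close>.\<close>

definition std_torus :: "(complex^'n) set" where
  "std_torus = {z. \<forall>i. cmod (z $ i) = 1}"

definition angle :: "real^'n \<Rightarrow> complex^'n" where
  "angle x = (\<chi> i. cis (x $ i))"

definition cvec :: "real^'n \<Rightarrow> complex^'n" where
  "cvec v = (\<chi> i. complex_of_real (v $ i))"

definition period :: "int^'n \<Rightarrow> real^'n" where
  "period k = (\<chi> i. 2 * pi * real_of_int (k $ i))"

definition complex_nbhd :: "(real^'n) set \<Rightarrow> real \<Rightarrow> real \<Rightarrow> ((complex^'n) \<times> (complex^'n)) set" where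
  "complex_nbhd G s r = {(y, x). infdist y (cvec ` G) < s \<and> norm (\<chi> i. Im (x $ i)) < r}"

text \<open>Holomorphy in several variables: Frechet differentiability with complex-linear
  derivative.\<close>

definition holomorphic2_on ::
    "(complex^'n \<Rightarrow> complex^'n \<Rightarrow> complex) \<Rightarrow> ((complex^'n) \<times> (complex^'n)) set \<Rightarrow> bool" where
  "holomorphic2_on F S \<longleftrightarrow>
    (\<forall>z\<in>S. \<exists>D. ((\<lambda>(y, x). F y x) has_derivative D) (at z) \<and>
       (\<forall>c u v. D (c *s u, c *s v) = c * D (u, v)))"

text \<open>\<open>p\<close> is a real function on \<open>G \<times> \<T>\<^sup>n\<close> (its values for \<open>y \<notin> G\<close> play no role) with an analytic
  extension to the complex neighbourhood of widths \<open>s\<close>, \<open>r\<close>, bounded there by \<open>M\<close>.\<close>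

definition analytic_bounded_on ::
    "(real^'n) set \<Rightarrow> real \<Rightarrow> real \<Rightarrow> real \<Rightarrow> (real^'n \<Rightarrow> real^'n \<Rightarrow> real) \<Rightarrow> bool" where
  "analytic_bounded_on G s r M p \<longleftrightarrow>
    (\<forall>y\<in>G. \<forall>x k. p y (x + period k) = p y x) \<and>
    (\<exists>F. holomorphic2_on F (complex_nbhd G s r) \<and>
      (\<forall>(y, x) \<in> complex_nbhd G s r. \<forall>k. F y (x + cvec (period k)) = F y x) \<and>
      (\<forall>(y, x) \<in> complex_nbhd G s r. cmod (F y x) \<le> M) \<and>
      (\<forall>y\<in>G. \<forall>x. F (cvec y) (cvec x) = complex_of_real (p y x)))"

definition hamiltonian_motion ::
    "(real^'n \<Rightarrow> real^'n \<Rightarrow> real) \<Rightarrow> (real \<Rightarrow> real^'n) \<Rightarrow> (real \<Rightarrow> real^'n) \<Rightarrow> bool" where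
  "hamiltonian_motion H y x \<longleftrightarrow>
    (\<forall>t. \<exists>Hy Hx.
       GDERIV (\<lambda>v. H v (x t)) (y t) :> Hy \<and>
       GDERIV (\<lambda>u. H (y t) u) (x t) :> Hx \<and>
       (y has_vector_derivative - Hx) (at t) \<and>
       (x has_vector_derivative Hy) (at t))"

text \<open>\<open>T\<close> is a topological \<open>n\<close>-torus in the phase space, with \<open>y\<close> in the interior of \<open>G\<close> so that
  the equations of motion make sense at every point. The homeomorphism \<open>\<Phi>\<close> conjugates
  the motion on \<open>T\<close> to the linear flow; this includes that the motions starting in \<open>T\<close> exist for all
  times and stay in \<open>T\<close>.\<close>

definition invariant_torus ::
    "(real^'n) set \<Rightarrow> (real^'n \<Rightarrow> real^'n \<Rightarrow> real) \<Rightarrow> real^'n \<Rightarrow> ((real^'n) \<times> (complex^'n)) set \<Rightarrow> bool"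
  where
  "invariant_torus G H \<omega> T \<longleftrightarrow>
    T \<subseteq> interior G \<times> std_torus \<and>
    (\<exists>\<Phi> \<Psi>. homeomorphism std_torus T \<Phi> \<Psi> \<and>
      (\<forall>\<theta>. \<exists>y x. hamiltonian_motion H y x \<and>
         (\<forall>t. \<Phi> (angle (\<theta> + t *\<^sub>R \<omega>)) = (y t, angle (x t)))))"

definition unperturbed :: "real^'n \<Rightarrow> nat \<Rightarrow> real^'n \<Rightarrow> real" where
  "unperturbed \<omega> l y = \<omega> \<bullet> y + norm y ^ (2 * l + 2) / real (2 * l + 2)"

end

theory Submission
  imports Defs "HOL-Complex_Analysis.Conformal_Mappings"
begin

text \<open>Rescaling \<open>y = \<rho> Y\<close> turns the Hamiltonian into \<open>\<omega> \<bullet> Y + f (Y, x)\<close> with \<open>f\<close> small on a fixed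
  complex domain. The twist \<open>|Y|\<^sup>2\<^sup>l\<^sup>+\<^sup>2\<close> degenerates at the origin, so the frequency is not adjusted
  inside the iteration. Instead, for every parameter \<open>p\<close> in a complex polydisc, a Newton iteration
  with small divisors produces a torus \<open>\<theta> \<mapsto> (v (p, \<theta>), \<theta> + u (p, \<theta>))\<close> close to \<open>\<theta> \<mapsto> (p, \<theta>)\<close>
  that is invariant with frequency \<open>\<omega>\<close> for the Hamiltonian with the additional linear term
  \<open>lam (p) \<bullet> (Y - p)\<close>. Everything depends holomorphically, in particular continuously, on \<open>p\<close>.
  Averaging the angle equation over the torus shows that \<open>lam (p)\<close> differs little from
  \<open>- \<rho>\<^sup>2\<^sup>l\<^sup>+\<^sup>1 |p|\<^sup>2\<^sup>l p\<close>, a vector field that points inwards on the boundary of a cube. By the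
  Poincare-Miranda theorem \<open>lam\<close> has a zero \<open>p\<close> in the cube, and the torus at this \<open>p\<close> is
  invariant for the original system.\<close>

section \<open>Holomorphic functions of several variables\<close>

text \<open>Kolmogorov's method corrects the frequency by moving the torus in action space, which
  requires an invertible Hessian of the unperturbed energy; here the Hessian is homogeneous of
  degree 2l and vanishes at the origin. Hence the analytic part makes no use of twist, and the twist
  enters only through the sign of a continuous field, where a degree argument suffices. The twist
  term is even counted as part of the small perturbation f. This dictates the order of the
  constants: the threshold for f does not involve \<epsilon>; then \<open>\<rho>\<close> is chosen,
  which leaves a twist of size \<open>A = \<rho> ^ (2 * l + 1)\<close>; only then is \<epsilon> made
  small against \<open>A\<close>, so that the perturbation cannot reverse the inward field. The
  parameter is a spectator of the iteration: no derivative in p is taken, so the polydisc of radius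
  3/2 never shrinks and only the angle strip does. The action equation is traded for constancy of
  the energy and exactness of a one-form, because a generating function keeps the torus exactly
  Lagrangian; the error then consists of \<open>e1\<close> and \<open>e2\<close> only.\<close>

text \<open>A point is a pair \<open>(p, z)\<close> of a parameter, or action, \<open>p\<close> and an angle \<open>z\<close>. The componentwise
  scalar multiplication \<open>\<odot>\<close> is needed because the product type has no complex vector space
  structure.\<close>
declare split_paired_All [simp del] split_paired_Ex [simp del]

type_synonym 'n cv = "(complex^'n) \<times> (complex^'n)"

definition cs :: "complex \<Rightarrow> 'n cv \<Rightarrow> 'n::finite cv" (infixr "\<odot>" 75) where
  "c \<odot> w = (c *s fst w, c *s snd w)"

text \<open>The derivative is the full one at each point of \<open>A\<close>, so the notion makes
  sense for every set, even a singleton: local arguments prove \<open>hol {w}\<close> point by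
  point.\<close>

definition hol :: "'n::finite cv set \<Rightarrow> ('n cv \<Rightarrow> complex) \<Rightarrow> bool" where
  "hol A f \<longleftrightarrow> (\<forall>w\<in>A. \<exists>D. (f has_derivative D) (at w) \<and> (\<forall>c h. D (c \<odot> h) = c * D h))"

text \<open>As a one-variable \<open>deriv\<close> the directional derivative is a total function,
  and one-variable Cauchy estimates apply to it at once. \<open>hol_D\<close> identifies it with the
  Frechet derivative.\<close>

definition dd :: "'n::finite cv \<Rightarrow> ('n cv \<Rightarrow> complex) \<Rightarrow> 'n cv \<Rightarrow> complex" where
  "dd h f w = deriv (\<lambda>t. f (w + t \<odot> h)) 0"

definition ey :: "'n \<Rightarrow> 'n::finite cv" where "ey i = (axis i 1, 0)"
definition ex :: "'n \<Rightarrow> 'n::finite cv" where "ex i = (0, axis i 1)"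

lemma fst_cs [simp]: "fst (c \<odot> w) = c *s fst w" and snd_cs [simp]: "snd (c \<odot> w) = c *s snd w"
  by (auto simp: cs_def)

lemma fst_ey [simp]: "fst (ey i) = axis i 1" and snd_ey [simp]: "snd (ey i) = 0"
  and fst_ex [simp]: "fst (ex i) = 0" and snd_ex [simp]: "snd (ex i) = axis i 1"
  by (auto simp: ey_def ex_def)

lemma cv_eqI: "(\<And>i. fst v $ i = fst w $ i) \<Longrightarrow> (\<And>i. snd v $ i = snd w $ i) \<Longrightarrow> v = w"
  by (simp add: prod_eq_iff vec_eq_iff)

lemma cs_simps [simp]: "1 \<odot> w = w" "0 \<odot> w = 0" "c \<odot> 0 = (0::'n::finite cv)"
  by (auto intro!: cv_eqI)

lemma cs_add: "(a + b) \<odot> w = a \<odot> w + b \<odot> w"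
  and cs_cs: "a \<odot> b \<odot> w = (a * b) \<odot> w"
  by (auto intro!: cv_eqI simp: algebra_simps)

lemma norm_csv: "norm (c *s (v::complex^'n)) = cmod c * norm v"
  by (simp add: norm_vec_def norm_mult L2_set_right_distrib)

lemma norm_cs: "norm (c \<odot> h) = cmod c * norm h"
  by (simp add: cs_def norm_Pair norm_csv power_mult_distrib flip: distrib_left)
    (simp add: real_sqrt_mult norm_prod_def)

lemma bounded_linear_cs: "bounded_linear (\<lambda>t. t \<odot> h)"
  by (rule bounded_linear_intro[where K="norm h"])
    (auto simp: norm_cs cs_add intro!: cv_eqI)

lemma has_derivative_line: "((\<lambda>t. w + t \<odot> h) has_derivative (\<lambda>s. s \<odot> h)) (at t)"
  by (auto intro!: derivative_eq_intros bounded_linear.has_derivative[OF bounded_linear_cs])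

lemma hol_line_aux:
  assumes "(f has_derivative D) (at (w + t \<odot> h))" "\<And>c h. D (c \<odot> h) = c * D h"
  shows "((\<lambda>t. f (w + t \<odot> h)) has_field_derivative D h) (at t)"
proof -
  have "((\<lambda>t. f (w + t \<odot> h)) has_derivative (\<lambda>s. D (s \<odot> h))) (at t)"
    using has_derivative_compose[OF has_derivative_line, of f D] assms(1) by simp
  thus ?thesis unfolding has_field_derivative_def assms(2) by (simp add: mult_commute_abs)
qed

lemma dd_unique:
  assumes "(f has_derivative D) (at w)" "\<And>c h. D (c \<odot> h) = c * D h"
  shows "dd h f w = D h"
  unfolding dd_def using hol_line_aux[of f D w 0 h] assms by (intro DERIV_imp_deriv) simp

lemma hol_D:
  assumes "hol A f" "w \<in> A"
  shows "(f has_derivative (\<lambda>h. dd h f w)) (at w)" "dd (c \<odot> h) f w = c * dd h f w"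
proof -
  obtain D where D: "(f has_derivative D) (at w)" "\<And>c h. D (c \<odot> h) = c * D h"
    using assms unfolding hol_def by blast
  have "(\<lambda>h. dd h f w) = D" using dd_unique[OF D] by auto
  thus "(f has_derivative (\<lambda>h. dd h f w)) (at w)" "dd (c \<odot> h) f w = c * dd h f w"
    using D by metis+
qed

lemma hol_line:
  assumes "hol A f" "w + t \<odot> h \<in> A"
  shows "((\<lambda>t. f (w + t \<odot> h)) has_field_derivative dd h f (w + t \<odot> h)) (at t)"
  using hol_line_aux hol_D[OF assms] by blast

lemma hol_line_holomorphic:
  assumes "hol A f" "\<And>t. t \<in> T \<Longrightarrow> w + t \<odot> h \<in> A"
  shows "(\<lambda>t. f (w + t \<odot> h)) holomorphic_on T"
  using hol_line[OF assms(1)] assms(2)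
  by (meson has_field_derivative_at_within holomorphic_onI field_differentiable_def)

lemma hol_cont: "hol A f \<Longrightarrow> w \<in> A \<Longrightarrow> isCont f w"
  using hol_D(1) has_derivative_continuous by blast

lemma hol_cont_on: "hol A f \<Longrightarrow> continuous_on A f"
  by (simp add: hol_cont continuous_at_imp_continuous_on)

lemma hol_subset: "hol A f \<Longrightarrow> B \<subseteq> A \<Longrightarrow> hol B f"
  by (auto simp: hol_def)

lemma dd_add: assumes "hol A f" "w \<in> A" shows "dd (g + h) f w = dd g f w + dd h f w"
  using has_derivative_bounded_linear[OF hol_D(1)[OF assms]] by (rule linear_simps)

lemma dd_sum: assumes "hol A f" "w \<in> A"
  shows "dd (\<Sum>i\<in>I. g i) f w = (\<Sum>i\<in>I. dd (g i) f w)"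
  by (rule linear_sum[OF bounded_linear.linear[OF has_derivative_bounded_linear[OF hol_D(1)[OF assms]]]])

lemma cv_decomp: "(a, b) = (\<Sum>i\<in>UNIV. a $ i \<odot> ey i) + (\<Sum>i\<in>UNIV. b $ i \<odot> ex i)"
proof (rule cv_eqI)
  fix j
  have 1: "(\<Sum>i\<in>UNIV. c $ i * axis i 1 $ j) = c $ j" for c :: "complex^'a"
    by (simp add: axis_def if_distrib cong: if_cong)
  show "fst (a, b) $ j = fst ((\<Sum>i\<in>UNIV. a $ i \<odot> ey i) + (\<Sum>i\<in>UNIV. b $ i \<odot> ex i)) $ j"
    "snd (a, b) $ j = snd ((\<Sum>i\<in>UNIV. a $ i \<odot> ey i) + (\<Sum>i\<in>UNIV. b $ i \<odot> ex i)) $ j"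
    by (simp_all add: fst_sum snd_sum 1)
qed

lemma dd_decomp:
  assumes "hol A f" "w \<in> A"
  shows "dd h f w = (\<Sum>i\<in>UNIV. fst h $ i * dd (ey i) f w) + (\<Sum>i\<in>UNIV. snd h $ i * dd (ex i) f w)"
proof -
  have "dd (fst h, snd h) f w =
    dd ((\<Sum>i\<in>UNIV. fst h $ i \<odot> ey i) + (\<Sum>i\<in>UNIV. snd h $ i \<odot> ex i)) f w"
    by (simp only: cv_decomp)
  thus ?thesis by (simp add: dd_add[OF assms] dd_sum[OF assms] hol_D(2)[OF assms])
qed

lemma hol_intro:
  assumes "\<And>w. w \<in> A \<Longrightarrow> (f has_derivative D w) (at w)" "\<And>w c h. w \<in> A \<Longrightarrow> D w (c \<odot> h) = c * D w h"
  shows "hol A f" "w \<in> A \<Longrightarrow> dd h f w = D w h"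
proof -
  show "hol A f" unfolding hol_def using assms by blast
  show "w \<in> A \<Longrightarrow> dd h f w = D w h" by (rule dd_unique; rule assms)
qed

lemma hol_const [simp]: "hol A (\<lambda>_. c)"
  by (rule hol_intro[where D="\<lambda>_ _. 0"]) auto

lemma dd_const [simp]: "dd h (\<lambda>_. c) w = 0"
  by (simp add: dd_def)

lemma hol_add: assumes "hol A f" "hol A g"
  shows "hol A (\<lambda>w. f w + g w)" "w \<in> A \<Longrightarrow> dd h (\<lambda>w. f w + g w) w = dd h f w + dd h g w"
  by (rule hol_intro[where D="\<lambda>w h. dd h f w + dd h g w"];
     (auto intro!: derivative_eq_intros hol_D(1)[OF assms(1)] hol_D(1)[OF assms(2)])[1]
      | simp add: hol_D(2)[OF assms(1)] hol_D(2)[OF assms(2)] algebra_simps)+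

lemma hol_mult: assumes "hol A f" "hol A g"
  shows "hol A (\<lambda>w. f w * g w)" "w \<in> A \<Longrightarrow> dd h (\<lambda>w. f w * g w) w = f w * dd h g w + dd h f w * g w"
  by (rule hol_intro[where D="\<lambda>w h. f w * dd h g w + dd h f w * g w"];
     (auto intro!: derivative_eq_intros hol_D(1)[OF assms(1)] hol_D(1)[OF assms(2)])[1]
      | simp add: hol_D(2)[OF assms(1)] hol_D(2)[OF assms(2)] algebra_simps)+

lemma hol_cmult: assumes "hol A f"
  shows "hol A (\<lambda>w. c * f w)" "w \<in> A \<Longrightarrow> dd h (\<lambda>w. c * f w) w = c * dd h f w"
  using hol_mult[OF hol_const assms] by auto

lemma hol_minus: assumes "hol A f"
  shows "hol A (\<lambda>w. - f w)" "w \<in> A \<Longrightarrow> dd h (\<lambda>w. - f w) w = - dd h f w"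
  using hol_cmult[OF assms, where c="-1"] by auto

lemma hol_diff: assumes "hol A f" "hol A g"
  shows "hol A (\<lambda>w. f w - g w)" "w \<in> A \<Longrightarrow> dd h (\<lambda>w. f w - g w) w = dd h f w - dd h g w"
  using hol_add[OF assms(1) hol_minus(1)[OF assms(2)]] hol_minus(2)[OF assms(2)] by auto

lemma hol_sum: assumes "\<And>i. i \<in> I \<Longrightarrow> hol A (f i)"
  shows "hol A (\<lambda>w. \<Sum>i\<in>I. f i w)"
    and "w \<in> A \<Longrightarrow> dd h (\<lambda>w. \<Sum>i\<in>I. f i w) w = (\<Sum>i\<in>I. dd h (f i) w)"
  by (rule hol_intro[where D="\<lambda>w h. \<Sum>i\<in>I. dd h (f i) w"];
     (auto intro!: derivative_eq_intros hol_D(1)[OF assms])[1] | simp add: hol_D(2)[OF assms] sum_distrib_left)+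

lemma bl_fst_nth: "bounded_linear (\<lambda>w::'n::finite cv. fst w $ i)"
  and bl_snd_nth: "bounded_linear (\<lambda>w::'n::finite cv. snd w $ i)"
  by (auto intro: bounded_linear_compose[OF bounded_linear_vec_nth bounded_linear_fst]
   bounded_linear_compose[OF bounded_linear_vec_nth bounded_linear_snd])

lemma hol_fst: "hol A (\<lambda>w. fst w $ i)" "dd h (\<lambda>w. fst w $ i) w = fst h $ i"
proof -
  note * = hol_intro[where D="\<lambda>w h. fst h $ i" and f="\<lambda>w. fst w $ i", OF bounded_linear_imp_has_derivative[OF bl_fst_nth]]
  show "hol A (\<lambda>w. fst w $ i)" by (rule *(1)) simp
  show "dd h (\<lambda>w. fst w $ i) w = fst h $ i" by (rule *(2)[of UNIV]) simp_all
qed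

lemma hol_snd: "hol A (\<lambda>w. snd w $ i)" "dd h (\<lambda>w. snd w $ i) w = snd h $ i"
proof -
  note * = hol_intro[where D="\<lambda>w h. snd h $ i" and f="\<lambda>w. snd w $ i", OF bounded_linear_imp_has_derivative[OF bl_snd_nth]]
  show "hol A (\<lambda>w. snd w $ i)" by (rule *(1)) simp
  show "dd h (\<lambda>w. snd w $ i) w = snd h $ i" by (rule *(2)[of UNIV]) simp_all
qed

lemma hol_cong: assumes "open A" "hol A f" "\<And>w. w \<in> A \<Longrightarrow> f w = g w"
  shows "hol A g" "w \<in> A \<Longrightarrow> dd h g w = dd h f w"
proof -
  have 1: "(g has_derivative (\<lambda>h. dd h f w)) (at w)" if "w \<in> A" for w
    using has_derivative_transform_within_open[OF hol_D(1)[OF assms(2) that] assms(1) that] assms(3) by auto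
  show "hol A g" "w \<in> A \<Longrightarrow> dd h g w = dd h f w"
    by (rule hol_intro[where D="\<lambda>w h. dd h f w"]; auto simp: 1 hol_D(2)[OF assms(2)])+
qed

lemma has_derivative_chi:
  fixes f :: "'n::finite \<Rightarrow> 'a::real_normed_vector \<Rightarrow> 'b::euclidean_space"
  assumes "\<And>i. (f i has_derivative D i) F"
  shows "((\<lambda>w. \<chi> i. f i w) has_derivative (\<lambda>h. \<chi> i. D i h)) F"
proof -
  have bl: "bounded_linear (axis i :: 'b \<Rightarrow> 'b^'n)" for i
    by (rule linear_conv_bounded_linear[THEN iffD1], rule linearI) (auto simp: axis_def vec_eq_iff)
  have eq: "(\<chi> i. g i) = (\<Sum>i\<in>UNIV. axis i (g i))" for g :: "'n \<Rightarrow> 'b"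
  proof (rule vec_eq_iff[THEN iffD2], rule allI)
    fix j
    have "(\<Sum>i\<in>UNIV. axis i (g i) $ j) = (\<Sum>i\<in>UNIV. if j = i then g i else 0)"
      by (intro sum.cong) (auto simp: axis_def)
    also have "\<dots> = g j" by simp
    finally show "(\<chi> i. g i) $ j = (\<Sum>i\<in>UNIV. axis i (g i)) $ j" by simp
  qed
  have "((\<lambda>w. \<Sum>i\<in>UNIV. axis i (f i w)) has_derivative (\<lambda>h. \<Sum>i\<in>UNIV. axis i (D i h))) F"
    by (intro has_derivative_sum bounded_linear.has_derivative[OF bl] assms)
  thus ?thesis by (simp only: eq)
qed

lemma hol_compose:
  fixes F :: "'n::finite cv \<Rightarrow> complex" and \<alpha> \<beta> :: "'n \<Rightarrow> 'm::finite cv \<Rightarrow> complex"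
  assumes F: "hol B F" and a: "\<And>i. hol A (\<alpha> i)" and b: "\<And>i. hol A (\<beta> i)"
    and AB: "\<And>w. w \<in> A \<Longrightarrow> (\<chi> i. \<alpha> i w, \<chi> i. \<beta> i w) \<in> B"
  shows "hol A (\<lambda>w. F (\<chi> i. \<alpha> i w, \<chi> i. \<beta> i w))"
    and "w \<in> A \<Longrightarrow> dd h (\<lambda>w. F (\<chi> i. \<alpha> i w, \<chi> i. \<beta> i w)) w =
      (\<Sum>i\<in>UNIV. dd h (\<alpha> i) w * dd (ey i) F (\<chi> i. \<alpha> i w, \<chi> i. \<beta> i w)) +
      (\<Sum>i\<in>UNIV. dd h (\<beta> i) w * dd (ex i) F (\<chi> i. \<alpha> i w, \<chi> i. \<beta> i w))"
proof -
  let ?G = "\<lambda>w. (\<chi> i. \<alpha> i w, \<chi> i. \<beta> i w)"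
  let ?D = "\<lambda>w h. dd (\<chi> i. dd h (\<alpha> i) w, \<chi> i. dd h (\<beta> i) w) F (?G w)"
  have 1: "((\<lambda>w. F (?G w)) has_derivative ?D w) (at w)" if "w \<in> A" for w
    using has_derivative_compose[OF has_derivative_Pair[OF has_derivative_chi[OF hol_D(1)[OF a that]]
       has_derivative_chi[OF hol_D(1)[OF b that]]] hol_D(1)[OF F AB[OF that]]] by simp
  have 2: "?D w (c \<odot> h) = c * ?D w h" if "w \<in> A" for w c h
  proof -
    have "(\<chi> i. dd (c \<odot> h) (\<alpha> i) w, \<chi> i. dd (c \<odot> h) (\<beta> i) w) =
       c \<odot> (\<chi> i. dd h (\<alpha> i) w, \<chi> i. dd h (\<beta> i) w)"
      by (rule cv_eqI) (simp_all add: hol_D(2)[OF a that] hol_D(2)[OF b that])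
    thus ?thesis by (simp add: hol_D(2)[OF F AB[OF that]])
  qed
  note * = hol_intro[of A "\<lambda>w. F (?G w)" ?D, OF 1 2]
  show "hol A (\<lambda>w. F (\<chi> i. \<alpha> i w, \<chi> i. \<beta> i w))" by (rule *(1))
  show "dd h (\<lambda>w. F (\<chi> i. \<alpha> i w, \<chi> i. \<beta> i w)) w =
      (\<Sum>i\<in>UNIV. dd h (\<alpha> i) w * dd (ey i) F (\<chi> i. \<alpha> i w, \<chi> i. \<beta> i w)) +
      (\<Sum>i\<in>UNIV. dd h (\<beta> i) w * dd (ex i) F (\<chi> i. \<alpha> i w, \<chi> i. \<beta> i w))" if "w \<in> A"
    using *(2)[OF _ _ that, of h]
    unfolding dd_decomp[OF F AB[OF that], of "(\<chi> i. dd h (\<alpha> i) w, \<chi> i. dd h (\<beta> i) w)"] by simp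
qed

section \<open>Cauchy and Taylor estimates along complex lines\<close>

lemma cauchy_higher:
  assumes "f holomorphic_on ball z r" "\<And>x. x \<in> ball z r \<Longrightarrow> cmod (f x) \<le> C" "0 < r"
  shows "cmod ((deriv ^^ n) f z) \<le> fact n * C / r ^ n"
proof -
  \<comment> \<open>Cauchy's inequality wants continuity up to the circle, but \<open>f\<close> is
    controlled only on the open disc: use radii s < r and let s tend to r.\<close>
  have *: "cmod ((deriv ^^ n) f z) \<le> fact n * C / s ^ n" if "s < r" "0 < s" for s
  proof (rule Cauchy_inequality)
    show "f holomorphic_on ball z s" using assms(1) by (rule holomorphic_on_subset) (use that in auto)
    show "continuous_on (cball z s) f"
      using assms(1) by (intro holomorphic_on_imp_continuous_on holomorphic_on_subset[OF assms(1)]) (use that in auto)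
  qed (use that assms(2) in \<open>auto simp: dist_norm norm_minus_commute\<close>)
  have lim: "((\<lambda>s. fact n * C / s ^ n) \<longlongrightarrow> fact n * C / r ^ n) (at_left r)"
    using assms(3) by (auto intro!: tendsto_eq_intros)
  show ?thesis
  proof (rule tendsto_lowerbound[OF lim])
    show "\<forall>\<^sub>F s in at_left r. cmod ((deriv ^^ n) f z) \<le> fact n * C / s ^ n"
      using eventually_at_left_real[OF assms(3)] by eventually_elim (use * in auto)
  qed auto
qed

text \<open>Every point of the half disc is the centre of a disc of radius R/2 inside the domain.
  Cauchy's inequality there bounds the first two derivatives by \<open>2 * C / R\<close> and
  \<open>8 * C / R\<^sup>2\<close>, the constants of the two remainders.\<close>

lemma taylor_bounds:
  assumes f: "f holomorphic_on ball 0 R" "\<And>x. x \<in> ball 0 R \<Longrightarrow> cmod (f x) \<le> C" "0 < R"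
    and t: "cmod t \<le> R / 2"
  shows "cmod (f t - f 0) \<le> 2 * C * cmod t / R"
    "cmod (f t - f 0 - deriv f 0 * t) \<le> 8 * C * (cmod t)\<^sup>2 / R\<^sup>2"
proof -
  let ?S = "cball (0::complex) (R/2)"
  have sub: "?S \<subseteq> ball 0 R" using f(3) by auto
  have bd: "cmod ((deriv ^^ n) f x) \<le> fact n * C / (R/2) ^ n" if "x \<in> ?S" for x n
  proof (rule cauchy_higher)
    have "ball x (R/2) \<subseteq> ball 0 R"
    proof
      fix y assume "y \<in> ball x (R/2)"
      hence "norm (y - x) < R/2" "norm x \<le> R/2" using that by (auto simp: dist_norm norm_minus_commute)
      thus "y \<in> ball 0 R" using norm_triangle_ineq[of "y-x" x] by simp
    qed
    thus "f holomorphic_on ball x (R/2)" "\<And>y. y \<in> ball x (R/2) \<Longrightarrow> cmod (f y) \<le> C"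
      using f holomorphic_on_subset by blast+
  qed (use f(3) in auto)
  have der: "((deriv ^^ n) f has_field_derivative (deriv ^^ Suc n) f x) (at x within ?S)" if "x \<in> ?S" for x n
    using holomorphic_derivI[OF holomorphic_higher_deriv[OF f(1) open_ball] open_ball, of x n] sub that by auto
  have in_S: "0 \<in> ?S" "t \<in> ?S" using t f(3) by auto
  have "cmod (f t - f 0) \<le> fact 1 * C / (R/2) ^ 1 * cmod t"
    using complex_Taylor[of ?S 0 "\<lambda>i. (deriv ^^ i) f", OF convex_cball der bd in_S] by (simp add: eval_nat_numeral)
  thus "cmod (f t - f 0) \<le> 2 * C * cmod t / R" by (simp add: mult.commute)
  have eq: "(\<Sum>i\<le>1. (deriv ^^ i) f 0 * (t - 0) ^ i / fact i) = f 0 + deriv f 0 * t" by simp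
  have "cmod (f t - (f 0 + deriv f 0 * t)) \<le> fact 2 * C / (R/2) ^ 2 * (cmod t)\<^sup>2"
    using complex_Taylor[of ?S 1 "\<lambda>i. (deriv ^^ i) f", OF convex_cball der bd in_S] unfolding eq
    by (simp add: numeral_2_eq_2)
  also have "\<dots> = 8 * C * (cmod t)\<^sup>2 / R\<^sup>2" by (simp add: power2_eq_square fact_2)
  finally show "cmod (f t - f 0 - deriv f 0 * t) \<le> 8 * C * (cmod t)\<^sup>2 / R\<^sup>2" by (simp add: diff_diff_eq)
qed

lemma hol_cauchy:
  assumes "hol A f" "\<And>t. cmod t < R \<Longrightarrow> w + t \<odot> h \<in> A" "\<And>t. cmod t < R \<Longrightarrow> cmod (f (w + t \<odot> h)) \<le> C" "0 < R"
  shows "cmod (dd h f w) \<le> C / R"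
proof -
  have "(\<lambda>t. f (w + t \<odot> h)) holomorphic_on ball 0 R"
    by (rule hol_line_holomorphic[OF assms(1)]) (use assms(2) in auto)
  from cauchy_higher[OF this, of C 1] assms(3,4) show ?thesis by (simp add: dd_def)
qed

lemma hol_taylor:
  assumes "hol A f" "\<And>t. cmod t < R \<Longrightarrow> w + t \<odot> h \<in> A" "\<And>t. cmod t < R \<Longrightarrow> cmod (f (w + t \<odot> h)) \<le> C" "0 < R"
    "cmod t \<le> R / 2"
  shows "cmod (f (w + t \<odot> h) - f w) \<le> 2 * C * cmod t / R"
    "cmod (f (w + t \<odot> h) - f w - t * dd h f w) \<le> 8 * C * (cmod t)\<^sup>2 / R\<^sup>2"
proof -
  have "(\<lambda>t. f (w + t \<odot> h)) holomorphic_on ball 0 R"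
    by (rule hol_line_holomorphic[OF assms(1)]) (use assms(2) in auto)
  from taylor_bounds[OF this, of C t] assms(3,4,5)
  show "cmod (f (w + t \<odot> h) - f w) \<le> 2 * C * cmod t / R"
    "cmod (f (w + t \<odot> h) - f w - t * dd h f w) \<le> 8 * C * (cmod t)\<^sup>2 / R\<^sup>2"
    by (simp_all add: dd_def mult.commute)
qed

text \<open>Weierstrass convergence. Cauchy's inequality on the line through x in direction h, with
  radius \<open>d / (2 * norm h)\<close>, makes the derivatives uniformly Cauchy on the half ball.
  Holomorphy is assumed eventually because the sequences of interest include difference quotients,
  which make sense near \<open>w0\<close> only for small steps.\<close>

lemma hol_limit_ball:
  fixes f :: "nat \<Rightarrow> 'n::finite cv \<Rightarrow> complex"
  assumes d: "d > 0" and f: "\<forall>\<^sub>F n in sequentially. hol (ball w0 d) (f n)"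
    and u: "uniform_limit (ball w0 d) f g sequentially"
  shows "hol (ball w0 (d/2)) g" "w \<in> ball w0 (d/2) \<Longrightarrow> (\<lambda>n. dd h (f n) w) \<longlonglongrightarrow> dd h g w"
proof -
  let ?S = "ball w0 (d/2)"
  obtain N0 where N0: "\<And>n. n \<ge> N0 \<Longrightarrow> hol (ball w0 d) (f n)" using f unfolding eventually_sequentially by blast
  have diff: "cmod (dd h (f n) x - dd h (f m) x) \<le> e * norm h"
    if "n \<ge> N0" "m \<ge> N0" "x \<in> ?S" "\<And>y. y \<in> ball w0 d \<Longrightarrow> cmod (f n y - f m y) \<le> e * d / 2" for n m x h e
  proof (cases "h = 0")
    case True
    thus ?thesis using hol_D(2)[OF N0[OF that(1)], of x 0 0] hol_D(2)[OF N0[OF that(2)], of x 0 0] that(3) d by auto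
  next
    case False
    let ?R = "d / (2 * norm h)"
    have in_ball: "x + t \<odot> h \<in> ball w0 d" if t: "cmod t < ?R" for t
    proof -
      have "norm (t \<odot> h) < d/2" using t False by (simp add: norm_cs field_simps)
      moreover have "norm (x - w0) < d/2" using \<open>x \<in> ?S\<close> by (simp add: dist_norm norm_minus_commute)
      ultimately have "norm (x + t \<odot> h - w0) < d"
        using norm_triangle_ineq[of "x - w0" "t \<odot> h"] by (simp add: algebra_simps)
      thus ?thesis by (simp add: dist_norm norm_minus_commute)
    qed
    have h2: "hol (ball w0 d) (\<lambda>y. f n y - f m y)" using hol_diff N0 that by blast
    have "cmod (dd h (\<lambda>y. f n y - f m y) x) \<le> (e * d / 2) / ?R"
      by (rule hol_cauchy[OF h2]) (use in_ball that(4) d False in auto)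
    moreover have "dd h (\<lambda>y. f n y - f m y) x = dd h (f n) x - dd h (f m) x"
      by (rule hol_diff(2)) (use N0 that d in auto)
    ultimately show ?thesis using d False by (simp add: field_simps)
  qed
  have unif: "\<exists>N\<ge>N0. \<forall>n\<ge>N. \<forall>m\<ge>N. \<forall>x\<in>?S. \<forall>h. cmod (dd h (f n) x - dd h (f m) x) \<le> e * norm h" if "e > 0" for e
  proof -
    from u have "\<forall>\<^sub>F n in sequentially. \<forall>x\<in>ball w0 d. dist (f n x) (g x) < e * d / 4"
      using u[unfolded uniform_limit_iff, rule_format, of "e * d / 4"] that d by simp
    then obtain N where N: "\<And>n y. n \<ge> N \<Longrightarrow> y \<in> ball w0 d \<Longrightarrow> cmod (f n y - g y) < e * d / 4"
      unfolding eventually_sequentially dist_norm by blast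
    have "cmod (dd h (f n) x - dd h (f m) x) \<le> e * norm h" if "n \<ge> max N N0" "m \<ge> max N N0" "x \<in> ?S" for n m x h
    proof (rule diff)
      fix y assume y: "y \<in> ball w0 d"
      have "cmod (f n y - g y - (f m y - g y)) \<le> cmod (f n y - g y) + cmod (f m y - g y)" by (rule norm_triangle_ineq4)
      thus "cmod (f n y - f m y) \<le> e * d / 2" using N[OF _ y, of n] N[OF _ y, of m] that by simp
    qed (use that in auto)
    thus ?thesis by (intro exI[of _ "max N N0"]) auto
  qed
  define g' where "g' x h = lim (\<lambda>n. dd h (f n) x)" for x h
  have conv: "(\<lambda>n. dd h (f n) x) \<longlonglongrightarrow> g' x h" if x: "x \<in> ?S" for x h
  proof -
    have "Cauchy (\<lambda>n. dd h (f n) x)"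
    proof (rule metric_CauchyI)
      fix e :: real assume e: "e > 0"
      obtain N where N: "\<And>n m. n \<ge> N \<Longrightarrow> m \<ge> N \<Longrightarrow> cmod (dd h (f n) x - dd h (f m) x) \<le> (e / (norm h + 1)) * norm h"
        using unif[of "e / (norm h + 1)"] e x by (meson add_nonneg_pos divide_pos_pos norm_ge_zero zero_less_one)
      have "(e / (norm h + 1)) * norm h < e"
        using e pos_divide_less_eq[of "norm h + 1" "e * norm h" e] by (simp add: add_nonneg_pos distrib_left)
      thus "\<exists>M. \<forall>m\<ge>M. \<forall>n\<ge>M. dist (dd h (f m) x) (dd h (f n) x) < e"
        using N by (intro exI[of _ N]) (force simp: dist_norm)
    qed
    thus ?thesis unfolding g'_def using Cauchy_convergent convergent_LIMSEQ_iff by blast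
  qed
  have nle: "\<forall>\<^sub>F n in sequentially. \<forall>x\<in>?S. \<forall>h. norm (dd h (f (n+N0)) x - g' x h) \<le> e * norm h" if e: "e > 0" for e
  proof -
    obtain N where N: "N \<ge> N0" "\<And>n m x h. n \<ge> N \<Longrightarrow> m \<ge> N \<Longrightarrow> x \<in> ?S \<Longrightarrow> cmod (dd h (f n) x - dd h (f m) x) \<le> e * norm h"
      using unif[OF e] by blast
    have "norm (dd h (f n) x - g' x h) \<le> e * norm h" if "n \<ge> N" "x \<in> ?S" for n x h
    proof (rule tendsto_upperbound)
      show "(\<lambda>m. norm (dd h (f n) x - dd h (f m) x)) \<longlonglongrightarrow> norm (dd h (f n) x - g' x h)"
        by (intro tendsto_intros conv that)
      show "\<forall>\<^sub>F m in sequentially. norm (dd h (f n) x - dd h (f m) x) \<le> e * norm h"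
        using eventually_ge_at_top[of N] by eventually_elim (use N that in auto)
    qed auto
    thus ?thesis unfolding eventually_sequentially by (intro exI[of _ N]) (metis trans_le_add1)
  qed
  have glim: "(\<lambda>n. f (n+N0) x) \<longlonglongrightarrow> g x" if "x \<in> ball w0 d" for x
    using tendsto_uniform_limitI[OF u that] by (rule LIMSEQ_ignore_initial_segment)
  have der: "((f (n+N0)) has_derivative (\<lambda>h. dd h (f (n+N0)) x)) (at x within ?S)" if "x \<in> ?S" for n x
    using hol_D(1)[OF N0, of "n+N0" x] that d by (auto intro: has_derivative_at_withinI)
  have "\<exists>G. \<forall>x\<in>?S. (\<lambda>n. f (n+N0) x) \<longlonglongrightarrow> G x \<and> (G has_derivative g' x) (at x within ?S)"
    by (rule has_derivative_sequence[OF convex_ball der nle, of w0 "g w0"]) (use d glim[of w0] in auto)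
  then obtain G where G: "\<And>x. x \<in> ?S \<Longrightarrow> (\<lambda>n. f (n+N0) x) \<longlonglongrightarrow> G x" "\<And>x. x \<in> ?S \<Longrightarrow> (G has_derivative g' x) (at x within ?S)"
    by blast
  have Gg: "G x = g x" if "x \<in> ?S" for x
    using LIMSEQ_unique[OF G(1)[OF that] glim] that d by auto
  have gd: "(g has_derivative g' x) (at x)" if "x \<in> ?S" for x
    using has_derivative_transform_within_open[of G "g' x" x UNIV ?S g] G(2)[OF that] that Gg
    by (simp add: at_within_open[OF that])
  have lin: "g' x (c \<odot> h) = c * g' x h" if "x \<in> ?S" for x c h
  proof (rule LIMSEQ_unique[OF conv[OF that]])
    have "(\<lambda>n. c * dd h (f n) x) \<longlonglongrightarrow> c * g' x h" by (intro tendsto_intros conv that)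
    moreover have "\<forall>\<^sub>F n in sequentially. c * dd h (f n) x = dd (c \<odot> h) (f n) x"
      using eventually_ge_at_top[of N0] by eventually_elim (use hol_D(2)[OF N0] that d in auto)
    ultimately show "(\<lambda>n. dd (c \<odot> h) (f n) x) \<longlonglongrightarrow> c * g' x h" by (simp add: filterlim_cong)
  qed
  note * = hol_intro[of ?S g g', OF gd lin]
  show "hol ?S g" by (rule *(1))
  show "(\<lambda>n. dd h (f n) w) \<longlonglongrightarrow> dd h g w" if "w \<in> ?S" using conv[OF that] *(2)[OF _ _ that] by simp
qed

lemma hol_limit:
  assumes f: "\<And>n. hol A (f n)"
    and u: "\<And>w. w \<in> A \<Longrightarrow> \<exists>d>0. ball w d \<subseteq> A \<and> uniform_limit (ball w d) f g sequentially"
  shows "hol A g" "w \<in> A \<Longrightarrow> (\<lambda>n. dd h (f n) w) \<longlonglongrightarrow> dd h g w"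
proof -
  have *: "hol {w} g \<and> (\<lambda>n. dd h (f n) w) \<longlonglongrightarrow> dd h g w" if "w \<in> A" for w h
  proof -
    obtain d where d: "d > 0" "ball w d \<subseteq> A" "uniform_limit (ball w d) f g sequentially" using u[OF \<open>w \<in> A\<close>] by blast
    have f': "\<forall>\<^sub>F n in sequentially. hol (ball w d) (f n)" using hol_subset[OF f d(2)] by simp
    have w: "w \<in> ball w (d/2)" using d by simp
    show ?thesis using hol_limit_ball[OF d(1) f' d(3)] w hol_subset[of "ball w (d/2)" g "{w}"] by blast
  qed
  show "hol A g" using * unfolding hol_def by blast
  show "w \<in> A \<Longrightarrow> (\<lambda>n. dd h (f n) w) \<longlonglongrightarrow> dd h g w" using * by blast
qed

section \<open>Difference quotients and second derivatives\<close>

lemma difference_quotient_bound: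
  fixes t X D :: complex
  assumes "t \<noteq> 0" "cmod (X - t * D) \<le> C * (cmod t)\<^sup>2 / R"
  shows "cmod ((1 / t) * X - D) \<le> C * cmod t / R"
proof -
  have "(1 / t) * X - D = (X - t * D) / t" using assms(1) by (simp add: diff_divide_distrib)
  hence "cmod ((1 / t) * X - D) = cmod (X - t * D) / cmod t" by (simp add: norm_divide)
  also have "\<dots> \<le> (C * (cmod t)\<^sup>2 / R) / cmod t" using assms(2) by (rule divide_right_mono) simp
  also have "\<dots> = C * cmod t / R" using assms(1) by (simp add: power2_eq_square)
  finally show ?thesis .
qed

text \<open>The second order Taylor bound makes the difference quotients with step 1/(n+1) converge
  uniformly near each point. So \<open>dd h f\<close> is locally a uniform limit of holomorphic
  functions, which gives its holomorphy without a Cauchy formula in several variables.\<close>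

lemma hol_dd_aux:
  assumes A: "open A" and f: "hol A f" and w0: "w0 \<in> A"
  obtains d where "d > 0" "ball w0 d \<subseteq> A"
    "\<forall>\<^sub>F n in sequentially. hol (ball w0 d) (\<lambda>w. of_nat (Suc n) * (f (w + (1 / of_nat (Suc n)) \<odot> h) - f w))"
    "\<forall>\<^sub>F n in sequentially. \<forall>w\<in>ball w0 d. w + (1 / of_nat (Suc n)) \<odot> h \<in> A"
    "uniform_limit (ball w0 d) (\<lambda>n w. of_nat (Suc n) * (f (w + (1 / of_nat (Suc n)) \<odot> h) - f w)) (dd h f) sequentially"
proof -
  obtain d1 where d1: "d1 > 0" "\<And>w. dist w w0 < d1 \<Longrightarrow> cmod (f w - f w0) < 1"
    using hol_cont[OF f w0] unfolding continuous_at_eps_delta by (metis dist_norm zero_less_one)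
  obtain d2 where d2: "d2 > 0" "ball w0 d2 \<subseteq> A" using A w0 by (meson openE)
  define d where "d = min d1 d2 / 2"
  have d: "d > 0" using d1 d2 by (simp add: d_def)
  define C where "C = cmod (f w0) + 1"
  have C: "C > 0" by (simp add: C_def add_nonneg_pos)
  have bd: "x \<in> A" "cmod (f x) \<le> C" if "dist w0 x < 2 * d" for x
  proof -
    have "dist w0 x < d1" "dist w0 x < d2" using that by (auto simp: d_def)
    thus "x \<in> A" "cmod (f x) \<le> C" using d1(2)[of x] d2(2) norm_triangle_ineq2[of "f x" "f w0"]
      by (auto simp: C_def dist_commute)
  qed
  \<comment> \<open>The summand 1 keeps the radius \<open>d / K\<close> meaningful for h =
    0.\<close>
  define K where "K = norm h + 1"
  have K: "K > 0" "norm h < K" by (auto simp: K_def add_nonneg_pos)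
  define R where "R = d / K"
  have R: "R > 0" using d K by (simp add: R_def)
  have near: "dist w0 (w + t \<odot> h) < 2 * d" if "w \<in> ball w0 d" "cmod t < R" for w t
  proof -
    have "norm (t \<odot> h) \<le> cmod t * K" using K by (simp add: norm_cs mult_left_mono)
    also have "\<dots> < d" using that(2) K by (simp add: R_def field_simps)
    finally have "norm (t \<odot> h) < d" .
    moreover have "norm (w - w0) < d" using that(1) by (simp add: dist_norm norm_minus_commute)
    ultimately have "norm (w - w0 + t \<odot> h) < 2 * d" using norm_triangle_ineq[of "w - w0" "t \<odot> h"] by simp
    moreover have "dist w0 (w + t \<odot> h) = norm (w - w0 + t \<odot> h)"
      by (metis add_diff_eq add.commute diff_add_eq dist_commute dist_norm)
    ultimately show ?thesis by simp
  qed
  have ev: "\<forall>\<^sub>F n in sequentially. inverse (real (Suc n)) < e" if "e > 0" for e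
    using order_tendstoD(2)[OF LIMSEQ_inverse_real_of_nat that] .
  have sz: "cmod (1 / of_nat (Suc n)) = inverse (real (Suc n))" for n
    by (simp add: norm_divide inverse_eq_divide del: of_nat_Suc)
  show ?thesis
  proof
    show "d > 0" by fact
    show "ball w0 d \<subseteq> A" using bd(1) d by (intro subsetI) simp
    show "\<forall>\<^sub>F n in sequentially. \<forall>w\<in>ball w0 d. w + (1 / of_nat (Suc n)) \<odot> h \<in> A"
      using ev[OF R]
    proof eventually_elim
      case (elim n)
      thus ?case using near bd(1) sz[of n] by metis
    qed
    then show "\<forall>\<^sub>F n in sequentially. hol (ball w0 d) (\<lambda>w. of_nat (Suc n) * (f (w + (1 / of_nat (Suc n)) \<odot> h) - f w))"
    proof eventually_elim
      case (elim n)
      let ?t = "1 / of_nat (Suc n) :: complex"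
      have "hol (ball w0 d) (\<lambda>w. f (\<chi> i. fst w $ i + fst (?t \<odot> h) $ i, \<chi> i. snd w $ i + snd (?t \<odot> h) $ i))"
      proof (rule hol_compose(1)[OF f])
        fix w assume "w \<in> ball w0 d"
        moreover have "(\<chi> i. fst w $ i + fst (?t \<odot> h) $ i, \<chi> i. snd w $ i + snd (?t \<odot> h) $ i) = w + ?t \<odot> h"
          by (rule cv_eqI) auto
        ultimately show "(\<chi> i. fst w $ i + fst (?t \<odot> h) $ i, \<chi> i. snd w $ i + snd (?t \<odot> h) $ i) \<in> A"
          using elim by metis
      qed (intro hol_add hol_fst hol_snd hol_const)+
      moreover have "(\<chi> i. fst w $ i + fst (?t \<odot> h) $ i, \<chi> i. snd w $ i + snd (?t \<odot> h) $ i) = w + ?t \<odot> h" for w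
        by (rule cv_eqI) auto
      ultimately have "hol (ball w0 d) (\<lambda>w. f (w + ?t \<odot> h))" by simp
      moreover have "hol (ball w0 d) f" by (rule hol_subset[OF f]) (use bd(1) d in \<open>intro subsetI, simp\<close>)
      ultimately show ?case by (intro hol_cmult hol_diff)
    qed
    show "uniform_limit (ball w0 d) (\<lambda>n w. of_nat (Suc n) * (f (w + (1 / of_nat (Suc n)) \<odot> h) - f w)) (dd h f) sequentially"
      unfolding uniform_limit_iff
    proof safe
      fix e :: real assume e: "e > 0"
      have "\<forall>\<^sub>F n in sequentially. inverse (real (Suc n)) < R / 2 \<and> inverse (real (Suc n)) < e * R\<^sup>2 / (8 * C)"
        using ev[of "R/2"] ev[of "e * R\<^sup>2 / (8 * C)"] R C e by (auto simp: eventually_conj_iff)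
      thus "\<forall>\<^sub>F n in sequentially. \<forall>x\<in>ball w0 d. dist (of_nat (Suc n) * (f (x + (1 / of_nat (Suc n)) \<odot> h) - f x)) (dd h f x) < e"
      proof eventually_elim
        case (elim n)
        show ?case
        proof
          fix w assume w: "w \<in> ball w0 d"
          let ?t = "1 / of_nat (Suc n) :: complex"
          have t: "cmod ?t > 0" "?t \<noteq> 0" by (simp_all add: norm_divide del: of_nat_Suc)
          have "cmod (f (w + ?t \<odot> h) - f w - ?t * dd h f w) \<le> 8 * C * (cmod ?t)\<^sup>2 / R\<^sup>2"
          proof (rule hol_taylor(2)[OF f _ _ R])
            show "cmod ?t \<le> R / 2" using elim sz[of n] by linarith
          qed (use near[OF w] bd in blast)+
          from difference_quotient_bound[OF t(2) this]
          have "cmod (of_nat (Suc n) * (f (w + ?t \<odot> h) - f w) - dd h f w) \<le> 8 * C * cmod ?t / R\<^sup>2"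
            by (simp del: of_nat_Suc)
          also have "8 * C * cmod ?t / R\<^sup>2 < e"
            using elim C R unfolding sz by (simp add: pos_divide_less_eq pos_less_divide_eq mult.commute del: of_nat_Suc)
          finally show "dist (of_nat (Suc n) * (f (w + ?t \<odot> h) - f w)) (dd h f w) < e" by (simp add: dist_norm)
        qed
      qed
    qed
  qed
qed

lemma hol_dd:
  assumes A: "open A" and f: "hol A f"
  shows "hol A (dd h f)"
proof -
  have "hol {w} (dd h f)" if wA: "w \<in> A" for w
  proof -
    obtain d where d: "d > 0" "ball w d \<subseteq> A"
    "\<forall>\<^sub>F n in sequentially. hol (ball w d) (\<lambda>w. of_nat (Suc n) * (f (w + (1 / of_nat (Suc n)) \<odot> h) - f w))"
    "\<forall>\<^sub>F n in sequentially. \<forall>w\<in>ball w d. w + (1 / of_nat (Suc n)) \<odot> h \<in> A"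
    "uniform_limit (ball w d) (\<lambda>n w. of_nat (Suc n) * (f (w + (1 / of_nat (Suc n)) \<odot> h) - f w)) (dd h (f)) sequentially"
      by (rule hol_dd_aux[OF A f wA]) (rule that)
    show ?thesis using hol_limit_ball(1)[OF d(1,3,5)] d(1) hol_subset[of "ball w (d/2)" "dd h f" "{w}"] by simp
  qed
  thus ?thesis unfolding hol_def by blast
qed

lemma has_derivative_translate:
  assumes "hol A f" "w + a \<in> A"
  shows "((\<lambda>w. f (w + a)) has_derivative (\<lambda>h. dd h f (w + a))) (at w)"
proof -
  have "((\<lambda>w. w + a) has_derivative (\<lambda>h. h)) (at w)" by (auto intro!: derivative_eq_intros)
  from has_derivative_compose[OF this hol_D(1)[OF assms]] show ?thesis .
qed

text \<open>Differentiating the difference quotients of \<open>f\<close> in direction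
  \<open>h\<close> along \<open>g\<close> gives the difference quotients of \<open>dd g f\<close>.
  The former converge by the Weierstrass limit, the latter by \<open>hol_dd_aux\<close> applied to
  \<open>dd g f\<close>.\<close>

lemma dd_commute:
  assumes A: "open A" and f: "hol A f" and w: "w \<in> A"
  shows "dd g (dd h f) w = dd h (dd g f) w"
proof -
  obtain d where d: "d > 0" "ball w d \<subseteq> A"
    "\<forall>\<^sub>F n in sequentially. hol (ball w d) (\<lambda>w. of_nat (Suc n) * (f (w + (1 / of_nat (Suc n)) \<odot> h) - f w))"
    "\<forall>\<^sub>F n in sequentially. \<forall>w\<in>ball w d. w + (1 / of_nat (Suc n)) \<odot> h \<in> A"
    "uniform_limit (ball w d) (\<lambda>n w. of_nat (Suc n) * (f (w + (1 / of_nat (Suc n)) \<odot> h) - f w)) (dd h (f)) sequentially"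
    by (rule hol_dd_aux[OF A f w]) (rule that)
  obtain d' where d': "d' > 0" "ball w d' \<subseteq> A"
    "\<forall>\<^sub>F n in sequentially. hol (ball w d') (\<lambda>w. of_nat (Suc n) * (dd g f (w + (1 / of_nat (Suc n)) \<odot> h) - dd g f w))"
    "\<forall>\<^sub>F n in sequentially. \<forall>w\<in>ball w d'. w + (1 / of_nat (Suc n)) \<odot> h \<in> A"
    "uniform_limit (ball w d') (\<lambda>n w. of_nat (Suc n) * (dd g f (w + (1 / of_nat (Suc n)) \<odot> h) - dd g f w)) (dd h (dd g f)) sequentially"
    by (rule hol_dd_aux[OF A hol_dd[OF A f] w]) (rule that)
  have 1: "(\<lambda>n. dd g (\<lambda>w. of_nat (Suc n) * (f (w + (1 / of_nat (Suc n)) \<odot> h) - f w)) w) \<longlonglongrightarrow> dd g (dd h f) w"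
    by (rule hol_limit_ball(2)[OF d(1,3,5)]) (use d in simp)
  have 2: "(\<lambda>n. of_nat (Suc n) * (dd g f (w + (1 / of_nat (Suc n)) \<odot> h) - dd g f w)) \<longlonglongrightarrow> dd h (dd g f) w"
    by (rule tendsto_uniform_limitI[OF d'(5)]) (use d' in simp)
  have ev: "\<forall>\<^sub>F n in sequentially. dd g (\<lambda>w. of_nat (Suc n) * (f (w + (1 / of_nat (Suc n)) \<odot> h) - f w)) w =
     of_nat (Suc n) * (dd g f (w + (1 / of_nat (Suc n)) \<odot> h) - dd g f w)"
    using d(4)
  proof eventually_elim
    case (elim n)
    let ?a = "(1 / of_nat (Suc n)) \<odot> h"
    have wb: "w \<in> ball w d" using d by simp
    have wa: "w + ?a \<in> A" using elim wb by blast
    have *: "((\<lambda>w. f (w + ?a)) has_derivative (\<lambda>h. dd h f (w + ?a))) (at w)"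
      by (rule has_derivative_translate[OF f wa])
    have "dd g (\<lambda>w. of_nat (Suc n) * (f (w + ?a) - f w)) w = of_nat (Suc n) * (dd g f (w + ?a) - dd g f w)"
    proof (rule dd_unique)
      show "((\<lambda>w. of_nat (Suc n) * (f (w + ?a) - f w)) has_derivative (\<lambda>g. of_nat (Suc n) * (dd g f (w + ?a) - dd g f w))) (at w)"
        by (intro has_derivative_mult_right has_derivative_diff * hol_D(1)[OF f w])
    qed (simp add: hol_D(2)[OF f w] hol_D(2)[OF f wa] algebra_simps del: of_nat_Suc)
    thus ?case .
  qed
  have "(\<lambda>n. dd g (\<lambda>w. of_nat (Suc n) * (f (w + (1 / of_nat (Suc n)) \<odot> h) - f w)) w) \<longlonglongrightarrow> dd h (dd g f) w"
    by (rule Lim_transform_eventually[OF 2]) (use ev in \<open>simp only: eq_commute\<close>)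
  thus ?thesis using LIMSEQ_unique[OF 1] by blast
qed

section \<open>Fourier series\<close>
text \<open>The increment of a primitive of \<open>h\<close> over one period has derivative zero in
  the starting point. Periodicity is asked only at base points in \<open>T\<close>, since the
  function of interest is holomorphic only on a bounded piece \<open>S\<close> of a strip.\<close>

lemma period_integral:
  fixes h :: "complex \<Rightarrow> complex"
  assumes S: "convex S" "open S" and h: "h holomorphic_on S"
    and T: "convex T" "T \<subseteq> S" "\<And>z. z \<in> T \<Longrightarrow> z + of_real (2 * pi) \<in> S"
    and per: "\<And>z. z \<in> T \<Longrightarrow> h (z + of_real (2 * pi)) = h z"
    and ab: "a \<in> T" "b \<in> T"
  shows "integral {0..1} (\<lambda>t. h (a + of_real (2 * pi * t))) = integral {0..1} (\<lambda>t. h (b + of_real (2 * pi * t)))"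
proof -
  obtain g where g0: "\<And>x. x \<in> S \<Longrightarrow> (g has_field_derivative h x) (at x within S)"
    by (rule holomorphic_convex_primitive'[OF S h]) (rule that)
  have g: "(g has_field_derivative h x) (at x)" if "x \<in> S" for x
    using g0[OF that] at_within_open[OF that S(2)] by simp
  have der0: "((\<lambda>z. g (z + of_real (2 * pi)) - g z) has_field_derivative 0) (at x within T)" if "x \<in> T" for x
  proof -
    have "((\<lambda>z. z + of_real (2 * pi)) has_field_derivative 1) (at x)" by (auto intro!: derivative_eq_intros)
    from DERIV_diff[OF DERIV_chain2[OF g[OF T(3)[OF that]] this] g[of x]] T(2) that
    have "((\<lambda>z. g (z + of_real (2 * pi)) - g z) has_field_derivative h (x + of_real (2 * pi)) * 1 - h x) (at x)"
      by blast
    hence "((\<lambda>z. g (z + of_real (2 * pi)) - g z) has_field_derivative 0) (at x)" using per[OF that] by simp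
    thus ?thesis by (rule has_field_derivative_at_within)
  qed
  obtain K where K: "\<And>x. x \<in> T \<Longrightarrow> g (x + of_real (2 * pi)) - g x = K"
    using has_field_derivative_zero_constant[OF T(1) der0] by blast
  have "integral {0..1} (\<lambda>t. h (c + of_real (2 * pi * t))) = K / of_real (2 * pi)" if c: "c \<in> T" for c
  proof -
    have inS: "c + of_real (2 * pi * t) \<in> S" if t: "t \<in> {0..1}" for t
    proof -
      have "(1 - t) *\<^sub>R c + t *\<^sub>R (c + of_real (2 * pi)) \<in> S"
        using t T c by (intro convexD_alt[OF S(1), of c "c + of_real (2 * pi)" t]) auto
      moreover have "(1 - t) *\<^sub>R c + t *\<^sub>R (c + of_real (2 * pi)) = c + of_real (2 * pi * t)"
        by (simp add: complex_eq_iff algebra_simps)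
      ultimately show ?thesis by simp
    qed
    have "((\<lambda>t. h (c + of_real (2 * pi * t)) * of_real (2 * pi)) has_integral
        (g (c + of_real (2 * pi * 1)) - g (c + of_real (2 * pi * 0)))) {0..1}"
    proof (rule fundamental_theorem_of_calculus)
      fix t :: real assume t: "t \<in> {0..1}"
      have 1: "((\<lambda>t. c + of_real (2 * pi * t)) has_vector_derivative of_real (2 * pi)) (at t within {0..1})"
        by (auto intro!: derivative_eq_intros simp: has_vector_derivative_def scaleR_conv_of_real)
      show "((\<lambda>t. g (c + of_real (2 * pi * t))) has_vector_derivative h (c + of_real (2 * pi * t)) * of_real (2 * pi)) (at t within {0..1})"
        using field_vector_diff_chain_within[OF 1 has_field_derivative_at_within[OF g[OF inS[OF t]]]]
        unfolding o_def by (subst mult.commute)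
    qed auto
    hence "((\<lambda>t. h (c + of_real (2 * pi * t)) * of_real (2 * pi)) has_integral K) {0..1}" using K[OF c] by simp
    hence "((\<lambda>t. h (c + of_real (2 * pi * t)) * of_real (2 * pi) / of_real (2 * pi)) has_integral (K / of_real (2 * pi))) {0..1}"
      by (rule has_integral_divide)
    thus ?thesis by (simp add: integral_unique)
  qed
  thus ?thesis using ab by simp
qed

text \<open>The remainder after n terms is the integral of \<open>g * b ^ n / (1 - b)\<close>, which
  decays geometrically. The bound on single terms supplies the absolute summability needed for an
  unordered sum over the integers.\<close>

lemma geometric_integral_sums:
  fixes g b :: "real \<Rightarrow> complex"
  assumes g: "continuous_on {0..1} g" and b: "continuous_on {0..1} b"
    and G: "\<And>t. t \<in> {0..1} \<Longrightarrow> cmod (g t) \<le> G" and \<beta>: "\<And>t. t \<in> {0..1} \<Longrightarrow> cmod (b t) \<le> \<beta>" "\<beta> < 1"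
  shows "(\<lambda>k. integral {0..1} (\<lambda>t. g t * b t ^ k)) sums integral {0..1} (\<lambda>t. g t / (1 - b t))"
    "cmod (integral {0..1} (\<lambda>t. g t * b t ^ k)) \<le> G * \<beta> ^ k"
proof -
  have z01: "(0::real) \<in> {0..1}" by simp
  have \<beta>0: "0 \<le> \<beta>" using order_trans[OF norm_ge_zero \<beta>(1)[OF z01]] .
  have G0: "0 \<le> G" using order_trans[OF norm_ge_zero G[OF z01]] .
  have ne: "1 - b t \<noteq> 0" if "t \<in> {0..1}" for t using \<beta>(1)[OF that] \<beta>(2) by auto
  have lb: "1 - \<beta> \<le> cmod (1 - b t)" if "t \<in> {0..1}" for t
    using \<beta>(1)[OF that] norm_triangle_ineq2[of 1 "b t"] by simp
  show "cmod (integral {0..1} (\<lambda>t. g t * b t ^ k)) \<le> G * \<beta> ^ k"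
  proof -
    have "cmod (integral {0..1} (\<lambda>t. g t * b t ^ k)) \<le> G * \<beta> ^ k * (1 - 0)"
    proof (rule integral_bound)
      show "continuous_on {0..1} (\<lambda>t. g t * b t ^ k)" by (intro continuous_intros g b)
      show "norm (g t * b t ^ k) \<le> G * \<beta> ^ k" if "t \<in> {0..1}" for t
        unfolding norm_mult norm_power using that by (intro mult_mono power_mono G \<beta>(1) G0) auto
    qed simp
    thus ?thesis by simp
  qed
  have c: "continuous_on {0..1} (\<lambda>t. g t / (1 - b t))" by (intro continuous_intros g b) (use ne in auto)
  have eq: "integral {0..1} (\<lambda>t. g t / (1 - b t)) - (\<Sum>k<n. integral {0..1} (\<lambda>t. g t * b t ^ k)) =
     integral {0..1} (\<lambda>t. g t * b t ^ n / (1 - b t))" for n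
  proof -
    have "(\<Sum>k<n. integral {0..1} (\<lambda>t. g t * b t ^ k)) = integral {0..1} (\<lambda>t. \<Sum>k<n. g t * b t ^ k)"
      by (rule integral_sum[symmetric]) (intro finite_lessThan integrable_continuous_real continuous_intros g b)+
    hence "integral {0..1} (\<lambda>t. g t / (1 - b t)) - (\<Sum>k<n. integral {0..1} (\<lambda>t. g t * b t ^ k)) =
      integral {0..1} (\<lambda>t. g t / (1 - b t) - (\<Sum>k<n. g t * b t ^ k))"
      by (subst integral_diff) (simp_all only:, (intro integrable_continuous_real continuous_intros g b c)+)
    also have "\<dots> = integral {0..1} (\<lambda>t. g t * b t ^ n / (1 - b t))"
    proof (rule integral_cong)
      fix t :: real assume t: "t \<in> {0..1}"
      have "(\<Sum>k<n. b t ^ k) = (1 - b t ^ n) / (1 - b t)" using ne[OF t] by (simp add: sum_gp_strict)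
      thus "g t / (1 - b t) - (\<Sum>k<n. g t * b t ^ k) = g t * b t ^ n / (1 - b t)"
        unfolding sum_distrib_left[symmetric] by (simp add: right_diff_distrib diff_divide_distrib)
    qed
    finally show ?thesis .
  qed
  have bd: "cmod (integral {0..1} (\<lambda>t. g t * b t ^ n / (1 - b t))) \<le> G * \<beta> ^ n / (1 - \<beta>)" for n
  proof -
    have "cmod (integral {0..1} (\<lambda>t. g t * b t ^ n / (1 - b t))) \<le> G * \<beta> ^ n / (1 - \<beta>) * (1 - 0)"
    proof (rule integral_bound)
      show "continuous_on {0..1} (\<lambda>t. g t * b t ^ n / (1 - b t))"
        by (intro continuous_intros g b) (use ne in auto)
      fix t :: real assume t: "t \<in> {0..1}"
      show "cmod (g t * b t ^ n / (1 - b t)) \<le> G * \<beta> ^ n / (1 - \<beta>)"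
        unfolding norm_divide norm_mult norm_power using t \<beta>(2)
        by (intro frac_le mult_mono power_mono G \<beta>(1) lb G0 mult_nonneg_nonneg zero_le_power \<beta>0) auto
    qed auto
    thus ?thesis by simp
  qed
  have "(\<lambda>n. G * \<beta> ^ n / (1 - \<beta>)) \<longlonglongrightarrow> G * 0 / (1 - \<beta>)"
    using \<beta>0 \<beta>(2) by (intro tendsto_intros LIMSEQ_power_zero) auto
  hence l0: "(\<lambda>n. G * \<beta> ^ n / (1 - \<beta>)) \<longlonglongrightarrow> 0" by simp
  have "(\<lambda>n. integral {0..1} (\<lambda>t. g t * b t ^ n / (1 - b t))) \<longlonglongrightarrow> 0"
    by (rule Lim_null_comparison[OF always_eventually[OF allI[OF bd]] l0])
  from tendsto_diff[OF tendsto_const[of "integral {0..1} (\<lambda>t. g t / (1 - b t))"] this[folded eq]]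
  show "(\<lambda>k. integral {0..1} (\<lambda>t. g t * b t ^ k)) sums integral {0..1} (\<lambda>t. g t / (1 - b t))"
    by (simp add: sums_def)
qed

section \<open>Fourier series of one complex angle\<close>

definition cstrip :: "real \<Rightarrow> complex set" where "cstrip r = {z. \<bar>Im z\<bar> < r}"

lemma cstrip_props: "convex (cstrip r)" "open (cstrip r)"
proof -
  have "cstrip r = {z. Im z < r} \<inter> {z. Im z > - r}" by (auto simp: cstrip_def)
  thus "convex (cstrip r)" "open (cstrip r)"
    by (auto intro!: convex_Int convex_halfspace_Im_lt convex_halfspace_Im_gt open_Int open_halfspace_Im_lt open_halfspace_Im_gt)
qed

definition fc :: "(complex \<Rightarrow> complex) \<Rightarrow> int \<Rightarrow> complex" where
  "fc \<phi> k = integral {0..1} (\<lambda>t. \<phi> (of_real (2 * pi * t)) * exp (- \<i> * of_int k * of_real (2 * pi * t)))"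

lemma exp_period: "exp (- \<i> * of_int k * (z + of_real (2 * pi))) = exp (- \<i> * of_int k * z)"
proof -
  have 1: "- \<i> * of_int k * (z + of_real (2 * pi)) = - \<i> * of_int k * z + of_real (2 * of_int (- k) * pi) * \<i>"
    by (simp add: algebra_simps)
  have 2: "exp (of_real (2 * of_int (- k) * pi) * \<i>) = 1" by (rule exp_integer_2pi) simp
  show ?thesis unfolding 1 exp_add 2 by simp
qed

text \<open>Moving the path of integration inside the strip is what later yields exponential decay
  of the coefficients.\<close>

lemma fc_shift:
  assumes h: "\<phi> holomorphic_on cstrip r" and per: "\<And>z. z \<in> cstrip r \<Longrightarrow> \<phi> (z + of_real (2 * pi)) = \<phi> z"
    and a: "a \<in> cstrip r"
  shows "integral {0..1} (\<lambda>t. \<phi> (a + of_real (2 * pi * t)) * exp (- \<i> * of_int k * (a + of_real (2 * pi * t)))) = fc \<phi> k"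
proof -
  let ?h = "\<lambda>z. \<phi> z * exp (- \<i> * of_int k * z)"
  have "r > 0" using a by (auto simp: cstrip_def)
  have "integral {0..1} (\<lambda>t. ?h (a + of_real (2 * pi * t))) = integral {0..1} (\<lambda>t. ?h (0 + of_real (2 * pi * t)))"
  proof (rule period_integral[OF cstrip_props])
    show "?h holomorphic_on cstrip r" by (intro holomorphic_intros h)
    show "convex (cstrip r)" by (rule cstrip_props)
    show "?h (z + of_real (2 * pi)) = ?h z" if "z \<in> cstrip r" for z
      using per[OF that] exp_period[of k z] by simp
  qed (use a \<open>r > 0\<close> in \<open>auto simp: cstrip_def\<close>)
  thus ?thesis by (simp add: fc_def)
qed

lemma fc_one: "fc (\<lambda>_. 1) k = (if k = 0 then 1 else 0)"
proof (cases "k = 0")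
  case False
  let ?G = "\<lambda>t. exp (- \<i> * of_int k * of_real (2 * pi * t)) / (- \<i> * of_int k * of_real (2 * pi))"
  have "((\<lambda>t. exp (- \<i> * of_int k * of_real (2 * pi * t))) has_integral (?G 1 - ?G 0)) {0..1}"
  proof (rule fundamental_theorem_of_calculus)
    fix t :: real assume "t \<in> {0..1}"
    have "((\<lambda>z. exp (- \<i> * of_int k * of_real (2 * pi) * z) / (- \<i> * of_int k * of_real (2 * pi))) has_field_derivative
       exp (- \<i> * of_int k * of_real (2 * pi) * of_real t)) (at (of_real t))"
      using False by (auto intro!: derivative_eq_intros)
    from has_vector_derivative_real_field[OF this]
    show "(?G has_vector_derivative exp (- \<i> * of_int k * of_real (2 * pi * t))) (at t within {0..1})"
      by (auto intro: has_vector_derivative_at_within simp: mult.assoc)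
  qed auto
  moreover have "?G 1 = ?G 0" using exp_period[of k 0] by simp
  ultimately show ?thesis using False by (simp add: fc_def integral_unique)
qed (simp add: fc_def)

text \<open>A Cauchy formula for periodic functions. The quotient of
  \<open>\<phi> \<zeta> - \<phi> z\<close> by \<open>exp (\<i> * \<zeta>) - exp (\<i> * z)\<close>
  is holomorphic and periodic, so its integrals over a period above and below z agree. Expanding the
  denominator geometrically on the two lines produces the terms with k \<le> 0 and with k \<ge> 1.
  Subtracting \<phi> z in the numerator takes the place of a residue.\<close>

lemma fourier_inversion:
  assumes h: "\<phi> holomorphic_on cstrip r" and per: "\<And>z. z \<in> cstrip r \<Longrightarrow> \<phi> (z + of_real (2 * pi)) = \<phi> z"
    and z: "z \<in> cstrip r"
  shows "((\<lambda>k. fc \<phi> k * exp (\<i> * of_int k * z)) has_sum \<phi> z) UNIV"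
proof -
  \<comment> \<open>The lines at heights \<sigma> and -\<sigma> enclose z inside the strip; the gap
    between z and these lines gives the common ratio \<open>\<beta>\<close> of both geometric
    series.\<close>
  define \<sigma> where "\<sigma> = (\<bar>Im z\<bar> + r) / 2"
  have \<sigma>: "\<bar>Im z\<bar> < \<sigma>" "\<sigma> < r" "0 < \<sigma>" using z by (auto simp: \<sigma>_def cstrip_def)
  define ap am where "ap = Complex (Re z - pi) \<sigma>" and "am = Complex (Re z - pi) (-\<sigma>)"
  define zp zm where "zp = (\<lambda>t::real. ap + of_real (2 * pi * t))" and "zm = (\<lambda>t::real. am + of_real (2 * pi * t))"
  define q where "q = (\<lambda>t. exp (\<i> * (zp t - z)))"
  define p where "p = (\<lambda>t. exp (- (\<i> * (zm t - z))))"
  define \<beta> where "\<beta> = exp (\<bar>Im z\<bar> - \<sigma>)"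
  have \<beta>: "\<beta> < 1" using \<sigma> by (simp add: \<beta>_def)
  have qb: "cmod (q t) \<le> \<beta>" and pb: "cmod (p t) \<le> \<beta>" for t
    by (auto simp: q_def p_def \<beta>_def zp_def zm_def ap_def am_def)
  \<comment> \<open>The window contains a whole period from the base points \<open>ap\<close> and
    \<open>am\<close>, but no translate of z by a nonzero multiple of 2 pi, because pi + 1 < 2 pi.
    Hence the denominator of the quotient vanishes in \<open>S\<close> only at z, where the
    singularity is removable.\<close>
  define S where "S = cstrip r \<inter> {\<zeta>. Re \<zeta> > Re z - pi - 1} \<inter> {\<zeta>. Re \<zeta> < Re z + pi + 1}"
  define T where "T = cstrip r \<inter> {\<zeta>. Re \<zeta> > Re z - pi - 1} \<inter> {\<zeta>. Re \<zeta> < Re z - pi + 1}"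
  have S: "convex S" "open S" and T: "convex T"
    unfolding S_def T_def by (intro convex_Int open_Int cstrip_props convex_halfspace_Re_lt convex_halfspace_Re_gt open_halfspace_Re_lt open_halfspace_Re_gt)+
  have pi3: "pi > 3" using pi_gt3 .
  have zS: "z \<in> S" using z pi3 by (simp add: S_def)
  let ?e = "\<lambda>\<zeta>. exp (\<i> * \<zeta>)"
  define num where "num = (\<lambda>\<zeta>. if \<zeta> = z then deriv \<phi> z else (\<phi> \<zeta> - \<phi> z) / (\<zeta> - z))"
  define den where "den = (\<lambda>\<zeta>. if \<zeta> = z then deriv ?e z else (?e \<zeta> - ?e z) / (\<zeta> - z))"
  have num: "num holomorphic_on S" unfolding num_def
  proof (rule pole_lemma)
    show "\<phi> holomorphic_on S" by (rule holomorphic_on_subset[OF h]) (auto simp: S_def)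
    show "z \<in> interior S" using zS S(2) by (simp add: interior_open)
  qed
  have den: "den holomorphic_on S" unfolding den_def
    by (rule pole_lemma) (use zS S in \<open>auto simp: interior_open intro!: holomorphic_intros\<close>)
  have e_ne: "?e \<zeta> \<noteq> ?e z" if "\<zeta> \<in> S" "\<zeta> \<noteq> z" for \<zeta>
  proof
    assume "?e \<zeta> = ?e z"
    then obtain n :: int where "\<i> * \<zeta> = \<i> * z + of_int (2 * n) * of_real pi * \<i>" unfolding exp_eq by (auto simp: mult_ac)
    hence "\<i> * (\<zeta> - (z + of_int (2 * n) * of_real pi)) = 0" by (simp add: algebra_simps)
    hence n: "\<zeta> = z + of_int (2 * n) * of_real pi" by simp
    hence Re: "Re \<zeta> = Re z + 2 * of_int n * pi" by simp
    have "n \<noteq> 0" using n that by auto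
    hence "real_of_int \<bar>n\<bar> \<ge> 1" by linarith
    hence "\<bar>2 * of_int n * pi\<bar> \<ge> 2 * pi" by (simp add: abs_mult)
    thus False using Re that(1) pi3 by (auto simp: S_def)
  qed
  have "deriv ?e z = \<i> * ?e z" by (rule DERIV_imp_deriv) (auto intro!: derivative_eq_intros)
  hence den0: "den \<zeta> \<noteq> 0" if "\<zeta> \<in> S" for \<zeta> using e_ne[OF that] by (auto simp: den_def)
  define G where "G = (\<lambda>\<zeta>. num \<zeta> / den \<zeta>)"
  have G: "G holomorphic_on S" unfolding G_def by (intro holomorphic_intros num den den0)
  have Geq: "G \<zeta> = (\<phi> \<zeta> - \<phi> z) / (?e \<zeta> - ?e z)" if "\<zeta> \<noteq> z" for \<zeta>
    using that by (simp add: G_def num_def den_def)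
  have e_per: "?e (\<zeta> + of_real (2 * pi)) = ?e \<zeta>" for \<zeta>
    using exp_period[of "-1" \<zeta>] by simp
  have Gint: "integral {0..1} (\<lambda>t. G (ap + of_real (2 * pi * t))) = integral {0..1} (\<lambda>t. G (am + of_real (2 * pi * t)))"
  proof (rule period_integral[OF S G T])
    show "T \<subseteq> S" using pi3 by (auto simp: S_def T_def)
    show "x + of_real (2 * pi) \<in> S" if "x \<in> T" for x using that pi3 by (auto simp: S_def T_def cstrip_def)
    show "G (x + of_real (2 * pi)) = G x" if x: "x \<in> T" for x
    proof -
      have "x \<noteq> z" "x + of_real (2 * pi) \<noteq> z" using x pi3 by (auto simp: T_def complex_eq_iff)
      thus ?thesis using per[of x] x e_per[of x] by (simp add: Geq T_def)
    qed
    show "ap \<in> T" "am \<in> T" using \<sigma> by (auto simp: ap_def am_def T_def cstrip_def)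
  qed
  have apm: "ap \<in> cstrip r" "am \<in> cstrip r" using \<sigma> by (auto simp: ap_def am_def cstrip_def)
  have zpm: "zp t \<in> cstrip r" "zm t \<in> cstrip r" for t using \<sigma> by (auto simp: zp_def zm_def ap_def am_def cstrip_def)
  have contz: "continuous_on {0..1} zp" "continuous_on {0..1} zm" unfolding zp_def zm_def by (intro continuous_intros)+
  have cont\<phi>: "continuous_on {0..1} (\<lambda>t. \<phi> (zp t))" "continuous_on {0..1} (\<lambda>t. \<phi> (zm t))"
    by (rule continuous_on_compose2[OF holomorphic_on_imp_continuous_on[OF h]]; use contz zpm in auto)+
  have contq: "continuous_on {0..1} q" "continuous_on {0..1} p" unfolding q_def p_def by (intro continuous_intros contz)+
  define gp gm where "gp = (\<lambda>t. \<phi> (zp t) - \<phi> z)" and "gm = (\<lambda>t. (\<phi> (zm t) - \<phi> z) * p t)"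
  have cg: "continuous_on {0..1} gp" "continuous_on {0..1} gm" unfolding gp_def gm_def by (intro continuous_intros cont\<phi> contq)+
  obtain Cp Cm where C: "\<And>t. t \<in> {0..1} \<Longrightarrow> cmod (gp t) \<le> Cp" "\<And>t. t \<in> {0..1} \<Longrightarrow> cmod (gm t) \<le> Cm"
    using continuous_on_compact_bound[OF compact_Icc cg(1)] continuous_on_compact_bound[OF compact_Icc cg(2)] by metis
  note sp = geometric_integral_sums[OF cg(1) contq(1) C(1) qb \<beta>]
  note sm = geometric_integral_sums[OF cg(2) contq(2) C(2) pb \<beta>]
  have Gp: "G (zp t) = - (1 / ?e z) * (gp t / (1 - q t))" if "t \<in> {0..1}" for t
  proof -
    have "zp t \<noteq> z" using \<sigma> by (auto simp: zp_def ap_def complex_eq_iff)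
    moreover have "?e (zp t) = q t * ?e z" by (simp add: q_def exp_diff algebra_simps)
    moreover have "q t \<noteq> 1" using qb[of t] \<beta> by auto
    ultimately show ?thesis by (simp add: Geq gp_def field_simps) (simp add: algebra_simps)?
  qed
  have Gm: "G (zm t) = (1 / ?e z) * (gm t / (1 - p t))" if "t \<in> {0..1}" for t
  proof -
    have "zm t \<noteq> z" using \<sigma> by (auto simp: zm_def am_def complex_eq_iff)
    moreover have "?e z = p t * ?e (zm t)" by (simp add: p_def exp_diff exp_minus algebra_simps)
    moreover have "p t \<noteq> 1" using pb[of t] \<beta> by (metis norm_one not_less)
    moreover have "p t \<noteq> 0" by (simp add: p_def)
    moreover have "(A - B) / (E - P * E) = 1 / (P * E) * ((A - B) * P / (1 - P))" if "P \<noteq> 0" "P \<noteq> 1" "E \<noteq> 0" for A B E P :: complex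
      using that by (simp add: divide_simps) (simp add: algebra_simps)
    ultimately show ?thesis using Geq[of "zm t"] unfolding gm_def by (metis exp_not_eq_zero)
  qed
  have sum0: "integral {0..1} (\<lambda>t. gp t / (1 - q t)) + integral {0..1} (\<lambda>t. gm t / (1 - p t)) = 0"
  proof -
    have "integral {0..1} (\<lambda>t. G (zp t)) = integral {0..1} (\<lambda>t. - (1 / ?e z) * (gp t / (1 - q t)))"
      by (rule integral_cong) (rule Gp)
    also have "\<dots> = - (1 / ?e z) * integral {0..1} (\<lambda>t. gp t / (1 - q t))" by (rule integral_mult_right)
    finally have 1: "integral {0..1} (\<lambda>t. G (zp t)) = - (1 / ?e z) * integral {0..1} (\<lambda>t. gp t / (1 - q t))" .
    have "integral {0..1} (\<lambda>t. G (zm t)) = integral {0..1} (\<lambda>t. (1 / ?e z) * (gm t / (1 - p t)))"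
      by (rule integral_cong) (rule Gm)
    also have "\<dots> = (1 / ?e z) * integral {0..1} (\<lambda>t. gm t / (1 - p t))" by (rule integral_mult_right)
    finally have 2: "integral {0..1} (\<lambda>t. G (zm t)) = (1 / ?e z) * integral {0..1} (\<lambda>t. gm t / (1 - p t))" .
    from Gint 1 2 have "(1 / ?e z) * (- integral {0..1} (\<lambda>t. gp t / (1 - q t))) = (1 / ?e z) * integral {0..1} (\<lambda>t. gm t / (1 - p t))"
      by (simp add: zp_def zm_def)
    hence "- integral {0..1} (\<lambda>t. gp t / (1 - q t)) = integral {0..1} (\<lambda>t. gm t / (1 - p t))"
      by (subst (asm) mult_left_cancel) simp_all
    thus ?thesis by (metis add.right_inverse)
  qed
  have coef: "integral {0..1} (\<lambda>t. \<psi> (a + of_real (2 * pi * t)) * exp (\<i> * of_int k * (z - (a + of_real (2 * pi * t))))) = fc \<psi> k * exp (\<i> * of_int k * z)"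
    if "\<psi> holomorphic_on cstrip r" "\<And>z. z \<in> cstrip r \<Longrightarrow> \<psi> (z + of_real (2 * pi)) = \<psi> z" "a \<in> cstrip r" for \<psi> a k
  proof -
    have eq: "exp (\<i> * of_int k * (z - w)) = exp (- \<i> * of_int k * w) * exp (\<i> * of_int k * z)" for w
      by (simp add: exp_add[symmetric] algebra_simps)
    have "integral {0..1} (\<lambda>t. \<psi> (a + of_real (2 * pi * t)) * exp (\<i> * of_int k * (z - (a + of_real (2 * pi * t))))) =
      integral {0..1} (\<lambda>t. (\<psi> (a + of_real (2 * pi * t)) * exp (- \<i> * of_int k * (a + of_real (2 * pi * t)))) * exp (\<i> * of_int k * z))"
      by (rule integral_cong) (subst eq, rule mult.assoc[symmetric])
    also have "\<dots> = fc \<psi> k * exp (\<i> * of_int k * z)"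
      by (simp only: integral_mult_left fc_shift[OF that])
    finally show ?thesis .
  qed
  let ?f = "\<lambda>k. fc \<phi> k * exp (\<i> * of_int k * z)"
  \<comment> \<open>The subtracted \<open>\<phi> z\<close> contributes a coefficient of the constant
    1, which is nonzero only for n = 0. This single term survives as the value of the series;
    \<open>intm\<close> starts at index 1 and has none.\<close>
  have intp: "integral {0..1} (\<lambda>t. gp t * q t ^ n) = ?f (- int n) - \<phi> z * (if n = 0 then 1 else 0)" for n
  proof -
    have qn: "q t ^ n = exp (\<i> * of_int (- int n) * (z - zp t))" for t
      unfolding q_def exp_of_nat_mult[symmetric] by (simp add: algebra_simps)
    have "integral {0..1} (\<lambda>t. gp t * q t ^ n) = integral {0..1} (\<lambda>t. \<phi> (zp t) * q t ^ n - \<phi> z * (1 * q t ^ n))"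
      by (simp add: gp_def algebra_simps)
    also have "\<dots> = integral {0..1} (\<lambda>t. \<phi> (zp t) * q t ^ n) - integral {0..1} (\<lambda>t. \<phi> z * (1 * q t ^ n))"
      by (rule integral_diff) (intro integrable_continuous_real continuous_intros cont\<phi> contq)+
    also have "integral {0..1} (\<lambda>t. \<phi> z * (1 * q t ^ n)) = \<phi> z * integral {0..1} (\<lambda>t. 1 * q t ^ n)" by (rule integral_mult_right)
    also have "integral {0..1} (\<lambda>t. \<phi> (zp t) * q t ^ n) = ?f (- int n)"
      unfolding qn unfolding zp_def by (rule coef[OF h per apm(1)])
    also have "integral {0..1} (\<lambda>t. 1 * q t ^ n) = fc (\<lambda>_. 1) (- int n) * exp (\<i> * of_int (- int n) * z)"
      unfolding qn unfolding zp_def by (rule coef[OF _ _ apm(1)]) auto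
    finally show ?thesis by (simp add: fc_one)
  qed
  have intm: "integral {0..1} (\<lambda>t. gm t * p t ^ n) = ?f (int n + 1)" for n
  proof -
    have pn: "p t * p t ^ n = exp (\<i> * of_int (int n + 1) * (z - zm t))" for t
    proof -
      have "p t * p t ^ n = exp (of_nat (Suc n) * - (\<i> * (zm t - z)))"
        unfolding p_def exp_of_nat_mult by simp
      also have "of_nat (Suc n) * - (\<i> * (zm t - z)) = \<i> * of_int (int n + 1) * (z - zm t)"
        by (simp add: algebra_simps)
      finally show ?thesis .
    qed
    have "integral {0..1} (\<lambda>t. gm t * p t ^ n) = integral {0..1} (\<lambda>t. \<phi> (zm t) * (p t * p t ^ n) - \<phi> z * (1 * (p t * p t ^ n)))"
      by (simp add: gm_def algebra_simps)
    also have "\<dots> = integral {0..1} (\<lambda>t. \<phi> (zm t) * (p t * p t ^ n)) - integral {0..1} (\<lambda>t. \<phi> z * (1 * (p t * p t ^ n)))"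
      by (rule integral_diff) (intro integrable_continuous_real continuous_intros cont\<phi> contq)+
    also have "integral {0..1} (\<lambda>t. \<phi> z * (1 * (p t * p t ^ n))) = \<phi> z * integral {0..1} (\<lambda>t. 1 * (p t * p t ^ n))" by (rule integral_mult_right)
    also have "integral {0..1} (\<lambda>t. \<phi> (zm t) * (p t * p t ^ n)) = ?f (int n + 1)"
      unfolding pn unfolding zm_def by (rule coef[OF h per apm(2)])
    also have "integral {0..1} (\<lambda>t. 1 * (p t * p t ^ n)) = fc (\<lambda>_. 1) (int n + 1) * exp (\<i> * of_int (int n + 1) * z)"
      unfolding pn unfolding zm_def by (rule coef[OF _ _ apm(2)]) auto
    finally show ?thesis by (simp add: fc_one)
  qed
  have \<beta>0: "0 < \<beta>" by (simp add: \<beta>_def)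
  have summ: "summable (\<lambda>n. norm (integral {0..1} (\<lambda>t. gp t * q t ^ n)))"
     "summable (\<lambda>n. norm (integral {0..1} (\<lambda>t. gm t * p t ^ n)))"
    by (rule summable_comparison_test'[where g="\<lambda>n. Cp * \<beta> ^ n" and N=0],
        use sp(2) \<beta> \<beta>0 in \<open>auto intro!: summable_mult summable_geometric\<close>)
       (rule summable_comparison_test'[where g="\<lambda>n. Cm * \<beta> ^ n" and N=0],
        use sm(2) \<beta> \<beta>0 in \<open>auto intro!: summable_mult summable_geometric\<close>)
  have hp: "((\<lambda>n. ?f (- int n) - \<phi> z * (if n = 0 then 1 else 0)) has_sum integral {0..1} (\<lambda>t. gp t / (1 - q t))) UNIV"
    using norm_summable_imp_has_sum[OF summ(1) sp(1)] unfolding intp .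
  have hm: "((\<lambda>n. ?f (int n + 1)) has_sum integral {0..1} (\<lambda>t. gm t / (1 - p t))) UNIV"
    using norm_summable_imp_has_sum[OF summ(2) sm(1)] unfolding intm .
  have h0: "((\<lambda>n::nat. \<phi> z * (if n = 0 then 1 else 0)) has_sum \<phi> z) UNIV"
    by (rule has_sum_finite_neutralI[of "{0}"]) auto
  have hp': "((\<lambda>n. ?f (- int n)) has_sum (integral {0..1} (\<lambda>t. gp t / (1 - q t)) + \<phi> z)) UNIV"
    using has_sum_add[OF hp h0] by simp
  have A: "(?f has_sum (integral {0..1} (\<lambda>t. gp t / (1 - q t)) + \<phi> z)) (range (\<lambda>n. - int n))"
    by (subst has_sum_reindex) (use hp' in \<open>auto simp: o_def inj_on_def\<close>)
  have B: "(?f has_sum integral {0..1} (\<lambda>t. gm t / (1 - p t))) (range (\<lambda>n. int n + 1))"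
    by (subst has_sum_reindex) (use hm in \<open>auto simp: o_def inj_on_def\<close>)
  have U: "range (\<lambda>n. - int n) \<union> range (\<lambda>n. int n + 1) = UNIV"
  proof (intro set_eqI iffI UNIV_I)
    fix k :: int
    show "k \<in> range (\<lambda>n. - int n) \<union> range (\<lambda>n. int n + 1)"
    proof (cases "k \<le> 0")
      case True hence "k = - int (nat (- k))" by simp thus ?thesis by blast
    next
      case False hence "k = int (nat (k - 1)) + 1" by simp thus ?thesis by blast
    qed
  qed
  have "(?f has_sum (integral {0..1} (\<lambda>t. gp t / (1 - q t)) + \<phi> z + integral {0..1} (\<lambda>t. gm t / (1 - p t)))) UNIV"
    using has_sum_Un_disjoint[OF A B] unfolding U by fastforce
  moreover have "integral {0..1} (\<lambda>t. gp t / (1 - q t)) + \<phi> z + integral {0..1} (\<lambda>t. gm t / (1 - p t)) = \<phi> z"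
    using sum0 by (simp add: algebra_simps)
  ultimately show ?thesis by simp
qed

section \<open>Product domains and the function classes on them\<close>

definition S :: "real \<Rightarrow> real \<Rightarrow> 'n::finite cv set" where
  "S a r = {w. \<forall>i. cmod (fst w $ i) < a \<and> \<bar>Im (snd w $ i)\<bar> < r}"

lemma S_I: "(\<And>i. cmod (fst w $ i) < a) \<Longrightarrow> (\<And>i. \<bar>Im (snd w $ i)\<bar> < r) \<Longrightarrow> w \<in> S a r"
  by (simp add: S_def)

lemma S_D: "w \<in> S a r \<Longrightarrow> cmod (fst w $ i) < a" "w \<in> S a r \<Longrightarrow> \<bar>Im (snd w $ i)\<bar> < r"
  by (auto simp: S_def)

lemma S_mono: "r' \<le> r \<Longrightarrow> a' \<le> a \<Longrightarrow> S a' r' \<subseteq> S a r"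
  unfolding S_def by (auto intro: less_le_trans)

lemma open_S: "open (S a r :: 'n::finite cv set)"
proof -
  have "S a r = (\<Inter>i\<in>UNIV. {w::'n cv. cmod (fst w $ i) < a} \<inter> {w. \<bar>Im (snd w $ i)\<bar> < r})" by (auto simp: S_def)
  thus ?thesis by (auto intro!: open_INT open_Int open_Collect_less continuous_intros)
qed

lemma S_inner:
  assumes "w \<in> S a r" obtains r' where "r' < r" "w \<in> S a r'"
proof -
  define r' where "r' = Max (insert 0 (range (\<lambda>i. (\<bar>Im (snd w $ i)\<bar> + r) / 2)))"
  have "r > 0" using S_D(2)[OF assms, of undefined] by linarith
  hence "r' < r" unfolding r'_def using S_D(2)[OF assms] by (subst Max_less_iff) auto
  moreover have "w \<in> S a r'"
  proof (rule S_I)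
    fix i show "cmod (fst w $ i) < a" using S_D(1)[OF assms] .
    have "\<bar>Im (snd w $ i)\<bar> < (\<bar>Im (snd w $ i)\<bar> + r) / 2" using S_D(2)[OF assms, of i] by simp
    also have "\<dots> \<le> r'" unfolding r'_def by (rule Max_ge) auto
    finally show "\<bar>Im (snd w $ i)\<bar> < r'" .
  qed
  ultimately show ?thesis by (rule that)
qed

definition bnd :: "real \<Rightarrow> real \<Rightarrow> real \<Rightarrow> ('n::finite cv \<Rightarrow> complex) \<Rightarrow> bool" where
  "bnd a r C f \<longleftrightarrow> (\<forall>w\<in>S a r. cmod (f w) \<le> C)"

lemma bndD: "bnd a r C f \<Longrightarrow> w \<in> S a r \<Longrightarrow> cmod (f w) \<le> C" by (simp add: bnd_def)

definition cnjv :: "'n::finite cv \<Rightarrow> 'n cv" where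
  "cnjv w = (\<chi> i. cnj (fst w $ i), \<chi> i. cnj (snd w $ i))"

definition periodic :: "'n::finite cv set \<Rightarrow> ('n cv \<Rightarrow> complex) \<Rightarrow> bool" where
  "periodic A f \<longleftrightarrow> (\<forall>w\<in>A. \<forall>i. f (w + of_real (2 * pi) \<odot> ex i) = f w)"

text \<open>Real analytic periodic functions. Symmetry under conjugation expresses real values at
  real points in a form inherited by products, compositions and derivatives in real
  directions.\<close>

definition cls :: "real \<Rightarrow> real \<Rightarrow> ('n::finite cv \<Rightarrow> complex) \<Rightarrow> bool" where
  "cls a r f \<longleftrightarrow> hol (S a r) f \<and> periodic (S a r) f \<and> (\<forall>w\<in>S a r. f (cnjv w) = cnj (f w))"

definition zind :: "'n::finite cv set \<Rightarrow> ('n cv \<Rightarrow> complex) \<Rightarrow> bool" where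
  "zind A f \<longleftrightarrow> (\<forall>w\<in>A. \<forall>w'\<in>A. fst w = fst w' \<longrightarrow> f w = f w')"

section \<open>Fourier modes in one of the angles\<close>

lemma S_shift_real: "w \<in> S a r \<Longrightarrow> w + of_real t \<odot> ex i \<in> S a r"
  by (auto simp: S_def axis_def)

lemma S_shift: "w \<in> S a r \<Longrightarrow> \<bar>Im (snd w $ i + t)\<bar> < r \<Longrightarrow> w + t \<odot> ex i \<in> S a r"
  by (auto simp: S_def axis_def)

lemma S_shift_iff: "w + t \<odot> ex i \<in> S a r \<Longrightarrow> \<bar>Im (snd w $ i + t)\<bar> < r"
  using S_D(2)[of "w + t \<odot> ex i" a r i] by simp

text \<open>The integral is based at w itself, so this is the whole mode, coefficient times
  exponential, as a function on phase space. Modes in different angles can therefore be extracted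
  one after the other.\<close>

definition Pr :: "'n::finite \<Rightarrow> int \<Rightarrow> ('n cv \<Rightarrow> complex) \<Rightarrow> 'n cv \<Rightarrow> complex" where
  "Pr i k f w = fc (\<lambda>t. f (w + t \<odot> ex i)) k"

lemma Pr_line:
  assumes f: "hol (S a r) f" "periodic (S a r) f" and w: "w \<in> S a r" "Im (snd w $ i) = 0"
  shows "(\<lambda>t. f (w + t \<odot> ex i)) holomorphic_on cstrip r"
    "\<And>t. t \<in> cstrip r \<Longrightarrow> f (w + (t + of_real (2 * pi)) \<odot> ex i) = f (w + t \<odot> ex i)"
proof -
  have in_S: "w + t \<odot> ex i \<in> S a r" if "t \<in> cstrip r" for t
    by (rule S_shift[OF w(1)]) (use that w(2) in \<open>simp add: cstrip_def\<close>)
  show "(\<lambda>t. f (w + t \<odot> ex i)) holomorphic_on cstrip r" by (rule hol_line_holomorphic[OF f(1) in_S])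
  show "f (w + (t + of_real (2 * pi)) \<odot> ex i) = f (w + t \<odot> ex i)" if "t \<in> cstrip r" for t
    using f(2) in_S[OF that] unfolding periodic_def by (simp add: cs_add add.assoc[symmetric])
qed

lemma Pr_base:
  assumes f: "hol (S a r) f" "periodic (S a r) f" and w: "w \<in> S a r" "Im (snd w $ i) = 0" and c: "c \<in> cstrip r"
  shows "Pr i k f (w + c \<odot> ex i) = exp (\<i> * of_int k * c) * Pr i k f w"
proof -
  let ?\<phi> = "\<lambda>t. f (w + t \<odot> ex i)"
  have "Pr i k f w = integral {0..1} (\<lambda>t. ?\<phi> (c + of_real (2 * pi * t)) * exp (- \<i> * of_int k * (c + of_real (2 * pi * t))))"
    unfolding Pr_def by (rule fc_shift[symmetric, OF Pr_line[OF f w] c])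
  also have "\<dots> = integral {0..1} (\<lambda>t. exp (- \<i> * of_int k * c) * (f (w + c \<odot> ex i + of_real (2 * pi * t) \<odot> ex i) * exp (- \<i> * of_int k * of_real (2 * pi * t))))"
  proof (rule integral_cong)
    fix t :: real
    have "exp (- \<i> * of_int k * (c + of_real (2 * pi * t))) = exp (- \<i> * of_int k * c) * exp (- \<i> * of_int k * of_real (2 * pi * t))"
      by (simp add: exp_add[symmetric] algebra_simps)
    thus "?\<phi> (c + of_real (2 * pi * t)) * exp (- \<i> * of_int k * (c + of_real (2 * pi * t))) =
      exp (- \<i> * of_int k * c) * (f (w + c \<odot> ex i + of_real (2 * pi * t) \<odot> ex i) * exp (- \<i> * of_int k * of_real (2 * pi * t)))"
      by (simp add: cs_add add.assoc mult_ac del: of_real_mult)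
  qed
  also have "\<dots> = exp (- \<i> * of_int k * c) * Pr i k f (w + c \<odot> ex i)"
    unfolding Pr_def fc_def by (rule integral_mult_right)
  finally show ?thesis by (simp add: exp_minus mult.assoc[symmetric])
qed

lemma S_real_part:
  fixes w :: "'n::finite cv" and i :: 'n
  assumes "w \<in> S a r"
  defines "w0 \<equiv> w + (- \<i> * of_real (Im (snd w $ i))) \<odot> ex i"
  shows "w0 \<in> S a r" "Im (snd w0 $ i) = 0" "w = w0 + (\<i> * of_real (Im (snd w $ i))) \<odot> ex i"
proof -
  have "r > 0" using S_D(2)[OF assms(1), of i] by linarith
  thus "w0 \<in> S a r" unfolding w0_def by (intro S_shift assms) simp
  show "Im (snd w0 $ i) = 0" by (simp add: w0_def)
  show "w = w0 + (\<i> * of_real (Im (snd w $ i))) \<odot> ex i" unfolding w0_def add.assoc cs_add[symmetric] by simp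
qed

lemma Pr_shift:
  assumes f: "hol (S a r) f" "periodic (S a r) f" and w: "w \<in> S a r" "w + s \<odot> ex i \<in> S a r"
  shows "Pr i k f (w + s \<odot> ex i) = exp (\<i> * of_int k * s) * Pr i k f w"
proof -
  let ?c = "\<i> * of_real (Im (snd w $ i))"
  obtain w0 where w0: "w0 \<in> S a r" "Im (snd w0 $ i) = 0" "w = w0 + ?c \<odot> ex i"
    using S_real_part[OF w(1)] by blast
  have c: "?c \<in> cstrip r" using S_D(2)[OF w(1)] by (simp add: cstrip_def)
  have cs: "?c + s \<in> cstrip r" using S_shift_iff[OF w(2)] by (simp add: cstrip_def)
  have "w + s \<odot> ex i = w0 + (?c + s) \<odot> ex i" using w0(3) by (simp add: cs_add add.assoc)
  hence "Pr i k f (w + s \<odot> ex i) = exp (\<i> * of_int k * (?c + s)) * Pr i k f w0" using Pr_base[OF f w0(1,2) cs] by simp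
  moreover have "Pr i k f w = exp (\<i> * of_int k * ?c) * Pr i k f w0" using Pr_base[OF f w0(1,2) c] w0(3) by simp
  moreover have "exp (\<i> * of_int k * (?c + s)) = exp (\<i> * of_int k * s) * exp (\<i> * of_int k * ?c)"
    by (simp add: exp_add[symmetric] algebra_simps)
  ultimately show ?thesis by simp
qed

lemma norm_fc_le:
  assumes "continuous_on UNIV (\<lambda>t::real. \<phi> (of_real t))" "\<And>t::real. cmod (\<phi> (of_real t)) \<le> M"
  shows "cmod (fc \<phi> k) \<le> M"
proof -
  have "cmod (fc \<phi> k) \<le> M * (1 - 0)" unfolding fc_def
  proof (rule integral_bound)
    have "continuous_on {0..1} (\<lambda>t::real. \<phi> (of_real (2 * pi * t)))"
      using continuous_on_compose2[OF assms(1), of "{0..1}" "\<lambda>t. 2 * pi * t"] by (auto intro: continuous_intros)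
    thus "continuous_on {0..1} (\<lambda>t. \<phi> (of_real (2 * pi * t)) * exp (- \<i> * of_int k * of_real (2 * pi * t)))"
      by (intro continuous_intros)
    show "norm (\<phi> (of_real (2 * pi * t)) * exp (- \<i> * of_int k * of_real (2 * pi * t))) \<le> M" for t
      using assms(2)[of "2 * pi * t"] by (simp add: norm_mult)
  qed simp
  thus ?thesis by simp
qed

lemma cont_line:
  assumes f: "hol (S a r) f" and w: "w \<in> S a r"
  shows "continuous_on UNIV (\<lambda>t::real. f (w + of_real t \<odot> ex i))"
proof -
  have "((\<lambda>t. f (w + t \<odot> ex i)) has_field_derivative dd (ex i) f (w + of_real t \<odot> ex i)) (at (of_real t))" for t :: real
    by (rule hol_line[OF f S_shift_real[OF w]])
  hence "isCont (\<lambda>t. f (w + t \<odot> ex i)) (of_real t)" for t :: real using DERIV_isCont by blast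
  hence "isCont (\<lambda>t::real. f (w + of_real t \<odot> ex i)) t" for t
    using isCont_o2[of t of_real "\<lambda>t. f (w + t \<odot> ex i)"] by simp
  thus ?thesis by (simp add: continuous_at_imp_continuous_on)
qed

lemma Pr_bound0:
  assumes f: "hol (S a r) f" and M: "\<And>t::real. cmod (f (w + of_real t \<odot> ex i)) \<le> M" and w: "w \<in> S a r"
  shows "cmod (Pr i k f w) \<le> M"
  unfolding Pr_def by (rule norm_fc_le[OF cont_line[OF f w] M])

text \<open>Shift the base point to imaginary height s, on the side chosen by the sign of k, and let
  s tend to r. The bound \<open>M\<close> is asked for only along the line in direction
  \<open>i\<close>, so it may depend on the other coordinates; the product bounds in
  \<open>fourier_exists\<close> rest on this.\<close>

lemma Pr_bound:
  assumes f: "hol (S a r) f" "periodic (S a r) f" and w: "w \<in> S a r"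
    and M: "\<And>t. w + t \<odot> ex i \<in> S a r \<Longrightarrow> cmod (f (w + t \<odot> ex i)) \<le> M"
  shows "cmod (Pr i k f w) \<le> M * exp (- (r - \<bar>Im (snd w $ i)\<bar>) * real_of_int \<bar>k\<bar>)"
proof -
  have r: "r > 0" using S_D(2)[OF w, of i] by linarith
  let ?c = "\<i> * of_real (Im (snd w $ i))"
  obtain w0 where w0: "w0 \<in> S a r" "Im (snd w0 $ i) = 0" "w = w0 + ?c \<odot> ex i"
    using S_real_part[OF w(1)] by blast
  have c: "?c \<in> cstrip r" using S_D(2)[OF w(1)] by (simp add: cstrip_def)
  have 1: "cmod (Pr i k f w0) \<le> M * exp (- s * real_of_int \<bar>k\<bar>)" if s: "0 < s" "s < r" for s
  proof -
    define d where "d = \<i> * of_real (if k \<ge> 0 then - s else s)"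
    have d: "d \<in> cstrip r" using s by (simp add: d_def cstrip_def)
    have wd: "w0 + d \<odot> ex i \<in> S a r" by (rule S_shift[OF w0(1)]) (use d w0(2) in \<open>simp add: cstrip_def\<close>)
    have le_M: "cmod (f (w0 + d \<odot> ex i + of_real t \<odot> ex i)) \<le> M" for t :: real
    proof -
      have "w0 + d \<odot> ex i + of_real t \<odot> ex i = w + (d - ?c + of_real t) \<odot> ex i"
      proof -
        have "w + (d - ?c + of_real t) \<odot> ex i = w0 + ?c \<odot> ex i + (d - ?c + of_real t) \<odot> ex i"
          using w0(3) by (rule arg_cong)
        also have "\<dots> = w0 + (?c + (d - ?c + of_real t)) \<odot> ex i" by (simp only: add.assoc cs_add)
        also have "?c + (d - ?c + of_real t) = d + of_real t" by simp
        finally show ?thesis by (simp only: add.assoc cs_add)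
      qed
      thus ?thesis using M[of "d - ?c + of_real t"] S_shift_real[OF wd, of t i] by simp
    qed
    have "exp (\<i> * of_int k * d) * Pr i k f w0 = Pr i k f (w0 + d \<odot> ex i)" using Pr_base[OF f w0(1,2) d] by simp
    hence "cmod (exp (\<i> * of_int k * d)) * cmod (Pr i k f w0) \<le> M"
      using Pr_bound0[OF f(1) le_M wd] by (metis norm_mult)
    moreover have "cmod (exp (\<i> * of_int k * d)) = exp (s * real_of_int \<bar>k\<bar>)" by (simp add: d_def)
    ultimately have "exp (s * real_of_int \<bar>k\<bar>) * cmod (Pr i k f w0) \<le> M" by metis
    thus ?thesis by (simp add: exp_minus field_simps)
  qed
  have 2: "cmod (Pr i k f w0) \<le> M * exp (- r * real_of_int \<bar>k\<bar>)"
  proof (rule tendsto_lowerbound)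
    show "((\<lambda>s. M * exp (- s * real_of_int \<bar>k\<bar>)) \<longlongrightarrow> M * exp (- r * real_of_int \<bar>k\<bar>)) (at_left r)"
      by (intro tendsto_intros)
    show "\<forall>\<^sub>F s in at_left r. cmod (Pr i k f w0) \<le> M * exp (- s * real_of_int \<bar>k\<bar>)"
      using eventually_at_left_real[OF r] by eventually_elim (use 1 in auto)
  qed auto
  have "cmod (Pr i k f w) = cmod (exp (\<i> * of_int k * ?c)) * cmod (Pr i k f w0)"
    using Pr_base[OF f w0(1,2) c] w0(3) by (simp add: norm_mult)
  also have "cmod (exp (\<i> * of_int k * ?c)) = exp (- (of_int k * Im (snd w $ i)))" by simp
  also have "\<dots> \<le> exp (\<bar>Im (snd w $ i)\<bar> * real_of_int \<bar>k\<bar>)"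
    using abs_ge_minus_self[of "of_int k * Im (snd w $ i)"] by (simp add: abs_mult mult.commute)
  finally have "cmod (Pr i k f w) \<le> exp (\<bar>Im (snd w $ i)\<bar> * real_of_int \<bar>k\<bar>) * (M * exp (- r * real_of_int \<bar>k\<bar>))"
    using mult_mono[OF _ 2, of _ "exp (\<bar>Im (snd w $ i)\<bar> * real_of_int \<bar>k\<bar>)"] by (meson exp_ge_zero mult_right_mono norm_ge_zero order_trans mult_left_mono 2)
  also have "\<dots> = M * exp (- (r - \<bar>Im (snd w $ i)\<bar>) * real_of_int \<bar>k\<bar>)"
    by (simp add: exp_add[symmetric] algebra_simps)
  finally show ?thesis .
qed

lemma Pr_inversion:
  assumes f: "hol (S a r) f" "periodic (S a r) f" and w: "w \<in> S a r"
  shows "((\<lambda>k. Pr i k f w) has_sum f w) UNIV"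
proof -
  let ?c = "\<i> * of_real (Im (snd w $ i))"
  obtain w0 where w0: "w0 \<in> S a r" "Im (snd w0 $ i) = 0" "w = w0 + ?c \<odot> ex i"
    using S_real_part[OF w(1)] by blast
  have c: "?c \<in> cstrip r" using S_D(2)[OF w(1)] by (simp add: cstrip_def)
  have "((\<lambda>k. fc (\<lambda>t. f (w0 + t \<odot> ex i)) k * exp (\<i> * of_int k * ?c)) has_sum f (w0 + ?c \<odot> ex i)) UNIV"
    by (rule fourier_inversion[OF Pr_line[OF f w0(1,2)] c])
  moreover have "fc (\<lambda>t. f (w0 + t \<odot> ex i)) k * exp (\<i> * of_int k * ?c) = Pr i k f w" for k
    using Pr_base[OF f w0(1,2) c, of k] w0(3) by (simp add: Pr_def mult.commute)
  ultimately show ?thesis using w0(3) by simp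
qed

text \<open>An explicit rate in terms of the Lipschitz constant, so that the Riemann sums of a
  parametrised integral converge uniformly in the parameter.\<close>

lemma riemann_bound:
  fixes h :: "real \<Rightarrow> complex"
  assumes lip: "\<And>s t. cmod (h s - h t) \<le> L * \<bar>s - t\<bar>" and N: "N > 0"
  shows "cmod (integral {0..1} h - (\<Sum>j<N. h (real j / real N)) / of_nat N) \<le> L / real N"
proof -
  have cont: "continuous_on A h" for A
  proof (rule continuous_on_subset[of UNIV])
    have "L-lipschitz_on UNIV h"
      using lip order_trans[OF norm_ge_zero lip[of 0 1]] by (intro lipschitz_onI) (auto simp: dist_norm)
    thus "continuous_on UNIV h" by (rule lipschitz_on_continuous_on)
  qed simp
  have int: "h integrable_on {x..y}" for x y by (intro integrable_continuous_real cont)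
  have "cmod (integral {0..real m / real N} h - (\<Sum>j<m. h (real j / real N)) / of_nat N) \<le> real m * (L / (real N)\<^sup>2)" for m
  proof (induction m)
    case (Suc m)
    let ?x = "real m / real N" and ?y = "real (Suc m) / real N"
    have xy: "0 \<le> ?x" "?x \<le> ?y" using N by (auto simp: divide_right_mono)
    have yx: "?y - ?x = 1 / real N" by (simp add: diff_divide_distrib[symmetric])
    have "cmod (integral {?x..?y} (\<lambda>t. h t - h ?x)) \<le> L / real N * (?y - ?x)"
    proof (rule integral_bound[OF xy(2)])
      show "continuous_on {?x..?y} (\<lambda>t. h t - h ?x)" by (intro continuous_intros cont)
      fix t assume t: "t \<in> {?x..?y}"
      have L0: "0 \<le> L" using order_trans[OF norm_ge_zero lip[of 0 1]] by simp
      have "cmod (h t - h ?x) \<le> L * \<bar>t - ?x\<bar>" by (rule lip)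
      also have "\<dots> \<le> L * (1 / real N)" using t yx by (intro mult_left_mono L0) auto
      finally show "norm (h t - h ?x) \<le> L / real N" by simp
    qed
    hence "cmod (integral {?x..?y} (\<lambda>t. h t - h ?x)) \<le> L / (real N)\<^sup>2" unfolding yx by (simp add: power2_eq_square)
    moreover have 2: "integral {?x..?y} (\<lambda>t. h t - h ?x) = integral {?x..?y} h - h ?x / of_nat N"
    proof -
      have "integral {?x..?y} (\<lambda>t. h ?x) = measure lborel {?x..?y} *\<^sub>R h ?x" by (rule integral_const_real)
      also have "measure lborel {?x..?y} = 1 / real N" unfolding yx[symmetric] using xy(2) by (rule content_real)
      finally have "integral {?x..?y} (\<lambda>t. h ?x) = h ?x / of_nat N" by (simp add: scaleR_conv_of_real)
      thus ?thesis using integral_diff[OF int integrable_const_ivl, of ?x ?y "h ?x"] by simp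
    qed
    ultimately have 3: "cmod (integral {?x..?y} h - h ?x / of_nat N) \<le> L / (real N)\<^sup>2" by metis
    have "integral {0..?y} h = integral {0..?x} h + integral {?x..?y} h"
      by (rule Henstock_Kurzweil_Integration.integral_combine[symmetric, OF xy int])
    hence "integral {0..?y} h - (\<Sum>j<Suc m. h (real j / real N)) / of_nat N =
      (integral {0..?x} h - (\<Sum>j<m. h (real j / real N)) / of_nat N) + (integral {?x..?y} h - h ?x / of_nat N)"
      by (simp only: sum.lessThan_Suc add_divide_distrib) simp
    hence "cmod (integral {0..?y} h - (\<Sum>j<Suc m. h (real j / real N)) / of_nat N) \<le>
       cmod (integral {0..?x} h - (\<Sum>j<m. h (real j / real N)) / of_nat N) + L / (real N)\<^sup>2"
      using norm_triangle_mono[OF order_refl 3] by metis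
    also have "\<dots> \<le> real (Suc m) * (L / (real N)\<^sup>2)" using Suc by (simp add: distrib_right add_divide_distrib)
    finally show ?case .
  qed simp
  from this[of N] N show ?thesis by (simp add: power2_eq_square)
qed

lemma hol_S_inner:
  fixes f :: "'n::finite cv \<Rightarrow> complex"
  assumes "\<And>r'. r' < r \<Longrightarrow> hol (S a r') f" shows "hol (S a r) f"
  unfolding hol_def
proof
  fix w :: "'n cv" assume "w \<in> S a r"
  then obtain r' where "r' < r" "w \<in> S a r'" by (rule S_inner)
  thus "\<exists>D. (f has_derivative D) (at w) \<and> (\<forall>c h. D (c \<odot> h) = c * D h)" using assms unfolding hol_def by blast
qed

lemma hol_translate:
  assumes "hol A f" "\<And>w. w \<in> A \<Longrightarrow> w + v \<in> A"
  shows "hol A (\<lambda>w. f (w + v))"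
  by (rule hol_intro(1)[of A _ "\<lambda>w h. dd h f (w + v)"], rule has_derivative_translate[OF assms(1)])
     (use assms hol_D(2) in blast)+

text \<open>Holomorphy under the integral sign. The Riemann sums are finite sums of translates of f,
  hence holomorphic, and converge uniformly on a smaller strip r': Cauchy's inequality with radius r
  - r' bounds the Lipschitz constant of the integrand.\<close>

lemma hol_Pr:
  assumes f: "hol (S a r) f" and M: "bnd a r M f"
  shows "hol (S a r) (Pr i k f)"
proof (rule hol_S_inner)
  fix r' assume r': "r' < r"
  let ?A = "S a r' :: 'a cv set"
  have sub: "?A \<subseteq> S a r" by (rule S_mono) (use r' in auto)
  let ?d = "r - r'"
  define C where "C = M * exp (real_of_int \<bar>k\<bar> * ?d)"
  define L where "L = C / ?d * (2 * pi)"
  let ?h = "\<lambda>w t. f (w + of_real (2 * pi * t) \<odot> ex i) * exp (- \<i> * of_int k * of_real (2 * pi * t))"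
  have lip: "cmod (?h w s - ?h w t) \<le> L * \<bar>s - t\<bar>" if w: "w \<in> ?A" for w s t
  proof -
    let ?\<psi> = "\<lambda>z. f (w + z \<odot> ex i) * exp (- \<i> * of_int k * z)"
    have in_S: "w + z \<odot> ex i \<in> S a r" if "z \<in> cstrip ?d" for z
    proof (rule S_shift)
      show "w \<in> S a r" using w sub by auto
      show "\<bar>Im (snd w $ i + z)\<bar> < r" using S_D(2)[OF w, of i] that by (simp add: cstrip_def)
    qed
    have \<psi>: "?\<psi> holomorphic_on cstrip ?d" by (intro holomorphic_intros hol_line_holomorphic[OF f in_S])
    have bd: "cmod (?\<psi> z) \<le> C" if z: "z \<in> cstrip ?d" for z
    proof -
      have "of_int k * Im z \<le> real_of_int \<bar>k\<bar> * ?d"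
      proof -
        have "of_int k * Im z \<le> \<bar>of_int k * Im z\<bar>" by simp
        also have "\<dots> \<le> real_of_int \<bar>k\<bar> * ?d" using z by (auto simp: abs_mult cstrip_def intro!: mult_left_mono)
        finally show ?thesis .
      qed
      thus ?thesis unfolding norm_mult C_def using bndD[OF M in_S[OF z]]
        by (intro mult_mono) (auto simp: algebra_simps intro: order_trans[OF norm_ge_zero])
    qed
    have der: "cmod (deriv ?\<psi> (of_real t)) \<le> C / ?d" for t :: real
    proof -
      have "ball (of_real t) ?d \<subseteq> cstrip ?d"
      proof
        fix z assume "z \<in> ball (complex_of_real t) ?d"
        hence "cmod (z - of_real t) < ?d" by (simp add: dist_norm norm_minus_commute)
        thus "z \<in> cstrip ?d" using abs_Im_le_cmod[of "z - of_real t"] by (simp add: cstrip_def)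
      qed
      hence "cmod ((deriv ^^ 1) ?\<psi> (of_real t)) \<le> fact 1 * C / ?d ^ 1"
        by (intro cauchy_higher holomorphic_on_subset[OF \<psi>] bd) (use r' in auto)
      thus ?thesis by simp
    qed
    have "cmod (?\<psi> (of_real (2 * pi * s)) - ?\<psi> (of_real (2 * pi * t))) \<le> C / ?d * cmod (of_real (2 * pi * s) - of_real (2 * pi * t))"
    proof (rule field_differentiable_bound[of "closed_segment (of_real (2 * pi * t)) (of_real (2 * pi * s))" _ "deriv ?\<psi>"])
      fix z assume z: "z \<in> closed_segment (complex_of_real (2 * pi * t)) (of_real (2 * pi * s))"
      then obtain x :: real where x: "z = of_real x" unfolding closed_segment_of_real by auto
      show "(?\<psi> has_field_derivative deriv ?\<psi> z) (at z within closed_segment (of_real (2 * pi * t)) (of_real (2 * pi * s)))"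
        by (rule has_field_derivative_at_within, rule holomorphic_derivI[OF \<psi> cstrip_props(2)])
          (use r' x in \<open>simp add: cstrip_def\<close>)
      show "cmod (deriv ?\<psi> z) \<le> C / ?d" using der x by simp
    qed auto
    also have "cmod (of_real (2 * pi * s) - of_real (2 * pi * t)) = 2 * pi * \<bar>s - t\<bar>"
      by (metis abs_mult abs_of_pos norm_of_real of_real_diff pi_gt_zero right_diff_distrib zero_less_mult_iff zero_less_numeral)
    finally show ?thesis by (simp add: L_def mult.assoc)
  qed
  let ?g = "\<lambda>n w. (\<Sum>j<Suc n. ?h w (real j / real (Suc n))) / of_nat (Suc n)"
  show "hol ?A (Pr i k f)"
  proof (rule hol_limit(1))
    fix n
    have h1: "hol ?A (\<lambda>w. f (w + of_real t \<odot> ex i))" for t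
      by (rule hol_translate[OF hol_subset[OF f sub] S_shift_real])
    have "hol ?A (\<lambda>w. inverse (of_nat (Suc n)) * (\<Sum>j<Suc n. exp (- \<i> * of_int k * of_real (2 * pi * (real j / real (Suc n)))) * f (w + of_real (2 * pi * (real j / real (Suc n))) \<odot> ex i)))"
      by (intro hol_cmult hol_sum h1)
    moreover have "(\<lambda>w. inverse (of_nat (Suc n)) * (\<Sum>j<Suc n. exp (- \<i> * of_int k * of_real (2 * pi * (real j / real (Suc n)))) * f (w + of_real (2 * pi * (real j / real (Suc n))) \<odot> ex i))) = ?g n"
      by (simp only: divide_inverse mult.commute)
    ultimately show "hol ?A (?g n)" by simp
  next
    fix w assume "w \<in> ?A"
    then obtain d where d: "d > 0" "ball w d \<subseteq> ?A" using open_S by (meson openE)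
    have "uniform_limit (ball w d) ?g (Pr i k f) sequentially"
      unfolding uniform_limit_iff
    proof safe
      fix e :: real assume e: "e > 0"
      have "(\<lambda>n. L * inverse (real (Suc n))) \<longlonglongrightarrow> L * 0" by (intro tendsto_intros LIMSEQ_inverse_real_of_nat)
      hence "\<forall>\<^sub>F n in sequentially. L * inverse (real (Suc n)) < e" using e by (intro order_tendstoD(2)[of _ "L * 0"]) auto
      thus "\<forall>\<^sub>F n in sequentially. \<forall>x\<in>ball w d. dist (?g n x) (Pr i k f x) < e"
      proof eventually_elim
        case (elim n)
        show ?case
        proof
          fix x assume "x \<in> ball w d"
          hence x: "x \<in> ?A" using d by auto
          have "cmod (Pr i k f x - ?g n x) \<le> L / real (Suc n)"
            unfolding Pr_def fc_def by (rule riemann_bound[OF lip[OF x]]) simp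
          thus "dist (?g n x) (Pr i k f x) < e" using elim by (simp add: dist_norm norm_minus_commute divide_inverse)
        qed
      qed
    qed
    thus "\<exists>d>0. ball w d \<subseteq> ?A \<and> uniform_limit (ball w d) ?g (Pr i k f) sequentially" using d by blast
  qed
qed

lemma periodic_Pr:
  fixes f :: "'n::finite cv \<Rightarrow> complex"
  shows "periodic (S a r) f \<Longrightarrow> periodic (S a r) (Pr i k f)"
  unfolding periodic_def Pr_def fc_def
proof (intro ballI allI integral_cong)
  fix w :: "'n cv" and j and t :: real
  assume f: "\<forall>w\<in>S a r. \<forall>i. f (w + of_real (2 * pi) \<odot> ex i) = f w" and w: "w \<in> S a r"
  have "w + of_real (2 * pi) \<odot> ex j + of_real (2 * pi * t) \<odot> ex i = (w + of_real (2 * pi * t) \<odot> ex i) + of_real (2 * pi) \<odot> ex j"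
    by (simp add: algebra_simps)
  hence "f (w + of_real (2 * pi) \<odot> ex j + of_real (2 * pi * t) \<odot> ex i) = f (w + of_real (2 * pi * t) \<odot> ex i)"
    using f S_shift_real[OF w, of "2 * pi * t" i] by metis
  thus "f (w + of_real (2 * pi) \<odot> ex j + of_real (2 * pi * t) \<odot> ex i) * exp (- \<i> * of_int k * of_real (2 * pi * t)) =
      f (w + of_real (2 * pi * t) \<odot> ex i) * exp (- \<i> * of_int k * of_real (2 * pi * t))" by (rule arg_cong)
qed

lemma Pr_equivariant:
  assumes "\<And>w. w \<in> S a r \<Longrightarrow> w + s \<odot> ex j \<in> S a r \<Longrightarrow> f (w + s \<odot> ex j) = c * f w"
    "w \<in> S a r" "w + s \<odot> ex j \<in> S a r"
  shows "Pr i k f (w + s \<odot> ex j) = c * Pr i k f w"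
proof -
  have "Pr i k f (w + s \<odot> ex j) = integral {0..1} (\<lambda>t. c * (f (w + of_real (2 * pi * t) \<odot> ex i) * exp (- \<i> * of_int k * of_real (2 * pi * t))))"
    unfolding Pr_def fc_def
  proof (rule integral_cong)
    fix t :: real
    have 1: "w + s \<odot> ex j + of_real (2 * pi * t) \<odot> ex i = (w + of_real (2 * pi * t) \<odot> ex i) + s \<odot> ex j"
      by (simp add: algebra_simps)
    have 2: "f ((w + of_real (2 * pi * t) \<odot> ex i) + s \<odot> ex j) = c * f (w + of_real (2 * pi * t) \<odot> ex i)"
      by (rule assms(1)) (use 1 S_shift_real[OF assms(2)] S_shift_real[OF assms(3), of "2 * pi * t" i] in metis)+
    show "f (w + s \<odot> ex j + of_real (2 * pi * t) \<odot> ex i) * exp (- \<i> * of_int k * of_real (2 * pi * t)) =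
      c * (f (w + of_real (2 * pi * t) \<odot> ex i) * exp (- \<i> * of_int k * of_real (2 * pi * t)))"
      by (subst 1, subst 2) (rule mult.assoc)
  qed
  also have "\<dots> = c * Pr i k f w" unfolding Pr_def fc_def by (rule integral_mult_right)
  finally show ?thesis .
qed

section \<open>Multi-indices and Fourier series in all angles\<close>

definition upd :: "int^'n \<Rightarrow> 'n \<Rightarrow> int \<Rightarrow> int^'n" where
  "upd k j m = (\<chi> i. if i = j then m else k $ i)"

text \<open>The index set once the angles in \<open>J\<close> have been expanded. Adding an angle is
  the bijection \<open>bij_upd\<close>, so that the series can be built by induction on
  \<open>J\<close>.\<close>

definition KJ :: "'n::finite set \<Rightarrow> (int^'n) set" where "KJ J = {k. \<forall>i. i \<notin> J \<longrightarrow> k $ i = 0}"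

lemma upd_nth [simp]: "upd k j m $ i = (if i = j then m else k $ i)" by (simp add: upd_def)

lemma KJ_empty: "KJ {} = {0}" by (auto simp: KJ_def vec_eq_iff)
lemma KJ_UNIV: "KJ UNIV = UNIV" by (auto simp: KJ_def)

lemma bij_upd: "j \<notin> J \<Longrightarrow> bij_betw (\<lambda>(k, m). upd k j m) (KJ J \<times> UNIV) (KJ (insert j J))"
proof (rule bij_betw_byWitness[where f'="\<lambda>k. (upd k j 0, k $ j)"])
  assume "j \<notin> J"
  thus "\<forall>p\<in>KJ J \<times> UNIV. (\<lambda>k. (upd k j 0, k $ j)) ((\<lambda>(k, m). upd k j m) p) = p"
    by (auto simp: KJ_def vec_eq_iff)
qed (auto simp: KJ_def vec_eq_iff)

text \<open>Fubini for unordered sums, one index at a time; nonnegativity reduces summability over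
  the product to that of the iterated sums.\<close>

lemma prod_has_sum:
  fixes g :: "'n::finite \<Rightarrow> int \<Rightarrow> real"
  assumes J: "finite J" and g: "\<And>i. (g i has_sum G i) UNIV" "\<And>i k. 0 \<le> g i k"
  shows "((\<lambda>k. \<Prod>i\<in>J. g i (k $ i)) has_sum (\<Prod>i\<in>J. G i)) (KJ J)"
  using J
proof (induction J)
  case empty
  show ?case using has_sum_finite[of "{0::int^'n}" "\<lambda>_. 1::real"] by (simp add: KJ_empty)
next
  case (insert j J)
  let ?F = "\<lambda>(k, m). (\<Prod>i\<in>J. g i (k $ i)) * g j m"
  have inner: "((\<lambda>m. ?F (k, m)) has_sum (\<Prod>i\<in>J. g i (k $ i)) * G j) UNIV" for k
    using has_sum_cmult_right[OF g(1)[of j]] by simp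
  have outer: "((\<lambda>k. (\<Prod>i\<in>J. g i (k $ i)) * G j) has_sum (\<Prod>i\<in>J. G i) * G j) (KJ J)"
    by (rule has_sum_cmult_left[OF insert.IH])
  have "?F summable_on (KJ J \<times> UNIV)"
    by (rule summable_on_SigmaI[OF inner]) (use outer g(2) in \<open>auto simp: summable_on_def intro!: mult_nonneg_nonneg prod_nonneg\<close>)
  with has_sum_SigmaI[OF inner outer] have "(?F has_sum (\<Prod>i\<in>J. G i) * G j) (KJ J \<times> UNIV)" by blast
  moreover have E: "?F p = (\<lambda>k. \<Prod>i\<in>insert j J. g i (k $ i)) ((\<lambda>(k, m). upd k j m) p)" for p
  proof -
    obtain k m where p: "p = (k, m)" by (cases p)
    have "(\<Prod>i\<in>J. g i (upd k j m $ i)) = (\<Prod>i\<in>J. g i (k $ i))" by (rule prod.cong) (use insert.hyps in auto)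
    thus ?thesis using insert.hyps p by (simp add: mult.commute)
  qed
  ultimately have "((\<lambda>p. (\<lambda>k. \<Prod>i\<in>insert j J. g i (k $ i)) ((\<lambda>(k, m). upd k j m) p)) has_sum (\<Prod>i\<in>J. G i) * G j) (KJ J \<times> UNIV)"
    using has_sum_cong[of "KJ J \<times> UNIV" ?F "\<lambda>p. (\<lambda>k. \<Prod>i\<in>insert j J. g i (k $ i)) ((\<lambda>(k, m). upd k j m) p)", OF E] by blast
  hence "((\<lambda>k. \<Prod>i\<in>insert j J. g i (k $ i)) has_sum (\<Prod>i\<in>J. G i) * G j) (KJ (insert j J))"
    using has_sum_reindex_bij_betw[OF bij_upd[OF insert.hyps(2)], where f="\<lambda>k. \<Prod>i\<in>insert j J. g i (k $ i)"] by blast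
  thus ?case using insert.hyps by (simp add: mult.commute)
qed

text \<open>The sum of exp (- d |k|) over the integers, that is, coth (d / 2).\<close>

definition Eexp :: "real \<Rightarrow> real" where "Eexp d = (1 + exp (- d)) / (1 - exp (- d))"

lemma exp_abs_has_sum:
  assumes "d > 0"
  shows "((\<lambda>k::int. exp (- d * real_of_int \<bar>k\<bar>)) has_sum Eexp d) UNIV"
proof -
  let ?f = "\<lambda>k::int. exp (- d * real_of_int \<bar>k\<bar>)"
  let ?q = "exp (- d)"
  have q: "norm ?q < 1" using assms by simp
  have geo: "((\<lambda>n. ?q ^ n) has_sum (1 / (1 - ?q))) (UNIV::nat set)"
    using geometric_sums[OF q] summable_geometric[of "norm ?q"] q
    by (intro norm_summable_imp_has_sum) (auto simp: norm_power)
  have pw: "?q ^ n = exp (- d * real n)" for n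
    using exp_of_nat_mult[of n "-d"] by (simp add: mult.commute)
  have A: "(?f has_sum (1 / (1 - ?q))) (range int)"
    by (subst has_sum_reindex) (use geo in \<open>auto simp: o_def pw inj_on_def\<close>)
  have hq: "((\<lambda>n. ?q * ?q ^ n) has_sum (?q * (1 / (1 - ?q)))) (UNIV::nat set)" by (rule has_sum_cmult_right[OF geo])
  have sq: "?q * ?q ^ n = exp (- d * real (Suc n))" for n unfolding power_Suc[symmetric] by (rule pw)
  from hq have "((\<lambda>n. exp (- d * real (Suc n))) has_sum (?q * (1 / (1 - ?q)))) (UNIV::nat set)"
    unfolding sq .
  hence B: "(?f has_sum (?q * (1 / (1 - ?q)))) (range (\<lambda>n. - int (Suc n)))"
    by (subst has_sum_reindex) (auto simp: o_def inj_on_def add.commute)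
  have U: "range int \<union> range (\<lambda>n. - int (Suc n)) = UNIV"
  proof (intro set_eqI iffI UNIV_I)
    fix k :: int
    show "k \<in> range int \<union> range (\<lambda>n. - int (Suc n))"
    proof (cases "k \<ge> 0")
      case True hence "k = int (nat k)" by simp thus ?thesis by blast
    next
      case False hence "k = - int (Suc (nat (- k - 1)))" by simp thus ?thesis by blast
    qed
  qed
  have "(?f has_sum (1 / (1 - ?q) + ?q * (1 / (1 - ?q)))) UNIV"
    unfolding U[symmetric] by (rule has_sum_Un_disjoint[OF A B]) auto
  moreover have "1 / (1 - ?q) + ?q * (1 / (1 - ?q)) = Eexp d" by (simp add: Eexp_def add_divide_distrib)
  ultimately show ?thesis by simp
qed

lemma Eexp_le: assumes "0 < d" "d \<le> 1" shows "0 \<le> Eexp d" "Eexp d \<le> 4 / d"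
proof -
  have "exp (- d) \<le> 1 / (1 + d)" using exp_ge_add_one_self[of d] assms by (simp add: exp_minus field_simps)
  also have "1 / (1 + d) \<le> 1 - d / 2" using assms by (simp add: field_simps)
  finally have *: "d / 2 \<le> 1 - exp (- d)" by simp
  show "0 \<le> Eexp d" using * assms by (simp add: Eexp_def)
  have "Eexp d \<le> 2 / (d / 2)" unfolding Eexp_def using * assms by (intro frac_le) auto
  thus "Eexp d \<le> 4 / d" by simp
qed

text \<open>The decay clause ranges over every smaller strip r' and every bound M', so that one
  family of modes serves all later estimates. The last clause makes \<open>c k\<close> a pure
  exponential in each angle of \<open>J\<close>.\<close>

definition is_fourier :: "real \<Rightarrow> real \<Rightarrow> ('n::finite cv \<Rightarrow> complex) \<Rightarrow> 'n set \<Rightarrow> (int^'n \<Rightarrow> 'n cv \<Rightarrow> complex) \<Rightarrow> bool" where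
  "is_fourier a r f J c \<longleftrightarrow>
    (\<forall>k. hol (S a r) (c k) \<and> periodic (S a r) (c k)) \<and>
    (\<forall>k r' M'. r' \<le> r \<longrightarrow> bnd a r' M' f \<longrightarrow>
       (\<forall>w\<in>S a r'. cmod (c k w) \<le> M' * (\<Prod>i\<in>J. exp (- (r' - \<bar>Im (snd w $ i)\<bar>) * real_of_int \<bar>k $ i\<bar>)))) \<and>
    (\<forall>w\<in>S a r. ((\<lambda>k. c k w) has_sum f w) (KJ J)) \<and>
    (\<forall>k. \<forall>i\<in>J. \<forall>w s. w \<in> S a r \<longrightarrow> w + s \<odot> ex i \<in> S a r \<longrightarrow> c k (w + s \<odot> ex i) = exp (\<i> * of_int (k $ i) * s) * c k w)"

text \<open>The modes for \<open>J\<close> are expanded once more in angle \<open>j\<close>. Their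
  product bounds make the enlarged family absolutely summable, which allows the two successive
  series to be merged into one over \<open>KJ (insert j J)\<close>.\<close>

lemma fourier_exists:
  fixes f :: "'n::finite cv \<Rightarrow> complex"
  assumes f: "hol (S a r) f" "periodic (S a r) f" and M: "bnd a r M f" and J: "finite J"
  shows "\<exists>c. is_fourier a r f J c"
  using J
proof (induction J)
  case empty
  have "is_fourier a r f {} (\<lambda>_. f)"
    unfolding is_fourier_def using f has_sum_finite[of "{0::int^'n}"] by (auto simp: KJ_empty bnd_def)
  thus ?case by blast
next
  case (insert j J)
  then obtain c where c: "is_fourier a r f J c" by blast
  have hol_c: "hol (S a r) (c k)" and per_c: "periodic (S a r) (c k)" for k using c by (auto simp: is_fourier_def)
  have c_bd: "cmod (c k w) \<le> M' * (\<Prod>i\<in>J. exp (- (r' - \<bar>Im (snd w $ i)\<bar>) * real_of_int \<bar>k $ i\<bar>))"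
    if "r' \<le> r" "bnd a r' M' f" "w \<in> S a r'" for k r' M' w using c that by (auto simp: is_fourier_def)
  have c_sum: "((\<lambda>k. c k w) has_sum f w) (KJ J)" if "w \<in> S a r" for w using c that by (auto simp: is_fourier_def)
  have c_eq: "c k (w + s \<odot> ex i) = exp (\<i> * of_int (k $ i) * s) * c k w"
    if "i \<in> J" "w \<in> S a r" "w + s \<odot> ex i \<in> S a r" for k i w s using c that by (auto simp: is_fourier_def)
  \<comment> \<open>Setting entry \<open>j\<close> to 0 recovers the index for \<open>J\<close> that
    \<open>k\<close> extends, in accordance with \<open>bij_upd\<close>.\<close>
  define c' where "c' k = Pr j (k $ j) (c (upd k j 0))" for k
  have c_M: "bnd a r M (c k)" for k
    unfolding bnd_def
  proof
    fix w :: "'n cv" assume w: "w \<in> S a r"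
    have M0: "0 \<le> M" using bndD[OF M w] norm_ge_zero order_trans by blast
    have "(\<Prod>i\<in>J. exp (- (r - \<bar>Im (snd w $ i)\<bar>) * real_of_int \<bar>k $ i\<bar>)) \<le> 1"
      by (rule prod_le_1) (use S_D(2)[OF w] in \<open>auto intro!: mult_nonpos_nonneg simp: less_imp_le\<close>)
    hence "M * (\<Prod>i\<in>J. exp (- (r - \<bar>Im (snd w $ i)\<bar>) * real_of_int \<bar>k $ i\<bar>)) \<le> M" using M0 by (simp add: mult_left_le)
    thus "cmod (c k w) \<le> M" using c_bd[OF order_refl M w, of k] by linarith
  qed
  have bd': "cmod (c' k w) \<le> M' * (\<Prod>i\<in>insert j J. exp (- (r' - \<bar>Im (snd w $ i)\<bar>) * real_of_int \<bar>k $ i\<bar>))"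
    if r': "r' \<le> r" and M': "bnd a r' M' f" and w: "w \<in> S a r'" for k r' M' w
  proof -
    have sub: "S a r' \<subseteq> (S a r :: 'n cv set)" using r' by (intro S_mono) auto
    let ?P = "\<Prod>i\<in>J. exp (- (r' - \<bar>Im (snd w $ i)\<bar>) * real_of_int \<bar>k $ i\<bar>)"
    have "cmod (c' k w) \<le> (M' * ?P) * exp (- (r' - \<bar>Im (snd w $ j)\<bar>) * real_of_int \<bar>k $ j\<bar>)"
      unfolding c'_def
    proof (rule Pr_bound[OF _ _ w])
      show "hol (S a r') (c (upd k j 0))" by (rule hol_subset[OF hol_c sub])
      show "periodic (S a r') (c (upd k j 0))" using per_c sub by (auto simp: periodic_def)
      fix t assume t: "w + t \<odot> ex j \<in> S a r'"
      have "(\<Prod>i\<in>J. exp (- (r' - \<bar>Im (snd (w + t \<odot> ex j) $ i)\<bar>) * real_of_int \<bar>upd k j 0 $ i\<bar>)) = ?P"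
        by (rule prod.cong) (use insert.hyps in \<open>auto simp: axis_def\<close>)
      thus "cmod (c (upd k j 0) (w + t \<odot> ex j)) \<le> M' * ?P" using c_bd[OF r' M' t, of "upd k j 0"] by simp
    qed
    thus ?thesis using insert.hyps by (simp add: mult_ac)
  qed
  have "is_fourier a r f (insert j J) c'"
    unfolding is_fourier_def
  proof (intro conjI allI ballI impI)
    fix k show "hol (S a r) (c' k)" unfolding c'_def by (rule hol_Pr[OF hol_c c_M])
    show "periodic (S a r) (c' k)" unfolding c'_def by (rule periodic_Pr[OF per_c])
  next
    fix k i w s assume i: "i \<in> insert j J" and w: "w \<in> S a r" "w + s \<odot> ex i \<in> S a r"
    show "c' k (w + s \<odot> ex i) = exp (\<i> * of_int (k $ i) * s) * c' k w"
    proof (cases "i = j")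
      case True
      thus ?thesis using Pr_shift[OF hol_c per_c w(1), of s j] w(2) by (simp add: c'_def)
    next
      case False
      hence "i \<in> J" using i by simp
      from c_eq[OF this, of _ s "upd k j 0"] False
      have "c (upd k j 0) (w + s \<odot> ex i) = exp (\<i> * of_int (k $ i) * s) * c (upd k j 0) w"
         if "w \<in> S a r" "w + s \<odot> ex i \<in> S a r" for w using that by simp
      from Pr_equivariant[where f="c (upd k j 0)" and c="exp (\<i> * of_int (k $ i) * s)", OF this w] show ?thesis by (simp add: c'_def)
    qed
  next
    fix w :: "'n cv" assume w: "w \<in> S a r"
    let ?F = "\<lambda>(k, m). Pr j m (c k) w"
    have F: "?F p = (\<lambda>k. c' k w) ((\<lambda>(k, m). upd k j m) p)" if "p \<in> KJ J \<times> UNIV" for p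
    proof -
      obtain k m where p: "p = (k, m)" by (cases p)
      have "k $ j = 0" using that p insert.hyps by (auto simp: KJ_def)
      hence "upd (upd k j m) j 0 = k" by (auto simp: vec_eq_iff)
      thus ?thesis by (simp add: p c'_def)
    qed
    have "((\<lambda>k. \<Prod>i\<in>insert j J. exp (- (r - \<bar>Im (snd w $ i)\<bar>) * real_of_int \<bar>k $ i\<bar>)) has_sum
       (\<Prod>i\<in>insert j J. Eexp (r - \<bar>Im (snd w $ i)\<bar>))) (KJ (insert j J))"
      by (rule prod_has_sum, use insert.hyps in simp, rule exp_abs_has_sum) (use S_D(2)[OF w] in auto)
    hence "(\<lambda>k. M * (\<Prod>i\<in>insert j J. exp (- (r - \<bar>Im (snd w $ i)\<bar>) * real_of_int \<bar>k $ i\<bar>))) summable_on (KJ (insert j J))"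
      using has_sum_cmult_right summable_on_def by blast
    hence "(\<lambda>k. cmod (c' k w)) summable_on (KJ (insert j J))"
      by (rule summable_on_comparison_test) (use bd'[OF order_refl M w] in auto)
    hence "(\<lambda>k. c' k w) summable_on (KJ (insert j J))" by (rule abs_summable_summable)
    hence "(\<lambda>p. (\<lambda>k. c' k w) ((\<lambda>(k, m). upd k j m) p)) summable_on (KJ J \<times> UNIV)"
      using summable_on_reindex_bij_betw[OF bij_upd[OF insert.hyps(2)], where f="\<lambda>k. c' k w"] by blast
    hence "?F summable_on (KJ J \<times> UNIV)" using summable_on_cong[of "KJ J \<times> UNIV" ?F "\<lambda>p. (\<lambda>k. c' k w) ((\<lambda>(k, m). upd k j m) p)", OF F] by blast
    moreover have "((\<lambda>m. ?F (k, m)) has_sum c k w) UNIV" for k using Pr_inversion[OF hol_c per_c w] by simp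
    ultimately have "(?F has_sum f w) (KJ J \<times> UNIV)" by (intro has_sum_SigmaI[OF _ c_sum[OF w]]) auto
    hence "((\<lambda>p. (\<lambda>k. c' k w) ((\<lambda>(k, m). upd k j m) p)) has_sum f w) (KJ J \<times> UNIV)"
      using has_sum_cong[of "KJ J \<times> UNIV" ?F "\<lambda>p. (\<lambda>k. c' k w) ((\<lambda>(k, m). upd k j m) p)", OF F] by blast
    thus "((\<lambda>k. c' k w) has_sum f w) (KJ (insert j J))"
      using has_sum_reindex_bij_betw[OF bij_upd[OF insert.hyps(2)], where f="\<lambda>k. c' k w"] by blast
  qed (use bd' in auto)
  thus ?case by blast
qed

text \<open>The angles are moved one at a time. Intermediate points stay in the domain because it is
  a product: each coordinate is either that of w or that of the end point.\<close>

lemma fourier_shift: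
  assumes c: "is_fourier a r f UNIV c" and w: "w \<in> S a r" "w + (0, v) \<in> S a r"
  shows "c k (w + (0, v)) = exp (\<i> * (\<Sum>i\<in>UNIV. of_int (k $ i) * v $ i)) * c k w"
proof -
  have "finite J \<Longrightarrow> w + (0, \<chi> i. if i \<in> J then v $ i else 0) \<in> S a r \<and>
    c k (w + (0, \<chi> i. if i \<in> J then v $ i else 0)) = exp (\<i> * (\<Sum>i\<in>J. of_int (k $ i) * v $ i)) * c k w" for J
  proof (induction J rule: finite_induct)
    case empty
    have "w + (0, \<chi> i. if i \<in> {} then v $ i else 0) = w" by (rule cv_eqI) auto
    thus ?case using w by simp
  next
    case (insert j J)
    let ?w = "w + (0, \<chi> i. if i \<in> J then v $ i else 0)" and ?w' = "w + (0, \<chi> i. if i \<in> insert j J then v $ i else 0)"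
    have eq: "?w' = ?w + v $ j \<odot> ex j" by (rule cv_eqI) (use insert.hyps in \<open>auto simp: axis_def\<close>)
    have "?w' \<in> S a r"
    proof (rule S_I)
      show "cmod (fst ?w' $ i) < a" for i using S_D(1)[OF w(1)] by simp
      show "\<bar>Im (snd ?w' $ i)\<bar> < r" for i using S_D(2)[OF w(1), of i] S_D(2)[OF w(2), of i] by auto
    qed
    moreover have "c k ?w' = exp (\<i> * of_int (k $ j) * v $ j) * c k ?w"
      unfolding eq using c insert.IH \<open>?w' \<in> S a r\<close> unfolding is_fourier_def eq by blast
    ultimately show ?case using insert by (simp add: distrib_left exp_add mult.assoc)
  qed
  from this[of UNIV] show ?thesis by (simp add: vec_lambda_eta)
qed

text \<open>Exhausting the lattice by boxes turns an unordered sum into the limit of a sequence, the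
  form in which limits of holomorphic functions are treated.\<close>

definition kbox :: "nat \<Rightarrow> (int^'n::finite) set" where "kbox N = {k. \<forall>i. \<bar>k $ i\<bar> \<le> int N}"

lemma finite_kbox: "finite (kbox N :: (int^'n::finite) set)"
proof (rule finite_subset)
  show "kbox N \<subseteq> vec_lambda ` (PiE UNIV (\<lambda>_::'n. {- int N..int N}))"
  proof
    fix k :: "int^'n" assume "k \<in> kbox N"
    hence "($) k \<in> PiE UNIV (\<lambda>_. {- int N..int N})" by (auto simp: kbox_def abs_le_iff minus_le_iff)
    thus "k \<in> vec_lambda ` (PiE UNIV (\<lambda>_::'n. {- int N..int N}))" by (metis image_eqI vec_lambda_eta)
  qed
qed (auto intro!: finite_imageI finite_PiE)

lemma filterlim_kbox: "filterlim kbox (finite_subsets_at_top (UNIV :: (int^'n::finite) set)) sequentially"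
  unfolding filterlim_finite_subsets_at_top
proof safe
  fix X :: "(int^'n) set" assume X: "finite X"
  let ?N = "\<Sum>k\<in>X. \<Sum>i\<in>UNIV. nat \<bar>k $ i\<bar>"
  have "k \<in> kbox N" if "k \<in> X" "?N \<le> N" for k N
    unfolding kbox_def
  proof safe
    fix i
    have "nat \<bar>k $ i\<bar> \<le> (\<Sum>i\<in>UNIV. nat \<bar>k $ i\<bar>)" by (rule member_le_sum) auto
    also have "\<dots> \<le> ?N" using that(1) X by (intro member_le_sum) auto
    finally show "\<bar>k $ i\<bar> \<le> int N" using that(2) by linarith
  qed
  thus "\<forall>\<^sub>F N in sequentially. finite (kbox N :: (int^'n) set) \<and> X \<subseteq> kbox N \<and> kbox N \<subseteq> UNIV"
    unfolding eventually_sequentially using finite_kbox by (intro exI[of _ ?N]) auto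
qed

lemma has_sum_kbox: "(f has_sum x) (UNIV :: (int^'n::finite) set) \<Longrightarrow> (\<lambda>N. sum f (kbox N)) \<longlonglongrightarrow> x"
  unfolding has_sum_def by (rule filterlim_compose[OF _ filterlim_kbox])

lemma has_sum_kbox_part:
  fixes f :: "int^'n::finite \<Rightarrow> 'b::{topological_comm_monoid_add,t2_space}"
  shows "((\<lambda>k. if k \<in> kbox N then f k else 0) has_sum (\<Sum>k\<in>kbox N. f k)) UNIV"
  by (rule has_sum_finite_neutralI[OF finite_kbox]) auto

text \<open>The tail outside \<open>kbox N\<close> is dominated by the tail of \<open>W\<close>,
  uniformly in w. The last claim, termwise differentiation, lets a series be checked against a
  differential equation mode by mode.\<close>

lemma hol_infsum:
  fixes g :: "int^'n::finite \<Rightarrow> 'n cv \<Rightarrow> complex"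
  assumes A: "open A" and g: "\<And>k. hol A (g k)" and W: "\<And>k w. w \<in> A \<Longrightarrow> cmod (g k w) \<le> W k" "(W has_sum Wt) UNIV"
  defines "G \<equiv> \<lambda>w. infsum (\<lambda>k. g k w) UNIV"
  shows "hol A G" "w \<in> A \<Longrightarrow> ((\<lambda>k. g k w) has_sum G w) UNIV" "w \<in> A \<Longrightarrow> cmod (G w) \<le> Wt"
    "w \<in> A \<Longrightarrow> (\<lambda>N. \<Sum>k\<in>kbox N. dd h (g k) w) \<longlonglongrightarrow> dd h G w"
proof -
  have abs: "(\<lambda>k. cmod (g k w)) summable_on UNIV" if "w \<in> A" for w
    by (rule summable_on_comparison_test[of W]) (use W that in \<open>auto simp: summable_on_def\<close>)
  have hs: "((\<lambda>k. g k w) has_sum G w) UNIV" if "w \<in> A" for w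
    unfolding G_def using abs_summable_summable[OF abs[OF that]] by (rule has_sum_infsum)
  show "w \<in> A \<Longrightarrow> ((\<lambda>k. g k w) has_sum G w) UNIV" by (rule hs)
  have tail: "cmod (G w - (\<Sum>k\<in>kbox N. g k w)) \<le> Wt - sum W (kbox N)" if w: "w \<in> A" for w N
  proof (rule norm_infsum_le)
    show "((\<lambda>k. g k w + - (if k \<in> kbox N then g k w else 0)) has_sum (G w - (\<Sum>k\<in>kbox N. g k w))) UNIV"
      unfolding diff_conv_add_uminus by (intro has_sum_add hs[OF w] has_sum_uminusI has_sum_kbox_part)
    show "((\<lambda>k. W k + - (if k \<in> kbox N then W k else 0)) has_sum (Wt - sum W (kbox N))) UNIV"
      unfolding diff_conv_add_uminus by (intro has_sum_add W(2) has_sum_uminusI has_sum_kbox_part)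
  qed (use W(1)[OF w] in auto)
  show "cmod (G w) \<le> Wt" if w: "w \<in> A"
    using norm_infsum_le[OF hs[OF w] W(2)] W(1)[OF w] by blast
  have unif: "uniform_limit A (\<lambda>N w. \<Sum>k\<in>kbox N. g k w) G sequentially"
    unfolding uniform_limit_iff
  proof safe
    fix e :: real assume e: "e > 0"
    have "(\<lambda>N. Wt - sum W (kbox N)) \<longlonglongrightarrow> Wt - Wt" by (intro tendsto_intros has_sum_kbox W)
    hence "\<forall>\<^sub>F N in sequentially. Wt - sum W (kbox N) < e" using e by (intro order_tendstoD(2)[of _ "Wt - Wt"]) auto
    thus "\<forall>\<^sub>F N in sequentially. \<forall>w\<in>A. dist (\<Sum>k\<in>kbox N. g k w) (G w) < e"
    proof eventually_elim
      case (elim N)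
      show ?case using tail elim by (auto simp: dist_norm norm_minus_commute intro: le_less_trans)
    qed
  qed
  have ex: "\<exists>d>0. ball w d \<subseteq> A \<and> uniform_limit (ball w d) (\<lambda>N w. \<Sum>k\<in>kbox N. g k w) G sequentially" if "w \<in> A" for w
  proof -
    obtain d where "d > 0" "ball w d \<subseteq> A" using A \<open>w \<in> A\<close> by (meson openE)
    thus ?thesis using uniform_limit_on_subset[OF unif] by blast
  qed
  have hs: "hol A (\<lambda>w. \<Sum>k\<in>kbox N. g k w)" for N by (rule hol_sum(1)[OF g])
  show "hol A G" by (rule hol_limit(1)[OF hs ex])
  show "(\<lambda>N. \<Sum>k\<in>kbox N. dd h (g k) w) \<longlonglongrightarrow> dd h G w" if "w \<in> A"
  proof -
    have "dd h (\<lambda>w. \<Sum>k\<in>kbox N. g k w) w = (\<Sum>k\<in>kbox N. dd h (g k) w)" for N by (rule hol_sum(2)[OF g that])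
    thus ?thesis using hol_limit(2)[OF hs ex that, of h] by simp
  qed
qed

lemma hol_cnj:
  fixes f :: "'n::finite cv \<Rightarrow> complex"
  assumes f: "hol (S a r) f"
  shows "hol (S a r) (\<lambda>w. cnj (f (cnjv w)))"
    "w \<in> S a r \<Longrightarrow> dd h (\<lambda>w. cnj (f (cnjv w))) w = cnj (dd (cnjv h) f (cnjv w))"
proof -
  have lin: "bounded_linear (cnjv :: 'n cv \<Rightarrow> 'n cv)"
  proof -
    have "norm (cnjv v) = norm v" for v :: "'n cv"
      by (simp add: cnjv_def norm_prod_def norm_vec_def)
    thus ?thesis by (intro bounded_linear_intro[where K=1]) (auto simp: cnjv_def vec_eq_iff)
  qed
  have in_S: "cnjv w \<in> S a r" if "w \<in> S a r" for w :: "'n cv" using that by (simp add: S_def cnjv_def)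
  have der: "((\<lambda>w. cnj (f (cnjv w))) has_derivative (\<lambda>h. cnj (dd (cnjv h) f (cnjv w)))) (at w)" if "w \<in> S a r" for w
    by (rule bounded_linear.has_derivative[OF bounded_linear_cnj],
        rule has_derivative_compose[OF bounded_linear_imp_has_derivative[OF lin] hol_D(1)[OF f in_S[OF that]]])
  have cl: "cnj (dd (cnjv (c \<odot> h)) f (cnjv w)) = c * cnj (dd (cnjv h) f (cnjv w))" if "w \<in> S a r" for w c and h :: "'n cv"
  proof -
    have "cnjv (c \<odot> h) = cnj c \<odot> cnjv h" by (rule cv_eqI) (auto simp: cnjv_def)
    thus ?thesis by (simp add: hol_D(2)[OF f in_S[OF that]])
  qed
  note * = hol_intro[of "S a r", OF der cl]
  show "hol (S a r) (\<lambda>w. cnj (f (cnjv w)))" by (rule *(1))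
  show "w \<in> S a r \<Longrightarrow> dd h (\<lambda>w. cnj (f (cnjv w))) w = cnj (dd (cnjv h) f (cnjv w))" by (rule *(2))
qed

section \<open>Small divisors\<close>
definition kdot :: "int^'n::finite \<Rightarrow> real^'n \<Rightarrow> real" where
  "kdot k \<omega> = (\<Sum>i\<in>UNIV. real_of_int (k $ i) * \<omega> $ i)"

definition knorm :: "int^'n::finite \<Rightarrow> real" where "knorm k = real_of_int (\<Sum>i\<in>UNIV. \<bar>k $ i\<bar>)"

lemma knorm_ge_1: assumes "k \<noteq> 0" shows "1 \<le> knorm k"
proof -
  obtain i where "k $ i \<noteq> 0" using assms by (auto simp: vec_eq_iff)
  hence "1 \<le> \<bar>k $ i\<bar>" by linarith
  also have "\<dots> \<le> (\<Sum>i\<in>UNIV. \<bar>k $ i\<bar>)" by (rule member_le_sum) auto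
  finally show ?thesis unfolding knorm_def by linarith
qed

text \<open>Raise t \<le> exp t to the power b, with t = d x / (2 b).\<close>

lemma powr_le_exp:
  assumes x: "1 \<le> x" and d: "0 < d" and b: "\<tau> \<le> real b" "0 < b"
  shows "x powr \<tau> \<le> (2 * real b / d) ^ b * exp (d / 2 * x)"
proof -
  have "x powr \<tau> \<le> x ^ b" using x b by (metis powr_mono powr_realpow less_le_trans zero_less_one)
  also have "x ^ b = (2 * real b / d) ^ b * (d * x / (2 * real b)) ^ b"
    using d b by (simp add: power_mult_distrib[symmetric])
  also have "\<dots> \<le> (2 * real b / d) ^ b * exp (d / 2 * x)"
  proof (rule mult_left_mono)
    have "d * x / (2 * real b) \<le> exp (d * x / (2 * real b))" using exp_ge_add_one_self[of "d * x / (2 * real b)"] by linarith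
    hence "(d * x / (2 * real b)) ^ b \<le> exp (d * x / (2 * real b)) ^ b" using x d by (intro power_mono) auto
    also have "\<dots> = exp (d / 2 * x)" unfolding exp_of_nat_mult[symmetric] using b by simp
    finally show "(d * x / (2 * real b)) ^ b \<le> exp (d / 2 * x)" .
  qed (use d in simp)
  finally show ?thesis .
qed

lemma diophantineE:
  assumes "diophantine (\<omega> :: real^'n::finite)"
  obtains \<gamma> b where "0 < \<gamma>" "0 < b" "\<And>k d. k \<noteq> 0 \<Longrightarrow> 0 < d \<Longrightarrow> kdot k \<omega> \<noteq> 0 \<and>
    1 / \<bar>kdot k \<omega>\<bar> \<le> 1 / \<gamma> * (2 * real b / d) ^ b * exp (d / 2 * knorm k)"
proof -
  obtain \<gamma> \<tau> where g: "0 < \<gamma>" and dio: "\<And>k::int^'n. k \<noteq> 0 \<Longrightarrow>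
     \<gamma> / (real_of_int (\<Sum>i\<in>UNIV. \<bar>k $ i\<bar>)) powr \<tau> < \<bar>(\<chi> i. real_of_int (k $ i)) \<bullet> \<omega>\<bar>"
    using assms unfolding diophantine_def by blast
  \<comment> \<open>A natural exponent that is at least \<tau>; \<open>Suc\<close> makes it
    positive.\<close>
  define b where "b = Suc (nat \<lceil>\<tau>\<rceil>)"
  have b: "\<tau> \<le> real b" "0 < b" unfolding b_def by linarith+
  show ?thesis
  proof
    fix k :: "int^'n" and d :: real assume k: "k \<noteq> 0" and d: "0 < d"
    have x: "1 \<le> knorm k" by (rule knorm_ge_1[OF k])
    have 1: "\<gamma> / knorm k powr \<tau> < \<bar>kdot k \<omega>\<bar>" using dio[OF k] by (simp add: kdot_def knorm_def inner_vec_def)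
    have pos: "0 < \<gamma> / knorm k powr \<tau>" using g x by simp
    have "1 / \<bar>kdot k \<omega>\<bar> \<le> 1 / (\<gamma> / knorm k powr \<tau>)" using 1 pos by (intro divide_left_mono mult_pos_pos) auto
    also have "\<dots> = 1 / \<gamma> * knorm k powr \<tau>" by simp
    also have "\<dots> \<le> 1 / \<gamma> * ((2 * real b / d) ^ b * exp (d / 2 * knorm k))"
      using g by (intro mult_left_mono powr_le_exp[OF x d b]) auto
    finally show "kdot k \<omega> \<noteq> 0 \<and> 1 / \<bar>kdot k \<omega>\<bar> \<le> 1 / \<gamma> * (2 * real b / d) ^ b * exp (d / 2 * knorm k)"
      using 1 pos by (auto simp: mult.assoc)
  qed (use g b in auto)
qed

text \<open>Moving all angles by t \<omega> multiplies a mode by an exponential in t, so the mode is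
  an eigenfunction of differentiation along \<omega>. The eigenvalues are the small
  divisors.\<close>

lemma dd_fourier:
  fixes w :: "'n::finite cv"
  assumes c: "is_fourier a r f UNIV c" and w: "w \<in> S a r"
  shows "dd (0, cvec \<omega>) (c k) w = \<i> * of_real (kdot k \<omega>) * c k w"
proof -
  let ?h = "(0, cvec \<omega>) :: 'n cv"
  have "open ((\<lambda>t. w + t \<odot> ?h) -` S a r)"
    by (rule continuous_open_vimage[OF open_S]) (intro continuous_intros linear_continuous_at bounded_linear_cs)
  moreover have "0 \<in> (\<lambda>t. w + t \<odot> ?h) -` S a r" using w by simp
  ultimately obtain e where e: "e > 0" "\<And>t. t \<in> ball 0 e \<Longrightarrow> w + t \<odot> ?h \<in> S a r" by (meson openE subsetD vimageE)
  have eq: "c k (w + t \<odot> ?h) = exp (\<i> * of_real (kdot k \<omega>) * t) * c k w" if "t \<in> ball 0 e" for t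
  proof -
    have "t \<odot> ?h = (0, t *s cvec \<omega>)" by (simp add: cs_def)
    moreover have "(\<Sum>i\<in>UNIV. of_int (k $ i) * (t *s cvec \<omega>) $ i) = of_real (kdot k \<omega>) * t"
      by (simp add: kdot_def cvec_def sum_distrib_right sum_distrib_left mult_ac)
    ultimately show ?thesis using fourier_shift[OF c w, of "t *s cvec \<omega>" k] e(2)[OF that] by (simp add: mult.assoc)
  qed
  have "((\<lambda>t. exp (\<i> * of_real (kdot k \<omega>) * t) * c k w) has_field_derivative \<i> * of_real (kdot k \<omega>) * c k w) (at 0)"
    by (auto intro!: derivative_eq_intros)
  hence "((\<lambda>t. c k (w + t \<odot> ?h)) has_field_derivative \<i> * of_real (kdot k \<omega>) * c k w) (at 0)"
    by (rule has_field_derivative_transform_within_open[OF _ open_ball[of 0 e]]) (use e(1) eq in auto)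
  thus ?thesis unfolding dd_def by (rule DERIV_imp_deriv)
qed

text \<open>Of the strip loss \<delta>, one half pays for the small divisors through
  \<open>powr_le_exp\<close>, and the other half for summing over the lattice:
  \<open>Eexp (\<delta> / 2)\<close> is at most \<open>8 / \<delta>\<close>, once for each
  angle.\<close>

definition sd_loss :: "real \<Rightarrow> nat \<Rightarrow> 'n::finite itself \<Rightarrow> real \<Rightarrow> real" where
  "sd_loss \<gamma> b TYPE('n) \<delta> = 1 / \<gamma> * (2 * real b / \<delta>) ^ b * (8 / \<delta>) ^ CARD('n)"

text \<open>Each nonconstant mode is divided by its eigenvalue, and \<open>m\<close> is the mode k =
  0, the mean over the angles. The bounds hold for all r' and M' with the same \<open>m\<close> and
  \<open>q\<close>, so that a solution can be estimated again later on a different strip.\<close>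

lemma small_divisor_aux:
  fixes f :: "'n::finite cv \<Rightarrow> complex" and \<omega> :: "real^'n"
  assumes g: "0 < \<gamma>" "0 < b" and dio: "\<And>k d. k \<noteq> 0 \<Longrightarrow> 0 < d \<Longrightarrow> kdot k \<omega> \<noteq> 0 \<and>
    1 / \<bar>kdot k \<omega>\<bar> \<le> 1 / \<gamma> * (2 * real b / d) ^ b * exp (d / 2 * knorm k)"
    and f: "hol (S a r) f" "periodic (S a r) f" and M: "bnd a r M f"
  shows "\<exists>m q. hol (S a r) m \<and> periodic (S a r) m \<and> hol (S a r) q \<and> periodic (S a r) q \<and> zind (S a r) m \<and>
    (\<forall>w\<in>S a r. dd (0, cvec \<omega>) q w = f w - m w) \<and>
    (\<forall>r' M'. r' \<le> r \<longrightarrow> bnd a r' M' f \<longrightarrow> bnd a r' M' m) \<and>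
    (\<forall>\<delta> r' M'. 0 < \<delta> \<longrightarrow> \<delta> \<le> 1 \<longrightarrow> r' \<le> r \<longrightarrow> bnd a r' M' f \<longrightarrow> bnd a (r' - \<delta>) (sd_loss \<gamma> b TYPE('n) \<delta> * M') q)"
proof -
  obtain c where c: "is_fourier a r f UNIV c" using fourier_exists[OF f M finite] by blast
  have hol_c: "hol (S a r) (c k)" and per_c: "periodic (S a r) (c k)" for k using c by (auto simp: is_fourier_def)
  have c_bd: "cmod (c k w) \<le> M' * (\<Prod>i\<in>UNIV. exp (- (r' - \<bar>Im (snd w $ i)\<bar>) * real_of_int \<bar>k $ i\<bar>))"
    if "r' \<le> r" "bnd a r' M' f" "w \<in> S a r'" for k r' M' w using c that by (auto simp: is_fourier_def)
  have c_sum: "((\<lambda>k. c k w) has_sum f w) UNIV" if "w \<in> S a r" for w using c that by (auto simp: is_fourier_def KJ_UNIV)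
  define G where "G k w = (if k = 0 then 0 else c k w / (\<i> * of_real (kdot k \<omega>)))" for k w
  define q where "q w = infsum (\<lambda>k. G k w) UNIV" for w
  define W where "W M' \<delta> k = M' * (1 / \<gamma> * (2 * real b / \<delta>) ^ b) * (\<Prod>i\<in>UNIV. exp (- (\<delta> / 2) * real_of_int \<bar>k $ i\<bar>))" for M' \<delta> and k :: "int^'n"
  define Wt where "Wt M' \<delta> = M' * (1 / \<gamma> * (2 * real b / \<delta>) ^ b) * Eexp (\<delta> / 2) ^ CARD('n)" for M' \<delta>
  have W: "(W M' \<delta> has_sum Wt M' \<delta>) UNIV" if "\<delta> > 0" for M' \<delta>
  proof -
    have "((\<lambda>k::int^'n. \<Prod>i\<in>UNIV. exp (- (\<delta> / 2) * real_of_int \<bar>k $ i\<bar>)) has_sum (\<Prod>i\<in>(UNIV::'n set). Eexp (\<delta> / 2))) (KJ UNIV)"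
      by (rule prod_has_sum[OF finite exp_abs_has_sum]) (use that in auto)
    from has_sum_cmult_right[OF this, where c="M' * (1 / \<gamma> * (2 * real b / \<delta>) ^ b)"]
    show ?thesis unfolding W_def Wt_def KJ_UNIV prod_constant .
  qed
  have GW: "cmod (G k w) \<le> W M' \<delta> k" if "\<delta> > 0" "r' \<le> r" "bnd a r' M' f" "w \<in> S a (r' - \<delta>)" for M' \<delta> r' k w
  proof -
    have w: "w \<in> S a r'" using that S_mono[of "r' - \<delta>" r' a a] by auto
    have M0: "0 \<le> M'" using bndD[OF that(3) w] norm_ge_zero order_trans by blast
    show ?thesis
    proof (cases "k = 0")
      case True
      thus ?thesis using M0 g that(1) by (simp add: G_def W_def)
    next
      case False
      have "cmod (G k w) = cmod (c k w) * (1 / \<bar>kdot k \<omega>\<bar>)" using False by (simp add: G_def norm_divide norm_mult)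
      also have "\<dots> \<le> (M' * (\<Prod>i\<in>UNIV. exp (- \<delta> * real_of_int \<bar>k $ i\<bar>))) * (1 / \<gamma> * (2 * real b / \<delta>) ^ b * exp (\<delta> / 2 * knorm k))"
      proof (rule mult_mono)
        have "(\<Prod>i\<in>UNIV. exp (- (r' - \<bar>Im (snd w $ i)\<bar>) * real_of_int \<bar>k $ i\<bar>)) \<le> (\<Prod>i\<in>UNIV. exp (- \<delta> * real_of_int \<bar>k $ i\<bar>))"
        proof (rule prod_mono, intro conjI)
          fix i
          have "\<delta> \<le> r' - \<bar>Im (snd w $ i)\<bar>" using S_D(2)[OF that(4), of i] by simp
          hence "\<delta> * real_of_int \<bar>k $ i\<bar> \<le> (r' - \<bar>Im (snd w $ i)\<bar>) * real_of_int \<bar>k $ i\<bar>" by (rule mult_right_mono) simp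
          thus "exp (- (r' - \<bar>Im (snd w $ i)\<bar>) * real_of_int \<bar>k $ i\<bar>) \<le> exp (- \<delta> * real_of_int \<bar>k $ i\<bar>)" by (simp add: algebra_simps)
        qed simp
        thus "cmod (c k w) \<le> M' * (\<Prod>i\<in>UNIV. exp (- \<delta> * real_of_int \<bar>k $ i\<bar>))"
          using c_bd[OF that(2,3) w, of k] mult_left_mono[OF _ M0] by (meson order_trans)
        show "1 / \<bar>kdot k \<omega>\<bar> \<le> 1 / \<gamma> * (2 * real b / \<delta>) ^ b * exp (\<delta> / 2 * knorm k)" using dio[OF False that(1)] by simp
        show "0 \<le> M' * (\<Prod>i\<in>UNIV. exp (- \<delta> * real_of_int \<bar>k $ i\<bar>))" using M0 by (simp add: prod_nonneg)
      qed simp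
      also have "exp (\<delta> / 2 * knorm k) = (\<Prod>i\<in>UNIV. exp (\<delta> / 2 * real_of_int \<bar>k $ i\<bar>))"
        by (simp add: knorm_def sum_distrib_left exp_sum)
      also have "(M' * (\<Prod>i\<in>UNIV. exp (- \<delta> * real_of_int \<bar>k $ i\<bar>))) * (1 / \<gamma> * (2 * real b / \<delta>) ^ b * (\<Prod>i\<in>UNIV. exp (\<delta> / 2 * real_of_int \<bar>k $ i\<bar>))) =
        M' * (1 / \<gamma> * (2 * real b / \<delta>) ^ b) * (\<Prod>i\<in>UNIV. exp (- \<delta> * real_of_int \<bar>k $ i\<bar>) * exp (\<delta> / 2 * real_of_int \<bar>k $ i\<bar>))"
        by (simp only: prod.distrib mult_ac)
      also have "\<dots> = W M' \<delta> k"
        unfolding W_def exp_add[symmetric] by (simp add: algebra_simps)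
      finally show ?thesis .
    qed
  qed
  have hol_G: "hol (S a r) (G k)" for k
  proof (cases "k = 0")
    case False
    hence G: "G k = (\<lambda>w. inverse (\<i> * of_real (kdot k \<omega>)) * c k w)" by (auto simp: G_def field_simps)
    show ?thesis unfolding G by (rule hol_cmult(1)[OF hol_c])
  next
    case True
    thus ?thesis by (simp add: G_def[abs_def])
  qed
  \<comment> \<open>The series is dominated only after a loss \<delta>. Since \<delta> is arbitrary,
    holomorphy and the equation follow on the full strip, though without a bound up to its
    boundary.\<close>
  have inner: "hol (S a (r - \<delta>)) q \<and> (\<forall>w\<in>S a (r - \<delta>). (\<lambda>N. \<Sum>k\<in>kbox N. dd (0, cvec \<omega>) (G k) w) \<longlonglongrightarrow> dd (0, cvec \<omega>) q w)"
    if d: "\<delta> > 0" for \<delta>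
  proof -
    have "S a (r - \<delta>) \<subseteq> (S a r :: 'n cv set)" using d by (intro S_mono) auto
    note * = hol_infsum[of "S a (r - \<delta>)" G "W M \<delta>", OF open_S hol_subset[OF hol_G this] GW[OF d order_refl M] W[OF d]]
    show ?thesis using *(1,4) unfolding q_def by blast
  qed
  have hol_q: "hol (S a r) q"
  proof (rule hol_S_inner)
    fix r' assume "r' < r"
    thus "hol (S a r') q" using inner[of "r - r'"] by simp
  qed
  have c0: "zind (S a r) (c 0)"
    unfolding zind_def
  proof (intro ballI impI)
    fix w w' :: "'n cv" assume w: "w \<in> S a r" "w' \<in> S a r" "fst w = fst w'"
    have "w' = w + (0, snd w' - snd w)" by (rule cv_eqI) (use w in auto)
    thus "c 0 w = c 0 w'" using fourier_shift[OF c w(1), of "snd w' - snd w" 0] w(2) by simp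
  qed
  have eq: "dd (0, cvec \<omega>) q w = f w - c 0 w" if w: "w \<in> S a r" for w
  proof -
    obtain r' where r': "r' < r" "w \<in> S a r'" by (rule S_inner[OF w])
    have l1: "(\<lambda>N. \<Sum>k\<in>kbox N. dd (0, cvec \<omega>) (G k) w) \<longlonglongrightarrow> dd (0, cvec \<omega>) q w" using inner[of "r - r'"] r' by simp
    have ddG: "dd (0, cvec \<omega>) (G k) w = (if k = 0 then 0 else c k w)" for k
    proof (cases "k = 0")
      case True
      thus ?thesis by (simp add: G_def[abs_def])
    next
      case False
      hence G: "G k = (\<lambda>w. inverse (\<i> * of_real (kdot k \<omega>)) * c k w)" by (auto simp: G_def field_simps)
      have "dd (0, cvec \<omega>) (G k) w = inverse (\<i> * of_real (kdot k \<omega>)) * dd (0, cvec \<omega>) (c k) w"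
        unfolding G by (rule hol_cmult(2)[OF hol_c w])
      thus ?thesis using dio[OF False zero_less_one] False by (simp add: dd_fourier[OF c w] field_simps)
    qed
    have "(\<Sum>k\<in>kbox N. dd (0, cvec \<omega>) (G k) w) = (\<Sum>k\<in>kbox N. c k w) - c 0 w" for N
    proof -
      have "(\<Sum>k\<in>kbox N. c k w) = c 0 w + (\<Sum>k\<in>kbox N - {0}. c k w)"
        by (rule sum.remove[OF finite_kbox]) (simp add: kbox_def)
      moreover have "(\<Sum>k\<in>kbox N. dd (0, cvec \<omega>) (G k) w) = (\<Sum>k\<in>kbox N - {0}. c k w)"
        unfolding ddG by (rule sum.mono_neutral_cong_right) (auto simp: finite_kbox)
      ultimately show ?thesis by simp
    qed
    hence "(\<lambda>N. \<Sum>k\<in>kbox N. dd (0, cvec \<omega>) (G k) w) \<longlonglongrightarrow> f w - c 0 w"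
      using tendsto_diff[OF has_sum_kbox[OF c_sum[OF w]] tendsto_const] by simp
    thus ?thesis using LIMSEQ_unique[OF l1] by blast
  qed
  have per_q: "periodic (S a r) q"
    using per_c unfolding periodic_def q_def G_def by (auto intro!: infsum_cong)
  have bd_m: "bnd a r' M' (c 0)" if "r' \<le> r" "bnd a r' M' f" for r' M'
    unfolding bnd_def using c_bd[OF that, of _ 0] by simp
  have bd_q: "bnd a (r' - \<delta>) (sd_loss \<gamma> b TYPE('n) \<delta> * M') q" if "0 < \<delta>" "\<delta> \<le> 1" "r' \<le> r" "bnd a r' M' f" for \<delta> r' M'
    unfolding bnd_def
  proof
    fix w :: "'n cv" assume w: "w \<in> S a (r' - \<delta>)"
    hence w': "w \<in> S a r'" using that S_mono[of "r' - \<delta>" r' a a] by auto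
    have M0: "0 \<le> M'" using bndD[OF that(4) w'] norm_ge_zero order_trans by blast
    have sub: "S a (r' - \<delta>) \<subseteq> (S a r :: 'n cv set)" using that by (intro S_mono) auto
    have "cmod (q w) \<le> Wt M' \<delta>"
      using hol_infsum(3)[of "S a (r' - \<delta>)" G "W M' \<delta>", OF open_S hol_subset[OF hol_G sub] GW[OF that(1,3,4)] W[OF that(1)] w]
      unfolding q_def by blast
    also have "\<dots> \<le> M' * (1 / \<gamma> * (2 * real b / \<delta>) ^ b) * (8 / \<delta>) ^ CARD('n)"
      unfolding Wt_def using M0 g that(1,2) Eexp_le[of "\<delta> / 2"] by (intro mult_left_mono power_mono) auto
    finally show "cmod (q w) \<le> sd_loss \<gamma> b TYPE('n) \<delta> * M'" by (simp add: sd_loss_def mult_ac)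
  qed
  show ?thesis
    using hol_c per_c hol_q per_q c0 eq bd_m bd_q by (intro exI[of _ "c 0"] exI[of _ q] conjI ballI allI impI)
qed

lemma cnjv_S: "cnjv w \<in> S a r \<longleftrightarrow> w \<in> S a r"
  by (simp add: S_def cnjv_def)

lemma cnjv_cnjv [simp]: "cnjv (cnjv w) = w" by (rule cv_eqI) (auto simp: cnjv_def)

text \<open>Averaging a solution with its reflection \<open>cnj (q (cnjv w))\<close> makes it real
  at real points. As \<omega> and f are real, the average solves the same equation, and no bound
  grows.\<close>

lemma small_divisor:
  fixes f :: "'n::finite cv \<Rightarrow> complex" and \<omega> :: "real^'n"
  assumes g: "0 < \<gamma>" "0 < b" and dio: "\<And>k d. k \<noteq> 0 \<Longrightarrow> 0 < d \<Longrightarrow> kdot k \<omega> \<noteq> 0 \<and>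
    1 / \<bar>kdot k \<omega>\<bar> \<le> 1 / \<gamma> * (2 * real b / d) ^ b * exp (d / 2 * knorm k)"
    and f: "cls a r f" and M: "bnd a r M f"
  shows "\<exists>m q. cls a r m \<and> cls a r q \<and> zind (S a r) m \<and>
    (\<forall>w\<in>S a r. dd (0, cvec \<omega>) q w = f w - m w) \<and>
    (\<forall>r' M'. r' \<le> r \<longrightarrow> bnd a r' M' f \<longrightarrow> bnd a r' M' m) \<and>
    (\<forall>\<delta> r' M'. 0 < \<delta> \<longrightarrow> \<delta> \<le> 1 \<longrightarrow> r' \<le> r \<longrightarrow> bnd a r' M' f \<longrightarrow> bnd a (r' - \<delta>) (sd_loss \<gamma> b TYPE('n) \<delta> * M') q)"
proof -
  have f': "hol (S a r) f" "periodic (S a r) f" and sym: "\<And>w. w \<in> S a r \<Longrightarrow> f (cnjv w) = cnj (f w)"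
    using f by (auto simp: cls_def)
  obtain m q where m: "hol (S a r) m" "periodic (S a r) m" and q: "hol (S a r) q" "periodic (S a r) q" and zi: "zind (S a r) m" and
    eq: "\<And>w. w\<in>S a r \<Longrightarrow> dd (0, cvec \<omega>) q w = f w - m w" and
    bm: "\<And>r' M'. r' \<le> r \<Longrightarrow> bnd a r' M' f \<Longrightarrow> bnd a r' M' m" and
    bq: "\<And>\<delta> r' M'. 0 < \<delta> \<Longrightarrow> \<delta> \<le> 1 \<Longrightarrow> r' \<le> r \<Longrightarrow> bnd a r' M' f \<Longrightarrow> bnd a (r' - \<delta>) (sd_loss \<gamma> b TYPE('n) \<delta> * M') q"
    using small_divisor_aux[OF g dio f' M] by blast
  define sy where "sy g w = (1/2) * (g w + cnj (g (cnjv w)))" for g :: "'n cv \<Rightarrow> complex" and w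
  have hol_sy: "hol (S a r) (sy g)" if "hol (S a r) g" for g
    unfolding sy_def by (intro hol_cmult hol_add that hol_cnj)
  have per_sy: "periodic (S a r) (sy g)" if "periodic (S a r) g" for g
    unfolding periodic_def
  proof (intro ballI allI)
    fix w :: "'n cv" and i assume w: "w \<in> S a r"
    have "cnjv (w + of_real (2 * pi) \<odot> ex i) = cnjv w + of_real (2 * pi) \<odot> ex i"
      by (rule cv_eqI) (auto simp: cnjv_def axis_def)
    hence "g (cnjv (w + of_real (2 * pi) \<odot> ex i)) = g (cnjv w)" using that w cnjv_S[of w a r] unfolding periodic_def by metis
    thus "sy g (w + of_real (2 * pi) \<odot> ex i) = sy g w" using that w unfolding sy_def periodic_def by metis
  qed
  have cls_sy: "cls a r (sy g)" if "hol (S a r) g" "periodic (S a r) g" for g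
    unfolding cls_def using hol_sy[OF that(1)] per_sy[OF that(2)] by (auto simp: sy_def)
  have bnd_sy: "bnd a r' M' (sy g)" if "bnd a r' M' g" for r' M' g
    unfolding bnd_def
  proof
    fix w :: "'n cv" assume w: "w \<in> S a r'"
    have "cmod (g w + cnj (g (cnjv w))) \<le> M' + M'"
      using bndD[OF that w] bndD[OF that, of "cnjv w"] w cnjv_S[of w a r'] by (intro norm_triangle_mono) auto
    thus "cmod (sy g w) \<le> M'" by (simp add: sy_def norm_mult)
  qed
  have zi': "zind (S a r) (sy m)"
    unfolding zind_def
  proof (intro ballI impI)
    fix w w' :: "'n cv" assume w: "w \<in> S a r" "w' \<in> S a r" "fst w = fst w'"
    have fc: "fst (cnjv w) = fst (cnjv w')" using w(3) by (simp add: cnjv_def)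
    have cw: "cnjv w \<in> S a r" "cnjv w' \<in> S a r" using w(1,2) by (simp_all add: cnjv_S)
    have "m w = m w'" using zi w unfolding zind_def by blast
    moreover have "m (cnjv w) = m (cnjv w')" using zi cw fc unfolding zind_def by blast
    ultimately show "sy m w = sy m w'" by (simp add: sy_def)
  qed
  have "dd (0, cvec \<omega>) (sy q) w = f w - sy m w" if w: "w \<in> S a r" for w
  proof -
    have cw: "cnjv w \<in> S a r" using w cnjv_S by blast
    have "cnjv (0, cvec \<omega>) = (0, cvec \<omega>)" by (rule cv_eqI) (auto simp: cnjv_def cvec_def)
    hence "dd (0, cvec \<omega>) (sy q) w = (1/2) * (dd (0, cvec \<omega>) q w + cnj (dd (0, cvec \<omega>) q (cnjv w)))"
      by (simp only: sy_def[abs_def] hol_cmult(2)[OF hol_add(1)[OF q(1) hol_cnj(1)[OF q(1)]] w]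
        hol_add(2)[OF q(1) hol_cnj(1)[OF q(1)] w] hol_cnj(2)[OF q(1) w])
    thus ?thesis using eq[OF w] eq[OF cw] sym[OF w] by (simp add: sy_def algebra_simps)
  qed
  hence e: "\<forall>w\<in>S a r. dd (0, cvec \<omega>) (sy q) w = f w - sy m w" by blast
  have m': "\<forall>r' M'. r' \<le> r \<longrightarrow> bnd a r' M' f \<longrightarrow> bnd a r' M' (sy m)"
    by (intro allI impI bnd_sy bm)
  have q': "\<forall>\<delta> r' M'. 0 < \<delta> \<longrightarrow> \<delta> \<le> 1 \<longrightarrow> r' \<le> r \<longrightarrow> bnd a r' M' f \<longrightarrow> bnd a (r' - \<delta>) (sd_loss \<gamma> b TYPE('n) \<delta> * M') (sy q)"
    by (intro allI impI bnd_sy bq)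
  show ?thesis
    by (rule exI[of _ "sy m"], rule exI[of _ "sy q"],
      rule conjI[OF cls_sy[OF m] conjI[OF cls_sy[OF q] conjI[OF zi' conjI[OF e conjI[OF m' q']]]]])
qed

section \<open>Function classes and estimates\<close>
lemma cls_hol: "cls a r f \<Longrightarrow> hol (S a r) f" by (simp add: cls_def)

lemma cls_periodic: "cls a r f \<Longrightarrow> w \<in> S a r \<Longrightarrow> f (w + of_real (2 * pi) \<odot> ex i) = f w"
  by (simp add: cls_def periodic_def)

lemma cls_sym: "cls a r f \<Longrightarrow> w \<in> S a r \<Longrightarrow> f (cnjv w) = cnj (f w)" by (simp add: cls_def)

lemma clsI:
  assumes "hol (S a r) f" "\<And>w i. w \<in> S a r \<Longrightarrow> f (w + of_real (2 * pi) \<odot> ex i) = f w"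
    "\<And>w. w \<in> S a r \<Longrightarrow> f (cnjv w) = cnj (f w)"
  shows "cls a r f"
  using assms by (simp add: cls_def periodic_def)

lemma cls_subset: "cls a r f \<Longrightarrow> r' \<le> r \<Longrightarrow> a' \<le> a \<Longrightarrow> cls a' r' f"
  unfolding cls_def periodic_def using S_mono[of r' r a' a] hol_subset by blast

lemma cls_const: "cnj c = c \<Longrightarrow> cls a r (\<lambda>_. c)"
  by (rule clsI) auto

lemma cls_add: "cls a r f \<Longrightarrow> cls a r g \<Longrightarrow> cls a r (\<lambda>w. f w + g w)"
  by (rule clsI) (auto simp: cls_periodic cls_sym intro: hol_add cls_hol simp del: of_real_mult)

lemma cls_mult: "cls a r f \<Longrightarrow> cls a r g \<Longrightarrow> cls a r (\<lambda>w. f w * g w)"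
  by (rule clsI) (auto simp: cls_periodic cls_sym intro: hol_mult cls_hol simp del: of_real_mult)

lemma cls_minus: "cls a r f \<Longrightarrow> cls a r (\<lambda>w. - f w)"
  by (rule clsI) (auto simp: cls_periodic cls_sym intro: hol_minus cls_hol simp del: of_real_mult)

lemma cls_diff: "cls a r f \<Longrightarrow> cls a r g \<Longrightarrow> cls a r (\<lambda>w. f w - g w)"
  using cls_add[OF _ cls_minus] by fastforce

lemma cls_sum:
  fixes f :: "'i \<Rightarrow> 'n::finite cv \<Rightarrow> complex"
  shows "(\<And>i. i \<in> I \<Longrightarrow> cls a r (f i)) \<Longrightarrow> cls a r (\<lambda>w. \<Sum>i\<in>I. f i w)"
proof (rule clsI)
  assume f: "\<And>i. i \<in> I \<Longrightarrow> cls a r (f i)"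
  show "hol (S a r) (\<lambda>w. \<Sum>i\<in>I. f i w)" by (rule hol_sum(1)) (rule cls_hol[OF f])
  fix w :: "'n cv" assume w: "w \<in> S a r"
  show "(\<Sum>i\<in>I. f i (w + of_real (2 * pi) \<odot> ex j)) = (\<Sum>i\<in>I. f i w)" for j
    by (rule sum.cong[OF refl]) (rule cls_periodic[OF f w])
  have "(\<Sum>i\<in>I. f i (cnjv w)) = (\<Sum>i\<in>I. cnj (f i w))" by (rule sum.cong[OF refl]) (rule cls_sym[OF f w])
  thus "(\<Sum>i\<in>I. f i (cnjv w)) = cnj (\<Sum>i\<in>I. f i w)" by simp
qed

lemma cls_fst: "cls a r (\<lambda>w. fst w $ i)"
  by (rule clsI) (auto simp: hol_fst cnjv_def)

lemmas cls_intros = cls_add cls_mult cls_minus cls_diff cls_sum cls_fst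

lemma cls_cong:
  assumes "cls a r f" "\<And>w. w \<in> S a r \<Longrightarrow> g w = f w"
  shows "cls a r g"
proof (rule clsI)
  show "hol (S a r) g" by (rule hol_cong(1)[OF open_S cls_hol[OF assms(1)]]) (simp add: assms(2))
  fix w :: "'a cv" assume w: "w \<in> S a r"
  show "g (w + of_real (2 * pi) \<odot> ex i) = g w" for i
    using assms(2)[OF w] assms(2)[OF S_shift_real[OF w, of "2 * pi" i]] cls_periodic[OF assms(1) w, of i] by simp
  show "g (cnjv w) = cnj (g w)" using assms w cls_sym[OF assms(1) w] by (simp add: cnjv_S)
qed


lemma cls_dd:
  assumes f: "cls a r f" and h: "cnjv h = h"
  shows "cls a r (dd h f)"
proof (rule clsI)
  show "hol (S a r) (dd h f)" by (rule hol_dd[OF open_S cls_hol[OF f]])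
  fix w :: "'a cv" assume w: "w \<in> S a r"
  show "dd h f (w + of_real (2 * pi) \<odot> ex i) = dd h f w" for i
  proof -
    have "((\<lambda>w. f (w + of_real (2 * pi) \<odot> ex i)) has_derivative (\<lambda>h. dd h f (w + of_real (2 * pi) \<odot> ex i))) (at w)"
      by (rule has_derivative_translate[OF cls_hol[OF f] S_shift_real[OF w]])
    hence "(f has_derivative (\<lambda>h. dd h f (w + of_real (2 * pi) \<odot> ex i))) (at w)"
      by (rule has_derivative_transform_within_open[OF _ open_S w]) (rule cls_periodic[OF f])
    thus ?thesis by (rule dd_unique[symmetric]) (rule hol_D(2)[OF cls_hol[OF f] S_shift_real[OF w]])
  qed
  have "dd h (\<lambda>w. cnj (f (cnjv w))) w = dd h f w"
    by (rule hol_cong(2)[OF open_S cls_hol[OF f] _ w]) (simp add: cls_sym[OF f])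
  moreover have "dd h (\<lambda>w. cnj (f (cnjv w))) w = cnj (dd (cnjv h) f (cnjv w))" by (rule hol_cnj(2)[OF cls_hol[OF f] w])
  ultimately show "dd h f (cnjv w) = cnj (dd h f w)" using h by (metis complex_cnj_cnj)
qed

lemma cnjv_ex [simp]: "cnjv (ex i) = ex i" and cnjv_ey [simp]: "cnjv (ey i) = ey i"
  and cnjv_cvec [simp]: "cnjv (0, cvec \<omega>) = (0, cvec \<omega>)"
  by (rule cv_eqI; simp add: cnjv_def axis_def cvec_def)+

text \<open>Here \<open>u\<close> is the periodic deviation of the angles from the identity, whereas
  \<open>v\<close> is the action itself. The parameter \<open>fst w\<close> enters only through
  \<open>u\<close> and \<open>v\<close>.\<close>

definition emb :: "('n::finite \<Rightarrow> 'n cv \<Rightarrow> complex) \<Rightarrow> ('n \<Rightarrow> 'n cv \<Rightarrow> complex) \<Rightarrow> 'n cv \<Rightarrow> 'n cv" where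
  "emb v u w = (\<chi> i. v i w, \<chi> i. snd w $ i + u i w)"

lemma fst_emb [simp]: "fst (emb v u w) $ i = v i w" and snd_emb [simp]: "snd (emb v u w) $ i = snd w $ i + u i w"
  by (auto simp: emb_def)

lemma hol_emb:
  assumes F: "hol B F" and v: "\<And>i. hol A (v i)" and u: "\<And>i. hol A (u i)" and AB: "\<And>w. w \<in> A \<Longrightarrow> emb v u w \<in> B"
  shows "hol A (\<lambda>w. F (emb v u w))"
    "w \<in> A \<Longrightarrow> dd h (\<lambda>w. F (emb v u w)) w = (\<Sum>i\<in>UNIV. dd h (v i) w * dd (ey i) F (emb v u w)) +
      (\<Sum>i\<in>UNIV. (snd h $ i + dd h (u i) w) * dd (ex i) F (emb v u w))"
proof -
  have hs: "hol A (\<lambda>w. snd w $ i + u i w)" for i by (intro hol_add hol_snd u)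
  note * = hol_compose[where \<alpha>=v and \<beta>="\<lambda>i w. snd w $ i + u i w", OF F v hs, folded emb_def, OF AB]
  show "hol A (\<lambda>w. F (emb v u w))" by (rule *(1))
  show "dd h (\<lambda>w. F (emb v u w)) w = (\<Sum>i\<in>UNIV. dd h (v i) w * dd (ey i) F (emb v u w)) +
      (\<Sum>i\<in>UNIV. (snd h $ i + dd h (u i) w) * dd (ex i) F (emb v u w))" if "w \<in> A"
    unfolding *(2)[OF _ that, simplified] using hol_add(2)[OF hol_snd(1) u that] by (simp add: hol_snd(2))
qed

lemma cls_emb:
  assumes F: "cls b s F" and v: "\<And>i. cls a r (v i)" and u: "\<And>i. cls a r (u i)"
    and AB: "\<And>w. w \<in> S a r \<Longrightarrow> emb v u w \<in> S b s"
  shows "cls a r (\<lambda>w. F (emb v u w))"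
proof (rule clsI)
  show "hol (S a r) (\<lambda>w. F (emb v u w))" by (rule hol_emb(1)[OF cls_hol[OF F] cls_hol[OF v] cls_hol[OF u] AB])
  fix w :: "'a cv" assume w: "w \<in> S a r"
  show "F (emb v u (w + of_real (2 * pi) \<odot> ex i)) = F (emb v u w)" for i
  proof -
    have "emb v u (w + of_real (2 * pi) \<odot> ex i) = emb v u w + of_real (2 * pi) \<odot> ex i"
      by (rule cv_eqI) (simp_all add: cls_periodic[OF v w] cls_periodic[OF u w] add_ac del: of_real_mult)
    thus ?thesis using cls_periodic[OF F AB[OF w]] by simp
  qed
  have "emb v u (cnjv w) = cnjv (emb v u w)"
    by (rule cv_eqI) (simp_all add: cls_sym[OF v w] cls_sym[OF u w] cnjv_def[of w] cnjv_def[of "emb v u w"]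
       del: cnjv_cvec, simp_all add: cls_sym[OF v w, unfolded cnjv_def] cls_sym[OF u w, unfolded cnjv_def])
  thus "F (emb v u (cnjv w)) = cnj (F (emb v u w))" using cls_sym[OF F AB[OF w]] by simp
qed

lemma cls_limit:
  assumes f: "\<And>n. cls a r (f n)" and u: "uniform_limit (S a r) f g sequentially"
  shows "cls a r g" "w \<in> S a r \<Longrightarrow> (\<lambda>n. dd h (f n) w) \<longlonglongrightarrow> dd h g w"
proof -
  have ex: "\<exists>d>0. ball w d \<subseteq> S a r \<and> uniform_limit (ball w d) f g sequentially" if "w \<in> S a r" for w
  proof -
    obtain d where "d > 0" "ball w d \<subseteq> S a r" using open_S \<open>w \<in> S a r\<close> by (meson openE)
    thus ?thesis using uniform_limit_on_subset[OF u] by blast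
  qed
  note * = hol_limit[OF cls_hol[OF f] ex]
  have lim: "(\<lambda>n. f n w) \<longlonglongrightarrow> g w" if "w \<in> S a r" for w by (rule tendsto_uniform_limitI[OF u that])
  show "w \<in> S a r \<Longrightarrow> (\<lambda>n. dd h (f n) w) \<longlonglongrightarrow> dd h g w" by (rule *(2))
  show "cls a r g"
  proof (rule clsI)
    show "hol (S a r) g" by (rule *(1))
    fix w :: "'a cv" assume w: "w \<in> S a r"
    show "g (w + of_real (2 * pi) \<odot> ex i) = g w" for i
      using LIMSEQ_unique[OF lim[OF S_shift_real[OF w, of "2 * pi" i]]] lim[OF w] cls_periodic[OF f w, of _ i] by simp
    have "(\<lambda>n. cnj (f n w)) \<longlonglongrightarrow> cnj (g w)" by (intro tendsto_intros lim w)
    thus "g (cnjv w) = cnj (g w)" using LIMSEQ_unique[OF lim[of "cnjv w"]] w cls_sym[OF f w] by (simp add: cnjv_S)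
  qed
qed

section \<open>Quantitative estimates on the product domains\<close>

lemma bnd_cauchy:
  fixes f :: "'n::finite cv \<Rightarrow> complex"
  assumes f: "hol (S a r) f" and C: "bnd a r C f" and d: "0 < \<delta>"
  shows "bnd a (r - \<delta>) (C / \<delta>) (dd (ex i) f)"
  unfolding bnd_def
proof
  fix w :: "'n cv" assume w: "w \<in> S a (r - \<delta>)"
  have in_S: "w + t \<odot> ex i \<in> S a r" if "cmod t < \<delta>" for t
  proof (rule S_shift)
    show "w \<in> S a r" using w S_mono[of "r - \<delta>" r a a] d by auto
    show "\<bar>Im (snd w $ i + t)\<bar> < r" using S_D(2)[OF w, of i] abs_Im_le_cmod[of t] that by simp
  qed
  show "cmod (dd (ex i) f w) \<le> C / \<delta>" by (rule hol_cauchy[OF f in_S bndD[OF C in_S] d])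
qed

lemma bnd_cauchy_y:
  fixes f :: "'n::finite cv \<Rightarrow> complex"
  assumes f: "hol (S a r) f" and C: "bnd a r C f" and d: "0 < \<delta>"
  shows "bnd (a - \<delta>) r (C / \<delta>) (dd (ey i) f)"
  unfolding bnd_def
proof
  fix w :: "'n cv" assume w: "w \<in> S (a - \<delta>) r"
  have in_S: "w + t \<odot> ey i \<in> S a r" if t: "cmod t < \<delta>" for t
  proof (rule S_I)
    fix j show "\<bar>Im (snd (w + t \<odot> ey i) $ j)\<bar> < r" using S_D(2)[OF w] by simp
    have "cmod (fst (w + t \<odot> ey i) $ j) \<le> cmod (fst w $ j) + cmod t"
      by (auto simp: axis_def norm_triangle_ineq)
    thus "cmod (fst (w + t \<odot> ey i) $ j) < a" using S_D(1)[OF w, of j] t by linarith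
  qed
  show "cmod (dd (ey i) f w) \<le> C / \<delta>" by (rule hol_cauchy[OF f in_S bndD[OF C in_S] d])
qed

text \<open>On the complex line through w in direction v there is room for |t| < \<delta> / x, and
  the one-variable Taylor bound is used at t = 1; this is where \<open>2 * x \<le> \<delta>\<close>
  comes from. \<open>y_taylor\<close> uses the same device to second order.\<close>

lemma zshift_bound:
  assumes f: "hol (S a r) f" and C: "bnd a r C f" and w: "w \<in> S a (r - \<delta>)" and x: "\<And>i. cmod (v $ i) \<le> x" "0 < x" "2 * x \<le> \<delta>"
  shows "cmod (f (w + (0, v)) - f w) \<le> 2 * C * x / \<delta>"
proof -
  have "cmod (f (w + 1 \<odot> (0, v)) - f w) \<le> 2 * C * cmod 1 / (\<delta> / x)"
  proof (rule hol_taylor(1)[OF f])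
    fix t assume t: "cmod t < \<delta> / x"
    show "w + t \<odot> (0, v) \<in> S a r"
    proof (rule S_I)
      fix i show "cmod (fst (w + t \<odot> (0, v)) $ i) < a" using S_D(1)[OF w] by simp
      have "\<bar>Im (t * v $ i)\<bar> \<le> cmod t * cmod (v $ i)" using abs_Im_le_cmod[of "t * v $ i"] by (simp add: norm_mult)
      also have "\<dots> \<le> cmod t * x" using x by (intro mult_left_mono) auto
      also have "\<dots> < \<delta>" using t x by (simp add: field_simps)
      finally show "\<bar>Im (snd (w + t \<odot> (0, v)) $ i)\<bar> < r" using S_D(2)[OF w, of i] by simp
    qed
    thus "cmod (f (w + t \<odot> (0, v))) \<le> C" by (rule bndD[OF C])
  qed (use x in \<open>auto simp: field_simps\<close>)
  thus ?thesis by (simp add: field_simps)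
qed

lemma y_taylor:
  assumes f: "hol (S a r) f" and C: "bnd a r C f" and w: "w \<in> S (a - \<delta>) r" and x: "\<And>i. cmod (v $ i) \<le> x" "0 < x" "2 * x \<le> \<delta>"
  shows "cmod (f (w + (v, 0)) - f w - (\<Sum>i\<in>UNIV. v $ i * dd (ey i) f w)) \<le> 8 * C * x\<^sup>2 / \<delta>\<^sup>2"
proof -
  have in_S: "w + t \<odot> (v, 0) \<in> S a r" if t: "cmod t < \<delta> / x" for t
  proof (rule S_I)
    fix i show "\<bar>Im (snd (w + t \<odot> (v, 0)) $ i)\<bar> < r" using S_D(2)[OF w] by simp
    have "cmod (t * v $ i) \<le> cmod t * x" unfolding norm_mult using x by (intro mult_left_mono) auto
    also have "\<dots> < \<delta>" using t x by (simp add: field_simps)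
    finally have "cmod (t * v $ i) < \<delta>" .
    thus "cmod (fst (w + t \<odot> (v, 0)) $ i) < a" using S_D(1)[OF w, of i] norm_triangle_ineq[of "fst w $ i" "t * v $ i"] by simp
  qed
  have "cmod (f (w + 1 \<odot> (v, 0)) - f w - 1 * dd (v, 0) f w) \<le> 8 * C * (cmod 1)\<^sup>2 / (\<delta> / x)\<^sup>2"
    by (rule hol_taylor(2)[OF f in_S bndD[OF C in_S]]) (use x in \<open>auto simp: field_simps\<close>)
  moreover have "w \<in> S a r" using w S_mono[of r r "a - \<delta>" a] x by auto
  hence "dd (v, 0) f w = (\<Sum>i\<in>UNIV. v $ i * dd (ey i) f w)" using dd_decomp[OF f, of w "(v, 0)"] by simp
  ultimately show ?thesis by (simp add: power_divide field_simps)
qed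

text \<open>Inverse of \<open>I + A\<close>. The last clause makes \<open>N\<close> independent of the angles whenever \<open>A\<close> is.\<close>

definition minv :: "real \<Rightarrow> real \<Rightarrow> ('n::finite \<Rightarrow> 'n \<Rightarrow> 'n cv \<Rightarrow> complex) \<Rightarrow> ('n \<Rightarrow> 'n \<Rightarrow> 'n cv \<Rightarrow> complex) \<Rightarrow> bool" where
  "minv a r A N \<longleftrightarrow> (\<forall>i j. cls a r (N i j)) \<and> (\<forall>i j. bnd a r 2 (N i j)) \<and>
    (\<forall>w\<in>S a r. \<forall>i j. (\<Sum>k\<in>UNIV. N i k w * ((if k = j then 1 else 0) + A k j w)) = (if i = j then 1 else 0)) \<and>
    (\<forall>w\<in>S a r. \<forall>i j. (\<Sum>k\<in>UNIV. ((if i = k then 1 else 0) + A i k w) * N k j w) = (if i = j then 1 else 0)) \<and>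
    (\<forall>w w'. (\<forall>i j. A i j w = A i j w') \<longrightarrow> (\<forall>i j. N i j w = N i j w'))"

lemma minvD:
  assumes "minv a r A N"
  shows "cls a r (N i j)" "bnd a r 2 (N i j)"
    "w \<in> S a r \<Longrightarrow> (\<Sum>k\<in>UNIV. N i k w * ((if k = j then 1 else 0) + A k j w)) = (if i = j then 1 else 0)"
    "w \<in> S a r \<Longrightarrow> (\<Sum>k\<in>UNIV. ((if i = k then 1 else 0) + A i k w) * N k j w) = (if i = j then 1 else 0)"
    "(\<And>i j. A i j w = A i j w') \<Longrightarrow> N i j w = N i j w'"
  using assms by (auto simp: minv_def)

text \<open>With n c \<le> 1/2 the entries of the m-th power of - A are at most
  \<open>(1/2) ^ m\<close>, so those of the Neumann series are at most 2. The series is a left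
  inverse by telescoping, and then a right inverse by the algebra of square matrices at each
  point.\<close>

lemma neumann:
  fixes A :: "'n::finite \<Rightarrow> 'n \<Rightarrow> 'n cv \<Rightarrow> complex"
  assumes A: "\<And>i j. cls a r (A i j)" and bd: "\<And>i j. bnd a r c (A i j)" and c: "2 * real CARD('n) * c \<le> 1"
  shows "\<exists>N. minv a r A N"
proof -
  define P where "P = rec_nat (\<lambda>i j w. if i = j then 1 else 0 :: complex) (\<lambda>_ Q i j w. \<Sum>k\<in>UNIV. Q i k w * - A k j w)"
  have P0: "P 0 i j w = (if i = j then 1 else 0)" and PS: "P (Suc m) i j w = (\<Sum>k\<in>UNIV. P m i k w * - A k j w)" for m i j w
    by (simp_all add: P_def)
  have clsP: "cls a r (P m i j)" for m i j
  proof (induction m arbitrary: i j)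
    case 0
    show ?case by (rule cls_cong[OF cls_const[of "if i = j then 1 else 0"]]) (auto simp: P0)
  next
    case (Suc m)
    show ?case by (rule cls_cong[of _ _ "\<lambda>w. \<Sum>k\<in>UNIV. P m i k w * - A k j w"]) (auto simp: PS intro!: cls_intros Suc A)
  qed
  have bdP: "cmod (P m i j w) \<le> (1/2) ^ m" if "w \<in> S a r" for m i j w
  proof (induction m arbitrary: i j)
    case 0
    show ?case by (simp add: P0)
  next
    case (Suc m)
    have "cmod (P (Suc m) i j w) \<le> (\<Sum>k\<in>(UNIV::'n set). (1/2) ^ m * c)"
      unfolding PS by (rule sum_norm_le) (auto simp: norm_mult intro!: mult_mono Suc bndD[OF bd that])
    also have "\<dots> = (1/2) ^ m * (real CARD('n) * c)" by simp
    also have "\<dots> \<le> (1/2) ^ m * (1/2)" using c by (intro mult_left_mono) auto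
    finally show ?case by simp
  qed
  define N where "N i j w = (\<Sum>m. P m i j w)" for i j w
  have sm: "summable (\<lambda>m. P m i j w)" if "w \<in> S a r" for i j w
    by (rule summable_comparison_test'[of "\<lambda>m. (1/2) ^ m" 0]) (auto simp: bdP[OF that] summable_geometric)
  have ul: "uniform_limit (S a r) (\<lambda>M w. \<Sum>m<M. P m i j w) (N i j) sequentially" for i j
    unfolding N_def by (rule Weierstrass_m_test[of _ _ "\<lambda>m. (1/2) ^ m"]) (auto simp: bdP summable_geometric)
  have clsN: "cls a r (N i j)" for i j
    by (rule cls_limit(1)[OF _ ul]) (intro cls_sum clsP)
  have bdN: "bnd a r 2 (N i j)" for i j
    unfolding bnd_def
  proof
    fix w :: "'n cv" assume w: "w \<in> S a r"
    have "cmod (N i j w) \<le> (\<Sum>m. (1/2) ^ m :: real)" unfolding N_def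
      by (rule norm_suminf_le) (auto simp: bdP[OF w] summable_geometric)
    thus "cmod (N i j w) \<le> 2" by (simp add: suminf_geometric)
  qed
  have left: "(\<Sum>k\<in>UNIV. N i k w * ((if k = j then 1 else 0) + A k j w)) = (if i = j then 1 else 0)" if w: "w \<in> S a r" for w i j
  proof -
    have "(\<Sum>k\<in>UNIV. N i k w * A k j w) = - (\<Sum>m. P (Suc m) i j w)"
    proof -
      have "(\<lambda>m. \<Sum>k\<in>UNIV. P m i k w * - A k j w) sums (\<Sum>k\<in>UNIV. N i k w * - A k j w)"
        unfolding N_def by (intro sums_sum sums_mult2 summable_sums sm w)
      hence "(\<lambda>m. P (Suc m) i j w) sums (\<Sum>k\<in>UNIV. N i k w * - A k j w)" unfolding PS .
      thus ?thesis by (simp add: sums_unique[symmetric] sum_negf)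
    qed
    moreover have "(\<Sum>m. P (Suc m) i j w) = N i j w - P 0 i j w"
      unfolding N_def by (rule suminf_split_head[OF sm[OF w]])
    moreover have "(\<Sum>k\<in>UNIV. N i k w * (if k = j then 1 else 0)) = N i j w" by (simp add: if_distrib cong: if_cong)
    ultimately show ?thesis by (simp add: distrib_left sum.distrib P0)
  qed
  have right: "(\<Sum>k\<in>UNIV. ((if i = k then 1 else 0) + A i k w) * N k j w) = (if i = j then 1 else 0)" if w: "w \<in> S a r" for w i j
  proof -
    let ?N = "(\<chi> i j. N i j w) :: complex^'n^'n" and ?M = "(\<chi> i j. (if i = j then 1 else 0) + A i j w) :: complex^'n^'n"
    have "?N ** ?M = mat 1" by (simp add: matrix_matrix_mult_def mat_def vec_eq_iff left[OF w])
    hence "?M ** ?N = mat 1" by (simp add: matrix_left_right_inverse)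
    hence "(?M ** ?N) $ i $ j = (mat 1 :: complex^'n^'n) $ i $ j" by simp
    thus ?thesis by (simp add: matrix_matrix_mult_def mat_def)
  qed
  have dep: "\<forall>w w'. (\<forall>i j. A i j w = A i j w') \<longrightarrow> (\<forall>i j. N i j w = N i j w')"
  proof (intro allI impI)
    fix w w' i j assume AA: "\<forall>i j. A i j w = A i j w'"
    have "P m i j w = P m i j w'" for m i j by (induction m arbitrary: i j) (simp_all add: P0 PS AA)
    thus "N i j w = N i j w'" by (simp add: N_def)
  qed
  show ?thesis unfolding minv_def
    by (rule exI[of _ N], intro conjI allI ballI; (rule clsN bdN left right | rule dep[rule_format])?) (use dep in auto)
qed

text \<open>\<open>e\<close> is the current error of the iteration and \<open>L\<close> dominates all losses of one step, so that
  every quantity occurring in the step is bounded by some \<open>L ^ k * e ^ j\<close>.\<close>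

locale order_calculus =
  fixes L e :: real and n_type :: "'n::finite itself"
  assumes L2: "2 \<le> L" and Ln: "real CARD('n) \<le> L" and e0: "0 \<le> e"
begin

definition ob :: "real \<Rightarrow> nat \<Rightarrow> nat \<Rightarrow> ('n cv \<Rightarrow> complex) \<Rightarrow> bool" where
  "ob r k j f \<longleftrightarrow> bnd (3/2) r (L ^ k * e ^ j) f"

lemma ob_mono: "ob r k j f \<Longrightarrow> k \<le> k' \<Longrightarrow> r' \<le> r \<Longrightarrow> ob r' k' j f"
proof -
  assume *: "ob r k j f" "k \<le> k'" "r' \<le> r"
  have "L ^ k * e ^ j \<le> L ^ k' * e ^ j" using L2 e0 * by (intro mult_right_mono power_increasing) auto
  thus ?thesis using * S_mono[of r' r "3/2" "3/2"] unfolding ob_def bnd_def by (meson order_refl order_trans subsetD)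
qed

text \<open>The factor 2 is absorbed by one more power of \<open>L\<close>, hence the strict
  inequalities between exponents; \<open>ob_sum\<close> treats the number of angles in the same way.
  The price is large exponents, which do no harm because only their total matters.\<close>

lemma ob_add: assumes "ob r k j f" "ob r k' j g" "k < l" "k' < l" shows "ob r l j (\<lambda>w. f w + g w)"
  unfolding ob_def bnd_def
proof
  fix w :: "'n cv" assume w: "w \<in> S (3/2) r"
  obtain l' where l: "l = Suc l'" using assms(3) by (cases l) auto
  have "cmod (f w) \<le> L ^ l' * e ^ j" "cmod (g w) \<le> L ^ l' * e ^ j"
    using ob_mono[OF assms(1), of l' r] ob_mono[OF assms(2), of l' r] assms l w unfolding ob_def bnd_def by auto
  hence "cmod (f w + g w) \<le> 2 * (L ^ l' * e ^ j)" using norm_triangle_ineq[of "f w" "g w"] by linarith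
  also have "\<dots> \<le> L * (L ^ l' * e ^ j)" using L2 e0 by (intro mult_right_mono) auto
  finally show "cmod (f w + g w) \<le> L ^ l * e ^ j" by (simp add: l)
qed

lemma ob_minus: "ob r k j f \<Longrightarrow> ob r k j (\<lambda>w. - f w)"
  by (simp add: ob_def bnd_def)

lemma ob_diff: assumes "ob r k j f" "ob r k' j g" "k < l" "k' < l" shows "ob r l j (\<lambda>w. f w - g w)"
  using ob_add[OF assms(1) ob_minus[OF assms(2)] assms(3,4)] by simp

lemma ob_mult: assumes "ob r k j f" "ob r k' j' g" "k + k' \<le> l" "j + j' = i" shows "ob r l i (\<lambda>w. f w * g w)"
proof -
  have "ob r (k + k') i (\<lambda>w. f w * g w)"
    unfolding ob_def bnd_def
  proof
    fix w :: "'n cv" assume w: "w \<in> S (3/2) r"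
    have "cmod (f w * g w) \<le> (L ^ k * e ^ j) * (L ^ k' * e ^ j')"
      unfolding norm_mult using assms w L2 e0 by (intro mult_mono) (auto simp: ob_def bnd_def)
    thus "cmod (f w * g w) \<le> L ^ (k + k') * e ^ i" using assms(4) by (auto simp: power_add mult_ac)
  qed
  thus ?thesis using ob_mono assms(3) by blast
qed

lemma ob_sum: assumes "\<And>i. ob r k j (f i)" "k < l" shows "ob r l j (\<lambda>w. \<Sum>i\<in>(UNIV::'n set). f i w)"
proof -
  have "ob r (Suc k) j (\<lambda>w. \<Sum>i\<in>UNIV. f i w)"
    unfolding ob_def bnd_def
  proof
    fix w :: "'n cv" assume w: "w \<in> S (3/2) r"
    have "cmod (\<Sum>i\<in>UNIV. f i w) \<le> (\<Sum>i\<in>(UNIV::'n set). L ^ k * e ^ j)"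
      by (rule sum_norm_le) (use assms w in \<open>auto simp: ob_def bnd_def\<close>)
    also have "\<dots> = real CARD('n) * (L ^ k * e ^ j)" by simp
    also have "\<dots> \<le> L * (L ^ k * e ^ j)" using Ln L2 e0 by (intro mult_right_mono) auto
    finally show "cmod (\<Sum>i\<in>UNIV. f i w) \<le> L ^ Suc k * e ^ j" by simp
  qed
  thus ?thesis using ob_mono[of r "Suc k" j _ l r] assms(2) by simp
qed

lemma ob_dot: assumes "\<And>i. ob r k j (f i)" "\<And>i. ob r k' j' (g i)" "k + k' < l" "j + j' = i"
  shows "ob r l i (\<lambda>w. \<Sum>i\<in>(UNIV::'n set). f i w * g i w)"
  by (rule ob_sum[OF ob_mult[OF assms(1,2) order_refl assms(4)] assms(3)])

lemma ob_dd: assumes "ob r k j f" "hol (S (3/2) r) f" "0 < \<delta>" "1 / \<delta> \<le> L" "r' \<le> r - \<delta>" "k < l" shows "ob r' l j (dd (ex i) f)"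
proof -
  have "L ^ k * e ^ j / \<delta> = (L ^ k * e ^ j) * (1 / \<delta>)" by simp
  also have "\<dots> \<le> (L ^ k * e ^ j) * L" using assms(4) L2 e0 by (intro mult_left_mono) auto
  finally have "L ^ k * e ^ j / \<delta> \<le> L ^ Suc k * e ^ j" by (simp add: mult_ac)
  hence "ob (r - \<delta>) (Suc k) j (dd (ex i) f)"
    using bnd_cauchy[OF assms(2) assms(1)[unfolded ob_def] assms(3)] unfolding ob_def bnd_def by (meson order_trans)
  thus ?thesis using ob_mono assms(5,6) by (meson Suc_leI)
qed

text \<open>Shifting the angles by a quantity of first order gains one power of \<open>e\<close>. Of
  the two extra powers of \<open>L\<close>, one covers the factor 2 and the other
  \<open>1 / \<delta>\<close>.\<close>

lemma ob_shift:
  assumes f: "ob r k j f" "hol (S (3/2) r) f" and d: "0 < \<delta>" "1 / \<delta> \<le> L" and v: "\<And>i. ob (r - \<delta>) k' 1 (v i)"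
    and small: "2 * (L ^ k' * e) \<le> \<delta>" "0 < e" and l: "k + k' + 2 \<le> l" "i = Suc j"
  shows "ob (r - \<delta>) l i (\<lambda>w. f (w + (0, \<chi> i. v i w)) - f w)"
proof -
  have "ob (r - \<delta>) (k + k' + 2) (Suc j) (\<lambda>w. f (w + (0, \<chi> i. v i w)) - f w)"
    unfolding ob_def bnd_def
  proof
    fix w :: "'n cv" assume w: "w \<in> S (3/2) (r - \<delta>)"
    have "cmod (f (w + (0, \<chi> i. v i w)) - f w) \<le> 2 * (L ^ k * e ^ j) * (L ^ k' * e) / \<delta>"
    proof (rule zshift_bound[OF f(2) f(1)[unfolded ob_def] w])
      show "cmod ((\<chi> i. v i w) $ i) \<le> L ^ k' * e" for i using v[of i] w by (simp add: ob_def bnd_def)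
    qed (use L2 small in auto)
    also have "\<dots> = 2 * (L ^ k * e ^ j) * (L ^ k' * e) * (1 / \<delta>)" by simp
    also have "\<dots> \<le> L * (L ^ k * e ^ j) * (L ^ k' * e) * L"
      using L2 e0 d by (intro mult_mono mult_right_mono mult_nonneg_nonneg) auto
    also have "\<dots> = L ^ (k + k' + 2) * e ^ Suc j" by (simp add: power_add power2_eq_square)
    finally show "cmod (f (w + (0, \<chi> i. v i w)) - f w) \<le> L ^ (k + k' + 2) * e ^ Suc j" .
  qed
  thus ?thesis using ob_mono l by blast
qed

end

section \<open>The Newton step\<close>
lemma zindD: "zind A g \<Longrightarrow> w \<in> A \<Longrightarrow> w' \<in> A \<Longrightarrow> fst w = fst w' \<Longrightarrow> g w = g w'"
  unfolding zind_def by blast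

lemma zindI: "(\<And>w w'. w \<in> A \<Longrightarrow> w' \<in> A \<Longrightarrow> fst w = fst w' \<Longrightarrow> g w = g w') \<Longrightarrow> zind A g"
  unfolding zind_def by blast

lemma zind_dd:
  fixes w :: "'n::finite cv"
  assumes z: "zind (S a r) g" and w: "w \<in> S a r" and h: "fst h = 0"
  shows "dd h g w = 0"
proof -
  have "open ((\<lambda>t. w + t \<odot> h) -` S a r)"
    by (rule continuous_open_vimage[OF open_S]) (intro continuous_intros linear_continuous_at bounded_linear_cs)
  moreover have "0 \<in> (\<lambda>t. w + t \<odot> h) -` S a r" using w by simp
  ultimately obtain e where e: "e > 0" "\<And>t. t \<in> ball 0 e \<Longrightarrow> w + t \<odot> h \<in> S a r" by (meson openE subsetD vimageE)
  have eq: "g w = g (w + t \<odot> h)" if "t \<in> ball 0 e" for t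
  proof -
    have "fst w = fst (w + t \<odot> h)" by (simp add: h)
    thus ?thesis using z w e(2)[OF that] unfolding zind_def by blast
  qed
  have "((\<lambda>t. g (w + t \<odot> h)) has_field_derivative 0) (at 0)"
    by (rule has_field_derivative_transform_within_open[OF DERIV_const open_ball[of 0 e]]) (use e(1) eq in auto)
  thus ?thesis unfolding dd_def by (rule DERIV_imp_deriv)
qed

lemma dd_omega:
  assumes "hol A f" "w \<in> A"
  shows "dd (0, cvec \<omega>) f w = (\<Sum>j\<in>UNIV. of_real (\<omega> $ j) * dd (ex j) f w)"
  using dd_decomp[OF assms, of "(0, cvec \<omega>)"] by (simp add: cvec_def)

lemma sum_delta_mult: "(\<Sum>k\<in>UNIV. (if i = k then 1 else 0) * (g k :: complex)) = g (i :: 'n::finite)"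
  "(\<Sum>k\<in>UNIV. (g k :: complex) * (if k = i then 1 else 0)) = g (i :: 'n::finite)"
  "(\<Sum>k\<in>UNIV. (if k = i then 1 else 0) * (g k :: complex)) = g (i :: 'n::finite)"
  "(\<Sum>k\<in>UNIV. (g k :: complex) * (if i = k then 1 else 0)) = g (i :: 'n::finite)"
  by (simp_all add: if_distrib if_distribR cong: if_cong)

lemma inverse_apply:
  fixes M N :: "'n::finite \<Rightarrow> 'n \<Rightarrow> complex"
  assumes "\<And>i j. (\<Sum>k\<in>UNIV. M i k * N k j) = (if i = j then 1 else 0)"
  shows "(\<Sum>k\<in>UNIV. M i k * (\<Sum>j\<in>UNIV. N k j * X j)) = X i"
proof -
  have "(\<Sum>k\<in>UNIV. M i k * (\<Sum>j\<in>UNIV. N k j * X j)) = (\<Sum>j\<in>UNIV. (\<Sum>k\<in>UNIV. M i k * N k j) * X j)"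
    unfolding sum_distrib_left sum_distrib_right by (subst sum.swap) (simp add: mult.assoc)
  thus ?thesis by (simp add: assms sum_delta_mult)
qed

lemma inverse_apply_transpose:
  fixes M N :: "'n::finite \<Rightarrow> 'n \<Rightarrow> complex"
  assumes "\<And>i j. (\<Sum>k\<in>UNIV. N i k * M k j) = (if i = j then 1 else 0)"
  shows "(\<Sum>l\<in>UNIV. M l j * (\<Sum>h\<in>UNIV. N h l * X h)) = X j"
proof (rule inverse_apply)
  fix i j
  have "(\<Sum>k\<in>UNIV. M k i * N j k) = (\<Sum>k\<in>UNIV. N j k * M k i)" by (simp add: mult.commute)
  also have "\<dots> = (if j = i then 1 else 0)" by (rule assms)
  finally show "(\<Sum>k\<in>UNIV. M k i * N j k) = (if i = j then 1 else 0)" by (simp add: eq_commute)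
qed

text \<open>The resolvent identity N' - N = - N' (M' - M) N: replacing the Jacobian by a nearby one
  changes the inverse to the same order.\<close>

lemma inverse_diff:
  fixes M N M' N' :: "'n::finite \<Rightarrow> 'n \<Rightarrow> complex"
  assumes N: "\<And>i j. (\<Sum>k\<in>UNIV. M i k * N k j) = (if i = j then 1 else 0)"
    and N': "\<And>i j. (\<Sum>k\<in>UNIV. N' i k * M' k j) = (if i = j then 1 else 0)"
  shows "N' i j - N i j = - (\<Sum>k\<in>UNIV. N' i k * (\<Sum>l\<in>UNIV. (M' k l - M k l) * N l j))"
proof -
  have "(\<Sum>k\<in>UNIV. N' i k * (\<Sum>l\<in>UNIV. M' k l * N l j)) = N i j"
    using inverse_apply[of N' M' i "\<lambda>l. N l j", OF N'] .
  moreover have "(\<Sum>k\<in>UNIV. N' i k * (\<Sum>l\<in>UNIV. M k l * N l j)) = N' i j"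
    by (simp add: N sum_delta_mult)
  ultimately show ?thesis by (simp add: left_diff_distrib right_diff_distrib sum_subtractf)
qed

text \<open>If the gradient equals M' om up to e2, then pairing it with the transpose of N' applied
  to dq cancels the matrices and leaves the derivative of q along om. The correction of the energy
  thus becomes an equation with constant coefficients.\<close>

lemma energy_pairing:
  fixes M' N' :: "'n::finite \<Rightarrow> 'n \<Rightarrow> complex"
  assumes N': "\<And>i j. (\<Sum>k\<in>UNIV. N' i k * M' k j) = (if i = j then 1 else 0)"
    and fy: "\<And>l. fy l = (\<Sum>j\<in>UNIV. M' l j * om j) - e2 l"
  shows "(\<Sum>l\<in>UNIV. fy l * (\<Sum>h\<in>UNIV. N' h l * dq h)) = (\<Sum>j\<in>UNIV. om j * dq j) - (\<Sum>l\<in>UNIV. e2 l * (\<Sum>h\<in>UNIV. N' h l * dq h))"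
proof -
  have "(\<Sum>l\<in>UNIV. (\<Sum>j\<in>UNIV. M' l j * om j) * (\<Sum>h\<in>UNIV. N' h l * dq h)) =
     (\<Sum>j\<in>UNIV. om j * (\<Sum>l\<in>UNIV. M' l j * (\<Sum>h\<in>UNIV. N' h l * dq h)))"
    unfolding sum_distrib_right[of "\<lambda>j. M' _ j * om j"] by (subst sum.swap) (simp add: sum_distrib_left mult_ac)
  also have "\<dots> = (\<Sum>j\<in>UNIV. om j * dq j)" by (simp only: inverse_apply_transpose[OF N'])
  finally show ?thesis by (simp add: fy left_diff_distrib sum_subtractf)
qed

text \<open>The right-hand side of the angle equation is affine in the unknown \<open>dl\<close>.
  Split in this way, the part caused by the errors and the responses to unit changes of the
  counterterm can be treated before \<open>dl\<close> is known.\<close>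

lemma linear_response:
  fixes N F nu1 :: "'n::finite \<Rightarrow> 'n \<Rightarrow> complex" and nu0 e2 dl :: "'n \<Rightarrow> complex"
  shows "(\<Sum>j\<in>UNIV. N k j * ((\<Sum>l\<in>UNIV. F j l * nu0 l) - e2 j)) +
      (\<Sum>i\<in>UNIV. dl i * (N k i + (\<Sum>j\<in>UNIV. N k j * (\<Sum>l\<in>UNIV. F j l * nu1 i l)))) =
    (\<Sum>j\<in>UNIV. N k j * (dl j + (\<Sum>l\<in>UNIV. F j l * (nu0 l + (\<Sum>i\<in>UNIV. dl i * nu1 i l))) - e2 j))"
proof -
  have 1: "(\<Sum>i\<in>UNIV. dl i * (\<Sum>j\<in>UNIV. N k j * (\<Sum>l\<in>UNIV. F j l * nu1 i l))) =
     (\<Sum>j\<in>UNIV. N k j * (\<Sum>l\<in>UNIV. F j l * (\<Sum>i\<in>UNIV. dl i * nu1 i l)))"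
  proof -
    have "(\<Sum>i\<in>UNIV. dl i * (\<Sum>j\<in>UNIV. N k j * (\<Sum>l\<in>UNIV. F j l * nu1 i l))) =
      (\<Sum>i\<in>UNIV. \<Sum>j\<in>UNIV. \<Sum>l\<in>UNIV. N k j * (F j l * (dl i * nu1 i l)))"
      by (simp add: sum_distrib_left mult_ac)
    also have "\<dots> = (\<Sum>j\<in>UNIV. \<Sum>i\<in>UNIV. \<Sum>l\<in>UNIV. N k j * (F j l * (dl i * nu1 i l)))" by (rule sum.swap)
    also have "\<dots> = (\<Sum>j\<in>UNIV. \<Sum>l\<in>UNIV. \<Sum>i\<in>UNIV. N k j * (F j l * (dl i * nu1 i l)))"
      by (rule sum.cong[OF refl]) (rule sum.swap)
    finally show ?thesis by (simp add: sum_distrib_left)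
  qed
  show ?thesis
    by (simp add: distrib_left right_diff_distrib sum.distrib sum_subtractf 1 mult.commute[of "dl _" "N k _"])
qed

text \<open>The Diophantine condition, with the growth in \<open>k\<close> traded for a strip of width \<open>d / 2\<close>.\<close>

definition loss_ok :: "real \<Rightarrow> nat \<Rightarrow> real^'n::finite \<Rightarrow> bool" where
  "loss_ok \<gamma> b \<omega> \<longleftrightarrow> 0 < \<gamma> \<and> 0 < b \<and> (\<forall>k d. k \<noteq> 0 \<longrightarrow> 0 < d \<longrightarrow> kdot k \<omega> \<noteq> 0 \<and>
    1 / \<bar>kdot k \<omega>\<bar> \<le> 1 / \<gamma> * (2 * real b / d) ^ b * exp (d / 2 * knorm k))"

text \<open>The last assumption keeps the response of the mean angular velocity to the counterterm
  within 1 / (2 n) of the identity, entry by entry, so that the counterterm can be solved for. The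
  bound 1 / 10 ^ 6 keeps the second action derivatives of f and the Taylor constants of the step
  below 1.\<close>

locale kam =
  fixes f :: "'n::finite cv \<Rightarrow> complex" and \<omega> :: "real^'n" and r0 \<eta> \<gamma> n :: real and b :: nat
  assumes f: "cls 2 r0 f" "bnd 2 r0 \<eta> f" and r0: "0 < r0" "r0 \<le> 1" and \<eta>: "0 \<le> \<eta>" "\<eta> \<le> 1 / 10 ^ 6"
    and dio: "loss_ok \<gamma> b \<omega>" and n: "n = real CARD('n)"
    and \<eta>_small: "4 * n ^ 3 * (100 * \<eta>) * (sd_loss \<gamma> b TYPE('n) (r0 / 16) * (1 / 10) / (r0 / 16)) \<le> 1 / (4 * n)"
begin

lemma n1: "1 \<le> n" by (simp add: n Suc_le_eq)

definition sdsol :: "real \<Rightarrow> ('n cv \<Rightarrow> complex) \<Rightarrow> ('n cv \<Rightarrow> complex) \<Rightarrow> ('n cv \<Rightarrow> complex) \<Rightarrow> bool" where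
  "sdsol r g m q \<longleftrightarrow> cls (3/2) r m \<and> cls (3/2) r q \<and> zind (S (3/2) r) m \<and>
    (\<forall>w\<in>S (3/2) r. dd (0, cvec \<omega>) q w = g w - m w) \<and>
    (\<forall>r' M'. r' \<le> r \<longrightarrow> bnd (3/2) r' M' g \<longrightarrow> bnd (3/2) r' M' m) \<and>
    (\<forall>\<delta> r' M'. 0 < \<delta> \<longrightarrow> \<delta> \<le> 1 \<longrightarrow> r' \<le> r \<longrightarrow> bnd (3/2) r' M' g \<longrightarrow> bnd (3/2) (r' - \<delta>) (sd_loss \<gamma> b TYPE('n) \<delta> * M') q)"

lemma sdsol_ex: "cls (3/2) r g \<Longrightarrow> bnd (3/2) r M g \<Longrightarrow> \<exists>m q. sdsol r g m q"
  unfolding sdsol_def using dio unfolding loss_ok_def by (intro small_divisor) auto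

lemma sdsolD:
  assumes "sdsol r g m q"
  shows "cls (3/2) r m" "cls (3/2) r q" "zind (S (3/2) r) m" "w \<in> S (3/2) r \<Longrightarrow> dd (0, cvec \<omega>) q w = g w - m w"
    "r' \<le> r \<Longrightarrow> bnd (3/2) r' M' g \<Longrightarrow> bnd (3/2) r' M' m"
    "0 < \<delta> \<Longrightarrow> \<delta> \<le> 1 \<Longrightarrow> r' \<le> r \<Longrightarrow> bnd (3/2) r' M' g \<Longrightarrow> bnd (3/2) (r' - \<delta>) (sd_loss \<gamma> b TYPE('n) \<delta> * M') q"
  using assms unfolding sdsol_def by auto

definition fy :: "'n \<Rightarrow> 'n cv \<Rightarrow> complex" where "fy i = dd (ey i) f"
definition fyy :: "'n \<Rightarrow> 'n \<Rightarrow> 'n cv \<Rightarrow> complex" where "fyy i l = dd (ey l) (fy i)"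

text \<open>Each action derivative of f costs 1/10 of the polydisc, once and for all and not in
  every step. The embeddings take values in radius 17/10, which leaves room for Taylor expansions of
  both f and \<open>fy\<close> with radius 1/10.\<close>

lemma fy: "cls 2 r0 (fy i)" "bnd (19/10) r0 (10 * \<eta>) (fy i)"
proof -
  show "cls 2 r0 (fy i)" unfolding fy_def by (rule cls_dd[OF f(1)]) simp
  have "bnd (2 - 1/10) r0 (\<eta> / (1/10)) (fy i)" unfolding fy_def by (rule bnd_cauchy_y[OF cls_hol[OF f(1)] f(2)]) simp
  thus "bnd (19/10) r0 (10 * \<eta>) (fy i)" by (simp add: mult.commute)
qed

lemma fyy: "cls 2 r0 (fyy i l)" "bnd (18/10) r0 (100 * \<eta>) (fyy i l)"
proof -
  show "cls 2 r0 (fyy i l)" unfolding fyy_def by (rule cls_dd[OF fy(1)]) simp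
  have "S (19/10) r0 \<subseteq> (S 2 r0 :: 'n cv set)" by (rule S_mono) auto
  hence "bnd (19/10 - 1/10) r0 (10 * \<eta> / (1/10)) (fyy i l)" unfolding fyy_def
    by (intro bnd_cauchy_y[OF hol_subset[OF cls_hol[OF fy(1)]] fy(2)]) auto
  thus "bnd (18/10) r0 (100 * \<eta>) (fyy i l)" by simp
qed

text \<open>The Hamilton-Jacobi equation says that the modified Hamiltonian has a constant value \<open>alp\<close> on
  the torus. Its error is \<open>e1\<close>, and \<open>e2\<close> is the error in the equation for the angles. The equation
  for the actions is replaced by the condition \<open>lagr\<close> that the torus is Lagrangian, which each
  step preserves exactly.\<close>

definition e1 where
  "e1 u v lam alp w = f (emb v u w) + (\<Sum>i\<in>UNIV. (of_real (\<omega> $ i) + lam i w) * (v i w - fst w $ i)) - alp w"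
definition e2 where
  "e2 u v lam i w = dd (0, cvec \<omega>) (u i) w - lam i w - fy i (emb v u w)"
definition Mx :: "('n \<Rightarrow> 'n cv \<Rightarrow> complex) \<Rightarrow> 'n \<Rightarrow> 'n \<Rightarrow> 'n cv \<Rightarrow> complex" where
  "Mx u i j w = (if i = j then 1 else 0) + dd (ex j) (u i) w"

text \<open>Exactness of the one-form with coefficients v - p against dx on the torus, where x is
  the angle z + u and s is the primitive. Subtracting the parameter p removes the cohomology class,
  which is why the primitive can be periodic.\<close>

definition lagr where
  "lagr r u v \<longleftrightarrow> (\<exists>s. cls (3/2) r s \<and> (\<forall>w\<in>S (3/2) r. \<forall>j. dd (ex j) s w = (\<Sum>i\<in>UNIV. Mx u i j w * (v i w - fst w $ i))))"

text \<open>With this bound on the derivatives of u the inverse of \<open>Mx\<close> differs from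
  the identity by at most 1 / (8 n) in each entry, and twice the bound still admits a Neumann
  inverse. The doubled bound is what holds for the new torus inside a step.\<close>

definition c1 :: real where "c1 = 1 / (16 * n ^ 2)"

definition St where
  "St r e u v lam alp \<longleftrightarrow> (\<forall>i. cls (3/2) r (u i)) \<and> (\<forall>i. cls (3/2) r (v i)) \<and> (\<forall>i. cls (3/2) r (lam i)) \<and>
    (\<forall>i. zind (S (3/2) r) (lam i)) \<and> cls (3/2) r alp \<and> zind (S (3/2) r) alp \<and>
    (\<forall>i. bnd (3/2) r (r0 / 4) (u i)) \<and> (\<forall>i j. bnd (3/2) r c1 (dd (ex j) (u i))) \<and>
    (\<forall>i. bnd (3/2) r (1/10) (\<lambda>w. v i w - fst w $ i)) \<and>
    bnd (3/2) r e (e1 u v lam alp) \<and> (\<forall>i. bnd (3/2) r e (e2 u v lam i)) \<and> lagr r u v"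

lemma emb_in:
  assumes "\<And>i. cmod (u i w) \<le> r0 / 4" "\<And>i. cmod (v i w - fst w $ i) \<le> 2/10" "w \<in> S (3/2) r" "r \<le> r0 / 2"
  shows "emb v u w \<in> S (17/10) r0"
proof (rule S_I)
  fix i
  have "cmod (v i w) \<le> cmod (v i w - fst w $ i) + cmod (fst w $ i)" using norm_triangle_ineq[of "v i w - fst w $ i" "fst w $ i"] by simp
  thus "cmod (fst (emb v u w) $ i) < 17/10" using assms(2)[of i] S_D(1)[OF assms(3), of i] by simp
  show "\<bar>Im (snd (emb v u w) $ i)\<bar> < r0"
    using assms(1)[of i] abs_Im_le_cmod[of "u i w"] S_D(2)[OF assms(3), of i] assms(4) r0 by simp
qed

end

context kam
begin

lemma c1_bounds: "0 < c1" "c1 \<le> 1 / 16" "2 * n * c1 = 1 / (8 * n)" "4 * n * c1 \<le> 1"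
proof -
  have nn: "1 \<le> n * n" using mult_mono[OF n1 n1] n1 by simp
  show "0 < c1" "c1 \<le> 1 / 16" "2 * n * c1 = 1 / (8 * n)" "4 * n * c1 \<le> 1"
    using n1 nn by (auto simp: c1_def field_simps power2_eq_square)
qed

text \<open>The new torus is obtained from the old one by a shift \<open>T\<close> of the angles by \<open>wv\<close>, followed by the
  translation of the actions by a closed one-form with generating function \<open>q\<close>. Both solve
  cohomological equations. The correction \<open>dl\<close> of the counterterm is determined by the requirement
  that the right-hand side of the equation for \<open>wv\<close> has mean zero.\<close>

lemma step:
  assumes St: "St r e u v lam alp" and e: "0 < e"
    and L: "2 \<le> L" "n \<le> L" "1 / d \<le> L" "sd_loss \<gamma> b TYPE('n) d \<le> L"
    and d: "0 < d" "d \<le> r0 / 16" and r: "r \<le> r0 / 2" "r0 / 4 \<le> r - 5 * d" and small: "L ^ 60 * e \<le> 1"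
  shows "\<exists>u' v' lam' alp'. (\<forall>i. cls (3/2) (r - 5 * d) (u' i)) \<and> (\<forall>i. cls (3/2) (r - 5 * d) (v' i)) \<and>
    (\<forall>i. cls (3/2) (r - 5 * d) (lam' i)) \<and> (\<forall>i. zind (S (3/2) (r - 5 * d)) (lam' i)) \<and>
    cls (3/2) (r - 5 * d) alp' \<and> zind (S (3/2) (r - 5 * d)) alp' \<and>
    bnd (3/2) (r - 5 * d) (L ^ 50 * e\<^sup>2) (e1 u' v' lam' alp') \<and> (\<forall>i. bnd (3/2) (r - 5 * d) (L ^ 50 * e\<^sup>2) (e2 u' v' lam' i)) \<and>
    lagr (r - 5 * d) u' v' \<and>
    (\<forall>i. bnd (3/2) (r - 5 * d) (L ^ 30 * e) (\<lambda>w. u' i w - u i w)) \<and>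
    (\<forall>i j. bnd (3/2) (r - 5 * d) (L ^ 30 * e) (\<lambda>w. dd (ex j) (u' i) w - dd (ex j) (u i) w)) \<and>
    (\<forall>i. bnd (3/2) (r - 5 * d) (L ^ 30 * e) (\<lambda>w. v' i w - v i w)) \<and>
    (\<forall>i. bnd (3/2) (r - 5 * d) (L ^ 30 * e) (\<lambda>w. lam' i w - lam i w)) \<and>
    bnd (3/2) (r - 5 * d) (L ^ 30 * e) (\<lambda>w. alp' w - alp w)"
proof -
  interpret order_calculus L e "TYPE('n)"
    by unfold_locales (use L e n in auto)
  have d1: "d \<le> 1" using d r0 by simp
  have pw: "L ^ k * e \<le> 1" if "k \<le> 60" for k
  proof -
    have "L ^ k * e \<le> L ^ 60 * e" using L e that by (intro mult_right_mono power_increasing) auto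
    thus ?thesis using small by simp
  qed
  have pwd: "L ^ k * e \<le> d" if "k < 60" for k
  proof -
    have "L * (L ^ k * e) \<le> 1" using pw[of "Suc k"] that by (simp add: mult.assoc)
    moreover have "1 \<le> L * d" using L d by (simp add: field_simps)
    ultimately have "L * (L ^ k * e) \<le> L * d" by linarith
    thus ?thesis using L by simp
  qed
  \<comment> \<open>The five losses d are caused by solving for q, differentiating it, solving for
    the angle shift, composing with the shift, and differentiating the new u.\<close>
  define r1 r2 r3 r4 r5 where rs: "r1 = r - d" "r2 = r - 2 * d" "r3 = r - 3 * d" "r4 = r - 4 * d" "r5 = r - 5 * d"
  have r_le: "r1 \<le> r" "r2 \<le> r1" "r3 \<le> r2" "r4 \<le> r3" "r5 \<le> r4" "r2 \<le> r" "r3 \<le> r" "r4 \<le> r" "r5 \<le> r"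
    "r3 \<le> r1" "r4 \<le> r2" "r5 \<le> r3" "r5 \<le> r2" "r4 \<le> r1" "r5 \<le> r1" using d by (auto simp: rs)
  have sub: "S (3/2) x \<subseteq> (S (3/2) y :: 'n cv set)" if "x \<le> y" for x y by (rule S_mono) (use that in auto)
  have obI: "ob x k j g" if "bnd (3/2) x C g" "C \<le> L ^ k * e ^ j" for x k j C and g :: "'n cv \<Rightarrow> complex"
    using that unfolding ob_def bnd_def by (meson order_trans)
  have obc: "ob x k j g'" if "ob x k j g" "\<And>w. w \<in> S (3/2) x \<Longrightarrow> g' w = g w" for x k j and g g' :: "'n cv \<Rightarrow> complex"
    using that unfolding ob_def bnd_def by simp

  have cu: "cls (3/2) r (u i)" and cv: "cls (3/2) r (v i)" and cl: "cls (3/2) r (lam i)" and zl: "zind (S (3/2) r) (lam i)"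
    and ca: "cls (3/2) r alp" and za: "zind (S (3/2) r) alp" and bu: "bnd (3/2) r (r0 / 4) (u i)"
    and bdu: "bnd (3/2) r c1 (dd (ex j) (u i))" and bv: "bnd (3/2) r (1/10) (\<lambda>w. v i w - fst w $ i)"
    and be1: "bnd (3/2) r e (e1 u v lam alp)" and be2: "bnd (3/2) r e (e2 u v lam i)" for i j
    using St unfolding St_def by auto
  obtain s where s: "cls (3/2) r s" "\<And>w j. w \<in> S (3/2) r \<Longrightarrow> dd (ex j) s w = (\<Sum>i\<in>UNIV. Mx u i j w * (v i w - fst w $ i))"
    using St unfolding St_def lagr_def by blast
  have cdu: "cls (3/2) r (dd (ex j) (u i))" for i j by (rule cls_dd[OF cu]) simp
  have G_in: "emb v u w \<in> S (17/10) r0" if "w \<in> S (3/2) r" for w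
  proof (rule emb_in[where u=u and w=w, OF bndD[OF bu that] _ that r(1)])
    show "cmod (v i w - fst w $ i) \<le> 2/10" for i using bndD[OF bv that, of i] by simp
  qed
  have sub2: "S (17/10) r0 \<subseteq> (S 2 r0 :: 'n cv set)" "S (17/10) r0 \<subseteq> (S (18/10) r0 :: 'n cv set)" by (rule S_mono; simp)+
  have G_in2: "emb v u w \<in> S 2 r0" if "w \<in> S (3/2) r" for w using G_in[OF that] sub2 by blast
  have cfG: "cls (3/2) r (\<lambda>w. f (emb v u w))" by (rule cls_emb[OF f(1) cv cu G_in2])
  have cfyG: "cls (3/2) r (\<lambda>w. fy i (emb v u w))" for i by (rule cls_emb[OF fy(1) cv cu G_in2])
  have cF: "cls (3/2) r (\<lambda>w. fyy i l (emb v u w))" for i l by (rule cls_emb[OF fyy(1) cv cu G_in2])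
  have bF: "bnd (3/2) r (100 * \<eta>) (\<lambda>w. fyy i l (emb v u w))" for i l
    unfolding bnd_def using bndD[OF fyy(2)] G_in sub2(2) by blast
  have oF: "ob r 0 0 (\<lambda>w. fyy i l (emb v u w))" for i l by (rule obI[OF bF]) (use \<eta> in simp)
  have ce1: "cls (3/2) r (e1 u v lam alp)" unfolding e1_def[abs_def]
    by (intro cls_diff cls_add cls_sum cls_mult cls_const cfG cl cv cls_fst ca) simp
  have ce2: "cls (3/2) r (e2 u v lam i)" for i unfolding e2_def[abs_def]
    by (intro cls_diff cls_dd[OF cu] cl cfyG) simp
  have oe1: "ob r 0 1 (e1 u v lam alp)" and oe2: "ob r 0 1 (e2 u v lam i)" for i
    using be1 be2 by (simp_all add: ob_def)

  have "\<exists>N. minv (3/2) r (\<lambda>i j. dd (ex j) (u i)) N"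
    by (rule neumann[OF cdu bdu]) (use c1_bounds n n1 in \<open>auto simp: field_simps\<close>)
  then obtain N where N: "minv (3/2) r (\<lambda>i j. dd (ex j) (u i)) N" by blast
  note cN = minvD(1)[OF N] and bN = minvD(2)[OF N] and NM = minvD(3)[OF N, folded Mx_def] and MN = minvD(4)[OF N, folded Mx_def]
  have oN: "ob r 1 0 (N i j)" for i j by (rule obI[OF bN]) (use L in simp)

  have sd_ob: "ob x k j m \<and> ob (x - d) (Suc k) j q" if "sdsol y g m q" "ob x k j g" "x \<le> y" for x y k j g m q
  proof
    show "ob x k j m" using sdsolD(5)[OF that(1,3)] that(2) by (simp add: ob_def)
    have "bnd (3/2) (x - d) (sd_loss \<gamma> b TYPE('n) d * (L ^ k * e ^ j)) q"
      using sdsolD(6)[OF that(1) d(1) d1 that(3)] that(2) by (simp add: ob_def)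
    moreover have "sd_loss \<gamma> b TYPE('n) d * (L ^ k * e ^ j) \<le> L ^ Suc k * e ^ j"
      using L e by (simp add: mult.assoc mult_right_mono)
    ultimately show "ob (x - d) (Suc k) j q" by (rule obI)
  qed

  \<comment> \<open>\<open>q0\<close> answers the energy error; \<open>qi i\<close> answers a unit
    change of the counterterm in direction i, which changes the energy by v - p in that component.
    They are combined once \<open>dl\<close> is known.\<close>
  have "cls (3/2) r (\<lambda>w. - e1 u v lam alp w)" by (rule cls_minus[OF ce1])
  then obtain m0 q0 where q0: "sdsol r (\<lambda>w. - e1 u v lam alp w) m0 q0"
    using sdsol_ex[of r "\<lambda>w. - e1 u v lam alp w" e] be1 by (auto simp: bnd_def)
  have b_pv: "bnd (3/2) r (1/10) (\<lambda>w. fst w $ i - v i w)" for i using bv[of i] by (simp add: bnd_def norm_minus_commute)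
  have "\<forall>i. \<exists>m q. sdsol r (\<lambda>w. fst w $ i - v i w) m q"
    by (intro allI sdsol_ex[OF _ b_pv] cls_diff cls_fst cv)
  then obtain mi qi where qi: "\<And>i. sdsol r (\<lambda>w. fst w $ i - v i w) (mi i) (qi i)" by metis
  have om0: "ob r 0 1 m0" and oq0: "ob r1 1 1 q0" using sd_ob[OF q0 ob_minus[OF oe1]] by (auto simp: rs)
  have o_pv: "ob r 0 0 (\<lambda>w. fst w $ i - v i w)" for i by (rule obI[OF b_pv]) simp
  have omi: "ob r 0 0 (mi i)" and oqi: "ob r1 1 0 (qi i)" for i using sd_ob[OF qi o_pv] by (auto simp: rs)
  have hq0: "hol (S (3/2) x) q0" and hqi: "hol (S (3/2) x) (qi i)" if "x \<le> r" for x i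
    using hol_subset[OF cls_hol[OF sdsolD(2)[OF q0]] sub[OF that]] hol_subset[OF cls_hol[OF sdsolD(2)[OF qi]] sub[OF that]] .
  have odq0: "ob r2 2 1 (dd (ex h) q0)" for h
    by (rule ob_dd[OF oq0 hq0 d(1) L(3)]) (auto simp: rs d(1) less_imp_le)
  have odqi: "ob r2 2 0 (dd (ex h) (qi i))" for h i
    by (rule ob_dd[OF oqi hqi d(1) L(3)]) (auto simp: rs d(1) less_imp_le)
  \<comment> \<open>The action translations belonging to \<open>q0\<close> and \<open>qi\<close>,
    and their effects on the angle equation multiplied by the inverse Jacobian: \<open>F0\<close>
    comes from the errors, \<open>F1 i\<close> from a unit change of \<open>lam i\<close>.
    \<open>F2\<close> removes the identity from \<open>F1\<close>, so that its mean is a small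
    matrix.\<close>
  define nu0 where "nu0 l w = (\<Sum>h\<in>UNIV. N h l w * dd (ex h) q0 w)" for l w
  define nu1 where "nu1 i l w = (\<Sum>h\<in>UNIV. N h l w * dd (ex h) (qi i) w)" for i l w
  define F0 where "F0 j w = (\<Sum>k\<in>UNIV. N j k w * ((\<Sum>l\<in>UNIV. fyy k l (emb v u w) * nu0 l w) - e2 u v lam k w))" for j w
  define F1 where "F1 i j w = N j i w + (\<Sum>k\<in>UNIV. N j k w * (\<Sum>l\<in>UNIV. fyy k l (emb v u w) * nu1 i l w))" for i j w
  define F2 where "F2 i j w = F1 i j w - (if i = j then 1 else 0)" for i j w
  have oN2: "ob r2 1 0 (N i j)" for i j using ob_mono[OF oN] r_le by blast
  have oF2: "ob r2 0 0 (\<lambda>w. fyy i l (emb v u w))" for i l using ob_mono[OF oF] r_le by blast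
  have onu0: "ob r2 4 1 (nu0 l)" for l unfolding nu0_def[abs_def] by (rule ob_dot[OF oN2 odq0]) auto
  have onu1: "ob r2 4 0 (nu1 i l)" for i l unfolding nu1_def[abs_def] by (rule ob_dot[OF oN2 odqi]) auto
  have oe22: "ob r2 0 1 (e2 u v lam i)" for i using ob_mono[OF oe2] r_le by blast
  have oF0: "ob r2 8 1 (F0 j)" for j
  proof -
    have "ob r2 5 1 (\<lambda>w. \<Sum>l\<in>UNIV. fyy k l (emb v u w) * nu0 l w)" for k by (rule ob_dot[OF oF2 onu0]) auto
    hence "ob r2 6 1 (\<lambda>w. (\<Sum>l\<in>UNIV. fyy k l (emb v u w) * nu0 l w) - e2 u v lam k w)" for k by (rule ob_diff[OF _ oe22]) auto
    thus ?thesis unfolding F0_def[abs_def] by (rule ob_dot[OF oN2]) auto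
  qed
  have oF1: "ob r2 8 0 (F1 i j)" for i j
  proof -
    have "ob r2 5 0 (\<lambda>w. \<Sum>l\<in>UNIV. fyy k l (emb v u w) * nu1 i l w)" for k by (rule ob_dot[OF oF2 onu1]) auto
    hence "ob r2 7 0 (\<lambda>w. \<Sum>k\<in>UNIV. N j k w * (\<Sum>l\<in>UNIV. fyy k l (emb v u w) * nu1 i l w))" by (rule ob_dot[OF oN2]) auto
    thus ?thesis unfolding F1_def[abs_def] by (rule ob_add[OF oN2]) auto
  qed
  have oF2': "ob r2 9 0 (F2 i j)" for i j
    unfolding F2_def[abs_def] by (rule ob_diff[OF oF1 obI[of _ 1 _ 0]]) (auto simp: bnd_def)
  have cls2: "cls (3/2) r2 g" if "cls (3/2) r g" for g using cls_subset[OF that r_le(6) order_refl] .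
  have cdq: "cls (3/2) r (dd (ex h) q0)" "cls (3/2) r (dd (ex h) (qi i))" for h i
    by (intro cls_dd sdsolD(2)[OF q0] sdsolD(2)[OF qi]; simp)+
  have cnu: "cls (3/2) r (nu0 l)" "cls (3/2) r (nu1 i l)" for l i
    unfolding nu0_def[abs_def] nu1_def[abs_def] by (intro cls_sum cls_mult cN cdq)+
  have cF0: "cls (3/2) r2 (F0 j)" for j unfolding F0_def[abs_def]
    by (intro cls2 cls_sum cls_mult cls_diff cN cF cnu ce2)
  have cF1: "cls (3/2) r2 (F1 i j)" for i j unfolding F1_def[abs_def]
    by (intro cls2 cls_add cls_sum cls_mult cls_diff cN cF cnu)
  have cF2: "cls (3/2) r2 (F2 i j)" for i j unfolding F2_def[abs_def]
    by (intro cls_diff cF1 cls_const) simp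
  have "\<forall>j. \<exists>m q. sdsol r2 (F0 j) m q" using sdsol_ex[OF cF0] oF0 unfolding ob_def by blast
  then obtain mu0 w0 where w0: "\<And>j. sdsol r2 (F0 j) (mu0 j) (w0 j)" by metis
  have "\<forall>i j. \<exists>m q. sdsol r2 (F2 i j) m q" using sdsol_ex[OF cF2] oF2' unfolding ob_def by blast
  then obtain mu1 w1 where w1: "\<And>i j. sdsol r2 (F2 i j) (mu1 i j) (w1 i j)" by metis
  have omu0: "ob r2 8 1 (mu0 j)" and ow0: "ob r3 9 1 (w0 j)" for j using sd_ob[OF w0 oF0] by (auto simp: rs)
  have ow1: "ob r3 10 0 (w1 i j)" for i j using sd_ob[OF w1 oF2'] by (auto simp: rs)

  \<comment> \<open>The mean is independent of the angles, so a bound on any nonempty strip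
    suffices. Giving up the fixed width r0 / 8, instead of the shrinking d, makes the bound on
    \<open>mu1\<close> the same in every step of the iteration.\<close>
  define r8 where "r8 = r - r0 / 8"
  have r8: "0 < r8" "r8 \<le> r2" "r8 \<le> r" using r d r0 by (auto simp: r8_def rs)
  have bF2: "bnd (3/2) r8 (1 / (2 * n)) (F2 i j)" for i j
    unfolding bnd_def
  proof
    fix w :: "'n cv" assume w8: "w \<in> S (3/2) r8"
    have w: "w \<in> S (3/2) r" using w8 sub r8 by blast
    define Kq where "Kq = sd_loss \<gamma> b TYPE('n) (r0 / 16) * (1 / 10) / (r0 / 16)"
    have Kq: "cmod (dd (ex h) (qi i) w) \<le> Kq" for h
    proof -
      have "bnd (3/2) (r - r0 / 16) (sd_loss \<gamma> b TYPE('n) (r0 / 16) * (1 / 10)) (qi i)"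
        by (rule sdsolD(6)[OF qi _ _ order_refl b_pv]) (use r0 in auto)
      hence "bnd (3/2) (r - r0 / 16 - r0 / 16) Kq (dd (ex h) (qi i))" unfolding Kq_def
        by (intro bnd_cauchy hqi) (use r0 in auto)
      moreover have "r - r0 / 16 - r0 / 16 = r8" by (simp add: r8_def)
      ultimately show ?thesis using bndD[OF _ w8] by simp
    qed
    have Nw: "cmod (N i j w) \<le> 2" for i j using bndD[OF bN w] .
    have sum_le: "cmod (\<Sum>k\<in>UNIV. g k) \<le> n * C" if "\<And>k. cmod (g k) \<le> C" for g :: "'n \<Rightarrow> complex" and C
      unfolding n using sum_norm_le[of UNIV g "\<lambda>_. C"] that by simp
    have nu: "cmod (nu1 i l w) \<le> n * (2 * Kq)" for l unfolding nu1_def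
      by (rule sum_le) (auto simp: norm_mult intro!: mult_mono Nw Kq)
    have "cmod (\<Sum>l\<in>UNIV. fyy k l (emb v u w) * nu1 i l w) \<le> n * (100 * \<eta> * (n * (2 * Kq)))" for k
      by (rule sum_le, unfold norm_mult, rule mult_mono[OF bndD[OF bF w] nu]) (use \<eta> in auto)
    hence "cmod (\<Sum>k\<in>UNIV. N j k w * (\<Sum>l\<in>UNIV. fyy k l (emb v u w) * nu1 i l w)) \<le> n * (2 * (n * (100 * \<eta> * (n * (2 * Kq)))))"
      by (intro sum_le, unfold norm_mult, intro mult_mono[OF Nw]) auto
    also have "\<dots> = 4 * n ^ 3 * (100 * \<eta>) * Kq" by (simp add: power3_eq_cube)
    also have "\<dots> \<le> 1 / (4 * n)" using \<eta>_small by (simp add: Kq_def)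
    finally have A: "cmod (\<Sum>k\<in>UNIV. N j k w * (\<Sum>l\<in>UNIV. fyy k l (emb v u w) * nu1 i l w)) \<le> 1 / (4 * n)" .
    have "(\<Sum>k\<in>UNIV. N j k w * Mx u k i w) = N j i w + (\<Sum>k\<in>UNIV. N j k w * dd (ex i) (u k) w)"
      by (simp add: Mx_def distrib_left sum.distrib sum_delta_mult)
    hence "N j i w - (if i = j then 1 else 0) = - (\<Sum>k\<in>UNIV. N j k w * dd (ex i) (u k) w)" using NM[OF w, of j i] by (auto simp: algebra_simps)
    moreover have "cmod (\<Sum>k\<in>UNIV. N j k w * dd (ex i) (u k) w) \<le> n * (2 * c1)"
      by (rule sum_le) (auto simp: norm_mult intro!: mult_mono Nw bndD[OF bdu w])
    ultimately have B: "cmod (N j i w - (if i = j then 1 else 0)) \<le> 1 / (4 * n)"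
      using c1_bounds(3) n1 by (simp add: mult.commute mult.left_commute) (simp add: field_simps)
    have "F2 i j w = (N j i w - (if i = j then 1 else 0)) + (\<Sum>k\<in>UNIV. N j k w * (\<Sum>l\<in>UNIV. fyy k l (emb v u w) * nu1 i l w))"
      by (simp add: F2_def F1_def)
    hence "cmod (F2 i j w) \<le> 1 / (4 * n) + 1 / (4 * n)" using norm_triangle_mono[OF B A] by simp
    thus "cmod (F2 i j w) \<le> 1 / (2 * n)" by simp
  qed
  have bmu1: "bnd (3/2) r2 (1 / (2 * n)) (mu1 i j)" for i j
    unfolding bnd_def
  proof
    fix w :: "'n cv" assume w: "w \<in> S (3/2) r2"
    let ?w = "(fst w, 0) :: 'n cv"
    have w8: "?w \<in> S (3/2) r8" by (rule S_I) (use S_D(1)[OF w] r8 in auto)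
    have "?w \<in> S (3/2) r2" using w8 sub[OF r8(2)] by blast
    hence "mu1 i j w = mu1 i j ?w" by (intro zindD[OF sdsolD(3)[OF w1] w]) auto
    thus "cmod (mu1 i j w) \<le> 1 / (2 * n)" using bndD[OF sdsolD(5)[OF w1 r8(2) bF2] w8] by simp
  qed
  have "\<exists>B. minv (3/2) r2 (\<lambda>i j. mu1 j i) B"
    by (rule neumann[OF sdsolD(1)[OF w1] bmu1]) (use n n1 in auto)
  then obtain B where B: "minv (3/2) r2 (\<lambda>i j. mu1 j i) B" by blast
  note cB = minvD(1)[OF B] and AB = minvD(4)[OF B] and Bdep = minvD(5)[OF B]
  have oB: "ob r2 1 0 (B i j)" for i j by (rule obI[OF minvD(2)[OF B]]) (use L in simp)
  \<comment> \<open>The mean of the right-hand side for the angle shift is \<open>mu0\<close> plus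
    \<open>dl\<close> plus the transpose of \<open>mu1\<close> applied to \<open>dl\<close>.
    Inverting identity plus transposed \<open>mu1\<close> makes it zero.\<close>
  define dl where "dl i w = - (\<Sum>j\<in>UNIV. B i j w * mu0 j w)" for i w
  have odl: "ob r2 10 1 (dl i)" for i unfolding dl_def[abs_def]
    by (rule ob_minus[OF ob_dot[OF oB omu0]]) auto
  have cdl: "cls (3/2) r2 (dl i)" for i unfolding dl_def[abs_def] by (intro cls_minus cls_sum cls_mult cB sdsolD(1)[OF w0])
  have zdl: "zind (S (3/2) r2) (dl i)" for i
  proof (rule zindI)
    fix w w' :: "'n cv" assume w: "w \<in> S (3/2) r2" "w' \<in> S (3/2) r2" "fst w = fst w'"
    have "mu1 j i w = mu1 j i w'" for i j by (rule zindD[OF sdsolD(3)[OF w1] w])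
    hence "B i j w = B i j w'" for i j by (rule Bdep)
    moreover have "mu0 j w = mu0 j w'" for j by (rule zindD[OF sdsolD(3)[OF w0] w])
    ultimately show "dl i w = dl i w'" by (simp add: dl_def)
  qed
  have dl_eq: "mu0 j w + (\<Sum>i\<in>UNIV. dl i w * mu1 i j w) = - dl j w" if w: "w \<in> S (3/2) r2" for j w
  proof -
    have "(\<Sum>i\<in>UNIV. ((if j = i then 1 else 0) + mu1 i j w) * (\<Sum>h\<in>UNIV. B i h w * - mu0 h w)) = - mu0 j w"
      by (rule inverse_apply[OF AB[OF w]])
    moreover have "(\<Sum>h\<in>UNIV. B i h w * - mu0 h w) = dl i w" for i by (simp add: dl_def sum_negf)
    ultimately have "(\<Sum>i\<in>UNIV. ((if j = i then 1 else 0) + mu1 i j w) * dl i w) = - mu0 j w" by simp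
    hence "dl j w + (\<Sum>i\<in>UNIV. mu1 i j w * dl i w) = - mu0 j w" by (simp add: distrib_right sum.distrib sum_delta_mult)
    moreover have "(\<Sum>i\<in>UNIV. mu1 i j w * dl i w) = (\<Sum>i\<in>UNIV. dl i w * mu1 i j w)" by (simp add: mult.commute)
    ultimately show ?thesis by (simp add: eq_neg_iff_add_eq_0 add_ac)
  qed

  \<comment> \<open>As \<open>dl\<close> does not depend on the angles, it behaves like a constant
    under every derivative taken here.\<close>
  have dd_comb: "dd h (\<lambda>w. g w + (\<Sum>i\<in>UNIV. dl i w * k i w)) w = dd h g w + (\<Sum>i\<in>UNIV. dl i w * dd h (k i) w)"
    if g: "hol (S (3/2) r2) g" and k: "\<And>i. hol (S (3/2) r2) (k i)" and w: "w \<in> S (3/2) r2" and h: "fst h = 0" for g k h w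
  proof -
    have hd: "hol (S (3/2) r2) (\<lambda>w. dl i w * k i w)" for i by (rule hol_mult(1)[OF cls_hol[OF cdl] k])
    have 1: "dd h (\<lambda>w. dl i w * k i w) w = dl i w * dd h (k i) w" for i
      using hol_mult(2)[OF cls_hol[OF cdl] k w, of h] zind_dd[OF zdl w h] by simp
    have "dd h (\<lambda>w. g w + (\<Sum>i\<in>UNIV. dl i w * k i w)) w = dd h g w + dd h (\<lambda>w. \<Sum>i\<in>UNIV. dl i w * k i w) w"
      by (rule hol_add(2)[OF g hol_sum(1)[OF hd] w])
    also have "dd h (\<lambda>w. \<Sum>i\<in>UNIV. dl i w * k i w) w = (\<Sum>i\<in>UNIV. dd h (\<lambda>w. dl i w * k i w) w)"
      by (rule hol_sum(2)[OF hd w])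
    finally show ?thesis by (simp only: 1)
  qed
  define q where "q w = q0 w + (\<Sum>i\<in>UNIV. dl i w * qi i w)" for w
  define wv where "wv j w = w0 j w + (\<Sum>i\<in>UNIV. dl i w * w1 i j w)" for j w
  define Dw where "Dw j w = F0 j w + (\<Sum>i\<in>UNIV. dl i w * F1 i j w)" for j w
  have cq: "cls (3/2) r2 q" unfolding q_def[abs_def]
    by (intro cls_add cls_sum cls_mult cdl cls2 sdsolD(2)[OF q0] sdsolD(2)[OF qi])
  have cwv: "cls (3/2) r2 (wv j)" for j unfolding wv_def[abs_def]
    by (intro cls_add cls_sum cls_mult cdl sdsolD(2)[OF w0] sdsolD(2)[OF w1])
  have dq: "dd h q w = dd h q0 w + (\<Sum>i\<in>UNIV. dl i w * dd h (qi i) w)" if "w \<in> S (3/2) r2" "fst h = 0" for w h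
    unfolding q_def[abs_def] by (rule dd_comb[OF hq0[OF r_le(6)] hqi[OF r_le(6)] that])
  have oq: "ob r2 13 1 q" unfolding q_def[abs_def]
  proof (rule ob_add)
    show "ob r2 1 1 q0" using ob_mono[OF oq0] r_le by blast
    have "ob r2 1 0 (qi i)" for i using ob_mono[OF oqi] r_le by blast
    thus "ob r2 12 1 (\<lambda>w. \<Sum>i\<in>UNIV. dl i w * qi i w)" by (rule ob_dot[OF odl]) auto
  qed auto
  have odq: "ob r3 14 1 (dd (ex h) q)" for h
    by (rule ob_dd[OF oq cls_hol[OF cq] d(1) L(3)]) (auto simp: rs)
  have owv: "ob r3 22 1 (wv j)" for j unfolding wv_def[abs_def]
  proof (rule ob_add)
    have "ob r3 10 1 (dl i)" for i using ob_mono[OF odl] r_le by blast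
    thus "ob r3 21 1 (\<lambda>w. \<Sum>i\<in>UNIV. dl i w * w1 i j w)" by (rule ob_dot[OF _ ow1]) auto
  qed (use ow0 in auto)
  have oDw: "ob r2 20 1 (Dw j)" for j unfolding Dw_def[abs_def]
    by (rule ob_add[OF oF0 ob_dot[OF odl oF1, of 19]]) auto
  have Dw: "dd (0, cvec \<omega>) (wv j) w = Dw j w" if w: "w \<in> S (3/2) r2" for j w
  proof -
    have comb: "dd (0, cvec \<omega>) (\<lambda>w. w0 j w + (\<Sum>i\<in>UNIV. dl i w * w1 i j w)) w =
      dd (0, cvec \<omega>) (w0 j) w + (\<Sum>i\<in>UNIV. dl i w * dd (0, cvec \<omega>) (w1 i j) w)"
      by (rule dd_comb[OF cls_hol[OF sdsolD(2)[OF w0]] cls_hol[OF sdsolD(2)[OF w1]] w]) simp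
    have "dd (0, cvec \<omega>) (wv j) w = (F0 j w - mu0 j w) + (\<Sum>i\<in>UNIV. dl i w * (F2 i j w - mu1 i j w))"
      unfolding wv_def[abs_def] comb by (simp add: sdsolD(4)[OF w0 w] sdsolD(4)[OF w1 w])
    also have "\<dots> = F0 j w + (\<Sum>i\<in>UNIV. dl i w * F2 i j w) - (mu0 j w + (\<Sum>i\<in>UNIV. dl i w * mu1 i j w))"
      by (simp add: right_diff_distrib sum_subtractf)
    also have "\<dots> = F0 j w + (\<Sum>i\<in>UNIV. dl i w * F2 i j w) + dl j w" unfolding dl_eq[OF w] by simp
    also have "\<dots> = Dw j w" by (simp add: Dw_def F2_def right_diff_distrib sum_subtractf sum_delta_mult)
    finally show ?thesis .
  qed
  \<comment> \<open>The linear equations have been solved with the inverse \<open>N\<close> of the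
    old Jacobian, so \<open>nu2\<close> is the translation that they see. The translation actually
    made, \<open>nu\<close> below, uses the new inverse; the difference is of second order.\<close>
  define nu2 where "nu2 l w = (\<Sum>h\<in>UNIV. N h l w * dd (ex h) q w)" for l w
  have response: "(\<Sum>j\<in>UNIV. Mx u i j w * Dw j w) = dl i w + (\<Sum>l\<in>UNIV. fyy i l (emb v u w) * nu2 l w) - e2 u v lam i w"
    if w: "w \<in> S (3/2) r2" for i w
  proof -
    have wr: "w \<in> S (3/2) r" using w sub r_le by blast
    have nu2: "nu0 l w + (\<Sum>i\<in>UNIV. dl i w * nu1 i l w) = nu2 l w" for l
    proof -
      have "(\<Sum>i\<in>UNIV. dl i w * nu1 i l w) = (\<Sum>h\<in>UNIV. \<Sum>i\<in>UNIV. N h l w * (dl i w * dd (ex h) (qi i) w))"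
        unfolding nu1_def sum_distrib_left by (subst sum.swap) (simp add: mult.left_commute)
      thus ?thesis unfolding nu0_def nu2_def by (simp add: dq[OF w] distrib_left sum.distrib sum_distrib_left)
    qed
    have "Dw k w = (\<Sum>j\<in>UNIV. N k j w * (dl j w + (\<Sum>l\<in>UNIV. fyy j l (emb v u w) * nu2 l w) - e2 u v lam j w))" for k
      unfolding Dw_def F0_def F1_def nu2[symmetric] by (rule linear_response)
    thus ?thesis using inverse_apply[of "\<lambda>i k. Mx u i k w" "\<lambda>k j. N k j w", OF MN[OF wr]] by simp
  qed

  define T where "T w = w + (0, \<chi> i. wv i w)" for w
  have T_emb: "T w = emb (\<lambda>i w. fst w $ i) wv w" for w by (rule cv_eqI) (auto simp: T_def)
  have fstT [simp]: "fst (T w) = fst w" for w by (simp add: T_def)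
  have T_in: "T w \<in> S (3/2) r3" if w: "w \<in> S (3/2) r4" for w
  proof (rule S_I)
    show "cmod (fst (T w) $ i) < 3/2" for i using S_D(1)[OF w] by simp
    have "cmod (wv i w) \<le> d" for i using owv[of i] w sub[of r4 r3] r_le pwd[of 22] unfolding ob_def bnd_def by force
    thus "\<bar>Im (snd (T w) $ i)\<bar> < r3" for i
      using S_D(2)[OF w, of i] abs_Im_le_cmod[of "wv i w"] order_trans by (fastforce simp: T_def rs)
  qed
  have cwv4: "cls (3/2) r4 (wv j)" for j using cls_subset[OF cwv r_le(11) order_refl] .
  have cT: "cls (3/2) r4 (\<lambda>w. g (T w))" if "cls (3/2) r g" for g
    unfolding T_emb by (rule cls_emb[OF cls_subset[OF that r_le(7) order_refl] cls_fst cwv4]) (use T_in T_emb in metis)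
  have dT: "dd h (\<lambda>w. g (T w)) w = (\<Sum>k\<in>UNIV. (snd h $ k + dd h (wv k) w) * dd (ex k) g (T w))"
    if g: "cls (3/2) r g" and w: "w \<in> S (3/2) r4" and h: "fst h = 0" for g h w
  proof -
    have "dd h (\<lambda>w. g (emb (\<lambda>i w. fst w $ i) wv w)) w = (\<Sum>i\<in>UNIV. dd h (\<lambda>w. fst w $ i) w * dd (ey i) g (emb (\<lambda>i w. fst w $ i) wv w)) +
      (\<Sum>i\<in>UNIV. (snd h $ i + dd h (wv i) w) * dd (ex i) g (emb (\<lambda>i w. fst w $ i) wv w))"
      by (rule hol_emb(2)[OF cls_hol[OF cls_subset[OF g r_le(7) order_refl]] hol_fst(1) cls_hol[OF cwv4] _ w]) (use T_in T_emb in metis)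
    thus ?thesis unfolding T_emb by (simp add: hol_fst(2) h)
  qed
  have dTj: "dd (ex j) (\<lambda>w. g (T w)) w = (\<Sum>k\<in>UNIV. Mx wv k j w * dd (ex k) g (T w))"
    if g: "cls (3/2) r g" and w: "w \<in> S (3/2) r4" for g j w
    unfolding dT[OF g w, of "ex j", simplified] Mx_def by (rule sum.cong) (auto simp: axis_def)
  have T_r: "T w \<in> S (3/2) r" if "w \<in> S (3/2) r4" for w using T_in[OF that] sub r_le by blast
  have oT: "ob r4 k j (\<lambda>w. g (T w))" if "ob r k j g" for k j g using that T_r unfolding ob_def bnd_def by blast
  have shift: "ob r4 (k + 24) (Suc j) (\<lambda>w. g (T w) - g w)" if g: "cls (3/2) r g" "ob r k j g" for k j g
  proof -
    have "ob (r3 - d) (k + 24) (Suc j) (\<lambda>w. g (w + (0, \<chi> i. wv i w)) - g w)"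
    proof (rule ob_shift[OF ob_mono[OF g(2) order_refl r_le(7)] _ d(1) L(3)])
      show "hol (S (3/2) r3) g" using hol_subset[OF cls_hol[OF g(1)] sub[OF r_le(7)]] .
      show "ob (r3 - d) 22 1 (wv i)" for i by (rule ob_mono[OF owv]) (use d in auto)
      have "2 * (L ^ 22 * e) \<le> L * (L ^ 22 * e)" using L e by (intro mult_right_mono) auto
      also have "\<dots> = L ^ 23 * e" by (simp add: eval_nat_numeral)
      also have "\<dots> \<le> d" by (rule pwd) simp
      finally show "2 * (L ^ 22 * e) \<le> d" .
    qed (use e in auto)
    thus ?thesis by (simp add: T_def rs)
  qed

  \<comment> \<open>Composition with \<open>T\<close> merely reparametrises the old torus, as
    \<open>emb1\<close> records; the torus itself is moved only by the later translation
    \<open>nu\<close>.\<close>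
  define u' where "u' i w = wv i w + u i (T w)" for i w
  define v1 where "v1 i w = v i (T w)" for i w
  have cu': "cls (3/2) r4 (u' i)" for i unfolding u'_def[abs_def] by (intro cls_add cwv4 cT cu)
  have cv1: "cls (3/2) r4 (v1 i)" for i unfolding v1_def[abs_def] by (intro cT cv)
  have emb1: "emb v1 u' w = emb v u (T w)" for w
    by (rule cv_eqI) (auto simp: v1_def u'_def, simp add: T_def)
  have du': "dd h (u' i) w = dd h (wv i) w + (\<Sum>k\<in>UNIV. (snd h $ k + dd h (wv k) w) * dd (ex k) (u i) (T w))"
    if "w \<in> S (3/2) r4" "fst h = 0" for h i w
    unfolding u'_def[abs_def] using hol_add(2)[OF cls_hol[OF cwv4] cls_hol[OF cT[OF cu]] that(1)] dT[OF cu that] by simp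
  have Mu': "Mx u' i j w = (\<Sum>k\<in>UNIV. Mx u i k (T w) * Mx wv k j w)" if w: "w \<in> S (3/2) r4" for i j w
  proof -
    have "(\<Sum>k\<in>UNIV. Mx u i k (T w) * Mx wv k j w) = Mx wv i j w + (\<Sum>k\<in>UNIV. dd (ex k) (u i) (T w) * Mx wv k j w)"
      unfolding Mx_def[of u] by (simp add: distrib_right sum.distrib sum_delta_mult)
    moreover have "(\<Sum>k\<in>UNIV. (snd (ex j) $ k + dd (ex j) (wv k) w) * dd (ex k) (u i) (T w)) = (\<Sum>k\<in>UNIV. dd (ex k) (u i) (T w) * Mx wv k j w)"
      by (rule sum.cong) (auto simp: Mx_def axis_def)
    ultimately show ?thesis using du'[OF w, of "ex j" i] by (simp add: Mx_def[of u'] Mx_def[of wv i])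
  qed
  have ou: "ob r 0 0 (u i)" for i by (rule obI[OF bu]) (use r0 in simp)
  have odu: "ob r 0 0 (dd (ex j) (u i))" for i j by (rule obI[OF bdu]) (use c1_bounds in simp)
  have ouu: "ob r4 25 1 (\<lambda>w. u' i w - u i w)" for i
  proof -
    have "ob r4 24 1 (\<lambda>w. u i (T w) - u i w)" using shift[OF cu ou] by simp
    hence "ob r4 25 1 (\<lambda>w. wv i w + (u i (T w) - u i w))" by (rule ob_add[OF ob_mono[OF owv order_refl r_le(4)]]) auto
    thus ?thesis by (simp add: u'_def add_diff_eq)
  qed
  have cu4: "cls (3/2) r4 (u i)" for i using cls_subset[OF cu r_le(8) order_refl] .
  have sub4: "S (3/2) r5 \<subseteq> (S (3/2) r4 :: 'n cv set)" using sub r_le by blast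
  have oduu: "ob r5 26 1 (\<lambda>w. dd (ex j) (u' i) w - dd (ex j) (u i) w)" for i j
  proof -
    have "ob r5 26 1 (dd (ex j) (\<lambda>w. u' i w - u i w))"
      by (rule ob_dd[OF ouu cls_hol[OF cls_diff[OF cu' cu4]] d(1) L(3)]) (auto simp: rs)
    thus ?thesis by (rule obc) (rule hol_diff(2)[OF cls_hol[OF cu'] cls_hol[OF cu4] subsetD[OF sub4], symmetric])
  qed
  have bdu': "bnd (3/2) r5 (2 * c1) (dd (ex j) (u' i))" for i j
    unfolding bnd_def
  proof
    fix w :: "'n cv" assume w: "w \<in> S (3/2) r5"
    have n2: "n\<^sup>2 \<le> L\<^sup>2" using L n1 by (intro power_mono) auto
    have L4: "16 \<le> L ^ 4" using power_mono[of 2 L 4] L by simp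
    have "L ^ 26 * e * (16 * n\<^sup>2) \<le> L ^ 26 * e * (L ^ 4 * L\<^sup>2)" using L4 n2 e L by (intro mult_left_mono mult_mono) auto
    also have "\<dots> = L ^ 32 * e" by (simp add: power_add[symmetric] mult_ac)
    also have "\<dots> \<le> 1" by (rule pw) simp
    finally have "L ^ 26 * e \<le> c1" using n1 by (simp add: c1_def field_simps)
    moreover have "cmod (dd (ex j) (u' i) w - dd (ex j) (u i) w) \<le> L ^ 26 * e" using oduu w by (simp add: ob_def bnd_def)
    moreover have "cmod (dd (ex j) (u i) w) \<le> c1" using bndD[OF bdu] w sub r_le by blast
    ultimately show "cmod (dd (ex j) (u' i) w) \<le> 2 * c1"
      using norm_triangle_ineq[of "dd (ex j) (u' i) w - dd (ex j) (u i) w" "dd (ex j) (u i) w"] by simp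
  qed
  have cu5: "cls (3/2) r5 (u' i)" for i using cls_subset[OF cu' r_le(5) order_refl] .
  have cdu': "cls (3/2) r5 (dd (ex j) (u' i))" for i j by (rule cls_dd[OF cu5]) simp
  have "\<exists>N. minv (3/2) r5 (\<lambda>i j. dd (ex j) (u' i)) N"
    by (rule neumann[OF cdu' bdu']) (use c1_bounds(4) n in simp)
  then obtain N' where N': "minv (3/2) r5 (\<lambda>i j. dd (ex j) (u' i)) N'" by blast
  note cN' = minvD(1)[OF N'] and bN' = minvD(2)[OF N'] and NM' = minvD(3)[OF N', folded Mx_def]
  have oN': "ob r5 1 0 (N' i j)" for i j by (rule obI[OF bN']) (use L in simp)
  have oN5: "ob r5 1 0 (N i j)" for i j using ob_mono[OF oN] r_le by blast
  have oNN: "ob r5 30 1 (\<lambda>w. N' i j w - N i j w)" for i j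
  proof -
    have "ob r5 28 1 (\<lambda>w. \<Sum>l\<in>UNIV. (dd (ex l) (u' k) w - dd (ex l) (u k) w) * N l j w)" for k by (rule ob_dot[OF oduu oN5]) auto
    hence "ob r5 30 1 (\<lambda>w. - (\<Sum>k\<in>UNIV. N' i k w * (\<Sum>l\<in>UNIV. (dd (ex l) (u' k) w - dd (ex l) (u k) w) * N l j w)))"
      by (intro ob_minus ob_dot[OF oN']) auto
    thus ?thesis
    proof (rule obc)
      fix w :: "'n cv" assume w: "w \<in> S (3/2) r5"
      hence wr: "w \<in> S (3/2) r" using sub r_le by blast
      have "N' i j w - N i j w = - (\<Sum>k\<in>UNIV. N' i k w * (\<Sum>l\<in>UNIV. (Mx u' k l w - Mx u k l w) * N l j w))"
        by (rule inverse_diff[OF MN[OF wr] NM'[OF w]])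
      thus "N' i j w - N i j w = - (\<Sum>k\<in>UNIV. N' i k w * (\<Sum>l\<in>UNIV. (dd (ex l) (u' k) w - dd (ex l) (u k) w) * N l j w))"
        by (simp add: Mx_def)
    qed
  qed
  \<comment> \<open>With the inverse of the new Jacobian, the form with coefficients
    \<open>nu\<close> against the new angles is exactly dq, so the Lagrangian condition survives
    without any error.\<close>
  define nu where "nu l w = (\<Sum>h\<in>UNIV. N' h l w * dd (ex h) q w)" for l w
  have odq5: "ob r5 14 1 (dd (ex h) q)" for h using ob_mono[OF odq] r_le by blast
  have onu: "ob r5 16 1 (nu l)" for l unfolding nu_def[abs_def] by (rule ob_dot[OF oN' odq5]) auto
  have cq5: "cls (3/2) r5 q" using cls_subset[OF cq r_le(13) order_refl] .
  have cnu': "cls (3/2) r5 (nu l)" for l unfolding nu_def[abs_def] by (intro cls_sum cls_mult cN' cls_dd[OF cq5]) simp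
  define v' where "v' i w = v1 i w + nu i w" for i w
  have cv1': "cls (3/2) r5 (v1 i)" for i using cls_subset[OF cv1 r_le(5) order_refl] .
  have cv': "cls (3/2) r5 (v' i)" for i unfolding v'_def[abs_def] by (intro cls_add cv1' cnu')
  have o_vp: "ob r 0 0 (\<lambda>w. v i w - fst w $ i)" for i by (rule obI[OF bv]) simp
  have ovv: "ob r5 25 1 (\<lambda>w. v' i w - v i w)" for i
  proof -
    have "ob r4 24 1 (\<lambda>w. (v i (T w) - fst (T w) $ i) - (v i w - fst w $ i))"
      using shift[OF cls_diff[OF cv cls_fst] o_vp] by simp
    hence "ob r4 24 1 (\<lambda>w. v1 i w - v i w)" by (simp add: v1_def)
    hence "ob r5 24 1 (\<lambda>w. v1 i w - v i w)" using ob_mono r_le(5) by blast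
    hence "ob r5 25 1 (\<lambda>w. (v1 i w - v i w) + nu i w)" by (rule ob_add[OF _ onu]) auto
    thus ?thesis by (simp add: v'_def algebra_simps)
  qed
  \<comment> \<open>The energy constant absorbs the means left over by the equations for
    \<open>q0\<close> and \<open>qi\<close>.\<close>
  define da where "da w = - (m0 w + (\<Sum>i\<in>UNIV. dl i w * mi i w))" for w
  define lam' where "lam' i w = lam i w + dl i w" for i w
  define alp' where "alp' w = alp w + da w" for w
  have cda: "cls (3/2) r2 da" unfolding da_def[abs_def]
    by (intro cls_minus cls_add cls_sum cls_mult cdl cls2 sdsolD(1)[OF q0] sdsolD(1)[OF qi])
  have oda: "ob r2 12 1 da" unfolding da_def[abs_def]
  proof (rule ob_minus, rule ob_add)
    show "ob r2 0 1 m0" using ob_mono[OF om0] r_le by blast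
    have "ob r2 0 0 (mi i)" for i using ob_mono[OF omi] r_le by blast
    thus "ob r2 11 1 (\<lambda>w. \<Sum>i\<in>UNIV. dl i w * mi i w)" by (rule ob_dot[OF odl]) auto
  qed auto
  have zsub: "zind (S (3/2) r5) g" if "zind (S (3/2) x) g" "r5 \<le> x" for x and g :: "'n cv \<Rightarrow> complex"
    using that sub[OF that(2)] unfolding zind_def by blast
  have zda: "zind (S (3/2) r5) da"
  proof -
    have "zind (S (3/2) r5) m0" "\<And>i. zind (S (3/2) r5) (mi i)" "\<And>i. zind (S (3/2) r5) (dl i)"
      using zsub sdsolD(3)[OF q0] sdsolD(3)[OF qi] zdl r_le by blast+
    thus ?thesis unfolding zind_def da_def by (metis (no_types, lifting) sum.cong)
  qed
  have zl5: "zind (S (3/2) r5) (lam' i)" for i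
    using zsub[OF zl r_le(9)] zsub[OF zdl r_le(13)] unfolding zind_def lam'_def by metis
  have za5: "zind (S (3/2) r5) alp'"
    using zsub[OF za r_le(9)] zda unfolding zind_def alp'_def by metis

  have cvec_nth: "cvec \<omega> $ k = of_real (\<omega> $ k)" for k by (simp add: cvec_def)
  \<comment> \<open>The angle error after the reparametrisation, but before the actions and the
    counterterm change. It is only of first order, which suffices because it enters the new energy
    error multiplied by \<open>nu\<close>.\<close>
  define e2p where "e2p l w = e2 u v lam l (T w) + (\<Sum>k\<in>UNIV. Mx u l k (T w) * Dw k w)" for l w
  have e2p: "dd (0, cvec \<omega>) (u' l) w - lam l w - fy l (emb v u (T w)) = e2p l w" if w: "w \<in> S (3/2) r4" for l w
  proof -
    have w2: "w \<in> S (3/2) r2" using w sub r_le by blast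
    have "lam l (T w) = lam l w" using zl[of l] T_r[OF w] w sub[OF r_le(8)] unfolding zind_def by (metis fstT subsetD)
    moreover have "dd (0, cvec \<omega>) (u l) (T w) = (\<Sum>k\<in>UNIV. of_real (\<omega> $ k) * dd (ex k) (u l) (T w))"
      by (rule dd_omega[OF cls_hol[OF cu] T_r[OF w]])
    moreover have "dd (0, cvec \<omega>) (u' l) w = Dw l w + (\<Sum>k\<in>UNIV. (of_real (\<omega> $ k) + Dw k w) * dd (ex k) (u l) (T w))"
      using du'[OF w, of "(0, cvec \<omega>)" l] Dw[OF w2] cvec_nth by simp
    moreover have "(\<Sum>k\<in>UNIV. Mx u l k (T w) * Dw k w) = Dw l w + (\<Sum>k\<in>UNIV. Dw k w * dd (ex k) (u l) (T w))"
      unfolding Mx_def by (simp add: distrib_right sum.distrib sum_delta_mult) (simp add: mult.commute)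
    ultimately show ?thesis unfolding e2p_def e2_def by (simp add: distrib_right sum.distrib)
  qed
  have oe2p: "ob r5 23 1 (e2p l)" for l
  proof -
    have "bnd (3/2) r 2 (Mx u l k)" for k
      unfolding bnd_def
    proof
      fix w :: "'n cv" assume "w \<in> S (3/2) r"
      from bndD[OF bdu this, of k l] c1_bounds(2)
      show "cmod (Mx u l k w) \<le> 2" unfolding Mx_def
        using norm_triangle_ineq[of "if l = k then 1 else 0" "dd (ex k) (u l) w"] by (auto split: if_splits)
    qed
    hence "ob r 1 0 (Mx u l k)" for k by (rule obI) (use L in simp)
    hence M: "ob r5 1 0 (\<lambda>w. Mx u l k (T w))" for k using ob_mono[OF oT] r_le(5) by blast
    have "ob r5 20 1 (Dw k)" for k using ob_mono[OF oDw] r_le by blast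
    from ob_dot[OF M this, of 22 1] have "ob r5 22 1 (\<lambda>w. \<Sum>k\<in>UNIV. Mx u l k (T w) * Dw k w)" by simp
    moreover have "ob r5 0 1 (\<lambda>w. e2 u v lam l (T w))" using ob_mono[OF oT[OF oe2]] r_le(5) by blast
    ultimately show ?thesis unfolding e2p_def[abs_def] by (intro ob_add[of r5 0 1 _ 22]) auto
  qed
  define x where "x = L ^ 16 * e"
  have x: "0 < x" "20 * x \<le> 1"
  proof -
    show "0 < x" using L e by (simp add: x_def)
    have "20 \<le> L ^ 5" using power_mono[of 2 L 5] L by simp
    hence "20 * x \<le> L ^ 5 * x" using \<open>0 < x\<close> by (intro mult_right_mono) auto
    also have "\<dots> = L ^ 21 * e" by (simp add: x_def power_add[symmetric] mult.assoc[symmetric])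
    also have "\<dots> \<le> 1" by (rule pw) simp
    finally show "20 * x \<le> 1" .
  qed
  have nux: "cmod (nu l w) \<le> x" if "w \<in> S (3/2) r5" for l w using onu[of l] that by (simp add: ob_def bnd_def x_def)
  have emb2: "emb v' u' w = emb v u (T w) + (\<chi> l. nu l w, 0)" for w
    unfolding emb1[symmetric] by (rule cv_eqI) (auto simp: v'_def)
  define Ta where "Ta w = f (emb v' u' w) - f (emb v u (T w)) - (\<Sum>l\<in>UNIV. nu l w * fy l (emb v u (T w)))" for w
  define Tb where "Tb i w = fy i (emb v' u' w) - fy i (emb v u (T w)) - (\<Sum>l\<in>UNIV. nu l w * fyy i l (emb v u (T w)))" for i w
  have oTa: "ob r5 32 2 Ta"
    unfolding ob_def bnd_def
  proof
    fix w :: "'n cv" assume w: "w \<in> S (3/2) r5"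
    have GT: "emb v u (T w) \<in> S (2 - 1/10) r0" using G_in[OF T_r] sub4 w S_mono[of r0 r0 "17/10" "2 - 1/10"] by fastforce
    have "cmod (Ta w) \<le> 8 * \<eta> * x\<^sup>2 / (1/10)\<^sup>2"
      unfolding Ta_def emb2 fy_def using y_taylor[OF cls_hol[OF f(1)] f(2) GT, of "\<chi> l. nu l w" x] nux[OF w] x by simp
    also have "\<dots> \<le> x\<^sup>2" using \<eta> mult_right_mono[of "800 * \<eta>" 1 "x\<^sup>2"] by (simp add: power_divide)
    finally show "cmod (Ta w) \<le> L ^ 32 * e ^ 2" by (simp add: x_def power_mult_distrib power_mult[symmetric])
  qed
  have oTb: "ob r5 32 2 (Tb i)" for i
    unfolding ob_def bnd_def
  proof
    fix w :: "'n cv" assume w: "w \<in> S (3/2) r5"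
    have GT: "emb v u (T w) \<in> S (19/10 - 1/10) r0" using G_in[OF T_r] sub4 w S_mono[of r0 r0 "17/10" "19/10 - 1/10"] by fastforce
    have h: "hol (S (19/10) r0) (fy i)" by (rule hol_subset[OF cls_hol[OF fy(1)]], rule S_mono) auto
    have "cmod (Tb i w) \<le> 8 * (10 * \<eta>) * x\<^sup>2 / (1/10)\<^sup>2"
      unfolding Tb_def emb2 fyy_def using y_taylor[OF h fy(2) GT, of "\<chi> l. nu l w" x] nux[OF w] x by simp
    also have "\<dots> \<le> x\<^sup>2" using \<eta> mult_right_mono[of "8000 * \<eta>" 1 "x\<^sup>2"] by (simp add: power_divide)
    finally show "cmod (Tb i w) \<le> L ^ 32 * e ^ 2" by (simp add: x_def power_mult_distrib power_mult[symmetric])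
  qed

  \<comment> \<open>All terms of first order have cancelled. What remains is a Taylor remainder, the
    change of an error under the small shift, and products of two quantities of first order.\<close>
  have E1: "e1 u' v' lam' alp' w = Ta w + (e1 u v lam alp (T w) - e1 u v lam alp w) + (\<Sum>l\<in>UNIV. dl l w * (v' l w - v l w)) -
      (\<Sum>l\<in>UNIV. e2p l w * nu l w)" if w: "w \<in> S (3/2) r5" for w
  proof -
    have w4: "w \<in> S (3/2) r4" and w2: "w \<in> S (3/2) r2" and wr: "w \<in> S (3/2) r" using w sub r_le by blast+
    have lamT: "lam l (T w) = lam l w" for l using zl[of l] T_r[OF w4] wr unfolding zind_def by (metis fstT)
    have alpT: "alp (T w) = alp w" using za T_r[OF w4] wr unfolding zind_def by (metis fstT)
    have pair: "(\<Sum>l\<in>UNIV. (fy l (emb v u (T w)) + of_real (\<omega> $ l) + lam l w) * nu l w) =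
      (\<Sum>j\<in>UNIV. of_real (\<omega> $ j) * dd (ex j) q w) - (\<Sum>l\<in>UNIV. e2p l w * nu l w)"
      unfolding nu_def
    proof (rule energy_pairing[where M'="\<lambda>i j. Mx u' i j w", OF NM'[OF w]])
      fix l
      have "(\<Sum>j\<in>UNIV. Mx u' l j w * of_real (\<omega> $ j)) = of_real (\<omega> $ l) + dd (0, cvec \<omega>) (u' l) w"
        unfolding dd_omega[OF cls_hol[OF cu'] w4] Mx_def by (simp add: distrib_right sum.distrib sum_delta_mult) (simp add: mult.commute)
      thus "fy l (emb v u (T w)) + of_real (\<omega> $ l) + lam l w = (\<Sum>j\<in>UNIV. Mx u' l j w * of_real (\<omega> $ j)) - e2p l w"
        using e2p[OF w4, of l] by (simp add: algebra_simps)
    qed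
    have "(\<Sum>j\<in>UNIV. of_real (\<omega> $ j) * dd (ex j) q w) = dd (0, cvec \<omega>) q w" by (rule dd_omega[OF cls_hol[OF cq] w2, symmetric])
    also have "\<dots> = (- e1 u v lam alp w - m0 w) + (\<Sum>i\<in>UNIV. dl i w * ((fst w $ i - v i w) - mi i w))"
      using dq[OF w2, of "(0, cvec \<omega>)"] sdsolD(4)[OF q0 wr] sdsolD(4)[OF qi wr] by simp
    also have "\<dots> = - e1 u v lam alp w - (\<Sum>i\<in>UNIV. dl i w * (v i w - fst w $ i)) + da w"
      unfolding da_def by (simp add: right_diff_distrib sum_subtractf)
    finally have dqw: "(\<Sum>j\<in>UNIV. of_real (\<omega> $ j) * dd (ex j) q w) = - e1 u v lam alp w - (\<Sum>i\<in>UNIV. dl i w * (v i w - fst w $ i)) + da w" .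
    have e1T: "e1 u v lam alp (T w) = f (emb v u (T w)) + (\<Sum>i\<in>UNIV. (of_real (\<omega> $ i) + lam i w) * (v1 i w - fst w $ i)) - alp w"
      unfolding e1_def by (simp add: lamT alpT v1_def)
    have X6: "(\<Sum>i\<in>UNIV. (of_real (\<omega> $ i) + lam' i w) * (v' i w - fst w $ i)) =
      (\<Sum>i\<in>UNIV. (of_real (\<omega> $ i) + lam i w) * (v1 i w - fst w $ i)) + (\<Sum>i\<in>UNIV. (of_real (\<omega> $ i) + lam i w) * nu i w) +
      (\<Sum>i\<in>UNIV. dl i w * (v' i w - fst w $ i))"
      unfolding sum.distrib[symmetric] by (rule sum.cong) (auto simp: lam'_def v'_def algebra_simps)
    have X5: "(\<Sum>l\<in>UNIV. nu l w * fy l (emb v u (T w))) + (\<Sum>i\<in>UNIV. (of_real (\<omega> $ i) + lam i w) * nu i w) =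
      (\<Sum>l\<in>UNIV. (fy l (emb v u (T w)) + of_real (\<omega> $ l) + lam l w) * nu l w)"
      unfolding sum.distrib[symmetric] by (rule sum.cong) (auto simp: algebra_simps)
    have X9: "(\<Sum>i\<in>UNIV. dl i w * (v' i w - fst w $ i)) - (\<Sum>i\<in>UNIV. dl i w * (v i w - fst w $ i)) = (\<Sum>l\<in>UNIV. dl l w * (v' l w - v l w))"
      unfolding sum_subtractf[symmetric] by (rule sum.cong) (auto simp: algebra_simps)
    have E: "e1 u' v' lam' alp' w = f (emb v' u' w) + (\<Sum>i\<in>UNIV. (of_real (\<omega> $ i) + lam' i w) * (v' i w - fst w $ i)) - (alp w + da w)"
      by (simp add: e1_def alp'_def)
    \<comment> \<open>The cancellation is a linear identity between a few scalars; abstract names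
      keep the sums out of the calculation.\<close>
    have "E = t + D + X3 - X4" if "t = F' - F - X5" "E = F' + X6 - (al + b)" "X6 = X7 + X8 + X9" "X5 + X8 = X10" "X9 - X11 = X3"
      "X10 = X12 - X4" "X12 = - e1w - X11 + b" "D = F + X7 - al - e1w" for E t D X3 X4 X5 X6 X7 X8 X9 X10 X11 X12 F F' al b e1w :: complex
      using that by simp (simp add: algebra_simps)
    from this[OF Ta_def E X6 X5 X9 pair dqw] show ?thesis unfolding e1T by simp
  qed
  \<comment> \<open>The quadratic terms come from moving the old error, the Jacobian and the second
    derivatives of f by \<open>T\<close>, from the exchange of the old inverse for the new one, and
    from the Taylor remainder.\<close>
  have E2: "e2 u' v' lam' i w = (e2 u v lam i (T w) - e2 u v lam i w) + (\<Sum>k\<in>UNIV. (dd (ex k) (u i) (T w) - dd (ex k) (u i) w) * Dw k w) +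
     (\<Sum>l\<in>UNIV. (fyy i l (emb v u w) * (nu2 l w - nu l w) - (fyy i l (emb v u (T w)) - fyy i l (emb v u w)) * nu l w)) - Tb i w"
    if w: "w \<in> S (3/2) r5" for i w
  proof -
    have w4: "w \<in> S (3/2) r4" and w2: "w \<in> S (3/2) r2" using w sub r_le by blast+
    have "e2 u' v' lam' i w = dd (0, cvec \<omega>) (u' i) w - lam i w - fy i (emb v u (T w)) - dl i w - (Tb i w + (\<Sum>l\<in>UNIV. nu l w * fyy i l (emb v u (T w))))"
      unfolding e2_def lam'_def Tb_def by simp
    also have "\<dots> = e2p i w - dl i w - Tb i w - (\<Sum>l\<in>UNIV. nu l w * fyy i l (emb v u (T w)))" unfolding e2p[OF w4] by simp
    also have "dl i w = (\<Sum>j\<in>UNIV. Mx u i j w * Dw j w) - (\<Sum>l\<in>UNIV. fyy i l (emb v u w) * nu2 l w) + e2 u v lam i w"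
      using response[OF w2, of i] by simp
    finally have "e2 u' v' lam' i w = (e2 u v lam i (T w) - e2 u v lam i w) + ((\<Sum>k\<in>UNIV. Mx u i k (T w) * Dw k w) - (\<Sum>k\<in>UNIV. Mx u i k w * Dw k w)) +
      ((\<Sum>l\<in>UNIV. fyy i l (emb v u w) * nu2 l w) - (\<Sum>l\<in>UNIV. nu l w * fyy i l (emb v u (T w)))) - Tb i w"
      unfolding e2p_def by simp
    moreover have "(\<Sum>k\<in>UNIV. Mx u i k (T w) * Dw k w) - (\<Sum>k\<in>UNIV. Mx u i k w * Dw k w) = (\<Sum>k\<in>UNIV. (dd (ex k) (u i) (T w) - dd (ex k) (u i) w) * Dw k w)"
      unfolding sum_subtractf[symmetric] by (rule sum.cong) (auto simp: Mx_def algebra_simps)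
    moreover have "(\<Sum>l\<in>UNIV. fyy i l (emb v u w) * nu2 l w) - (\<Sum>l\<in>UNIV. nu l w * fyy i l (emb v u (T w))) =
      (\<Sum>l\<in>UNIV. (fyy i l (emb v u w) * (nu2 l w - nu l w) - (fyy i l (emb v u (T w)) - fyy i l (emb v u w)) * nu l w))"
      unfolding sum_subtractf[symmetric] by (rule sum.cong) (auto simp: algebra_simps)
    ultimately show ?thesis by simp
  qed
  have dl5: "ob r5 10 1 (dl i)" for i using ob_mono[OF odl] r_le by blast
  have O1: "ob r5 50 2 (e1 u' v' lam' alp')"
  proof -
    have "ob r4 24 2 (\<lambda>w. e1 u v lam alp (T w) - e1 u v lam alp w)" using shift[OF ce1 oe1] by (simp add: numeral_2_eq_2)
    hence t1: "ob r5 24 2 (\<lambda>w. e1 u v lam alp (T w) - e1 u v lam alp w)" using ob_mono r_le(5) by blast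
    have t2: "ob r5 36 2 (\<lambda>w. \<Sum>l\<in>UNIV. dl l w * (v' l w - v l w))" by (rule ob_dot[OF dl5 ovv]) auto
    have t3: "ob r5 40 2 (\<lambda>w. \<Sum>l\<in>UNIV. e2p l w * nu l w)" by (rule ob_dot[OF oe2p onu]) auto
    have "ob r5 33 2 (\<lambda>w. Ta w + (e1 u v lam alp (T w) - e1 u v lam alp w))" by (rule ob_add[OF oTa t1]) auto
    from ob_add[OF this t2, of 37]
    have "ob r5 37 2 (\<lambda>w. Ta w + (e1 u v lam alp (T w) - e1 u v lam alp w) + (\<Sum>l\<in>UNIV. dl l w * (v' l w - v l w)))" by simp
    from ob_diff[OF this t3, of 50] show ?thesis by (rule obc) (auto simp: E1)
  qed
  have O2: "ob r5 50 2 (e2 u' v' lam' i)" for i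
  proof -
    have "ob r4 24 2 (\<lambda>w. e2 u v lam i (T w) - e2 u v lam i w)" using shift[OF ce2 oe2] by (simp add: numeral_2_eq_2)
    hence t1: "ob r5 24 2 (\<lambda>w. e2 u v lam i (T w) - e2 u v lam i w)" using ob_mono r_le(5) by blast
    have "ob r4 24 1 (\<lambda>w. dd (ex k) (u i) (T w) - dd (ex k) (u i) w)" for k using shift[OF cdu odu] by simp
    hence s2: "ob r5 24 1 (\<lambda>w. dd (ex k) (u i) (T w) - dd (ex k) (u i) w)" for k using ob_mono r_le(5) by blast
    have Dw5: "ob r5 20 1 (Dw k)" for k using ob_mono[OF oDw] r_le by blast
    have t2: "ob r5 45 2 (\<lambda>w. \<Sum>k\<in>UNIV. (dd (ex k) (u i) (T w) - dd (ex k) (u i) w) * Dw k w)" by (rule ob_dot[OF s2 Dw5]) auto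
    have "ob r5 45 2 (\<lambda>w. \<Sum>h\<in>UNIV. (N' h l w - N h l w) * dd (ex h) q w)" for l by (rule ob_dot[OF oNN odq5]) auto
    hence "ob r5 45 2 (\<lambda>w. - (\<Sum>h\<in>UNIV. (N' h l w - N h l w) * dd (ex h) q w))" for l by (rule ob_minus)
    moreover have "- (\<Sum>h\<in>UNIV. (N' h l w - N h l w) * dd (ex h) q w) = nu2 l w - nu l w" for l w
      by (simp add: nu2_def nu_def left_diff_distrib sum_subtractf)
    ultimately have s3: "ob r5 45 2 (\<lambda>w. nu2 l w - nu l w)" for l by simp
    have oF5: "ob r5 0 0 (\<lambda>w. fyy i l (emb v u w))" for l using ob_mono[OF oF] r_le by blast
    have "ob r4 24 1 (\<lambda>w. fyy i l (emb v u (T w)) - fyy i l (emb v u w))" for l using shift[OF cF oF] by simp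
    hence s4: "ob r5 24 1 (\<lambda>w. fyy i l (emb v u (T w)) - fyy i l (emb v u w))" for l using ob_mono r_le(5) by blast
    have "ob r5 45 2 (\<lambda>w. fyy i l (emb v u w) * (nu2 l w - nu l w))" for l by (rule ob_mult[OF oF5 s3]) auto
    moreover have "ob r5 40 2 (\<lambda>w. (fyy i l (emb v u (T w)) - fyy i l (emb v u w)) * nu l w)" for l by (rule ob_mult[OF s4 onu]) auto
    ultimately have "ob r5 46 2 (\<lambda>w. fyy i l (emb v u w) * (nu2 l w - nu l w) - (fyy i l (emb v u (T w)) - fyy i l (emb v u w)) * nu l w)" for l
      by (rule ob_diff) auto
    hence t3: "ob r5 47 2 (\<lambda>w. \<Sum>l\<in>UNIV. (fyy i l (emb v u w) * (nu2 l w - nu l w) - (fyy i l (emb v u (T w)) - fyy i l (emb v u w)) * nu l w))"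
      by (rule ob_sum) auto
    have "ob r5 46 2 (\<lambda>w. (e2 u v lam i (T w) - e2 u v lam i w) + (\<Sum>k\<in>UNIV. (dd (ex k) (u i) (T w) - dd (ex k) (u i) w) * Dw k w))"
      by (rule ob_add[OF t1 t2]) auto
    from ob_add[OF this t3, of 48]
    have "ob r5 48 2 (\<lambda>w. (e2 u v lam i (T w) - e2 u v lam i w) + (\<Sum>k\<in>UNIV. (dd (ex k) (u i) (T w) - dd (ex k) (u i) w) * Dw k w) +
       (\<Sum>l\<in>UNIV. (fyy i l (emb v u w) * (nu2 l w - nu l w) - (fyy i l (emb v u (T w)) - fyy i l (emb v u w)) * nu l w)))" by simp
    from ob_diff[OF this oTb, of 50 i] show ?thesis by (rule obc) (auto simp: E2)
  qed
  have lag: "lagr r5 u' v'"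
    unfolding lagr_def
  \<comment> \<open>Pulling the old primitive back by \<open>T\<close> accounts for the
    reparametrisation, and q for the translation of the actions.\<close>
  proof (intro exI[of _ "\<lambda>w. s (T w) + q w"] conjI ballI allI)
    have cs5: "cls (3/2) r5 (\<lambda>w. s (T w))" using cls_subset[OF cT[OF s(1)] r_le(5) order_refl] .
    show "cls (3/2) r5 (\<lambda>w. s (T w) + q w)" by (intro cls_add cs5 cq5)
    fix w :: "'n cv" and j assume w: "w \<in> S (3/2) r5"
    have w4: "w \<in> S (3/2) r4" using w sub4 by blast
    have "dd (ex j) (\<lambda>w. s (T w) + q w) w = dd (ex j) (\<lambda>w. s (T w)) w + dd (ex j) q w"
      by (rule hol_add(2)[OF cls_hol[OF cs5] cls_hol[OF cq5] w])
    also have "dd (ex j) (\<lambda>w. s (T w)) w = (\<Sum>k\<in>UNIV. Mx wv k j w * dd (ex k) s (T w))" by (rule dTj[OF s(1) w4])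
    also have "\<dots> = (\<Sum>k\<in>UNIV. \<Sum>i\<in>UNIV. Mx u i k (T w) * Mx wv k j w * (v1 i w - fst w $ i))"
      by (simp add: s(2)[OF T_r[OF w4]] v1_def sum_distrib_left mult_ac)
    also have "\<dots> = (\<Sum>i\<in>UNIV. \<Sum>k\<in>UNIV. Mx u i k (T w) * Mx wv k j w * (v1 i w - fst w $ i))" by (rule sum.swap)
    also have "\<dots> = (\<Sum>i\<in>UNIV. Mx u' i j w * (v1 i w - fst w $ i))" by (simp add: Mu'[OF w4] sum_distrib_right)
    also have "dd (ex j) q w = (\<Sum>l\<in>UNIV. Mx u' l j w * nu l w)"
      unfolding nu_def by (rule inverse_apply_transpose[where M="\<lambda>i j. Mx u' i j w", OF NM'[OF w], symmetric])
    also have "(\<Sum>i\<in>UNIV. Mx u' i j w * (v1 i w - fst w $ i)) + (\<Sum>l\<in>UNIV. Mx u' l j w * nu l w) =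
      (\<Sum>i\<in>UNIV. Mx u' i j w * (v' i w - fst w $ i))"
      unfolding sum.distrib[symmetric] by (rule sum.cong) (auto simp: v'_def algebra_simps)
    finally show "dd (ex j) (\<lambda>w. s (T w) + q w) w = (\<Sum>i\<in>UNIV. Mx u' i j w * (v' i w - fst w $ i))" .
  qed
  have fin: "bnd (3/2) r5 (L ^ 30 * e) g" if "ob x k 1 g" "k \<le> 30" "r5 \<le> x" for x k and g :: "'n cv \<Rightarrow> complex"
    using ob_mono[OF that] by (simp add: ob_def)
  have cl5: "cls (3/2) r5 (lam' i)" for i unfolding lam'_def[abs_def]
    by (intro cls_add cls_subset[OF cl r_le(9) order_refl] cls_subset[OF cdl r_le(13) order_refl])
  have ca5: "cls (3/2) r5 alp'" unfolding alp'_def[abs_def]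
    by (intro cls_add cls_subset[OF ca r_le(9) order_refl] cls_subset[OF cda r_le(13) order_refl])
  have f1: "bnd (3/2) r5 (L ^ 30 * e) (\<lambda>w. u' i w - u i w)" for i by (rule fin[OF ouu]) (use r_le in auto)
  have f2: "bnd (3/2) r5 (L ^ 30 * e) (\<lambda>w. dd (ex j) (u' i) w - dd (ex j) (u i) w)" for i j by (rule fin[OF oduu]) auto
  have f3: "bnd (3/2) r5 (L ^ 30 * e) (\<lambda>w. v' i w - v i w)" for i by (rule fin[OF ovv]) auto
  have f4: "bnd (3/2) r5 (L ^ 30 * e) (\<lambda>w. lam' i w - lam i w)" for i
    using fin[OF odl] r_le by (simp add: lam'_def)
  have f5: "bnd (3/2) r5 (L ^ 30 * e) (\<lambda>w. alp' w - alp w)"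
    using fin[OF oda] r_le by (simp add: alp'_def)
  have O1': "bnd (3/2) r5 (L ^ 50 * e\<^sup>2) (e1 u' v' lam' alp')" using O1 by (simp add: ob_def)
  have O2': "bnd (3/2) r5 (L ^ 50 * e\<^sup>2) (e2 u' v' lam' i)" for i using O2 by (simp add: ob_def)
  have r5e: "r - 5 * d = r5" by (simp add: rs)
  show ?thesis unfolding r5e
    by (rule exI[of _ u'], rule exI[of _ v'], rule exI[of _ lam'], rule exI[of _ alp'])
       (intro conjI allI cu5 cv' cl5 zl5 ca5 za5 O1' O2' lag f1 f2 f3 f4 f5)
qed

end

section \<open>Convergence of the iteration\<close>
lemma geometric_uniform_limit:
  fixes g :: "nat \<Rightarrow> 'a \<Rightarrow> complex"
  assumes "\<And>j w. w \<in> A \<Longrightarrow> cmod (g (Suc j) w - g j w) \<le> C * (1/2) ^ j"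
  shows "\<exists>h. uniform_limit A g h sequentially"
proof -
  have "uniform_limit A (\<lambda>n w. \<Sum>i<n. g (Suc i) w - g i w) (\<lambda>w. \<Sum>i. g (Suc i) w - g i w) sequentially"
    by (rule Weierstrass_m_test[where M="\<lambda>j. C * (1/2) ^ j"]) (use assms in \<open>auto intro!: summable_mult summable_geometric\<close>)
  hence "uniform_limit A (\<lambda>n w. (\<Sum>i<n. g (Suc i) w - g i w) + g 0 w) (\<lambda>w. (\<Sum>i. g (Suc i) w - g i w) + g 0 w) sequentially"
    by (rule uniform_limit_add[OF _ uniform_limit_const])
  moreover have "(\<Sum>i<n. g (Suc i) w - g i w) + g 0 w = g n w" for n w using sum_lessThan_telescope[of "\<lambda>i. g i w" n] by simp
  ultimately show ?thesis by auto
qed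

lemma cls_geometric_limit:
  assumes c: "\<And>j. cls a r (g j)" and d: "\<And>j. bnd a r (C * (1/2) ^ j) (\<lambda>w. g (Suc j) w - g j w)"
  shows "\<exists>h. cls a r h \<and> (\<forall>w\<in>S a r. (\<lambda>j. g j w) \<longlonglongrightarrow> h w) \<and> (\<forall>w\<in>S a r. \<forall>e. (\<lambda>j. dd e (g j) w) \<longlonglongrightarrow> dd e h w)"
proof -
  obtain h where h: "uniform_limit (S a r) g h sequentially"
    using geometric_uniform_limit[of "S a r" g C] d unfolding bnd_def by blast
  have "(\<lambda>j. g j w) \<longlonglongrightarrow> h w" if "w \<in> S a r" for w using tendsto_uniform_limitI[OF h that] .
  thus ?thesis using cls_limit[OF c h] by blast
qed

lemma bnd_limit:
  assumes "\<And>w. w \<in> S a r \<Longrightarrow> (\<lambda>j. g j w) \<longlonglongrightarrow> h w" "\<And>j. bnd a r C (g j)"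
  shows "bnd a r C h"
  unfolding bnd_def
proof
  fix w :: "'a cv" assume w: "w \<in> S a r"
  show "cmod (h w) \<le> C"
    by (rule Lim_norm_ubound[OF _ assms(1)[OF w]]) (use bndD[OF assms(2) w] in auto)
qed

text \<open>Halving the strip loss multiplies the small divisor loss by a fixed factor, which
  becomes the \<open>B\<close> of \<open>counterterm_kam\<close>; over the iteration the losses grow
  only geometrically.\<close>

lemma sd_loss_halve:
  "sd_loss \<gamma> b TYPE('n::finite) (x * (1/2) ^ j) = sd_loss \<gamma> b TYPE('n) x * (2 ^ (b + CARD('n))) ^ j"
proof -
  have 1: "c / (x * (1/2) ^ j) = c / x * 2 ^ j" for c :: real by (simp add: field_simps power_divide)
  have "((2::real) ^ j) ^ b * (2 ^ j) ^ CARD('n) = (2 ^ (b + CARD('n))) ^ j"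
    by (simp add: power_mult[symmetric] power_add[symmetric] algebra_simps)
  thus ?thesis unfolding sd_loss_def 1 power_mult_distrib by (simp add: algebra_simps)
qed

section \<open>The invariance equation and the limit of the iteration\<close>

context kam
begin

text \<open>Mixed derivatives of the primitive s agree, and the second derivatives of u cancel by
  their own symmetry. In this form the Lagrangian condition involves only first derivatives of u and
  v, so it passes to the limit of the iteration without control of the primitives.\<close>

lemma lagrange_symmetric:
  assumes u: "\<And>i. cls (3/2) r (u i)" and v: "\<And>i. cls (3/2) r (v i)" and l: "lagr r u v" and w: "w \<in> S (3/2) r"
  shows "(\<Sum>i\<in>UNIV. Mx u i j w * dd (ex k) (v i) w) = (\<Sum>i\<in>UNIV. Mx u i k w * dd (ex j) (v i) w)"
proof -
  obtain s where s: "cls (3/2) r s" "\<And>w j. w \<in> S (3/2) r \<Longrightarrow> dd (ex j) s w = (\<Sum>i\<in>UNIV. Mx u i j w * (v i w - fst w $ i))"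
    using l unfolding lagr_def by blast
  have hM: "hol (S (3/2) r) (Mx u i j)" for i j unfolding Mx_def[abs_def]
    by (intro hol_add(1) hol_const hol_dd open_S cls_hol u)
  have hy: "hol (S (3/2) r) (\<lambda>w. v i w - fst w $ i)" for i by (intro hol_diff(1) cls_hol v hol_fst(1))
  have ddM: "dd (ex k) (Mx u i j) w = dd (ex k) (dd (ex j) (u i)) w" for i j k
    unfolding Mx_def[abs_def] using hol_add(2)[OF hol_const hol_dd[OF open_S cls_hol[OF u]] w] by simp
  have ddy: "dd (ex k) (\<lambda>w. v i w - fst w $ i) w = dd (ex k) (v i) w" for i k
    using hol_diff(2)[OF cls_hol[OF v] hol_fst(1) w, of "ex k" i i] by (simp add: hol_fst(2))
  have A: "dd (ex k) (dd (ex j) s) w = (\<Sum>i\<in>UNIV. dd (ex k) (dd (ex j) (u i)) w * (v i w - fst w $ i)) +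
      (\<Sum>i\<in>UNIV. Mx u i j w * dd (ex k) (v i) w)" for j k
  proof -
    have hs: "hol (S (3/2) r) (\<lambda>w. \<Sum>i\<in>UNIV. Mx u i j w * (v i w - fst w $ i))"
      by (intro hol_sum(1) hol_mult(1) hM hy)
    have "dd (ex k) (dd (ex j) s) w = dd (ex k) (\<lambda>w. \<Sum>i\<in>UNIV. Mx u i j w * (v i w - fst w $ i)) w"
      by (rule hol_cong(2)[OF open_S hs _ w]) (simp add: s(2))
    also have "\<dots> = (\<Sum>i\<in>UNIV. dd (ex k) (\<lambda>w. Mx u i j w * (v i w - fst w $ i)) w)"
      by (rule hol_sum(2)[OF hol_mult(1)[OF hM hy] w])
    also have "\<dots> = (\<Sum>i\<in>UNIV. Mx u i j w * dd (ex k) (v i) w + dd (ex k) (dd (ex j) (u i)) w * (v i w - fst w $ i))"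
      by (simp add: hol_mult(2)[OF hM hy w] ddy ddM)
    finally show ?thesis by (simp add: sum.distrib)
  qed
  have "dd (ex k) (dd (ex j) s) w = dd (ex j) (dd (ex k) s) w" by (rule dd_commute[OF open_S cls_hol[OF s(1)] w])
  moreover have "dd (ex k) (dd (ex j) (u i)) w = dd (ex j) (dd (ex k) (u i)) w" for i by (rule dd_commute[OF open_S cls_hol[OF u] w])
  ultimately show ?thesis using A[of k j] A[of j k] by simp
qed

text \<open>Differentiating the Hamilton-Jacobi equation and using the Lagrangian symmetry turns it into
  the second half of the invariance equation.\<close>

lemma invariance_from_energy:
  assumes u: "\<And>i. cls (3/2) r (u i)" and v: "\<And>i. cls (3/2) r (v i)" and lam: "\<And>i. hol (S (3/2) r) (lam i)" "\<And>i. zind (S (3/2) r) (lam i)"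
    and alp: "hol (S (3/2) r) alp" "zind (S (3/2) r) alp"
    and in2: "\<And>w. w \<in> S (3/2) r \<Longrightarrow> emb v u w \<in> S 2 r0"
    and e1: "\<And>w. w \<in> S (3/2) r \<Longrightarrow> e1 u v lam alp w = 0" and e2: "\<And>w i. w \<in> S (3/2) r \<Longrightarrow> e2 u v lam i w = 0"
    and sym: "\<And>w j k. w \<in> S (3/2) r \<Longrightarrow> (\<Sum>i\<in>UNIV. Mx u i j w * dd (ex k) (v i) w) = (\<Sum>i\<in>UNIV. Mx u i k w * dd (ex j) (v i) w)"
    and du: "\<And>i j. bnd (3/2) r c1 (dd (ex j) (u i))" and w: "w \<in> S (3/2) r"
  shows "dd (0, cvec \<omega>) (v i) w = - dd (ex i) f (emb v u w)"
proof -
  have "\<exists>N. minv (3/2) r (\<lambda>i j. dd (ex j) (u i)) N"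
    by (rule neumann[OF cls_dd[OF u] du]) (use c1_bounds n n1 in \<open>auto simp: field_simps\<close>)
  then obtain N where "minv (3/2) r (\<lambda>i j. dd (ex j) (u i)) N" by blast
  note MN = minvD(4)[OF this, folded Mx_def]
  \<comment> \<open>The defect of the action equation. It turns out to be annihilated by the
    transpose of \<open>Mx\<close>, which is invertible by the bound on the derivatives of
    u.\<close>
  define X where "X i = dd (0, cvec \<omega>) (v i) w + dd (ex i) f (emb v u w)" for i
  have "(\<Sum>i\<in>UNIV. Mx u i j w * X i) = 0" for j
  proof -
    have hF: "hol (S (3/2) r) (\<lambda>w. f (emb v u w))" by (rule hol_emb(1)[OF cls_hol[OF f(1)] cls_hol[OF v] cls_hol[OF u]]) (rule in2)
    have hy: "hol (S (3/2) r) (\<lambda>w. v i w - fst w $ i)" for i by (intro hol_diff(1) cls_hol v hol_fst(1))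
    have hl: "hol (S (3/2) r) (\<lambda>w. of_real (\<omega> $ i) + lam i w)" for i by (intro hol_add(1) hol_const lam)
    have hp: "hol (S (3/2) r) (\<lambda>w. (of_real (\<omega> $ i) + lam i w) * (v i w - fst w $ i))" for i by (intro hol_mult(1) hl hy)
    have ddy: "dd (ex j) (\<lambda>w. v i w - fst w $ i) w = dd (ex j) (v i) w" for i
      using hol_diff(2)[OF cls_hol[OF v] hol_fst(1) w, of "ex j" i i] by (simp add: hol_fst(2))
    have ddl: "dd (ex j) (\<lambda>w. of_real (\<omega> $ i) + lam i w) w = 0" for i
      using hol_add(2)[OF hol_const lam(1) w] zind_dd[OF lam(2) w, of "ex j" i] by simp
    have 1: "dd (ex j) (\<lambda>w. (of_real (\<omega> $ i) + lam i w) * (v i w - fst w $ i)) w = (of_real (\<omega> $ i) + lam i w) * dd (ex j) (v i) w" for i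
      using hol_mult(2)[OF hl hy w, of "ex j" i i] ddl ddy by simp
    have "dd (ex j) (e1 u v lam alp) w = 0"
    proof -
      have "dd (ex j) (e1 u v lam alp) w = dd (ex j) (\<lambda>_. 0) w"
        by (rule hol_cong(2)[OF open_S hol_const _ w]) (simp add: e1)
      thus ?thesis by simp
    qed
    moreover have "dd (ex j) (e1 u v lam alp) w = dd (ex j) (\<lambda>w. f (emb v u w)) w +
        (\<Sum>i\<in>UNIV. (of_real (\<omega> $ i) + lam i w) * dd (ex j) (v i) w)"
    proof -
      have "dd (ex j) (e1 u v lam alp) w = dd (ex j) (\<lambda>w. f (emb v u w) + (\<Sum>i\<in>UNIV. (of_real (\<omega> $ i) + lam i w) * (v i w - fst w $ i))) w - dd (ex j) alp w"
        unfolding e1_def[abs_def] by (rule hol_diff(2)[OF hol_add(1)[OF hF hol_sum(1)[OF hp]] alp(1) w])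
      also have "dd (ex j) alp w = 0" by (rule zind_dd[OF alp(2) w]) simp
      also have "dd (ex j) (\<lambda>w. f (emb v u w) + (\<Sum>i\<in>UNIV. (of_real (\<omega> $ i) + lam i w) * (v i w - fst w $ i))) w =
        dd (ex j) (\<lambda>w. f (emb v u w)) w + dd (ex j) (\<lambda>w. \<Sum>i\<in>UNIV. (of_real (\<omega> $ i) + lam i w) * (v i w - fst w $ i)) w"
        by (rule hol_add(2)[OF hF hol_sum(1)[OF hp] w])
      also have "dd (ex j) (\<lambda>w. \<Sum>i\<in>UNIV. (of_real (\<omega> $ i) + lam i w) * (v i w - fst w $ i)) w =
        (\<Sum>i\<in>UNIV. dd (ex j) (\<lambda>w. (of_real (\<omega> $ i) + lam i w) * (v i w - fst w $ i)) w)"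
        by (rule hol_sum(2)[OF hp w])
      finally show ?thesis by (simp add: 1)
    qed
    moreover have "dd (ex j) (\<lambda>w. f (emb v u w)) w = (\<Sum>i\<in>UNIV. dd (ex j) (v i) w * fy i (emb v u w)) +
        (\<Sum>i\<in>UNIV. Mx u i j w * dd (ex i) f (emb v u w))"
    proof -
      have "dd (ex j) (\<lambda>w. f (emb v u w)) w = (\<Sum>i\<in>UNIV. dd (ex j) (v i) w * dd (ey i) f (emb v u w)) +
        (\<Sum>i\<in>UNIV. (snd (ex j) $ i + dd (ex j) (u i) w) * dd (ex i) f (emb v u w))"
        by (rule hol_emb(2)[OF cls_hol[OF f(1)] cls_hol[OF v] cls_hol[OF u] _ w]) (rule in2)
      moreover have "snd (ex j) $ i + dd (ex j) (u i) w = Mx u i j w" for i by (simp add: Mx_def axis_def eq_commute)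
      ultimately show ?thesis by (simp add: fy_def)
    qed
    ultimately have "(\<Sum>i\<in>UNIV. dd (ex j) (v i) w * (fy i (emb v u w) + of_real (\<omega> $ i) + lam i w)) +
      (\<Sum>i\<in>UNIV. Mx u i j w * dd (ex i) f (emb v u w)) = 0"
      by (simp add: distrib_left distrib_right sum.distrib mult.commute add_ac)
    moreover have "fy i (emb v u w) + of_real (\<omega> $ i) + lam i w = (\<Sum>k\<in>UNIV. Mx u i k w * of_real (\<omega> $ k))" for i
    proof -
      have "(\<Sum>k\<in>UNIV. Mx u i k w * of_real (\<omega> $ k)) = of_real (\<omega> $ i) + dd (0, cvec \<omega>) (u i) w"
        unfolding dd_omega[OF cls_hol[OF u] w] Mx_def by (simp add: distrib_right sum.distrib sum_delta_mult) (simp add: mult.commute)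
      thus ?thesis using e2[OF w, of i] by (simp add: e2_def algebra_simps)
    qed
    moreover have "(\<Sum>i\<in>UNIV. dd (ex j) (v i) w * (\<Sum>k\<in>UNIV. Mx u i k w * of_real (\<omega> $ k))) = (\<Sum>i\<in>UNIV. Mx u i j w * dd (0, cvec \<omega>) (v i) w)"
    proof -
      have "(\<Sum>i\<in>UNIV. dd (ex j) (v i) w * (\<Sum>k\<in>UNIV. Mx u i k w * of_real (\<omega> $ k))) =
        (\<Sum>k\<in>UNIV. of_real (\<omega> $ k) * (\<Sum>i\<in>UNIV. Mx u i k w * dd (ex j) (v i) w))"
        unfolding sum_distrib_left by (subst sum.swap) (simp add: mult_ac)
      also have "\<dots> = (\<Sum>k\<in>UNIV. of_real (\<omega> $ k) * (\<Sum>i\<in>UNIV. Mx u i j w * dd (ex k) (v i) w))"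
        by (simp only: sym[OF w])
      also have "\<dots> = (\<Sum>i\<in>UNIV. Mx u i j w * (\<Sum>k\<in>UNIV. of_real (\<omega> $ k) * dd (ex k) (v i) w))"
        unfolding sum_distrib_left by (subst sum.swap) (simp add: mult_ac)
      finally show ?thesis by (simp only: dd_omega[OF cls_hol[OF v] w])
    qed
    ultimately show ?thesis unfolding X_def by (simp add: distrib_left sum.distrib)
  qed
  hence "(\<Sum>h\<in>UNIV. N h i w * (\<Sum>l\<in>UNIV. Mx u l h w * X l)) = 0" by simp
  moreover have "(\<Sum>h\<in>UNIV. N h i w * (\<Sum>l\<in>UNIV. Mx u l h w * X l)) = X i"
    by (rule inverse_apply_transpose[where M="\<lambda>h i. N h i w" and N="\<lambda>l h. Mx u l h w"]) (rule MN[OF w])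
  ultimately show ?thesis by (simp add: X_def add_eq_0_iff2)
qed

text \<open>The budgets \<open>\<kappa> * (1 - (1/2) ^ j)\<close> leave room for the corrections of all later steps.\<close>

definition stage :: "real \<Rightarrow> (nat \<Rightarrow> real) \<Rightarrow> (nat \<Rightarrow> real) \<Rightarrow> nat \<Rightarrow> ('n \<Rightarrow> 'n cv \<Rightarrow> complex) \<Rightarrow> ('n \<Rightarrow> 'n cv \<Rightarrow> complex) \<Rightarrow>
    ('n \<Rightarrow> 'n cv \<Rightarrow> complex) \<Rightarrow> ('n cv \<Rightarrow> complex) \<Rightarrow> bool" where
  "stage \<kappa> R E j u v lam alp \<longleftrightarrow> St (R j) (E j) u v lam alp \<and>
    (\<forall>i. bnd (3/2) (R j) (\<kappa> * (1 - (1/2) ^ j)) (u i)) \<and> (\<forall>i k. bnd (3/2) (R j) (\<kappa> * (1 - (1/2) ^ j)) (dd (ex k) (u i))) \<and>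
    (\<forall>i. bnd (3/2) (R j) (\<kappa> * (1 - (1/2) ^ j)) (\<lambda>w. v i w - fst w $ i))"

lemma stage_step:
  assumes st: "stage \<kappa> R E j u v lam alp" and \<kappa>: "0 < \<kappa>" "\<kappa> \<le> r0 / 4" "\<kappa> \<le> c1" "\<kappa> \<le> 1 / 10"
    and e: "0 < E j" "L ^ 60 * E j \<le> 1" "L ^ 50 * (E j)\<^sup>2 \<le> E (Suc j)" "L ^ 30 * E j \<le> \<kappa> / 2 * (1/2) ^ j"
    and L: "2 \<le> L" "n \<le> L" "1 / d \<le> L" "sd_loss \<gamma> b TYPE('n) d \<le> L"
    and d: "0 < d" "d \<le> r0 / 16" and r: "R j \<le> r0 / 2" "r0 / 4 \<le> R (Suc j)" "R (Suc j) = R j - 5 * d"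
  shows "\<exists>u' v' lam' alp'. stage \<kappa> R E (Suc j) u' v' lam' alp' \<and>
    (\<forall>i. bnd (3/2) (R (Suc j)) (\<kappa> / 2 * (1/2) ^ j) (\<lambda>w. u' i w - u i w)) \<and>
    (\<forall>i. bnd (3/2) (R (Suc j)) (\<kappa> / 2 * (1/2) ^ j) (\<lambda>w. v' i w - v i w)) \<and>
    (\<forall>i. bnd (3/2) (R (Suc j)) (\<kappa> / 2 * (1/2) ^ j) (\<lambda>w. lam' i w - lam i w)) \<and>
    bnd (3/2) (R (Suc j)) (\<kappa> / 2 * (1/2) ^ j) (\<lambda>w. alp' w - alp w)"
proof -
  have St: "St (R j) (E j) u v lam alp" and bu: "\<And>i. bnd (3/2) (R j) (\<kappa> * (1 - (1/2) ^ j)) (u i)"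
    and bdu: "\<And>i k. bnd (3/2) (R j) (\<kappa> * (1 - (1/2) ^ j)) (dd (ex k) (u i))"
    and bv: "\<And>i. bnd (3/2) (R j) (\<kappa> * (1 - (1/2) ^ j)) (\<lambda>w. v i w - fst w $ i)"
    using st unfolding stage_def by auto
  have r': "r0 / 4 \<le> R j - 5 * d" using r by simp
  let ?r = "R (Suc j)"
  from step[OF St e(1) L d r(1) r' e(2), folded r(3)]
  obtain u' v' lam' alp' where c: "\<forall>i. cls (3/2) ?r (u' i)" "\<forall>i. cls (3/2) ?r (v' i)" "\<forall>i. cls (3/2) ?r (lam' i)"
     "\<forall>i. zind (S (3/2) ?r) (lam' i)" "cls (3/2) ?r alp'" "zind (S (3/2) ?r) alp'"
     "bnd (3/2) ?r (L ^ 50 * (E j)\<^sup>2) (e1 u' v' lam' alp')" "\<forall>i. bnd (3/2) ?r (L ^ 50 * (E j)\<^sup>2) (e2 u' v' lam' i)"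
     "lagr ?r u' v'" and
    i: "\<forall>i. bnd (3/2) ?r (L ^ 30 * E j) (\<lambda>w. u' i w - u i w)"
     "\<forall>i k. bnd (3/2) ?r (L ^ 30 * E j) (\<lambda>w. dd (ex k) (u' i) w - dd (ex k) (u i) w)"
     "\<forall>i. bnd (3/2) ?r (L ^ 30 * E j) (\<lambda>w. v' i w - v i w)"
     "\<forall>i. bnd (3/2) ?r (L ^ 30 * E j) (\<lambda>w. lam' i w - lam i w)"
     "bnd (3/2) ?r (L ^ 30 * E j) (\<lambda>w. alp' w - alp w)" by blast
  have weak: "bnd a x C' g" if "bnd a x C g" "C \<le> C'" for a x C C' and g :: "'n cv \<Rightarrow> complex"
    using that unfolding bnd_def by (meson order_trans)
  have sub: "S (3/2) ?r \<subseteq> (S (3/2) (R j) :: 'n cv set)" by (rule S_mono) (use r d in auto)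
  have budget: "bnd (3/2) ?r (\<kappa> * (1 - (1/2) ^ Suc j)) g'"
    if "bnd (3/2) (R j) (\<kappa> * (1 - (1/2) ^ j)) g" "bnd (3/2) ?r (L ^ 30 * E j) (\<lambda>w. g' w - g w)" for g g' :: "'n cv \<Rightarrow> complex"
    unfolding bnd_def
  proof
    fix w :: "'n cv" assume w: "w \<in> S (3/2) ?r"
    have "cmod (g' w) \<le> cmod (g' w - g w) + cmod (g w)" using norm_triangle_ineq[of "g' w - g w" "g w"] by simp
    also have "\<dots> \<le> \<kappa> / 2 * (1/2) ^ j + \<kappa> * (1 - (1/2) ^ j)"
      by (rule add_mono[OF order_trans[OF bndD[OF that(2) w] e(4)] bndD[OF that(1) subsetD[OF sub w]]])
    also have "\<dots> = \<kappa> * (1 - (1/2) ^ Suc j)" by (simp add: algebra_simps)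
    finally show "cmod (g' w) \<le> \<kappa> * (1 - (1/2) ^ Suc j)" .
  qed
  have k: "\<kappa> * (1 - (1/2) ^ Suc j) \<le> \<kappa>" using \<kappa> by simp
  have B1: "bnd (3/2) ?r (\<kappa> * (1 - (1/2) ^ Suc j)) (u' i)" for i by (rule budget[OF bu]) (use i(1) in blast)
  have B2: "bnd (3/2) ?r (\<kappa> * (1 - (1/2) ^ Suc j)) (dd (ex k) (u' i))" for i k by (rule budget[OF bdu]) (use i(2) in blast)
  have B3: "bnd (3/2) ?r (\<kappa> * (1 - (1/2) ^ Suc j)) (\<lambda>w. v' i w - fst w $ i)" for i
    by (rule budget[OF bv[of i]]) (use i(3) in simp)
  have "St ?r (E (Suc j)) u' v' lam' alp'"
    unfolding St_def using c weak[OF B1 order_trans[OF k \<kappa>(2)]] weak[OF B2 order_trans[OF k \<kappa>(3)]] weak[OF B3 order_trans[OF k \<kappa>(4)]]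
      weak[OF c(7) e(3)] weak[OF spec[OF c(8)] e(3)] by blast
  hence s': "stage \<kappa> R E (Suc j) u' v' lam' alp'" unfolding stage_def using B1 B2 B3 by blast
  show ?thesis
    by (rule exI[of _ u'], rule exI[of _ v'], rule exI[of _ lam'], rule exI[of _ alp'])
      (intro conjI allI s' weak[OF spec[OF i(1)] e(4)] weak[OF spec[OF i(3)] e(4)] weak[OF spec[OF i(4)] e(4)] weak[OF i(5) e(4)])
qed

text \<open>At the unperturbed torus the energy error is f itself and the angle error is, up to
  sign, its action gradient, which is at most \<open>10 * \<eta>\<close> by the Cauchy estimate with
  radius 1/10.\<close>

lemma stage_0:
  assumes R: "R 0 = r0 / 2" and E: "10 * \<eta> \<le> E 0" and \<kappa>: "0 \<le> \<kappa>"
  shows "stage \<kappa> R E 0 (\<lambda>_ _. 0) (\<lambda>i w. fst w $ i) (\<lambda>_ _. 0) (\<lambda>_. 0)"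
proof -
  have e: "emb (\<lambda>i w. fst w $ i) (\<lambda>_ _. 0) w = (w :: 'n cv)" for w by (rule cv_eqI) auto
  have s: "S (3/2) (r0 / 2) \<subseteq> (S 2 r0 :: 'n cv set)" "S (3/2) (r0 / 2) \<subseteq> (S (19/10) r0 :: 'n cv set)" using r0 by (intro S_mono; simp)+
  have 1: "bnd (3/2) (r0 / 2) (E 0) (e1 (\<lambda>_ _. 0) (\<lambda>i w. fst w $ i) (\<lambda>_ _. 0) (\<lambda>_. 0))"
    unfolding bnd_def e1_def e using bndD[OF f(2)] s(1) E \<eta>(1) by fastforce
  have 2: "bnd (3/2) (r0 / 2) (E 0) (e2 (\<lambda>_ _. 0) (\<lambda>i w. fst w $ i) (\<lambda>_ _. 0) i)" for i
    unfolding bnd_def e2_def e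
  proof
    fix w :: "'n cv" assume "w \<in> S (3/2) (r0 / 2)"
    from bndD[OF fy(2) subsetD[OF s(2) this], of i]
    show "cmod (dd (0, cvec \<omega>) (\<lambda>_. 0) w - 0 - fy i w) \<le> E 0" using E by simp
  qed
  have "lagr (r0 / 2) (\<lambda>_ _. 0) (\<lambda>i w. fst w $ i)"
    unfolding lagr_def by (intro exI[of _ "\<lambda>_. 0"]) (simp add: cls_const)
  thus ?thesis unfolding stage_def St_def R
    using 1 2 r0 c1_bounds by (simp add: cls_const cls_fst bnd_def zind_def)
qed

text \<open>The strip losses halve, \<open>L j\<close> grows like \<open>B ^ j\<close> and
  \<open>E j\<close> falls like the inverse of \<open>B ^ (60 * j)\<close>, so that
  \<open>L j ^ 60 * E j\<close> stays constant. This geometric decay is slower than the quadratic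
  estimate would allow, but it reduces the smallness conditions of all steps to the single condition
  on \<open>e0\<close>.\<close>

lemma counterterm_kam:
  assumes \<kappa>: "0 < \<kappa>" "\<kappa> \<le> r0 / 4" "\<kappa> \<le> c1" "\<kappa> \<le> 1 / 10"
    and L0: "2 \<le> L0" "n \<le> L0" "40 / r0 \<le> L0" "sd_loss \<gamma> b TYPE('n) (r0 / 40) \<le> L0"
    and e0: "0 < e0" "10 * \<eta> \<le> e0" "(L0 * 2 ^ (b + CARD('n))) ^ 60 * e0 \<le> \<kappa>"
  shows "\<exists>u v lam. (\<forall>i. cls (3/2) (r0 / 4) (u i)) \<and> (\<forall>i. cls (3/2) (r0 / 4) (v i)) \<and> (\<forall>i. cls (3/2) (r0 / 4) (lam i)) \<and>
    (\<forall>i. zind (S (3/2) (r0 / 4)) (lam i)) \<and> (\<forall>i. bnd (3/2) (r0 / 4) \<kappa> (u i)) \<and> (\<forall>i j. bnd (3/2) (r0 / 4) \<kappa> (dd (ex j) (u i))) \<and>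
    (\<forall>i. bnd (3/2) (r0 / 4) \<kappa> (\<lambda>w. v i w - fst w $ i)) \<and>
    (\<forall>i. \<forall>w \<in> S (3/2) (r0 / 4). dd (0, cvec \<omega>) (u i) w = lam i w + dd (ey i) f (emb v u w)) \<and>
    (\<forall>i. \<forall>w \<in> S (3/2) (r0 / 4). dd (0, cvec \<omega>) (v i) w = - dd (ex i) f (emb v u w))"
proof -
  define B :: real where "B = 2 ^ (b + CARD('n))"
  have B2: "2 \<le> B" unfolding B_def using power_increasing[of 1 "b + CARD('n)" "2::real"] by (simp add: Suc_le_eq)
  hence B0: "0 < B" by simp
  have Bp: "2 ^ j \<le> B ^ j" for j using B2 by (intro power_mono) auto
  \<comment> \<open>The strips shrink from r0 / 2 towards r0 / 4, and consecutive widths differ by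
    \<open>5 * d j\<close>, the cost of one step.\<close>
  define R where "R j = r0 / 4 + r0 / 4 * (1/2) ^ j" for j :: nat
  define d where "d j = r0 / 40 * (1/2) ^ j" for j :: nat
  define L where "L j = L0 * B ^ j" for j :: nat
  define E where "E j = e0 * (1 / B ^ 60) ^ j" for j :: nat
  have key: "(L0 * B) ^ 60 * e0 \<le> \<kappa>" using e0(3) by (simp add: B_def)
  have half: "(1/2::real) ^ j \<le> 1" for j by (rule power_le_one) auto
  have E0: "0 < E j" for j using e0 B0 by (simp add: E_def)
  have LE: "L j ^ 60 * E j = L0 ^ 60 * e0" for j
    using B0 by (simp add: L_def E_def power_mult_distrib power_divide power_mult[symmetric] mult.commute)
  have L060: "L0 ^ 60 * e0 \<le> \<kappa>"
  proof -
    have "L0 ^ 60 * e0 \<le> (L0 * B) ^ 60 * e0" using L0 B2 e0 by (intro mult_right_mono power_mono) auto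
    thus ?thesis using key by simp
  qed
  have L2: "2 \<le> L j" for j
  proof -
    have "1 \<le> B ^ j" using B2 by (intro one_le_power) auto
    from mult_mono[OF L0(1) this] L0 show ?thesis by (simp add: L_def)
  qed
  have L1: "L0 \<le> L j" for j
  proof -
    have "1 \<le> B ^ j" using B2 by (intro one_le_power) auto
    from mult_left_mono[OF this, of L0] L0 show ?thesis by (simp add: L_def)
  qed
  have stp: "\<exists>u' v' lam' alp'. stage \<kappa> R E (Suc j) u' v' lam' alp' \<and>
    (\<forall>i. bnd (3/2) (R (Suc j)) (\<kappa> / 2 * (1/2) ^ j) (\<lambda>w. u' i w - u i w)) \<and>
    (\<forall>i. bnd (3/2) (R (Suc j)) (\<kappa> / 2 * (1/2) ^ j) (\<lambda>w. v' i w - v i w)) \<and>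
    (\<forall>i. bnd (3/2) (R (Suc j)) (\<kappa> / 2 * (1/2) ^ j) (\<lambda>w. lam' i w - lam i w)) \<and>
    bnd (3/2) (R (Suc j)) (\<kappa> / 2 * (1/2) ^ j) (\<lambda>w. alp' w - alp w)" if "stage \<kappa> R E j u v lam alp" for j u v lam alp
  proof (rule stage_step[where L="L j" and d="d j", OF that \<kappa> E0])
    show "L j ^ 60 * E j \<le> 1" using LE[of j] L060 \<kappa>(4) by simp
    show "L j ^ 50 * (E j)\<^sup>2 \<le> E (Suc j)"
    proof -
      have "(B ^ 60 * L j ^ 50) * E j \<le> (B ^ 60 * L j ^ 60) * E j"
        using L2[of j] E0[of j] B0 by (intro mult_right_mono mult_left_mono power_increasing) auto
      also have "\<dots> = (L0 * B) ^ 60 * e0" using LE[of j] by (simp add: power_mult_distrib mult_ac)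
      also have "\<dots> \<le> 1" using key \<kappa>(4) by simp
      finally have "(B ^ 60 * L j ^ 50 * E j) * E j \<le> 1 * E j" using E0[of j] by (intro mult_right_mono) auto
      moreover have "E (Suc j) = E j / B ^ 60" by (simp add: E_def)
      ultimately have "(L j ^ 50 * (E j)\<^sup>2) * B ^ 60 \<le> E (Suc j) * B ^ 60" using B0 by (simp add: power2_eq_square mult_ac)
      thus ?thesis using B0 by simp
    qed
    show "L j ^ 30 * E j \<le> \<kappa> / 2 * (1/2) ^ j"
    proof -
      have "2 * 2 ^ j \<le> L j * L j ^ 29"
      proof (rule mult_mono)
        have "2 ^ j \<le> L j" using mult_mono[of 1 L0 "2 ^ j" "B ^ j"] L0 Bp[of j] by (simp add: L_def)
        also have "\<dots> \<le> L j ^ 29" using L2[of j] by (intro self_le_power) auto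
        finally show "2 ^ j \<le> L j ^ 29" .
      qed (use L2[of j] in auto)
      also have "\<dots> = L j ^ 30" by (simp add: eval_nat_numeral)
      finally have "2 * 2 ^ j * (L j ^ 30 * E j) \<le> L j ^ 30 * (L j ^ 30 * E j)"
        using E0[of j] L2[of j] by (intro mult_right_mono) auto
      also have "\<dots> = L j ^ 60 * E j" by (simp add: mult.assoc[symmetric] power_add[symmetric])
      also have "\<dots> \<le> \<kappa>" using LE L060 by simp
      finally show ?thesis by (simp add: field_simps power_divide)
    qed
    show "2 \<le> L j" by (rule L2)
    show "n \<le> L j" using L0 L1[of j] by simp
    show "1 / d j \<le> L j"
    proof -
      have "1 / d j = 40 / r0 * 2 ^ j" by (simp add: d_def power_divide)
      also have "\<dots> \<le> L0 * B ^ j" using L0 Bp[of j] by (intro mult_mono) auto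
      finally show ?thesis by (simp add: L_def)
    qed
    show "sd_loss \<gamma> b TYPE('n) (d j) \<le> L j"
      unfolding d_def sd_loss_halve L_def B_def[symmetric] using L0 B0 by (intro mult_right_mono) auto
    show "0 < d j" using r0 by (simp add: d_def)
    show "d j \<le> r0 / 16" using r0 mult_mono[OF _ half[of j], of "r0/40" "r0/16"] by (simp add: d_def)
    have "r0 / 4 * (1/2) ^ j \<le> r0 / 4 * 1" using r0 by (intro mult_left_mono half) simp
    thus "R j \<le> r0 / 2" unfolding R_def by linarith
    show "r0 / 4 \<le> R (Suc j)" using r0 by (simp add: R_def)
    show "R (Suc j) = R j - 5 * d j" by (simp add: R_def d_def)
  qed
  define P where "P j x = stage \<kappa> R E j (fst x) (fst (snd x)) (fst (snd (snd x))) (snd (snd (snd x)))" for j and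
    x :: "('n \<Rightarrow> 'n cv \<Rightarrow> complex) \<times> ('n \<Rightarrow> 'n cv \<Rightarrow> complex) \<times> ('n \<Rightarrow> 'n cv \<Rightarrow> complex) \<times> ('n cv \<Rightarrow> complex)"
  define Q where "Q j x y \<longleftrightarrow>
    (\<forall>i. bnd (3/2) (R (Suc j)) (\<kappa> / 2 * (1/2) ^ j) (\<lambda>w. fst y i w - fst x i w)) \<and>
    (\<forall>i. bnd (3/2) (R (Suc j)) (\<kappa> / 2 * (1/2) ^ j) (\<lambda>w. fst (snd y) i w - fst (snd x) i w)) \<and>
    (\<forall>i. bnd (3/2) (R (Suc j)) (\<kappa> / 2 * (1/2) ^ j) (\<lambda>w. fst (snd (snd y)) i w - fst (snd (snd x)) i w)) \<and>
    bnd (3/2) (R (Suc j)) (\<kappa> / 2 * (1/2) ^ j) (\<lambda>w. snd (snd (snd y)) w - snd (snd (snd x)) w)" for j and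
    x y :: "('n \<Rightarrow> 'n cv \<Rightarrow> complex) \<times> ('n \<Rightarrow> 'n cv \<Rightarrow> complex) \<times> ('n \<Rightarrow> 'n cv \<Rightarrow> complex) \<times> ('n cv \<Rightarrow> complex)"
  \<comment> \<open>A step only asserts existence, so the four components are bundled into a tuple
    and chosen successively; \<open>Q\<close> keeps the distance between consecutive tori, which
    yields convergence.\<close>
  have "\<exists>F. \<forall>j. P j (F j) \<and> Q j (F j) (F (Suc j))"
  proof (rule dependent_nat_choice)
    have "P 0 ((\<lambda>_ _. 0), (\<lambda>i w. fst w $ i), (\<lambda>_ _. 0), (\<lambda>_. 0))"
      unfolding P_def fst_conv snd_conv by (rule stage_0) (use e0 \<kappa> in \<open>auto simp: R_def E_def\<close>)
    thus "\<exists>x. P 0 x" by blast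
    fix x j assume "P j x"
    from stp[OF this[unfolded P_def]] show "\<exists>y. P (Suc j) y \<and> Q j x y"
      unfolding P_def Q_def by (elim exE) (rule_tac x="(u', v', lam', alp')" in exI, simp only: fst_conv snd_conv simp_thms)
  qed
  then obtain F where F: "\<And>j. P j (F j)" "\<And>j. Q j (F j) (F (Suc j))" by blast
  define u where "u j = fst (F j)" for j
  define v where "v j = fst (snd (F j))" for j
  define lam where "lam j = fst (snd (snd (F j)))" for j
  define alp where "alp j = snd (snd (snd (F j)))" for j
  have stj: "stage \<kappa> R E j (u j) (v j) (lam j) (alp j)" for j using F(1)[of j] unfolding P_def u_def v_def lam_def alp_def .
  have Qj: "Q j (F j) (F (Suc j))" for j by (rule F(2))
  let ?A = "S (3/2) (r0 / 4) :: 'n cv set"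
  have Rj: "r0 / 4 \<le> R j" for j using r0 by (simp add: R_def)
  have AR: "?A \<subseteq> S (3/2) (R j)" for j by (rule S_mono) (use Rj in auto)
  have c_sub: "cls (3/2) (r0 / 4) g" if "cls (3/2) (R j) g" for g j by (rule cls_subset[OF that Rj order_refl])
  have b_sub: "bnd (3/2) (r0 / 4) C g" if "bnd (3/2) (R j) C g" for g :: "'n cv \<Rightarrow> complex" and j C using that AR unfolding bnd_def by blast
  have Stj: "St (R j) (E j) (u j) (v j) (lam j) (alp j)" for j using stj unfolding stage_def by blast
  have cu: "cls (3/2) (r0 / 4) (u j i)" and cv: "cls (3/2) (r0 / 4) (v j i)" and cl: "cls (3/2) (r0 / 4) (lam j i)" and ca: "cls (3/2) (r0 / 4) (alp j)" for j i
    using Stj[of j] c_sub[of j] unfolding St_def by blast+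
  have Lu: "bnd (3/2) (r0 / 4) (\<kappa> / 2 * (1/2) ^ j) (\<lambda>w. u (Suc j) i w - u j i w)"
    and Lv: "bnd (3/2) (r0 / 4) (\<kappa> / 2 * (1/2) ^ j) (\<lambda>w. v (Suc j) i w - v j i w)"
    and Ll: "bnd (3/2) (r0 / 4) (\<kappa> / 2 * (1/2) ^ j) (\<lambda>w. lam (Suc j) i w - lam j i w)"
    and La: "bnd (3/2) (r0 / 4) (\<kappa> / 2 * (1/2) ^ j) (\<lambda>w. alp (Suc j) w - alp j w)" for j i
    using Qj[of j] b_sub[of "Suc j"] unfolding Q_def u_def v_def lam_def alp_def by blast+
  have "\<forall>i. \<exists>h. cls (3/2) (r0 / 4) h \<and> (\<forall>w\<in>?A. (\<lambda>j. u j i w) \<longlonglongrightarrow> h w) \<and> (\<forall>w\<in>?A. \<forall>e. (\<lambda>j. dd e (u j i) w) \<longlonglongrightarrow> dd e h w)"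
    by (intro allI cls_geometric_limit[where C="\<kappa> / 2"] cu Lu)
  then obtain U where U: "\<And>i. cls (3/2) (r0 / 4) (U i)" "\<And>i w. w \<in> ?A \<Longrightarrow> (\<lambda>j. u j i w) \<longlonglongrightarrow> U i w"
    "\<And>i w e. w \<in> ?A \<Longrightarrow> (\<lambda>j. dd e (u j i) w) \<longlonglongrightarrow> dd e (U i) w" by metis
  have "\<forall>i. \<exists>h. cls (3/2) (r0 / 4) h \<and> (\<forall>w\<in>?A. (\<lambda>j. v j i w) \<longlonglongrightarrow> h w) \<and> (\<forall>w\<in>?A. \<forall>e. (\<lambda>j. dd e (v j i) w) \<longlonglongrightarrow> dd e h w)"
    by (intro allI cls_geometric_limit[where C="\<kappa> / 2"] cv Lv)
  then obtain V where V: "\<And>i. cls (3/2) (r0 / 4) (V i)" "\<And>i w. w \<in> ?A \<Longrightarrow> (\<lambda>j. v j i w) \<longlonglongrightarrow> V i w"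
    "\<And>i w e. w \<in> ?A \<Longrightarrow> (\<lambda>j. dd e (v j i) w) \<longlonglongrightarrow> dd e (V i) w" by metis
  have "\<forall>i. \<exists>h. cls (3/2) (r0 / 4) h \<and> (\<forall>w\<in>?A. (\<lambda>j. lam j i w) \<longlonglongrightarrow> h w) \<and> (\<forall>w\<in>?A. \<forall>e. (\<lambda>j. dd e (lam j i) w) \<longlonglongrightarrow> dd e h w)"
    by (intro allI cls_geometric_limit[where C="\<kappa> / 2"] cl Ll)
  then obtain La' where La': "\<And>i. cls (3/2) (r0 / 4) (La' i)" "\<And>i w. w \<in> ?A \<Longrightarrow> (\<lambda>j. lam j i w) \<longlonglongrightarrow> La' i w" by metis
  obtain Al where Al: "cls (3/2) (r0 / 4) Al" "\<And>w. w \<in> ?A \<Longrightarrow> (\<lambda>j. alp j w) \<longlonglongrightarrow> Al w"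
    using cls_geometric_limit[where g=alp, OF ca La] by blast
  have zlim: "zind ?A h" if "\<And>j. zind (S (3/2) (R j)) (g j)" "\<And>w. w \<in> ?A \<Longrightarrow> (\<lambda>j. g j w) \<longlonglongrightarrow> h w" for g h
  proof (rule zindI)
    fix w w' assume w: "w \<in> ?A" "w' \<in> ?A" "fst w = fst w'"
    have "g j w = g j w'" for j by (rule zindD[OF that(1)]) (use w AR in auto)
    hence "(\<lambda>j. g j w) = (\<lambda>j. g j w')" by blast
    thus "h w = h w'" using that(2)[OF w(1)] that(2)[OF w(2)] LIMSEQ_unique by metis
  qed
  have zl: "zind ?A (La' i)" for i by (rule zlim[OF _ La'(2)]) (use Stj in \<open>simp add: St_def\<close>)
  have za: "zind ?A Al" by (rule zlim[OF _ Al(2)]) (use Stj in \<open>simp add: St_def\<close>)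
  have k1: "\<kappa> * (1 - (1/2) ^ j) \<le> \<kappa>" for j using \<kappa> by simp
  have bk: "bnd (3/2) (r0 / 4) \<kappa> g" if "bnd (3/2) (R j) (\<kappa> * (1 - (1/2) ^ j)) g" for j and g :: "'n cv \<Rightarrow> complex"
    using b_sub[OF that] k1[of j] unfolding bnd_def by (meson order_trans)
  have bu: "bnd (3/2) (r0 / 4) \<kappa> (u j i)" and bdu: "bnd (3/2) (r0 / 4) \<kappa> (dd (ex k) (u j i))" for i j k
    using stj[of j] bk[of j] unfolding stage_def by blast+
  have bU: "bnd (3/2) (r0 / 4) \<kappa> (U i)" for i by (rule bnd_limit[OF U(2) bu])
  have bDU: "bnd (3/2) (r0 / 4) \<kappa> (dd (ex k) (U i))" for i k by (rule bnd_limit[OF U(3) bdu])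
  have bV: "bnd (3/2) (r0 / 4) \<kappa> (\<lambda>w. V i w - fst w $ i)" for i
  proof (rule bnd_limit)
    show "(\<lambda>j. v j i w - fst w $ i) \<longlonglongrightarrow> V i w - fst w $ i" if "w \<in> ?A" for w by (intro tendsto_intros V(2) that)
    show "bnd (3/2) (r0 / 4) \<kappa> (\<lambda>w. v j i w - fst w $ i)" for j using stj[of j] bk[of j] unfolding stage_def by blast
  qed
  have in2: "emb V U w \<in> S 2 r0" if w: "w \<in> ?A" for w
  proof -
    have "emb V U w \<in> S (17/10) r0"
    proof (rule emb_in[OF _ _ w])
      show "cmod (U i w) \<le> r0 / 4" "cmod (V i w - fst w $ i) \<le> 2/10" for i using bndD[OF bU w, of i] bndD[OF bV w, of i] \<kappa> by auto
    qed (use r0 in auto)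
    moreover have "S (17/10) r0 \<subseteq> (S 2 r0 :: 'n cv set)" by (rule S_mono) auto
    ultimately show ?thesis by blast
  qed
  have emb_lim: "(\<lambda>j. emb (v j) (u j) w) \<longlonglongrightarrow> emb V U w" if w: "w \<in> ?A" for w
    unfolding emb_def by (intro tendsto_Pair vec_tendstoI) (simp_all add: tendsto_add U(2)[OF w] V(2)[OF w])
  have comp_lim: "(\<lambda>j. g (emb (v j) (u j) w)) \<longlonglongrightarrow> g (emb V U w)" if "hol (S 2 r0) g" "w \<in> ?A" for g w
    by (rule isCont_tendsto_compose[OF hol_cont[OF that(1) in2[OF that(2)]] emb_lim[OF that(2)]])
  have E_lim: "E \<longlonglongrightarrow> 0"
  proof -
    have "1 < B ^ 60" using B2 by (intro one_less_power) auto
    hence "(\<lambda>j. (1 / B ^ 60) ^ j) \<longlonglongrightarrow> 0" by (intro LIMSEQ_power_zero) (use B0 in auto)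
    from tendsto_mult_left[OF this, of e0] show ?thesis by (simp add: E_def[abs_def])
  qed
  have zero: "x = 0" if "X \<longlonglongrightarrow> x" "\<And>j. cmod (X j) \<le> E j" for x X
    using LIMSEQ_unique[OF that(1) Lim_null_comparison[OF _ E_lim]] that(2) by auto
  have Z1: "e1 U V La' Al w = 0" if w: "w \<in> ?A" for w
  proof (rule zero)
    show "(\<lambda>j. e1 (u j) (v j) (lam j) (alp j) w) \<longlonglongrightarrow> e1 U V La' Al w" unfolding e1_def
      by (intro tendsto_intros comp_lim[OF cls_hol[OF f(1)] w] La'(2) V(2) Al(2) w)
    show "cmod (e1 (u j) (v j) (lam j) (alp j) w) \<le> E j" for j
      using Stj[of j] w AR unfolding St_def bnd_def by blast
  qed
  have Z2: "e2 U V La' i w = 0" if w: "w \<in> ?A" for i w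
  proof (rule zero)
    show "(\<lambda>j. e2 (u j) (v j) (lam j) i w) \<longlonglongrightarrow> e2 U V La' i w" unfolding e2_def
      by (intro tendsto_intros comp_lim[OF cls_hol[OF fy(1)] w] La'(2) U(3) w)
    show "cmod (e2 (u j) (v j) (lam j) i w) \<le> E j" for j
      using Stj[of j] w AR unfolding St_def bnd_def by blast
  qed
  have symm: "(\<Sum>i\<in>UNIV. Mx U i a w * dd (ex k) (V i) w) = (\<Sum>i\<in>UNIV. Mx U i k w * dd (ex a) (V i) w)" if w: "w \<in> ?A" for a k w
  proof (rule LIMSEQ_unique)
    show "(\<lambda>j. \<Sum>i\<in>UNIV. Mx (u j) i a w * dd (ex k) (v j i) w) \<longlonglongrightarrow> (\<Sum>i\<in>UNIV. Mx U i a w * dd (ex k) (V i) w)"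
      unfolding Mx_def by (intro tendsto_intros U(3) V(3) w)
    have "(\<Sum>i\<in>UNIV. Mx (u j) i a w * dd (ex k) (v j i) w) = (\<Sum>i\<in>UNIV. Mx (u j) i k w * dd (ex a) (v j i) w)" for j
    proof -
      have "\<forall>i. cls (3/2) (R j) (u j i)" "\<forall>i. cls (3/2) (R j) (v j i)" "lagr (R j) (u j) (v j)"
        using Stj[of j] unfolding St_def by blast+
      from lagrange_symmetric[OF spec[OF this(1)] spec[OF this(2)] this(3) subsetD[OF AR w]] show ?thesis .
    qed
    moreover have "(\<lambda>j. \<Sum>i\<in>UNIV. Mx (u j) i k w * dd (ex a) (v j i) w) \<longlonglongrightarrow> (\<Sum>i\<in>UNIV. Mx U i k w * dd (ex a) (V i) w)"
      unfolding Mx_def by (intro tendsto_intros U(3) V(3) w)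
    ultimately show "(\<lambda>j. \<Sum>i\<in>UNIV. Mx (u j) i a w * dd (ex k) (v j i) w) \<longlonglongrightarrow> (\<Sum>i\<in>UNIV. Mx U i k w * dd (ex a) (V i) w)" by simp
  qed
  have bDU1: "bnd (3/2) (r0 / 4) c1 (dd (ex k) (U i))" for i k using bDU[of k i] \<kappa>(3) unfolding bnd_def by (meson order_trans)
  have D1: "dd (0, cvec \<omega>) (U i) w = La' i w + dd (ey i) f (emb V U w)" if "w \<in> ?A" for i w
    using Z2[OF that, of i] by (simp add: e2_def fy_def algebra_simps)
  have D2: "dd (0, cvec \<omega>) (V i) w = - dd (ex i) f (emb V U w)" if "w \<in> ?A" for i w
    by (rule invariance_from_energy[OF U(1) V(1) cls_hol[OF La'(1)] zl cls_hol[OF Al(1)] za in2 Z1 Z2 symm bDU1 that])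
  show ?thesis
    by (rule exI[of _ U], rule exI[of _ V], rule exI[of _ La']) (intro conjI allI ballI U(1) V(1) La'(1) zl bU bDU bV D1 D2; assumption)
qed

end

section \<open>Real tori\<close>
lemma convex_line_S: "convex {t. p + t \<odot> h \<in> S a r}"
proof (rule convexI)
  fix s t :: complex and x y :: real
  assume st: "s \<in> {t. p + t \<odot> h \<in> S a r}" "t \<in> {t. p + t \<odot> h \<in> S a r}" and xy: "0 \<le> x" "0 \<le> y" "x + y = 1"
  have sS: "p + s \<odot> h \<in> S a r" and tS: "p + t \<odot> h \<in> S a r" using st by auto
  have comb: "c + (x *\<^sub>R s + y *\<^sub>R t) * d = x *\<^sub>R (c + s * d) + y *\<^sub>R (c + t * d)" for c d
  proof -
    have "c = x *\<^sub>R c + y *\<^sub>R c" using xy(3) by (metis scaleR_add_left scaleR_one)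
    thus ?thesis by (simp add: algebra_simps)
  qed
  have nth: "fst (p + z \<odot> h) $ i = fst p $ i + z * fst h $ i" "snd (p + z \<odot> h) $ i = snd p $ i + z * snd h $ i" for z i by simp_all
  have "p + (x *\<^sub>R s + y *\<^sub>R t) \<odot> h \<in> S a r"
  proof (rule S_I)
    fix i
    have "cmod (x *\<^sub>R (fst p $ i + s * fst h $ i) + y *\<^sub>R (fst p $ i + t * fst h $ i)) \<le>
      x * cmod (fst p $ i + s * fst h $ i) + y * cmod (fst p $ i + t * fst h $ i)"
      using norm_triangle_ineq[of "x *\<^sub>R (fst p $ i + s * fst h $ i)" "y *\<^sub>R (fst p $ i + t * fst h $ i)"] xy by simp
    also have "\<dots> < a" using S_D(1)[OF sS, of i] S_D(1)[OF tS, of i] xy by (intro convex_bound_lt) auto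
    finally show "cmod (fst (p + (x *\<^sub>R s + y *\<^sub>R t) \<odot> h) $ i) < a" unfolding nth comb .
    have "\<bar>x * Im (snd p $ i + s * snd h $ i) + y * Im (snd p $ i + t * snd h $ i)\<bar> \<le>
      x * \<bar>Im (snd p $ i + s * snd h $ i)\<bar> + y * \<bar>Im (snd p $ i + t * snd h $ i)\<bar>"
      using abs_triangle_ineq[of "x * Im (snd p $ i + s * snd h $ i)" "y * Im (snd p $ i + t * snd h $ i)"] xy
      by (simp add: abs_mult)
    also have "\<dots> < r" using S_D(2)[OF sS, of i] S_D(2)[OF tS, of i] xy by (intro convex_bound_lt) auto
    finally show "\<bar>Im (snd (p + (x *\<^sub>R s + y *\<^sub>R t) \<odot> h) $ i)\<bar> < r"
      unfolding nth comb plus_complex.sel scaleR_complex.sel .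
  qed
  thus "x *\<^sub>R s + y *\<^sub>R t \<in> {t. p + t \<odot> h \<in> S a r}" by simp
qed

text \<open>The complex line through the point \<open>w\<close> and its real part reduces this to one variable.\<close>

lemma hol_zero_on_reals:
  fixes g :: "'n::finite cv \<Rightarrow> complex"
  assumes g: "hol (S a r) g" and z: "\<And>w. w \<in> S a r \<Longrightarrow> cnjv w = w \<Longrightarrow> g w = 0" and w: "w \<in> S a r"
  shows "g w = 0"
proof -
  define p :: "'n cv" where "p = (\<chi> i. of_real (Re (fst w $ i)), \<chi> i. of_real (Re (snd w $ i)))"
  define h :: "'n cv" where "h = (\<chi> i. of_real (Im (fst w $ i)), \<chi> i. of_real (Im (snd w $ i)))"
  define T where "T = {t. p + t \<odot> h \<in> S a r}"
  have wph: "w = p + \<i> \<odot> h" by (rule cv_eqI) (auto simp: p_def h_def complex_eq_iff)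
  have oT: "open T"
  proof -
    have "open ((\<lambda>t. p + t \<odot> h) -` S a r)"
      by (rule continuous_open_vimage[OF open_S]) (intro continuous_intros linear_continuous_at bounded_linear_cs)
    thus ?thesis by (simp add: T_def vimage_def)
  qed
  have T0: "0 \<in> T"
    unfolding T_def mem_Collect_eq
  proof (rule S_I)
    fix i
    show "cmod (fst (p + 0 \<odot> h) $ i) < a" using S_D(1)[OF w, of i] abs_Re_le_cmod[of "fst w $ i"] by (simp add: p_def)
    show "\<bar>Im (snd (p + 0 \<odot> h) $ i)\<bar> < r" using S_D(2)[OF w, of i] by (simp add: p_def)
  qed
  have "0 islimpt (T \<inter> \<real>)"
    unfolding islimpt_approachable
  proof (intro allI impI)
    fix e :: real assume e: "0 < e"
    obtain d where d: "d > 0" "ball 0 d \<subseteq> T" using oT T0 by (meson openE)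
    let ?x = "complex_of_real (min d e / 2)"
    have "?x \<in> T" using d e by (intro subsetD[OF d(2)]) auto
    thus "\<exists>x'\<in>T \<inter> \<real>. x' \<noteq> 0 \<and> dist x' 0 < e" using d e by (intro bexI[of _ ?x]) (auto simp del: of_real_divide)
  qed
  moreover have "g (p + t \<odot> h) = 0" if t: "t \<in> T \<inter> \<real>" for t
  proof (rule z)
    show "p + t \<odot> h \<in> S a r" using t by (simp add: T_def)
    have "t \<in> \<real>" using t by blast
    then obtain x where "t = of_real x" using Reals_cases by blast
    thus "cnjv (p + t \<odot> h) = p + t \<odot> h" by (intro cv_eqI) (auto simp: cnjv_def p_def h_def)
  qed
  moreover have "(\<lambda>t. g (p + t \<odot> h)) holomorphic_on T" by (rule hol_line_holomorphic[OF g]) (simp add: T_def)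
  moreover have "\<i> \<in> T" using w by (simp add: T_def wph[symmetric])
  moreover have "connected T" unfolding T_def by (intro convex_connected convex_line_S)
  ultimately have "g (p + \<i> \<odot> h) = 0"
    using analytic_continuation[of "\<lambda>t. g (p + t \<odot> h)" T "T \<inter> \<real>" 0 \<i>] oT T0 by blast
  thus ?thesis using wph by simp
qed

text \<open>The complex extension of P is only given to be real at real points. Its difference from
  its own reflection is holomorphic and vanishes there, hence everywhere.\<close>

lemma cnj_symmetric_if_real:
  fixes g :: "'n::finite cv \<Rightarrow> complex"
  assumes g: "hol (S a r) g" and z: "\<And>w. w \<in> S a r \<Longrightarrow> cnjv w = w \<Longrightarrow> cnj (g w) = g w" and w: "w \<in> S a r"
  shows "g (cnjv w) = cnj (g w)"
proof -
  have "g w - cnj (g (cnjv w)) = 0"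
    by (rule hol_zero_on_reals[OF hol_diff(1)[OF g hol_cnj(1)[OF g]] _ w]) (simp add: z)
  thus ?thesis by (metis complex_cnj_cnj eq_iff_diff_eq_0)
qed

section \<open>The lattice of periods and the torus as a quotient\<close>

lemma cvec_nth [simp]: "cvec v $ i = of_real (v $ i)" by (simp add: cvec_def)

lemma cvec_add: "cvec (v + w) = cvec v + cvec w"
  by (simp add: vec_eq_iff)

lemma period_axis: "cvec (period (axis i 1)) = of_real (2 * pi) *s axis i 1"
  by (simp add: vec_eq_iff period_def axis_def)

lemma cls_period:
  fixes w :: "'n::finite cv"
  assumes g: "cls a r g" and w: "w \<in> S a r"
  shows "g (w + (0, cvec (period k))) = g w"
proof -
  have S: "w + (0, cvec v) \<in> S a r" if "w \<in> S a r" for v and w :: "'n cv"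
    by (rule S_I) (use S_D[OF that] in auto)
  have nat: "g (w + of_nat m \<odot> (of_real (2 * pi) \<odot> ex i)) = g w" if "w \<in> S a r" for m i w
  proof (induction m)
    case (Suc m)
    have "w + of_nat m \<odot> (of_real (2 * pi) \<odot> ex i) \<in> S a r"
      using S_shift_real[OF that, of "real m * (2 * pi)" i] by (simp add: cs_cs)
    from cls_periodic[OF g this, of i] Suc show ?case by (simp add: cs_add add_ac)
  qed simp
  have int: "g (w + of_int m \<odot> (of_real (2 * pi) \<odot> ex i)) = g w" if "w \<in> S a r" for m i w
  proof (cases "m \<ge> 0")
    case True
    thus ?thesis using nat[OF that, of "nat m" i] by simp
  next
    case False
    let ?w = "w + of_int m \<odot> (of_real (2 * pi) \<odot> ex i)"
    have "?w \<in> S a r" using S_shift_real[OF that, of "of_int m * (2 * pi)" i] by (simp add: cs_cs)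
    from nat[OF this, of "nat (- m)" i] False show ?thesis by (simp add: add.assoc cs_add[symmetric])
  qed
  have "g (w + (0, cvec (period (\<chi> i. if i \<in> I then k $ i else 0)))) = g w" if "finite I" for I
    using that
  proof (induction I)
    case empty
    have "(0, cvec (period (\<chi> i. 0))) = (0 :: 'n cv)" by (rule cv_eqI) (auto simp: period_def)
    thus ?case by simp
  next
    case (insert j I)
    let ?v = "w + (0, cvec (period (\<chi> i. if i \<in> I then k $ i else 0)))"
    have e: "w + (0, cvec (period (\<chi> i. if i \<in> insert j I then k $ i else 0))) = ?v + of_int (k $ j) \<odot> (of_real (2 * pi) \<odot> ex j)"
      by (rule cv_eqI) (use insert(2) in \<open>auto simp: period_def axis_def\<close>)
    show ?case unfolding e int[OF S[OF w]] by (rule insert.IH)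
  qed
  from this[of UNIV] show ?thesis by simp
qed

lemma angle_in_std_torus: "angle \<theta> \<in> std_torus" by (simp add: angle_def std_torus_def)

lemma angle_period [simp]: "angle (\<theta> + period k) = angle \<theta>"
proof -
  have "cis (2 * pi * real_of_int m) = 1" for m :: int by (simp add: cis.ctr complex_eq_iff)
  thus ?thesis by (simp add: angle_def vec_eq_iff period_def cis_mult[symmetric])
qed

lemma angle_eqD:
  assumes "angle \<theta> = angle (\<theta>' :: real^'n)"
  shows "\<exists>k. \<theta> = \<theta>' + period k"
proof -
  have "\<forall>i. \<exists>m::int. \<theta> $ i = \<theta>' $ i + 2 * pi * m"
  proof
    fix i
    have "cis (\<theta> $ i) = cis (\<theta>' $ i)" using assms by (simp add: angle_def vec_eq_iff)
    hence "sin (\<theta> $ i) = sin (\<theta>' $ i) \<and> cos (\<theta> $ i) = cos (\<theta>' $ i)" by (simp add: complex_eq_iff)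
    thus "\<exists>m::int. \<theta> $ i = \<theta>' $ i + 2 * pi * m" using sin_cos_eq_iff by blast
  qed
  then obtain m where "\<And>i. \<theta> $ i = \<theta>' $ i + 2 * pi * real_of_int (m i)" by metis
  thus ?thesis by (intro exI[of _ "\<chi> i. m i"]) (simp add: vec_eq_iff period_def)
qed

lemma continuous_angle: "continuous_on A angle"
  unfolding angle_def by (intro continuous_intros)

lemma std_torus_eq: "std_torus = angle ` cbox (\<chi> i. - pi) (\<chi> i. pi :: real ^ 'n)"
proof -
  have "z \<in> angle ` cbox (\<chi> i. - pi) (\<chi> i. pi)" if z: "z \<in> std_torus" for z :: "complex^'n"
  proof (rule image_eqI)
    have n1: "cmod (z $ i) = 1" for i using z by (simp add: std_torus_def)
    have "z $ i \<noteq> 0" for i using n1[of i] by auto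
    hence "cis (Arg (z $ i)) = z $ i" for i by (simp add: cis_Arg sgn_eq n1)
    thus "z = angle (\<chi> i. Arg (z $ i))" by (simp add: angle_def vec_eq_iff)
    show "(\<chi> i. Arg (z $ i)) \<in> cbox (\<chi> i. - pi) (\<chi> i. pi)"
      using Arg_bounded[of "z $ _"] by (auto simp: mem_box_cart less_imp_le)
  qed
  thus ?thesis using angle_in_std_torus by blast
qed

lemma compact_std_torus: "compact (std_torus :: (complex^'n) set)"
  unfolding std_torus_eq by (intro compact_continuous_image continuous_angle compact_cbox)

text \<open>The angle map is closed on the fundamental cube, so continuity descends to the torus.\<close>

lemma continuous_on_std_torus:
  fixes \<Phi> :: "complex^'n \<Rightarrow> 'b::topological_space"
  assumes "continuous_on UNIV (\<lambda>\<theta>. \<Phi> (angle \<theta>))"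
  shows "continuous_on std_torus \<Phi>"
  unfolding continuous_on_closed_vimage[OF compact_imp_closed[OF compact_std_torus]]
proof (intro allI impI)
  fix B :: "'b set" assume B: "closed B"
  let ?C = "cbox (\<chi> i. - pi) (\<chi> i. pi) :: (real^'n) set"
  have "closed ((\<lambda>\<theta>. \<Phi> (angle \<theta>)) -` B)" by (rule closed_vimage[OF B assms])
  hence "compact (((\<lambda>\<theta>. \<Phi> (angle \<theta>)) -` B) \<inter> ?C)" by (intro closed_Int_compact compact_cbox)
  hence "closed (angle ` (((\<lambda>\<theta>. \<Phi> (angle \<theta>)) -` B) \<inter> ?C))"
    by (intro compact_imp_closed compact_continuous_image continuous_angle)
  moreover have "angle ` (((\<lambda>\<theta>. \<Phi> (angle \<theta>)) -` B) \<inter> ?C) = \<Phi> -` B \<inter> std_torus"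
    unfolding std_torus_eq by auto
  ultimately show "closed (\<Phi> -` B \<inter> std_torus)" by simp
qed

text \<open>In the l1 norm u contracts by 1/2, so adding u to the angles is injective, also modulo
  the lattice because u is periodic. Compactness of the torus then upgrades the continuous injection
  to a homeomorphism onto its image.\<close>

lemma torus_embedding:
  fixes u v :: "real^'n \<Rightarrow> real^'n"
  assumes cont: "continuous_on UNIV u" "continuous_on UNIV v"
    and per: "\<And>\<theta> k. u (\<theta> + period k) = u \<theta>" "\<And>\<theta> k. v (\<theta> + period k) = v \<theta>"
    and lip: "\<And>\<theta> \<theta>'. (\<Sum>i\<in>UNIV. \<bar>u \<theta> $ i - u \<theta>' $ i\<bar>) \<le> 1 / 2 * (\<Sum>i\<in>UNIV. \<bar>\<theta> $ i - \<theta>' $ i\<bar>)"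
  shows "\<exists>T \<Phi> \<Psi>. homeomorphism std_torus T \<Phi> \<Psi> \<and> (\<forall>\<theta>. \<Phi> (angle \<theta>) = (v \<theta>, angle (\<theta> + u \<theta>))) \<and> T \<subseteq> range v \<times> std_torus"
proof -
  \<comment> \<open>An arbitrary lift of a torus point to angles; periodicity of u and v makes
    \<open>\<Phi>\<close> independent of the choice.\<close>
  define sec :: "complex^'n \<Rightarrow> real^'n" where "sec z = (SOME \<theta>. angle \<theta> = z)" for z
  define \<Phi> where "\<Phi> z = (v (sec z), angle (sec z + u (sec z)))" for z
  have \<Phi>: "\<Phi> (angle \<theta>) = (v \<theta>, angle (\<theta> + u \<theta>))" for \<theta>
  proof -
    have "angle (sec (angle \<theta>)) = angle \<theta>" unfolding sec_def by (rule someI[of _ \<theta>]) simp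
    then obtain k where k: "sec (angle \<theta>) = \<theta> + period k" using angle_eqD by blast
    have "\<theta> + period k + u \<theta> = (\<theta> + u \<theta>) + period k" by simp
    thus ?thesis unfolding \<Phi>_def k per by (simp only: angle_period)
  qed
  have "continuous_on UNIV (\<lambda>\<theta>. (v \<theta>, angle (\<theta> + u \<theta>)))"
    by (intro continuous_intros cont continuous_on_compose2[OF continuous_angle[of UNIV]]) auto
  hence c: "continuous_on std_torus \<Phi>" by (intro continuous_on_std_torus) (simp add: \<Phi>)
  have "inj_on \<Phi> std_torus"
  proof (rule inj_onI)
    fix z z' assume z: "z \<in> std_torus" "z' \<in> std_torus" and eq: "\<Phi> z = \<Phi> z'"
    obtain \<theta> \<theta>' where t: "z = angle \<theta>" "z' = angle \<theta>'" using z unfolding std_torus_eq by blast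
    have "angle (\<theta> + u \<theta>) = angle (\<theta>' + u \<theta>')" using eq unfolding t \<Phi> by simp
    then obtain k where k: "\<theta> + u \<theta> = \<theta>' + u \<theta>' + period k" using angle_eqD by blast
    let ?t = "\<theta>' + period k"
    have "\<theta> - ?t = u ?t - u \<theta>" using k per(1)[of \<theta>' k] by (simp add: algebra_simps)
    hence "\<bar>\<theta> $ i - ?t $ i\<bar> = \<bar>u \<theta> $ i - u ?t $ i\<bar>" for i by (metis abs_minus_commute vector_minus_component)
    hence "(\<Sum>i\<in>UNIV. \<bar>\<theta> $ i - ?t $ i\<bar>) \<le> 1 / 2 * (\<Sum>i\<in>UNIV. \<bar>\<theta> $ i - ?t $ i\<bar>)" using lip[of \<theta> ?t] by simp
    moreover have "0 \<le> (\<Sum>i\<in>UNIV. \<bar>\<theta> $ i - ?t $ i\<bar>)" by (rule sum_nonneg) simp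
    ultimately have "(\<Sum>i\<in>UNIV. \<bar>\<theta> $ i - ?t $ i\<bar>) = 0" by linarith
    hence "\<theta> = ?t" by (subst (asm) sum_nonneg_eq_0_iff) (auto simp: vec_eq_iff)
    thus "z = z'" unfolding t by (metis angle_period)
  qed
  from homeomorphism_compact[OF compact_std_torus c refl this]
  obtain \<Psi> where "homeomorphism std_torus (\<Phi> ` std_torus) \<Phi> \<Psi>" by blast
  moreover have "\<Phi> ` std_torus \<subseteq> range v \<times> std_torus"
    unfolding std_torus_eq[symmetric] using angle_in_std_torus by (auto simp: \<Phi>_def)
  ultimately show ?thesis using \<Phi> by blast
qed

text \<open>If \<phi>' stayed within \<delta> of a larger A, then \<phi> would drift at a positive
  rate; \<open>T\<close> is a time at which the drift exceeds the oscillation 2 K. This average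
  along one orbit takes the place of an average over the torus.\<close>

lemma bounded_primitive_average:
  fixes \<phi> :: "real \<Rightarrow> complex"
  assumes d: "\<And>t. (\<phi> has_vector_derivative \<phi>' t) (at t)" and K: "\<And>t. cmod (\<phi> t) \<le> K" and A: "\<And>t. cmod (\<phi>' t - A) \<le> \<delta>"
  shows "cmod A \<le> \<delta>"
proof (rule ccontr)
  assume "\<not> cmod A \<le> \<delta>"
  hence pos: "0 < cmod A - \<delta>" by simp
  have d0: "0 \<le> \<delta>" using order_trans[OF norm_ge_zero A] .
  have K0: "0 \<le> K" using order_trans[OF norm_ge_zero K] .
  define T where "T = (2 * K + 1) / (cmod A - \<delta>)"
  have T: "0 < T" "T * (cmod A - \<delta>) = 2 * K + 1" using pos K0 by (auto simp: T_def)
  have "norm ((\<phi> T - T *\<^sub>R A) - (\<phi> 0 - 0 *\<^sub>R A)) \<le> \<delta> * norm (T - 0)"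
  proof (rule differentiable_bound[where S=UNIV])
    fix t :: real
    have "((\<lambda>t. \<phi> t - t *\<^sub>R A) has_vector_derivative (\<phi>' t - A)) (at t)"
      by (auto intro!: derivative_eq_intros d)
    thus "((\<lambda>t. \<phi> t - t *\<^sub>R A) has_derivative (\<lambda>x. x *\<^sub>R (\<phi>' t - A))) (at t within UNIV)"
      by (simp add: has_vector_derivative_def)
    show "onorm (\<lambda>x. x *\<^sub>R (\<phi>' t - A)) \<le> \<delta>"
      by (rule onorm_bound[OF d0]) (simp add: mult.commute[of \<delta>] mult_left_mono[OF A])
  qed auto
  hence "cmod (\<phi> T - T *\<^sub>R A - \<phi> 0) \<le> \<delta> * T" using T by simp
  moreover have "T *\<^sub>R A = (\<phi> T - \<phi> 0) - (\<phi> T - T *\<^sub>R A - \<phi> 0)" by simp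
  hence "cmod (T *\<^sub>R A) \<le> cmod (\<phi> T - \<phi> 0) + cmod (\<phi> T - T *\<^sub>R A - \<phi> 0)" by (metis norm_triangle_ineq4)
  moreover have "cmod (\<phi> T - \<phi> 0) \<le> 2 * K" using norm_triangle_ineq4[of "\<phi> T" "\<phi> 0"] K[of T] K[of 0] by simp
  ultimately have "T * cmod A \<le> 2 * K + \<delta> * T" using T by simp
  thus False using T by (simp add: algebra_simps)
qed

text \<open>Apply Brouwer to c + lam c clamped to the cube. At a fixed point a component of lam
  could be nonzero only on a face where it points outwards, which the sign conditions
  exclude.\<close>

lemma poincare_miranda:
  fixes lam :: "real^'n \<Rightarrow> real^'n"
  assumes cont: "continuous_on {c. \<forall>i. \<bar>c $ i\<bar> \<le> 1} lam"
    and up: "\<And>c i. \<forall>i. \<bar>c $ i\<bar> \<le> 1 \<Longrightarrow> c $ i = 1 \<Longrightarrow> lam c $ i \<le> 0"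
    and dn: "\<And>c i. \<forall>i. \<bar>c $ i\<bar> \<le> 1 \<Longrightarrow> c $ i = -1 \<Longrightarrow> 0 \<le> lam c $ i"
  shows "\<exists>c. (\<forall>i. \<bar>c $ i\<bar> \<le> 1) \<and> lam c = 0"
proof -
  let ?Q = "{c :: real^'n. \<forall>i. \<bar>c $ i\<bar> \<le> 1}"
  have Q: "?Q = cbox (\<chi> i. -1) (\<chi> i. 1)" by (auto simp: mem_box_cart abs_le_iff minus_le_iff)
  let ?g = "\<lambda>c. \<chi> i. max (-1) (min 1 (c $ i + lam c $ i))"
  obtain c where c: "c \<in> ?Q" "?g c = c"
  proof (rule brouwer[of ?Q ?g])
    show "compact ?Q" "convex ?Q" unfolding Q by (auto intro: compact_cbox convex_box)
    show "?Q \<noteq> {}" by (auto intro!: exI[of _ 0])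
    show "continuous_on ?Q ?g" by (intro continuous_intros cont)
    show "?g \<in> ?Q \<rightarrow> ?Q" by (auto simp: abs_le_iff minus_le_iff)
  qed
  have "lam c $ i = 0" for i
  proof -
    have e: "max (-1) (min 1 (c $ i + lam c $ i)) = c $ i" using c(2) by (simp add: vec_eq_iff)
    have "c $ i = 1 \<Longrightarrow> lam c $ i \<le> 0" "c $ i = -1 \<Longrightarrow> 0 \<le> lam c $ i" using up dn c(1) by auto
    thus ?thesis using e by (auto simp: max_def min_def split: if_splits)
  qed
  thus ?thesis using c(1) by (intro exI[of _ c]) (auto simp: vec_eq_iff)
qed

text \<open>The holomorphic extension of the twist term: squares instead of squared moduli, and a
  polynomial because the exponent 2l + 2 is even.\<close>

definition hpow :: "nat \<Rightarrow> 'n::finite cv \<Rightarrow> complex" where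
  "hpow l w = (\<Sum>i\<in>UNIV. (fst w $ i)\<^sup>2) ^ (l + 1) / of_nat (2 * l + 2)"

lemma cls_hpow: "cls a r (hpow l :: 'n::finite cv \<Rightarrow> complex)"
proof -
  have p: "cls a r (\<lambda>w. g w ^ k)" if "cls a r g" for g :: "'n cv \<Rightarrow> complex" and k
    by (induction k) (auto intro: cls_const cls_mult that)
  have "cls a r (\<lambda>w::'n cv. (1 / of_nat (2 * l + 2)) * (\<Sum>i\<in>UNIV. (fst w $ i)\<^sup>2) ^ (l + 1) :: complex)"
    by (intro cls_mult cls_const p cls_sum cls_fst) simp
  thus ?thesis by (simp add: hpow_def[abs_def])
qed

lemma dd_hpow: "dd (ey i) (hpow l) w = (\<Sum>k\<in>UNIV. (fst w $ k)\<^sup>2) ^ l * fst w $ i"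
proof -
  have "((\<lambda>t. (fst (w + t \<odot> ey i) $ k)\<^sup>2) has_field_derivative 2 * fst w $ k * axis i 1 $ k) (at 0)" for k
    by (auto intro!: derivative_eq_intros)
  from DERIV_sum[OF this] have "((\<lambda>t. \<Sum>k\<in>UNIV. (fst (w + t \<odot> ey i) $ k)\<^sup>2) has_field_derivative (\<Sum>k\<in>UNIV. 2 * fst w $ k * axis i 1 $ k)) (at 0)"
    .
  from DERIV_cdivide[OF DERIV_power[OF this, of "l + 1"], of "of_nat (2 * l + 2)"]
  have "((\<lambda>t. hpow l (w + t \<odot> ey i)) has_field_derivative
     (of_nat (l + 1) * (\<Sum>k\<in>UNIV. (fst w $ k)\<^sup>2) ^ l * (\<Sum>k\<in>UNIV. 2 * fst w $ k * axis i 1 $ k)) / of_nat (2 * l + 2)) (at 0)"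
    unfolding hpow_def by (simp add: mult_ac)
  moreover have "(\<Sum>k\<in>UNIV. 2 * fst w $ k * axis i 1 $ k) = 2 * fst w $ i"
    by (simp add: axis_def if_distrib cong: if_cong)
  moreover have "(of_nat (l + 1) * X * (2 * Y)) / of_nat (2 * l + 2) = X * Y" for X Y :: complex
  proof -
    have "of_nat (2 * l + 2) = 2 * (of_nat (l + 1) :: complex)" by simp
    moreover have "(of_nat (l + 1) :: complex) \<noteq> 0" using of_nat_0_neq[of l] by simp
    ultimately show ?thesis by (simp add: field_simps del: of_nat_Suc of_nat_add)
  qed
  ultimately have "((\<lambda>t. hpow l (w + t \<odot> ey i)) has_field_derivative (\<Sum>k\<in>UNIV. (fst w $ k)\<^sup>2) ^ l * fst w $ i) (at 0)" by simp
  thus ?thesis unfolding dd_def by (rule DERIV_imp_deriv)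
qed

section \<open>Real points and real curves in the complex domain\<close>

definition rp :: "real^'n \<Rightarrow> real^'n \<Rightarrow> 'n::finite cv" where "rp c \<theta> = (cvec c, cvec \<theta>)"

lemma fst_rp [simp]: "fst (rp c \<theta>) $ i = of_real (c $ i)" and snd_rp [simp]: "snd (rp c \<theta>) $ i = of_real (\<theta> $ i)"
  by (simp_all add: rp_def)

lemma rp_in_S: "(\<And>i. \<bar>c $ i\<bar> < a) \<Longrightarrow> 0 < r \<Longrightarrow> rp c \<theta> \<in> S a r"
  by (rule S_I) auto

lemma rp_add: "rp c (\<theta> + t *\<^sub>R v) = rp c \<theta> + of_real t \<odot> (0, cvec v)"
  by (rule cv_eqI) auto

lemma rp_period: "rp c (\<theta> + period k) = rp c \<theta> + (0, cvec (period k))"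
  by (rule cv_eqI) auto

lemma cnjv_rp [simp]: "cnjv (rp c \<theta>) = rp c \<theta>"
  by (rule cv_eqI) (auto simp: cnjv_def)

lemma cls_rp_real:
  assumes "cls a r g" "rp c \<theta> \<in> S a r"
  shows "of_real (Re (g (rp c \<theta>))) = g (rp c \<theta>)"
  using cls_sym[OF assms] by (simp add: complex_eq_iff)

lemma bounded_linear_cvec: "bounded_linear (cvec :: real^'n \<Rightarrow> complex^'n)"
proof (rule linear_conv_bounded_linear[THEN iffD1], rule linearI)
  show "cvec (x + y) = cvec x + cvec y" for x y :: "real^'n" by (rule cvec_add)
  show "cvec (c *\<^sub>R x) = c *\<^sub>R cvec x" for c and x :: "real^'n" by (simp add: vec_eq_iff scaleR_conv_of_real[where 'a=complex])
qed

lemma continuous_rp: "continuous_on A (\<lambda>x. rp (f x) (g x))" if "continuous_on A f" "continuous_on A g"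
  unfolding rp_def by (intro continuous_on_Pair bounded_linear.continuous_on[OF bounded_linear_cvec] that)

lemma hol_rp_line:
  assumes g: "hol (S a r) g" and w: "\<And>\<theta>. rp c \<theta> \<in> S a r"
  shows "((\<lambda>t. g (rp c (\<theta> + t *\<^sub>R v))) has_vector_derivative dd (0, cvec v) g (rp c (\<theta> + t *\<^sub>R v))) (at t)"
  unfolding rp_add
  by (rule has_vector_derivative_real_field[OF hol_line[OF g]]) (use w[of "\<theta> + t *\<^sub>R v"] in \<open>simp only: rp_add\<close>)

lemma has_vector_derivative_chi:
  fixes g :: "'n::finite \<Rightarrow> real \<Rightarrow> real"
  assumes "\<And>i. (g i has_vector_derivative d i) (at t)"
  shows "((\<lambda>t. \<chi> i. g i t) has_vector_derivative (\<chi> i. d i)) (at t)"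
proof -
  have "((\<lambda>t. \<chi> i. g i t) has_derivative (\<lambda>h. \<chi> i. h *\<^sub>R d i)) (at t)"
    by (rule has_derivative_chi) (use assms in \<open>simp add: has_vector_derivative_def\<close>)
  moreover have "(\<lambda>h. \<chi> i. h *\<^sub>R d i) = (\<lambda>h. h *\<^sub>R (\<chi> i. d i))" by (simp add: vec_eq_iff fun_eq_iff)
  ultimately show ?thesis by (simp add: has_vector_derivative_def)
qed

lemma rp_lipschitz:
  fixes g :: "'n::finite cv \<Rightarrow> complex"
  assumes g: "hol (S a r) g" and w: "\<And>\<theta>. rp c \<theta> \<in> S a r" and b: "\<And>j. bnd a r \<kappa> (dd (ex j) g)"
  shows "cmod (g (rp c \<theta>) - g (rp c \<theta>')) \<le> \<kappa> * (\<Sum>j\<in>UNIV. \<bar>\<theta> $ j - \<theta>' $ j\<bar>)"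
proof -
  let ?v = "\<theta> - \<theta>'"
  have k0: "0 \<le> \<kappa>" using order_trans[OF norm_ge_zero bndD[OF b w]] .
  have dv: "cmod (dd (0, cvec ?v) g (rp c \<theta>)) \<le> \<kappa> * (\<Sum>j\<in>UNIV. \<bar>?v $ j\<bar>)" for \<theta>
  proof -
    have "cmod (\<Sum>j\<in>UNIV. of_real (?v $ j) * dd (ex j) g (rp c \<theta>)) \<le> (\<Sum>j\<in>UNIV. \<kappa> * \<bar>?v $ j\<bar>)"
      by (rule sum_norm_le) (simp only: norm_mult norm_of_real mult.commute[of \<kappa>], intro mult_left_mono bndD[OF b w] abs_ge_zero)
    thus ?thesis unfolding dd_omega[OF g w] sum_distrib_left .
  qed
  have "cmod (g (rp c (\<theta>' + 1 *\<^sub>R ?v)) - g (rp c (\<theta>' + 0 *\<^sub>R ?v))) \<le> (\<kappa> * (\<Sum>j\<in>UNIV. \<bar>?v $ j\<bar>)) * norm (1 - 0 :: real)"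
  proof (rule differentiable_bound[where S=UNIV])
    fix t :: real
    show "((\<lambda>t. g (rp c (\<theta>' + t *\<^sub>R ?v))) has_derivative (\<lambda>h. h *\<^sub>R dd (0, cvec ?v) g (rp c (\<theta>' + t *\<^sub>R ?v)))) (at t within UNIV)"
      using hol_rp_line[OF g w] by (simp add: has_vector_derivative_def)
    show "onorm (\<lambda>h. h *\<^sub>R dd (0, cvec ?v) g (rp c (\<theta>' + t *\<^sub>R ?v))) \<le> \<kappa> * (\<Sum>j\<in>UNIV. \<bar>?v $ j\<bar>)"
    proof (rule onorm_bound)
      show "0 \<le> \<kappa> * (\<Sum>j\<in>UNIV. \<bar>?v $ j\<bar>)" by (intro mult_nonneg_nonneg k0 sum_nonneg) simp
      show "norm (h *\<^sub>R dd (0, cvec ?v) g (rp c (\<theta>' + t *\<^sub>R ?v))) \<le> \<kappa> * (\<Sum>j\<in>UNIV. \<bar>?v $ j\<bar>) * norm h" for h :: real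
        unfolding norm_scaleR real_norm_def mult.commute[of "\<bar>h\<bar>"] by (rule mult_right_mono[OF dv]) simp
    qed
  qed auto
  thus ?thesis by simp
qed

text \<open>The scaling y = \<rho> Y is only conformally symplectic, and the prefactor \<rho> of f
  compensates for that: it cancels in the action gradient and remains in the angle gradient, where
  it matches the velocity of \<rho> Y.\<close>

lemma gradient_hamiltonian:
  fixes f :: "'n::finite cv \<Rightarrow> complex" and \<omega> Y x :: "real^'n"
  assumes f: "hol (S 2 r0) f" "0 < r0" and \<rho>: "0 < \<rho>"
    and H: "\<And>y x. \<forall>i. \<bar>y $ i\<bar> < 2 * \<rho> \<Longrightarrow> H y x = \<omega> \<bullet> y + \<rho> * Re (f (rp ((1/\<rho>) *\<^sub>R y) x))"
    and Y: "\<And>i. \<bar>Y $ i\<bar> < 2"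
  shows "GDERIV (\<lambda>v. H v x) (\<rho> *\<^sub>R Y) :> (\<chi> i. \<omega> $ i + Re (dd (ey i) f (rp Y x)))"
    "GDERIV (\<lambda>u. H (\<rho> *\<^sub>R Y) u) x :> (\<chi> i. \<rho> * Re (dd (ex i) f (rp Y x)))"
proof -
  have w: "rp Y x \<in> S 2 r0" by (rule rp_in_S[OF Y f(2)])
  have sc: "(1/\<rho>) *\<^sub>R (\<rho> *\<^sub>R Y) = Y" using \<rho> by simp
  note dcv = bounded_linear.has_derivative[OF bounded_linear_cvec]
  have d1: "((\<lambda>v. rp ((1/\<rho>) *\<^sub>R v) x) has_derivative (\<lambda>h. (cvec ((1/\<rho>) *\<^sub>R h), 0))) (at (\<rho> *\<^sub>R Y))"
    unfolding rp_def by (intro has_derivative_Pair has_derivative_const dcv has_derivative_scaleR_right has_derivative_ident)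
  have "((\<lambda>v. f (rp ((1/\<rho>) *\<^sub>R v) x)) has_derivative (\<lambda>h. dd (cvec ((1/\<rho>) *\<^sub>R h), 0) f (rp Y x))) (at (\<rho> *\<^sub>R Y))"
    by (rule has_derivative_compose[OF d1, of f "\<lambda>h. dd h f (rp Y x)", unfolded sc, OF hol_D(1)[OF f(1) w]])
  from bounded_linear.has_derivative[OF bounded_linear_Re this]
  have "((\<lambda>v. \<omega> \<bullet> v + \<rho> * Re (f (rp ((1/\<rho>) *\<^sub>R v) x))) has_derivative (\<lambda>h. \<omega> \<bullet> h + \<rho> * Re (dd (cvec ((1/\<rho>) *\<^sub>R h), 0) f (rp Y x)))) (at (\<rho> *\<^sub>R Y))"
    by (intro has_derivative_add bounded_linear.has_derivative[OF bounded_linear_inner_right has_derivative_ident] has_derivative_mult_right)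
  moreover have "\<omega> \<bullet> h + \<rho> * Re (dd (cvec ((1/\<rho>) *\<^sub>R h), 0) f (rp Y x)) = h \<bullet> (\<chi> i. \<omega> $ i + Re (dd (ey i) f (rp Y x)))" for h
  proof -
    have "dd (cvec ((1/\<rho>) *\<^sub>R h), 0) f (rp Y x) = (\<Sum>i\<in>UNIV. of_real (h $ i / \<rho>) * dd (ey i) f (rp Y x))"
      using dd_decomp[OF f(1) w, of "(cvec ((1/\<rho>) *\<^sub>R h), 0)"] by simp
    hence "\<rho> * Re (dd (cvec ((1/\<rho>) *\<^sub>R h), 0) f (rp Y x)) = (\<Sum>i\<in>UNIV. h $ i * Re (dd (ey i) f (rp Y x)))"
      using \<rho> by (simp add: sum_distrib_left del: of_real_divide)
    thus ?thesis by (simp add: inner_vec_def distrib_left sum.distrib mult.commute)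
  qed
  ultimately have d2: "((\<lambda>v. \<omega> \<bullet> v + \<rho> * Re (f (rp ((1/\<rho>) *\<^sub>R v) x))) has_derivative (\<lambda>h. h \<bullet> (\<chi> i. \<omega> $ i + Re (dd (ey i) f (rp Y x))))) (at (\<rho> *\<^sub>R Y))"
    by simp
  have "((\<lambda>v. H v x) has_derivative (\<lambda>h. h \<bullet> (\<chi> i. \<omega> $ i + Re (dd (ey i) f (rp Y x))))) (at (\<rho> *\<^sub>R Y))"
  proof (rule has_derivative_transform_within_open[OF d2])
    show "open (box (\<chi> i. - 2 * \<rho>) (\<chi> i. 2 * \<rho>) :: (real^'n) set)" by (rule open_box)
    show "\<rho> *\<^sub>R Y \<in> box (\<chi> i. - 2 * \<rho>) (\<chi> i. 2 * \<rho>)"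
    proof -
      have "\<bar>\<rho> * Y $ i\<bar> < 2 * \<rho>" for i using mult_strict_left_mono[OF Y \<rho>, of i] \<rho> by (simp add: abs_mult)
      hence "- 2 * \<rho> < \<rho> * Y $ i \<and> \<rho> * Y $ i < 2 * \<rho>" for i unfolding abs_less_iff by (simp add: minus_less_iff)
      thus ?thesis by (simp add: mem_box_cart)
    qed
    fix v :: "real^'n" assume "v \<in> box (\<chi> i. - 2 * \<rho>) (\<chi> i. 2 * \<rho>)"
    hence "\<forall>i. \<bar>v $ i\<bar> < 2 * \<rho>" by (simp add: mem_box_cart abs_less_iff minus_less_iff)
    thus "\<omega> \<bullet> v + \<rho> * Re (f (rp ((1/\<rho>) *\<^sub>R v) x)) = H v x" by (simp add: H)
  qed
  thus "GDERIV (\<lambda>v. H v x) (\<rho> *\<^sub>R Y) :> (\<chi> i. \<omega> $ i + Re (dd (ey i) f (rp Y x)))" by (simp add: gderiv_def)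
  have "\<forall>i. \<bar>(\<rho> *\<^sub>R Y) $ i\<bar> < 2 * \<rho>" using mult_strict_left_mono[OF Y \<rho>] \<rho> by (simp add: abs_mult mult.commute)
  hence He: "H (\<rho> *\<^sub>R Y) u = \<omega> \<bullet> (\<rho> *\<^sub>R Y) + \<rho> * Re (f (rp Y u))" for u using H[of "\<rho> *\<^sub>R Y" u] unfolding sc by blast
  have "((\<lambda>u. rp Y u) has_derivative (\<lambda>h. (0, cvec h))) (at x)"
    unfolding rp_def by (intro has_derivative_Pair has_derivative_const dcv has_derivative_ident)
  from has_derivative_compose[OF this hol_D(1)[OF f(1) w]]
  have "((\<lambda>u. f (rp Y u)) has_derivative (\<lambda>h. dd (0, cvec h) f (rp Y x))) (at x)" .
  from has_derivative_add[OF has_derivative_const has_derivative_mult_right[OF bounded_linear.has_derivative[OF bounded_linear_Re this]]]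
  have "((\<lambda>u. H (\<rho> *\<^sub>R Y) u) has_derivative (\<lambda>h. \<rho> * Re (dd (0, cvec h) f (rp Y x)))) (at x)"
    unfolding He by simp
  moreover have "\<rho> * Re (dd (0, cvec h) f (rp Y x)) = h \<bullet> (\<chi> i. \<rho> * Re (dd (ex i) f (rp Y x)))" for h
    unfolding dd_omega[OF f(1) w] by (simp add: inner_vec_def sum_distrib_left mult_ac)
  ultimately show "GDERIV (\<lambda>u. H (\<rho> *\<^sub>R Y) u) x :> (\<chi> i. \<rho> * Re (dd (ex i) f (rp Y x)))" by (simp add: gderiv_def)
qed

text \<open>The gradient of \<open>hpow\<close> in the actions.\<close>

definition hq :: "nat \<Rightarrow> 'n \<Rightarrow> complex^'n \<Rightarrow> complex" where
  "hq l i p = (\<Sum>k\<in>UNIV. (p $ k)\<^sup>2) ^ l * p $ i"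

lemma norm_le_sum_nth: "norm (p :: 'a::real_normed_vector^'n) \<le> (\<Sum>k\<in>UNIV. norm (p $ k))"
  unfolding norm_vec_def by (rule L2_set_le_sum) simp

text \<open>Uniform continuity on a ball replaces an explicit estimate of the polynomial. The
  tolerance depends only on l and the dimension, so it can be fixed before all smallness
  conditions.\<close>

lemma hq_uniform:
  "\<exists>\<kappa>>0. \<forall>(p::complex^'n) q i. (\<forall>k. cmod (p $ k) \<le> 1) \<longrightarrow> (\<forall>k. cmod (q $ k - p $ k) \<le> \<kappa>) \<longrightarrow> cmod (hq l i q - hq l i p) \<le> 1 / 4"
proof -
  let ?N = "real CARD('n)"
  let ?B = "cball 0 (2 * ?N) :: (complex^'n) set"
  have N: "0 < ?N" by simp
  have "uniformly_continuous_on ?B (\<lambda>p. \<chi> i. hq l i p)"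
    unfolding hq_def by (intro compact_uniformly_continuous continuous_intros compact_cball)
  then obtain d where d: "0 < d" "\<And>p q. p \<in> ?B \<Longrightarrow> q \<in> ?B \<Longrightarrow> dist q p < d \<Longrightarrow> dist (\<chi> i. hq l i q) (\<chi> i. hq l i p) < 1 / 4"
    unfolding uniformly_continuous_on_def by (metis zero_less_divide_1_iff zero_less_numeral)
  define \<kappa> where "\<kappa> = min 1 (d / (2 * ?N))"
  have k0: "0 < \<kappa>" using d N by (simp add: \<kappa>_def)
  have "cmod (hq l i q - hq l i p) \<le> 1 / 4" if p: "\<forall>k. cmod (p $ k) \<le> 1" and q: "\<forall>k. cmod (q $ k - p $ k) \<le> \<kappa>" for p q :: "complex^'n" and i
  proof -
    have nb: "norm x \<le> ?N * C" if "\<forall>k. cmod (x $ k) \<le> C" for x :: "complex^'n" and C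
      using order_trans[OF norm_le_sum_nth sum_bounded_above[of UNIV "\<lambda>k. cmod (x $ k)" C]] that by simp
    have "cmod (q $ k) \<le> 2" for k
      using norm_triangle_ineq[of "q $ k - p $ k" "p $ k"] p[rule_format, of k] q[rule_format, of k] by (simp add: \<kappa>_def)
    hence "q \<in> ?B" using nb[of q 2] by (simp add: mult.commute)
    moreover have "p \<in> ?B" using nb[of p 1] p N by simp
    moreover have "dist q p < d"
    proof -
      have "norm (q - p) \<le> ?N * \<kappa>" using nb[of "q - p" \<kappa>] q by simp
      also have "\<dots> \<le> ?N * (d / (2 * ?N))" by (intro mult_left_mono) (auto simp: \<kappa>_def)
      also have "\<dots> < d" using d N by simp
      finally show ?thesis by (simp add: dist_norm)
    qed
    ultimately have lt: "norm ((\<chi> i. hq l i q) - (\<chi> i. hq l i p)) < 1 / 4" using d(2) by (simp add: dist_norm)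
    have "cmod (((\<chi> i. hq l i q) - (\<chi> i. hq l i p)) $ i) < 1 / 4" by (rule order_le_less_trans[OF Finite_Cartesian_Product.norm_nth_le lt])
    thus ?thesis by simp
  qed
  thus ?thesis using k0 by blast
qed

text \<open>Componentwise bounds become Euclidean ones at the cost of a factor n, hence the products
  with the dimension. The distance to G is estimated by the distance to its point 0, and the
  conjugation symmetry of the extension follows from its values at real points.\<close>

lemma analytic_bounded_scaled:
  fixes p :: "real^'n \<Rightarrow> real^'n \<Rightarrow> real"
  assumes an: "analytic_bounded_on G s r M p" and G0: "0 \<in> G" and \<rho>: "0 < \<rho>" "real CARD('n) * (2 * \<rho>) \<le> s"
    and GG: "\<And>y. \<forall>i. \<bar>y $ i\<bar> < 2 * \<rho> \<Longrightarrow> y \<in> G" and r0: "0 < r0" "real CARD('n) * r0 \<le> r"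
  shows "\<exists>g. cls 2 r0 g \<and> bnd 2 r0 M g \<and> (\<forall>y x. (\<forall>i. \<bar>y $ i\<bar> < 2 * \<rho>) \<longrightarrow> g (rp ((1/\<rho>) *\<^sub>R y) x) = of_real (p y x))"
proof -
  obtain F where F: "holomorphic2_on F (complex_nbhd G s r)"
      "\<forall>(y, x) \<in> complex_nbhd G s r. \<forall>k. F y (x + cvec (period k)) = F y x"
      "\<forall>(y, x) \<in> complex_nbhd G s r. cmod (F y x) \<le> M"
      "\<forall>y\<in>G. \<forall>x. F (cvec y) (cvec x) = complex_of_real (p y x)"
    using an unfolding analytic_bounded_on_def by blast
  define F' where "F' = (\<lambda>(y, x). F y x)"
  have hF: "hol (complex_nbhd G s r) F'"
    unfolding hol_def
  proof
    fix z assume "z \<in> complex_nbhd G s r"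
    then obtain D where D: "(F' has_derivative D) (at z)" "\<And>c u v. D (c *s u, c *s v) = c * D (u, v)"
      using F(1) unfolding holomorphic2_on_def F'_def by blast
    show "\<exists>D. (F' has_derivative D) (at z) \<and> (\<forall>c h. D (c \<odot> h) = c * D h)"
      using D by (intro exI[of _ D]) (simp add: cs_def)
  qed
  define sc :: "'n cv \<Rightarrow> 'n cv" where "sc w = (\<chi> i. of_real \<rho> * fst w $ i, \<chi> i. snd w $ i)" for w
  define g where "g w = F' (sc w)" for w
  have less: "norm (x :: 'a::real_normed_vector^'n) < real CARD('n) * C" if "\<And>k. norm (x $ k) < C" for x C
  proof -
    have "(\<Sum>k\<in>UNIV. norm (x $ k)) < (\<Sum>k\<in>(UNIV :: 'n set). C)" by (rule sum_strict_mono) (use that in auto)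
    thus ?thesis using norm_le_sum_nth[of x] by simp
  qed
  have sc_in: "sc w \<in> complex_nbhd G s r" if w: "w \<in> S 2 r0" for w
  proof -
    have "norm (fst (sc w)) < real CARD('n) * (2 * \<rho>)"
    proof (rule less)
      fix k show "cmod (fst (sc w) $ k) < 2 * \<rho>" using S_D(1)[OF w, of k] \<rho> by (simp add: sc_def norm_mult mult.commute)
    qed
    moreover have "infdist (fst (sc w)) (cvec ` G) \<le> dist (fst (sc w)) (cvec 0)" by (rule infdist_le) (use G0 in blast)
    moreover have "cvec 0 = (0 :: complex^'n)" by (simp add: vec_eq_iff)
    ultimately have 1: "infdist (fst (sc w)) (cvec ` G) < s" using \<rho>(2) by simp
    have "norm (\<chi> i. Im (snd (sc w) $ i)) < real CARD('n) * r0"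
    proof (rule less)
      fix k show "norm ((\<chi> i. Im (snd (sc w) $ i)) $ k) < r0" using S_D(2)[OF w, of k] by (simp add: sc_def)
    qed
    thus ?thesis unfolding complex_nbhd_def using 1 r0(2) by (auto simp: sc_def)
  qed
  have bg: "bnd 2 r0 M g"
    unfolding bnd_def
  proof
    fix w :: "'n cv" assume "w \<in> S 2 r0"
    from bspec[OF F(3) sc_in[OF this]]
    show "cmod (g w) \<le> M" by (simp add: g_def F'_def case_prod_beta)
  qed
  have hg: "hol (S 2 r0) g" unfolding g_def sc_def
    by (rule hol_compose(1)[OF hF hol_cmult(1)[OF hol_fst(1)] hol_snd(1)]) (use sc_in in \<open>simp add: sc_def\<close>)
  have real: "g (rp ((1/\<rho>) *\<^sub>R y) x) = of_real (p y x)" if "\<forall>i. \<bar>y $ i\<bar> < 2 * \<rho>" for y x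
  proof -
    have "sc (rp ((1/\<rho>) *\<^sub>R y) x) = (cvec y, cvec x)" by (rule cv_eqI) (use \<rho> in \<open>auto simp: sc_def\<close>)
    thus ?thesis unfolding g_def F'_def using F(4) GG[OF that] by simp
  qed
  have "cls 2 r0 g"
  proof (rule clsI[OF hg])
    fix w :: "'n cv" assume w: "w \<in> S 2 r0"
    show "g (w + of_real (2 * pi) \<odot> ex i) = g w" for i
    proof -
      have "sc (w + of_real (2 * pi) \<odot> ex i) = (fst (sc w), snd (sc w) + cvec (period (axis i 1)))"
        by (rule cv_eqI) (auto simp: sc_def period_axis)
      moreover have "F (fst (sc w)) (snd (sc w) + cvec (period (axis i 1))) = F (fst (sc w)) (snd (sc w))"
        using bspec[OF F(2) sc_in[OF w]] by (simp add: case_prod_beta)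
      ultimately show ?thesis by (simp add: g_def F'_def case_prod_beta)
    qed
    show "g (cnjv w) = cnj (g w)"
    proof (rule cnj_symmetric_if_real[OF hg _ w])
      fix w :: "'n cv" assume w: "w \<in> S 2 r0" and c: "cnjv w = w"
      define y x where "y = (\<chi> i. \<rho> * Re (fst w $ i))" and "x = (\<chi> i. Re (snd w $ i))"
      have "fst w $ i = of_real (Re (fst w $ i))" "snd w $ i = of_real (Re (snd w $ i))" for i
        using arg_cong[OF c, of "\<lambda>w. fst w $ i"] arg_cong[OF c, of "\<lambda>w. snd w $ i"] by (auto simp: cnjv_def complex_eq_iff)
      hence e: "w = rp ((1/\<rho>) *\<^sub>R y) x" using \<rho> by (intro cv_eqI) (auto simp: y_def x_def)
      have "\<forall>i. \<bar>y $ i\<bar> < 2 * \<rho>"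
      proof
        fix i
        have "\<bar>Re (fst w $ i)\<bar> < 2" using abs_Re_le_cmod[of "fst w $ i"] S_D(1)[OF w, of i] by simp
        thus "\<bar>y $ i\<bar> < 2 * \<rho>" using \<rho> by (simp add: y_def abs_mult mult.commute)
      qed
      from real[OF this] show "cnj (g w) = g w" unfolding e by simp
    qed
  qed
  thus ?thesis using bg real by blast
qed

context kam
begin

text \<open>Where the counterterm vanishes, the equations for \<open>U\<close> and \<open>V\<close>
  along the linear flow are Hamilton's equations in rescaled actions. Being independent of the
  angles, the counterterm vanishes on the whole torus as soon as it does at angle 0.\<close>

lemma torus_from_solution:
  assumes U: "\<And>i. cls (3/2) (r0 / 4) (U i)" and V: "\<And>i. cls (3/2) (r0 / 4) (V i)"
    and zl: "\<And>i. zind (S (3/2) (r0 / 4)) (lam i)"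
    and bDU: "\<And>i j. bnd (3/2) (r0 / 4) c1 (dd (ex j) (U i))" and bV: "\<And>i. bnd (3/2) (r0 / 4) (1/10) (\<lambda>w. V i w - fst w $ i)"
    and DU: "\<And>i w. w \<in> S (3/2) (r0 / 4) \<Longrightarrow> dd (0, cvec \<omega>) (U i) w = lam i w + dd (ey i) f (emb V U w)"
    and DV: "\<And>i w. w \<in> S (3/2) (r0 / 4) \<Longrightarrow> dd (0, cvec \<omega>) (V i) w = - dd (ex i) f (emb V U w)"
    and c: "\<forall>i. \<bar>c $ i\<bar> \<le> 1" "\<And>i. lam i (rp c 0) = 0" and \<rho>: "0 < \<rho>"
    and H: "\<And>y x. \<forall>i. \<bar>y $ i\<bar> < 2 * \<rho> \<Longrightarrow> H y x = \<omega> \<bullet> y + \<rho> * Re (f (rp ((1/\<rho>) *\<^sub>R y) x))"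
    and G: "\<And>y. \<forall>i. \<bar>y $ i\<bar> < 2 * \<rho> \<Longrightarrow> y \<in> interior G"
  shows "\<exists>T. invariant_torus G H \<omega> T"
proof -
  have w: "rp c \<theta> \<in> S (3/2) (r0 / 4)" for \<theta> by (rule rp_in_S[OF le_less_trans[OF spec[OF c(1)]]]) (use r0 in auto)
  define u where "u \<theta> = (\<chi> i. Re (U i (rp c \<theta>)))" for \<theta>
  define v where "v \<theta> = (\<chi> i. Re (V i (rp c \<theta>)))" for \<theta>
  have Ur: "U i (rp c \<theta>) = of_real (u \<theta> $ i)" for i \<theta> using cls_rp_real[OF U w] by (simp add: u_def)
  have Vr: "V i (rp c \<theta>) = of_real (v \<theta> $ i)" for i \<theta> using cls_rp_real[OF V w] by (simp add: v_def)
  have embr: "emb V U (rp c \<theta>) = rp (v \<theta>) (\<theta> + u \<theta>)" for \<theta> by (rule cv_eqI) (auto simp: Ur Vr)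
  have contc: "continuous_on UNIV (\<lambda>\<theta>. \<chi> i. Re (g i (rp c \<theta>)))" if "\<And>i. cls (3/2) (r0 / 4) (g i)" for g
    by (intro continuous_on_vec_lambda continuous_on_Re
        continuous_on_compose2[OF hol_cont_on[OF cls_hol[OF that]] continuous_rp[OF continuous_on_const continuous_on_id]]) (use w in auto)
  have cu: "continuous_on UNIV u" and cv: "continuous_on UNIV v" unfolding u_def[abs_def] v_def[abs_def] by (intro contc U V)+
  have pu: "u (\<theta> + period k) = u \<theta>" and pv: "v (\<theta> + period k) = v \<theta>" for \<theta> k
    unfolding u_def v_def rp_period by (simp_all add: cls_period[OF U w] cls_period[OF V w])
  have lip: "(\<Sum>i\<in>UNIV. \<bar>u \<theta> $ i - u \<theta>' $ i\<bar>) \<le> 1 / 2 * (\<Sum>i\<in>UNIV. \<bar>\<theta> $ i - \<theta>' $ i\<bar>)" for \<theta> \<theta>'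
  proof -
    have "\<bar>u \<theta> $ i - u \<theta>' $ i\<bar> \<le> c1 * (\<Sum>j\<in>UNIV. \<bar>\<theta> $ j - \<theta>' $ j\<bar>)" for i
      using rp_lipschitz[OF cls_hol[OF U] w bDU, of i \<theta> \<theta>'] unfolding Ur of_real_diff[symmetric] norm_of_real .
    hence "(\<Sum>i\<in>UNIV. \<bar>u \<theta> $ i - u \<theta>' $ i\<bar>) \<le> (\<Sum>i\<in>(UNIV::'n set). c1 * (\<Sum>j\<in>UNIV. \<bar>\<theta> $ j - \<theta>' $ j\<bar>))" by (rule sum_mono)
    also have "\<dots> = n * c1 * (\<Sum>j\<in>UNIV. \<bar>\<theta> $ j - \<theta>' $ j\<bar>)" by (simp add: n)
    also have "\<dots> \<le> 1 / 2 * (\<Sum>j\<in>UNIV. \<bar>\<theta> $ j - \<theta>' $ j\<bar>)"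
      using c1_bounds(4) by (intro mult_right_mono sum_nonneg) auto
    finally show ?thesis .
  qed
  have vb: "\<bar>v \<theta> $ i\<bar> < 2" for \<theta> i
  proof -
    have "V i (rp c \<theta>) - fst (rp c \<theta>) $ i = of_real (v \<theta> $ i - c $ i)" by (simp add: Vr)
    hence "\<bar>v \<theta> $ i - c $ i\<bar> \<le> 1/10" using bndD[OF bV w, of i \<theta>] by (simp only: norm_of_real)
    thus ?thesis using c(1)[rule_format, of i] by linarith
  qed
  have "\<exists>T \<Phi> \<Psi>. homeomorphism std_torus T \<Phi> \<Psi> \<and> (\<forall>\<theta>. \<Phi> (angle \<theta>) = (\<rho> *\<^sub>R v \<theta>, angle (\<theta> + u \<theta>))) \<and> T \<subseteq> range (\<lambda>\<theta>. \<rho> *\<^sub>R v \<theta>) \<times> std_torus"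
    by (rule torus_embedding) (use cu cv pu pv lip in \<open>auto intro: continuous_on_scaleR continuous_on_const\<close>)
  then obtain T \<Phi> \<Psi> where T: "homeomorphism std_torus T \<Phi> \<Psi>" "\<And>\<theta>. \<Phi> (angle \<theta>) = (\<rho> *\<^sub>R v \<theta>, angle (\<theta> + u \<theta>))"
     "T \<subseteq> range (\<lambda>\<theta>. \<rho> *\<^sub>R v \<theta>) \<times> std_torus" by blast
  have vG: "\<rho> *\<^sub>R v \<theta> \<in> interior G" for \<theta>
    by (rule G) (use mult_strict_left_mono[OF vb \<rho>] \<rho> in \<open>simp add: abs_mult mult.commute\<close>)
  have ham: "hamiltonian_motion H (\<lambda>t. \<rho> *\<^sub>R v (\<theta> + t *\<^sub>R \<omega>)) (\<lambda>t. \<theta> + t *\<^sub>R \<omega> + u (\<theta> + t *\<^sub>R \<omega>))" for \<theta>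
    unfolding hamiltonian_motion_def
  proof
    fix t
    let ?\<theta> = "\<theta> + t *\<^sub>R \<omega>"
    let ?z = "rp (v ?\<theta>) (?\<theta> + u ?\<theta>)"
    let ?Hy = "\<chi> i. \<omega> $ i + Re (dd (ey i) f ?z)" and ?Hx = "\<chi> i. \<rho> * Re (dd (ex i) f ?z)"
    have lam0: "lam i (rp c ?\<theta>) = 0" for i using zindD[OF zl w[of ?\<theta>] w[of 0], of i] c(2)[of i] by (simp add: rp_def)
    have dr: "((\<lambda>t. Re (g (rp c (\<theta> + t *\<^sub>R \<omega>)))) has_vector_derivative Re (dd (0, cvec \<omega>) g (rp c ?\<theta>))) (at t)" if "cls (3/2) (r0 / 4) g" for g
      by (rule bounded_linear.has_vector_derivative[OF bounded_linear_Re hol_rp_line[OF cls_hol[OF that] w]])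
    have "((\<lambda>t. v (\<theta> + t *\<^sub>R \<omega>)) has_vector_derivative (\<chi> i. - Re (dd (ex i) f ?z))) (at t)"
      unfolding v_def by (rule has_vector_derivative_chi) (use dr[OF V] DV[OF w] embr in \<open>simp add: v_def\<close>)
    hence "((\<lambda>t. \<rho> *\<^sub>R v (\<theta> + t *\<^sub>R \<omega>)) has_vector_derivative \<rho> *\<^sub>R (\<chi> i. - Re (dd (ex i) f ?z))) (at t)"
      by (rule bounded_linear.has_vector_derivative[OF bounded_linear_scaleR_right])
    moreover have "\<rho> *\<^sub>R (\<chi> i. - Re (dd (ex i) f ?z)) = - ?Hx" by (simp add: vec_eq_iff)
    ultimately have 1: "((\<lambda>t. \<rho> *\<^sub>R v (\<theta> + t *\<^sub>R \<omega>)) has_vector_derivative - ?Hx) (at t)" by simp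
    have "((\<lambda>t. u (\<theta> + t *\<^sub>R \<omega>)) has_vector_derivative (\<chi> i. Re (dd (ey i) f ?z))) (at t)"
      unfolding u_def by (rule has_vector_derivative_chi) (use dr[OF U] DU[OF w] embr lam0 in \<open>simp add: u_def\<close>)
    hence "((\<lambda>t. \<theta> + t *\<^sub>R \<omega> + u (\<theta> + t *\<^sub>R \<omega>)) has_vector_derivative (\<omega> + (\<chi> i. Re (dd (ey i) f ?z)))) (at t)"
      by (auto intro!: derivative_eq_intros)
    moreover have "\<omega> + (\<chi> i. Re (dd (ey i) f ?z)) = ?Hy" by (simp add: vec_eq_iff)
    ultimately have 2: "((\<lambda>t. \<theta> + t *\<^sub>R \<omega> + u (\<theta> + t *\<^sub>R \<omega>)) has_vector_derivative ?Hy) (at t)" by simp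
    have gr: "GDERIV (\<lambda>v. H v (?\<theta> + u ?\<theta>)) (\<rho> *\<^sub>R v ?\<theta>) :> ?Hy" "GDERIV (\<lambda>u. H (\<rho> *\<^sub>R v ?\<theta>) u) (?\<theta> + u ?\<theta>) :> ?Hx"
      by (rule gradient_hamiltonian[OF cls_hol[OF f(1)] r0(1) \<rho> H vb]; assumption)+
    show "\<exists>Hy Hx. GDERIV (\<lambda>v. H v (?\<theta> + u ?\<theta>)) (\<rho> *\<^sub>R v ?\<theta>) :> Hy \<and> GDERIV (\<lambda>u. H (\<rho> *\<^sub>R v ?\<theta>) u) (?\<theta> + u ?\<theta>) :> Hx \<and>
       ((\<lambda>t. \<rho> *\<^sub>R v (\<theta> + t *\<^sub>R \<omega>)) has_vector_derivative - Hx) (at t) \<and>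
       ((\<lambda>t. \<theta> + t *\<^sub>R \<omega> + u (\<theta> + t *\<^sub>R \<omega>)) has_vector_derivative Hy) (at t)"
      by (intro exI conjI) (rule gr(1), rule gr(2), rule 1, rule 2)
  qed
  have "invariant_torus G H \<omega> T"
    unfolding invariant_torus_def
  proof (intro conjI exI[of _ \<Phi>] exI[of _ \<Psi>] allI)
    show "T \<subseteq> interior G \<times> std_torus" using T(3) vG by blast
    show "homeomorphism std_torus T \<Phi> \<Psi>" by (rule T(1))
    show "\<exists>y x. hamiltonian_motion H y x \<and> (\<forall>t. \<Phi> (angle (\<theta> + t *\<^sub>R \<omega>)) = (y t, angle (x t)))" for \<theta>
      using ham[of \<theta>] T(2) by blast
  qed
  thus ?thesis by blast
qed

text \<open>Averaging the angle equation along the linear flow shows that the counterterm \<open>lam\<close> is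
  close to minus the gradient of the unperturbed energy, which points outwards on the cube.\<close>

lemma counterterm_zero:
  fixes U V lam
  assumes U: "\<And>i. cls (3/2) (r0 / 4) (U i)" and lam: "\<And>i. cls (3/2) (r0 / 4) (lam i)" "\<And>i. zind (S (3/2) (r0 / 4)) (lam i)"
    and bU: "\<And>i. bnd (3/2) (r0 / 4) (r0 / 4) (U i)"
    and \<kappa>: "\<kappa> \<le> 1 / 10" and bV: "\<And>i. bnd (3/2) (r0 / 4) \<kappa> (\<lambda>w. V i w - fst w $ i)"
    and DU: "\<And>i w. w \<in> S (3/2) (r0 / 4) \<Longrightarrow> dd (0, cvec \<omega>) (U i) w = lam i w + dd (ey i) f (emb V U w)"
    and fg: "\<And>w. f w = of_real A * hpow l w + g w" and A: "0 < A" and g: "cls 2 r0 g" "\<And>i. bnd (19/10) r0 (A / 4) (dd (ey i) g)"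
    and hq: "\<And>(p::complex^'n) q i. (\<forall>k. cmod (p $ k) \<le> 1) \<Longrightarrow> (\<forall>k. cmod (q $ k - p $ k) \<le> \<kappa>) \<Longrightarrow> cmod (hq l i q - hq l i p) \<le> 1 / 4"
  shows "\<exists>c. (\<forall>i. \<bar>c $ i\<bar> \<le> 1) \<and> (\<forall>i. lam i (rp c 0) = 0)"
proof -
  let ?Q = "{c :: real^'n. \<forall>i. \<bar>c $ i\<bar> \<le> 1}"
  have w: "rp c \<theta> \<in> S (3/2) (r0 / 4)" if "c \<in> ?Q" for c \<theta> by (rule rp_in_S[OF le_less_trans[of "\<bar>c $ _\<bar>" 1]]) (use that r0 in auto)
  \<comment> \<open>Half of the tolerance \<open>A / 2\<close> is the variation of the twist
    gradient between the parameter and the torus; the other half is the action gradient of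
    \<open>g\<close>.\<close>
  have est: "\<bar>Re (lam i (rp c 0)) + A * ((\<Sum>k\<in>UNIV. (c $ k)\<^sup>2) ^ l * c $ i)\<bar> \<le> A / 2" if c: "c \<in> ?Q" for c i
  proof -
    let ?w = "\<lambda>t. rp c (0 + t *\<^sub>R \<omega>)"
    let ?A = "lam i (rp c 0) + of_real A * hq l i (cvec c)"
    have "cmod ?A \<le> A / 2"
    \<comment> \<open>\<open>U i\<close> is bounded along the orbit while its derivative stays close
      to the constant \<open>?A\<close>, so \<open>?A\<close> must be small.\<close>
    proof (rule bounded_primitive_average)
      show "((\<lambda>t. U i (?w t)) has_vector_derivative dd (0, cvec \<omega>) (U i) (?w t)) (at t)" for t
        by (rule hol_rp_line[OF cls_hol[OF U] w[OF c]])
      show "cmod (U i (?w t)) \<le> r0 / 4" for t by (rule bndD[OF bU w[OF c]])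
      fix t
      let ?e = "emb V U (?w t)"
      have bv: "cmod (V k (?w t) - fst (?w t) $ k) \<le> \<kappa>" for k by (rule bndD[OF bV w[OF c]])
      have e: "?e \<in> S (17/10) r0"
      proof (rule emb_in[where u=U and v=V, OF _ _ w[OF c]])
        show "cmod (U k (?w t)) \<le> r0 / 4" for k by (rule bndD[OF bU w[OF c]])
        show "cmod (V k (?w t) - fst (?w t) $ k) \<le> 2/10" for k using bv[of k] \<kappa> by simp
      qed (use r0 in simp)
      have sub: "S (17/10) r0 \<subseteq> (S 2 r0 :: 'n cv set)" "S (17/10) r0 \<subseteq> (S (19/10) r0 :: 'n cv set)" by (rule S_mono; simp)+
      have fst_e: "fst ?e = (\<chi> k. V k (?w t))" by (simp add: vec_eq_iff)
      have "dd (ey i) f ?e = of_real A * hq l i (fst ?e) + dd (ey i) g ?e"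
      proof -
        have f': "f = (\<lambda>w. of_real A * hpow l w + g w)" using fg by blast
        have hh: "hol (S 2 r0) (hpow l :: 'n cv \<Rightarrow> complex)" by (rule cls_hol[OF cls_hpow])
        have "dd (ey i) f ?e = dd (ey i) (\<lambda>w. of_real A * hpow l w) ?e + dd (ey i) g ?e"
          unfolding f' by (rule hol_add(2)[OF hol_cmult(1)[OF hh] cls_hol[OF g(1)] subsetD[OF sub(1) e]])
        also have "dd (ey i) (\<lambda>w. of_real A * hpow l w) ?e = of_real A * dd (ey i) (hpow l) ?e"
          by (rule hol_cmult(2)[OF hh subsetD[OF sub(1) e]])
        finally show ?thesis by (simp only: dd_hpow hq_def)
      qed
      moreover have "lam i (?w t) = lam i (rp c 0)" by (rule zindD[OF lam(2) w[OF c] w[OF c]]) (simp add: rp_def)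
      ultimately have "dd (0, cvec \<omega>) (U i) (?w t) - ?A = of_real A * (hq l i (fst ?e) - hq l i (cvec c)) + dd (ey i) g ?e"
        using DU[OF w[OF c]] by (simp add: right_diff_distrib)
      also have "cmod \<dots> \<le> A * (1 / 4) + A / 4"
      proof (rule norm_triangle_mono)
        have "cmod (hq l i (fst ?e) - hq l i (cvec c)) \<le> 1 / 4"
          by (rule hq) (use c bv in \<open>auto simp: fst_e\<close>)
        from mult_left_mono[OF this, of A] A
        show "cmod (of_real A * (hq l i (fst ?e) - hq l i (cvec c))) \<le> A * (1 / 4)" by (simp add: norm_mult)
        show "cmod (dd (ey i) g ?e) \<le> A / 4" by (rule bndD[OF g(2) subsetD[OF sub(2) e]])
      qed
      finally show "cmod (dd (0, cvec \<omega>) (U i) (?w t) - ?A) \<le> A / 2" by simp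
    qed
    moreover have "?A = of_real (Re (lam i (rp c 0)) + A * ((\<Sum>k\<in>UNIV. (c $ k)\<^sup>2) ^ l * c $ i))"
      using cls_rp_real[OF lam(1) w[OF c], of i 0] by (simp add: hq_def)
    ultimately show ?thesis by (simp only: norm_of_real)
  qed
  \<comment> \<open>On a face of the cube the unperturbed component has size at least
    \<open>A\<close>, which exceeds the error \<open>A / 2\<close>, so its sign decides.\<close>
  have big: "1 \<le> (\<Sum>k\<in>UNIV. (c $ k)\<^sup>2) ^ l" if "\<bar>c $ i\<bar> = 1" for c :: "real^'n" and i
  proof (rule one_le_power)
    have "(c $ i)\<^sup>2 \<le> (\<Sum>k\<in>UNIV. (c $ k)\<^sup>2)" by (rule member_le_sum) auto
    moreover have "(c $ i)\<^sup>2 = 1" using that by (simp add: power2_eq_1_iff abs_if split: if_splits)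
    ultimately show "1 \<le> (\<Sum>k\<in>UNIV. (c $ k)\<^sup>2)" by simp
  qed
  have "\<exists>c. (\<forall>i. \<bar>c $ i\<bar> \<le> 1) \<and> (\<chi> i. Re (lam i (rp c 0))) = 0"
  proof (rule poincare_miranda)
    show "continuous_on ?Q (\<lambda>c. \<chi> i. Re (lam i (rp c 0)))"
      by (intro continuous_on_vec_lambda continuous_on_Re
        continuous_on_compose2[OF hol_cont_on[OF cls_hol[OF lam(1)]] continuous_rp[OF continuous_on_id continuous_on_const]]) (use w in auto)
    fix c :: "real^'n" and i assume c: "\<forall>i. \<bar>c $ i\<bar> \<le> 1"
    have cQ: "c \<in> ?Q" using c by simp
    show "(\<chi> i. Re (lam i (rp c 0))) $ i \<le> 0" if ci: "c $ i = 1"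
    proof -
      have "A * 1 \<le> A * (\<Sum>k\<in>UNIV. (c $ k)\<^sup>2) ^ l" by (intro mult_left_mono big[of c i]) (use A ci in auto)
      moreover note est[OF cQ, of i]
      ultimately show ?thesis unfolding ci abs_le_iff by simp
    qed
    show "0 \<le> (\<chi> i. Re (lam i (rp c 0))) $ i" if ci: "c $ i = -1"
    proof -
      have "A * 1 \<le> A * (\<Sum>k\<in>UNIV. (c $ k)\<^sup>2) ^ l" by (intro mult_left_mono big[of c i]) (use A ci in auto)
      moreover note est[OF cQ, of i]
      ultimately show ?thesis unfolding ci abs_le_iff by simp
    qed
  qed
  then obtain c where c: "c \<in> ?Q" "(\<chi> i. Re (lam i (rp c 0))) = 0" by blast
  have "lam i (rp c 0) = 0" for i
    using cls_rp_real[OF lam(1) w[OF c(1)], of i 0] c(2) by (simp add: vec_eq_iff)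
  thus ?thesis using c(1) by blast
qed

end

section \<open>The rescaled Hamiltonian and the choice of constants\<close>

lemma hpow_rp: "hpow l (rp Y x) = of_real (norm Y ^ (2 * l + 2) / real (2 * l + 2))"
proof -
  have "(norm Y)\<^sup>2 = (\<Sum>i\<in>UNIV. (Y $ i)\<^sup>2)" by (simp add: norm_vec_def L2_set_def sum_nonneg)
  hence "(\<Sum>i\<in>UNIV. (complex_of_real (Y $ i))\<^sup>2) = of_real ((norm Y)\<^sup>2)" by simp
  moreover have "2 * l + 2 = 2 * (l + 1)" by simp
  ultimately show ?thesis unfolding hpow_def fst_rp by (simp only: power_mult of_real_power of_real_divide of_real_of_nat_eq)
qed

lemma bnd_hpow: "bnd 2 r ((4 * real CARD('n)) ^ (l + 1)) (hpow l :: 'n::finite cv \<Rightarrow> complex)"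
  unfolding bnd_def
proof
  fix w :: "'n cv" assume w: "w \<in> S 2 r"
  have "cmod (\<Sum>i\<in>UNIV. (fst w $ i)\<^sup>2) \<le> (\<Sum>i\<in>(UNIV::'n set). 4)"
  proof (rule sum_norm_le)
    fix i
    have "(cmod (fst w $ i))\<^sup>2 \<le> 2\<^sup>2" using S_D(1)[OF w, of i] by (intro power_mono) auto
    thus "cmod ((fst w $ i)\<^sup>2) \<le> 4" by (simp add: norm_power)
  qed
  hence "cmod (\<Sum>i\<in>UNIV. (fst w $ i)\<^sup>2) ^ (l + 1) \<le> (4 * real CARD('n)) ^ (l + 1)" by (intro power_mono) (auto simp: mult.commute)
  moreover have "cmod (hpow l w) = cmod (\<Sum>i\<in>UNIV. (fst w $ i)\<^sup>2) ^ (l + 1) / real (2 * l + 2)"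
    unfolding hpow_def norm_divide norm_power norm_of_nat ..
  moreover have "X / real (2 * l + 2) \<le> X" if "0 \<le> X" for X
    using divide_left_mono[of 1 "real (2 * l + 2)" X] that by simp
  ultimately show "cmod (hpow l w) \<le> (4 * real CARD('n)) ^ (l + 1)"
    by (metis (no_types, lifting) norm_ge_zero order_trans zero_le_power)
qed

text \<open>What remains is the order of choices. \<open>r0\<close>, \<open>\<kappa>\<close>,
  \<open>L0\<close>, \<open>e0\<close> and \<open>\<eta>\<close> depend only on the frequency, r, l
  and the dimension; \<open>\<rho>\<close> depends on these, on G and on s;
  \<open>\<epsilon>'\<close> comes last. The KAM threshold is met by \<open>\<rho>\<close> for the
  twist and by \<epsilon> for the perturbation.\<close>

theorem theorem3:
  fixes G :: "(real^'n) set" and l :: nat and \<omega> :: "real^'n"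
    and P :: "real \<Rightarrow> real^'n \<Rightarrow> real^'n \<Rightarrow> real"
    and \<epsilon>\<^sub>0 s r M :: real
  assumes "bounded G" and "closed_region G" and "0 \<in> interior G"
    and "0 < l"
    and "\<omega> \<noteq> 0" and "diophantine \<omega>"
    and "0 < \<epsilon>\<^sub>0" and "0 < s" and "s < 1" and "0 < r" and "r < 1"
    and "\<And>\<epsilon>. 0 < \<epsilon> \<Longrightarrow> \<epsilon> < \<epsilon>\<^sub>0 \<Longrightarrow> analytic_bounded_on G s r M (P \<epsilon>)"
  shows "\<exists>\<epsilon>'>0. \<forall>\<epsilon>. 0 < \<epsilon> \<and> \<epsilon> < \<epsilon>' \<longrightarrow>
    (\<exists>T. invariant_torus G (\<lambda>y x. unperturbed \<omega> l y + \<epsilon> * P \<epsilon> y x) \<omega> T)"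
proof -
  define n where "n = real CARD('n)"
  have n1: "1 \<le> n" by (simp add: n_def Suc_le_eq)
  obtain \<gamma> b where gb: "0 < \<gamma>" "0 < b" and "\<And>k d. k \<noteq> 0 \<Longrightarrow> 0 < d \<Longrightarrow> kdot k \<omega> \<noteq> 0 \<and>
    1 / \<bar>kdot k \<omega>\<bar> \<le> 1 / \<gamma> * (2 * real b / d) ^ b * exp (d / 2 * knorm k)" using diophantineE[OF assms(6)] by blast
  hence loss: "loss_ok \<gamma> b \<omega>" unfolding loss_ok_def by blast
  have sd0: "0 \<le> sd_loss \<gamma> b TYPE('n) d" if "0 < d" for d unfolding sd_loss_def using gb that by simp
  \<comment> \<open>The given strip is measured in the Euclidean norm, the product domain
    componentwise.\<close>
  define r0 where "r0 = r / n"
  have r0: "0 < r0" "r0 \<le> 1" "n * r0 \<le> r" using assms(10,11) n1 by (auto simp: r0_def field_simps)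
  obtain \<kappa>0 where k0: "0 < \<kappa>0" "\<And>(p::complex^'n) q i. (\<forall>k. cmod (p $ k) \<le> 1) \<Longrightarrow> (\<forall>k. cmod (q $ k - p $ k) \<le> \<kappa>0) \<Longrightarrow> cmod (hq l i q - hq l i p) \<le> 1 / 4"
    using hq_uniform[of l] by blast
  \<comment> \<open>In order: the tolerance for the twist gradient, room in the angle strip, the
    value of \<open>c1\<close>, and room in the action polydisc.\<close>
  define \<kappa> where "\<kappa> = min \<kappa>0 (min (r0 / 4) (min (1 / (16 * n ^ 2)) (1 / 10)))"
  have \<kappa>: "0 < \<kappa>" "\<kappa> \<le> \<kappa>0" "\<kappa> \<le> r0 / 4" "\<kappa> \<le> 1 / (16 * n ^ 2)" "\<kappa> \<le> 1 / 10" using k0 r0 n1 by (auto simp: \<kappa>_def)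
  define L0 where "L0 = 2 + n + 40 / r0 + sd_loss \<gamma> b TYPE('n) (r0 / 40)"
  have L0: "2 \<le> L0" "n \<le> L0" "40 / r0 \<le> L0" "sd_loss \<gamma> b TYPE('n) (r0 / 40) \<le> L0"
    using sd0[of "r0 / 40"] r0 n1 by (auto simp: L0_def)
  define e0 where "e0 = \<kappa> / (L0 * 2 ^ (b + CARD('n))) ^ 60"
  have e0: "0 < e0" "(L0 * 2 ^ (b + CARD('n))) ^ 60 * e0 \<le> \<kappa>" using \<kappa> L0 by (auto simp: e0_def)
  define Y where "Y = sd_loss \<gamma> b TYPE('n) (r0 / 16) * (1 / 10) / (r0 / 16)"
  have Y: "0 \<le> Y" using sd0[of "r0 / 16"] r0 by (simp add: Y_def)
  \<comment> \<open>The summand 1 keeps the division by \<open>Z\<close> in the next constant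
    legitimate when \<open>Y\<close> is 0.\<close>
  define Z where "Z = 4 * n ^ 3 * 100 * Y + 1"
  have Z: "1 \<le> Z" using Y n1 by (simp add: Z_def)
  define \<eta> where "\<eta> = min (e0 / 10) (min (1 / 10 ^ 6) (1 / (4 * n) / Z))"
  have \<eta>: "0 < \<eta>" "10 * \<eta> \<le> e0" "\<eta> \<le> 1 / 10 ^ 6" "\<eta> \<le> 1 / (4 * n) / Z" using e0 n1 Z by (auto simp: \<eta>_def)
  have \<eta>_small: "4 * n ^ 3 * (100 * \<eta>) * Y \<le> 1 / (4 * n)"
  proof -
    have "4 * n ^ 3 * (100 * \<eta>) * Y \<le> Z * \<eta>" using \<eta>(1) by (simp add: Z_def algebra_simps)
    also have "\<dots> \<le> Z * (1 / (4 * n) / Z)" using \<eta>(4) Z by (intro mult_left_mono) auto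
    finally show ?thesis using Z by simp
  qed
  obtain \<delta> where \<delta>: "0 < \<delta>" "ball 0 \<delta> \<subseteq> interior G" using assms(3) open_interior openE by blast
  define C where "C = (4 * n) ^ (l + 1)"
  have C: "0 < C" using n1 by (simp add: C_def)
  \<comment> \<open>In order: higher powers of \<rho> are smaller, the scaled polydisc fits into the
    complex neighbourhood, its real part fits into the interior of G, and the twist uses at most
    half of \<eta>.\<close>
  define \<rho> where "\<rho> = min 1 (min (s / (2 * n)) (min (\<delta> / (2 * n)) (\<eta> / 2 / C)))"
  have \<rho>: "0 < \<rho>" "\<rho> \<le> 1" "\<rho> \<le> s / (2 * n)" "\<rho> \<le> \<delta> / (2 * n)" "\<rho> \<le> \<eta> / 2 / C"
    using assms(8) n1 \<delta> \<eta> C by (auto simp: \<rho>_def)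
  have \<rho>s: "n * (2 * \<rho>) \<le> s" and \<rho>\<delta>: "n * (2 * \<rho>) \<le> \<delta>" and \<rho>C: "\<rho> * C \<le> \<eta> / 2"
    using \<rho>(3,4,5) n1 C by (simp_all add: field_simps)
  have G: "y \<in> interior G" if y: "\<forall>i. \<bar>y $ i\<bar> < 2 * \<rho>" for y :: "real^'n"
  proof -
    have "norm y \<le> (\<Sum>i\<in>UNIV. \<bar>y $ i\<bar>)" by (rule norm_le_l1_cart)
    also have "\<dots> < (\<Sum>i\<in>(UNIV::'n set). 2 * \<rho>)" by (rule sum_strict_mono) (use y in auto)
    also have "\<dots> \<le> \<delta>" using \<rho>\<delta> by (simp add: n_def)
    finally show ?thesis using \<delta>(2) by auto
  qed
  \<comment> \<open>The twist is homogeneous of degree 2l + 2, and one factor \<rho> is divided out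
    of the Hamiltonian.\<close>
  define A where "A = \<rho> ^ (2 * l + 1)"
  have A: "0 < A" using \<rho> by (simp add: A_def)
  have "A * C \<le> \<rho> * C"
  proof -
    have "\<rho> ^ (2 * l + 1) \<le> \<rho> ^ 1" using \<rho> by (intro power_decreasing) auto
    thus ?thesis unfolding A_def using C by (intro mult_right_mono) auto
  qed
  hence AC: "A * C \<le> \<eta> / 2" using \<rho>C by simp
  define M' where "M' = \<bar>M\<bar> + 1"
  have M': "0 < M'" "M \<le> M'" by (auto simp: M'_def)
  \<comment> \<open>The bound \<open>\<eta> / 2\<close> gives the perturbation the other half of
    \<eta>. The bound \<open>A / 40\<close> becomes \<open>A / 4\<close> for the action gradient, by
    the Cauchy estimate with radius 1/10, and so keeps it below the twist.\<close>
  define \<epsilon>' where "\<epsilon>' = min \<epsilon>\<^sub>0 (\<rho> / M' * min (\<eta> / 2) (A / 40))"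
  have "0 < \<epsilon>'" using assms(7) \<rho> M' \<eta> A by (simp add: \<epsilon>'_def)
  moreover have "\<exists>T. invariant_torus G (\<lambda>y x. unperturbed \<omega> l y + \<epsilon> * P \<epsilon> y x) \<omega> T" if e: "0 < \<epsilon>" "\<epsilon> < \<epsilon>'" for \<epsilon>
  proof -
    have eM: "\<epsilon> / \<rho> * M' \<le> \<eta> / 2" "\<epsilon> / \<rho> * M' \<le> A / 40"
    proof -
      have "\<epsilon> / \<rho> * M' \<le> (\<rho> / M' * min (\<eta> / 2) (A / 40)) / \<rho> * M'"
        using e \<rho> M' by (intro mult_right_mono divide_right_mono) (auto simp: \<epsilon>'_def)
      also have "\<dots> = min (\<eta> / 2) (A / 40)" using \<rho> M' by simp
      finally show "\<epsilon> / \<rho> * M' \<le> \<eta> / 2" "\<epsilon> / \<rho> * M' \<le> A / 40" by auto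
    qed
    have G0: "0 \<in> G" and GG: "\<And>y. \<forall>i. \<bar>y $ i\<bar> < 2 * \<rho> \<Longrightarrow> y \<in> G" using assms(3) G interior_subset by blast+
    have an: "analytic_bounded_on G s r M (P \<epsilon>)" using assms(12) e by (simp add: \<epsilon>'_def)
    from analytic_bounded_scaled[OF an G0 \<rho>(1) \<rho>s[unfolded n_def] GG r0(1) r0(3)[unfolded n_def]]
    obtain g0 where g0: "cls 2 r0 g0" "bnd 2 r0 M g0" "\<And>y x. \<forall>i. \<bar>y $ i\<bar> < 2 * \<rho> \<Longrightarrow> g0 (rp ((1/\<rho>) *\<^sub>R y) x) = of_real (P \<epsilon> y x)" by blast
    define g where "g w = of_real (\<epsilon> / \<rho>) * g0 w" for w
    define f where "f w = of_real A * hpow l w + g w" for w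
    have cg: "cls 2 r0 g" unfolding g_def[abs_def] by (intro cls_mult cls_const g0) simp
    have cf: "cls 2 r0 f" unfolding f_def[abs_def] by (intro cls_add cls_mult cls_const cls_hpow cg) simp
    have gM: "cmod (g w) \<le> \<epsilon> / \<rho> * M'" if "w \<in> S 2 r0" for w
      unfolding g_def norm_mult norm_of_real using bndD[OF g0(2) that] M' e \<rho> by (intro mult_mono) auto
    have bg: "bnd 2 r0 (A / 40) g" unfolding bnd_def using gM eM(2) by (meson order_trans)
    have bf: "bnd 2 r0 \<eta> f"
      unfolding bnd_def
    proof
      fix w :: "'n cv" assume w: "w \<in> S 2 r0"
      have "cmod (of_real A * hpow l w) \<le> A * C"
        unfolding norm_mult norm_of_real using bndD[OF bnd_hpow w, of l] A by (simp add: C_def n_def)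
      hence "cmod (f w) \<le> \<eta> / 2 + \<eta> / 2" unfolding f_def
        by (intro norm_triangle_mono order_trans[OF _ AC] order_trans[OF gM[OF w] eM(1)])
      thus "cmod (f w) \<le> \<eta>" by simp
    qed
    have bdg: "bnd (19/10) r0 (A / 4) (dd (ey i) g)" for i
      using bnd_cauchy_y[OF cls_hol[OF cg] bg, of "1/10" i] by simp
    interpret K: kam f \<omega> r0 \<eta> \<gamma> n b
      by unfold_locales (use cf bf r0 \<eta> loss \<eta>_small in \<open>simp_all add: n_def Y_def\<close>)
    have kc: "\<kappa> \<le> K.c1" using \<kappa>(4) by (simp add: K.c1_def)
    from K.counterterm_kam[OF \<kappa>(1,3) kc \<kappa>(5) L0 e0(1) \<eta>(2) e0(2)]
    obtain U V lam where sol: "\<And>i. cls (3/2) (r0 / 4) (U i)" "\<And>i. cls (3/2) (r0 / 4) (V i)" "\<And>i. cls (3/2) (r0 / 4) (lam i)"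
      "\<And>i. zind (S (3/2) (r0 / 4)) (lam i)" "\<And>i. bnd (3/2) (r0 / 4) \<kappa> (U i)" "\<And>i j. bnd (3/2) (r0 / 4) \<kappa> (dd (ex j) (U i))"
      "\<And>i. bnd (3/2) (r0 / 4) \<kappa> (\<lambda>w. V i w - fst w $ i)"
      "\<And>i w. w \<in> S (3/2) (r0 / 4) \<Longrightarrow> dd (0, cvec \<omega>) (U i) w = lam i w + dd (ey i) f (emb V U w)"
      "\<And>i w. w \<in> S (3/2) (r0 / 4) \<Longrightarrow> dd (0, cvec \<omega>) (V i) w = - dd (ex i) f (emb V U w)" by blast
    have weak: "bnd a x C' h" if "bnd a x C h" "C \<le> C'" for a x C C' and h :: "'n cv \<Rightarrow> complex"
      using that unfolding bnd_def by (meson order_trans)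
    have hq: "cmod (hq l i q - hq l i p) \<le> 1 / 4" if "\<forall>k. cmod (p $ k) \<le> 1" "\<forall>k. cmod (q $ k - p $ k) \<le> \<kappa>" for p q :: "complex^'n" and i
      by (rule k0(2)[OF that(1)]) (use that(2) \<kappa>(2) in \<open>blast intro: order_trans\<close>)
    have "\<exists>c. (\<forall>i. \<bar>c $ i\<bar> \<le> 1) \<and> (\<forall>i. lam i (rp c 0) = 0)"
      by (rule K.counterterm_zero[OF sol(1) sol(3,4) weak[OF sol(5) \<kappa>(3)] \<kappa>(5) sol(7,8) f_def A cg bdg hq])
    then obtain c where c: "\<forall>i. \<bar>c $ i\<bar> \<le> 1" "\<And>i. lam i (rp c 0) = 0" by blast
    have H: "unperturbed \<omega> l y + \<epsilon> * P \<epsilon> y x = \<omega> \<bullet> y + \<rho> * Re (f (rp ((1/\<rho>) *\<^sub>R y) x))" if "\<forall>i. \<bar>y $ i\<bar> < 2 * \<rho>" for y x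
    proof -
      have "f (rp ((1/\<rho>) *\<^sub>R y) x) = of_real (A * (norm ((1/\<rho>) *\<^sub>R y) ^ (2 * l + 2) / real (2 * l + 2)) + \<epsilon> / \<rho> * P \<epsilon> y x)"
        unfolding f_def g_def hpow_rp g0(3)[OF that] of_real_add of_real_mult ..
      moreover have "\<rho> * (A * (norm ((1/\<rho>) *\<^sub>R y) ^ (2 * l + 2) / real (2 * l + 2))) = norm y ^ (2 * l + 2) / real (2 * l + 2)"
      proof -
        have "\<rho> * A = \<rho> ^ (2 * l + 2)" by (simp add: A_def)
        moreover have "norm ((1/\<rho>) *\<^sub>R y) ^ (2 * l + 2) = norm y ^ (2 * l + 2) / \<rho> ^ (2 * l + 2)"
          using \<rho> by (simp only: norm_scaleR power_mult_distrib) (simp add: power_divide)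
        ultimately show ?thesis using \<rho> by (simp only: mult.assoc[symmetric]) simp
      qed
      ultimately show ?thesis using \<rho> by (simp only: Re_complex_of_real distrib_left unperturbed_def) simp
    qed
    show ?thesis
      by (rule K.torus_from_solution[OF sol(1,2,4) weak[OF sol(6) kc] weak[OF sol(7) \<kappa>(5)] sol(8,9) c \<rho>(1) H G])
  qed
  ultimately show ?thesis by blast
qed

end
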